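(* Let $n=2m+1\ge5$ be an odd integer and let $\xi\in\mathbb{R}$ with $[\mathbb{Q}(\xi):\mathbb{Q}]>n$. Then $\widehat{\lambda}_{2m+1}(\xi)\le\alpha_m$, where $\alpha_m$ is the positive root of the polynomial $P_m(x)=1-(m+1)x-mx^2$.
   Context: For $\xi\in\mathbb{R}$ and an integer $n\ge1$, $\widehat{\lambda}_n(\xi)$ denotes the supremum of all $\lambda\ge0$ such that, for every sufficiently large real $X$, the conditions $|x_0|\le X$ and $\max_{1\le k\le n}|x_0\xi^k-x_k|\le X^{-\lambda}$ admit a non-zero solution $(x_0,\dots,x_n)\in\mathbb{Z}^{n+1}$. *)

theory Defs
  imports
    "HOL-Analysis.Analysis"
    "HOL-Computational_Algebra.Polynomial"
    "HOL-Algebra.Generated_Fields"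
    "HOL-Algebra.Algebraic_Closure_Type"
begin

text \<open>
  The supremum is taken in the extended reals, since the set of admissible exponents is unbounded
  for rational \<open>\<xi>\<close>. Only the values at \<open>0, \<dots>, n\<close> of the sequence \<open>x\<close> matter; \<open>n \<ge> 1\<close> is
  intended (the maximum is over an empty set for \<open>n = 0\<close>).
\<close>

definition uniform_exponent_ok :: "nat \<Rightarrow> real \<Rightarrow> real \<Rightarrow> bool" where
  "uniform_exponent_ok n \<xi> l \<longleftrightarrow>
     (\<forall>\<^sub>F B in (at_top :: real filter). \<exists>x :: nat \<Rightarrow> int.
        (\<exists>k\<le>n. x k \<noteq> 0) \<and>
        \<bar>real_of_int (x 0)\<bar> \<le> B \<and>
        (MAX k\<in>{1..n}. \<bar>real_of_int (x 0) * \<xi> ^ k - real_of_int (x k)\<bar>) \<le> B powr (- l))"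

definition lambda_hat :: "nat \<Rightarrow> real \<Rightarrow> ereal" where
  "lambda_hat n \<xi> = Sup {ereal l | l. 0 \<le> l \<and> uniform_exponent_ok n \<xi> l}"

abbreviation real_ring :: "real ring" where
  "real_ring \<equiv> ring_of_type_algebra"

definition rat_adjoin :: "real \<Rightarrow> real set" where
  "rat_adjoin \<xi> = generate_field real_ring (insert \<xi> \<rat>)"

text \<open>The degree \<open>[\<rat>(\<xi>) : \<rat>]\<close>, infinite if \<open>\<xi>\<close> is transcendental.\<close>

definition rat_adjoin_degree :: "real \<Rightarrow> enat" where
  "rat_adjoin_degree \<xi> =
     (if ring.finite_dimension real_ring \<rat> (rat_adjoin \<xi>)
      then enat (ring.dim real_ring \<rat> (rat_adjoin \<xi>)) else \<infinity>)"

definition P_poly :: "nat \<Rightarrow> real poly" where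
  "P_poly m = [:1, - (real m + 1), - real m:]"

definition alpha :: "nat \<Rightarrow> real" where
  "alpha m = (THE x. x > 0 \<and> poly (P_poly m) x = 0)"

lemma P_poly_ex1_positive_root: "\<exists>!x. x > 0 \<and> poly (P_poly m) x = 0"
proof (rule ex_ex1I)
  have "\<exists>x\<ge>0. x \<le> 1 \<and> poly (P_poly m) x = 0"
    by (rule IVT2) (auto simp: P_poly_def)
  then obtain x where x: "0 \<le> x" "poly (P_poly m) x = 0" by blast
  moreover have "x \<noteq> 0" using x by (auto simp: P_poly_def)
  ultimately show "\<exists>x. x > 0 \<and> poly (P_poly m) x = 0" by (intro exI[of _ x]) auto
next
  fix x y :: real
  assume x: "x > 0 \<and> poly (P_poly m) x = 0" and y: "y > 0 \<and> poly (P_poly m) y = 0"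
  have "(x - y) * (real m + 1 + real m * (x + y)) = 0"
    using x y by (simp add: P_poly_def algebra_simps)
  moreover have "real m + 1 + real m * (x + y) > 0"
    using x y by (intro add_pos_nonneg[of "real m + 1"] mult_nonneg_nonneg) auto
  ultimately show "x = y" by simp
qed

end

theory Submission
  imports Defs "Jordan_Normal_Form.Determinant"
begin

text \<open>
  Suppose that some exponent \<open>l > alpha m\<close> is admissible, and let \<open>alpha m < \<lambda> < l\<close>. The best simultaneous
  approximations to \<open>\<xi>, \<dots>, \<xi>\<^sup>n\<close> form a sequence of integer points whose distance to the line through
  \<open>(1, \<xi>, \<dots>, \<xi>\<^sup>n)\<close> is at most the power \<open>- \<lambda>\<close> of the height of the next point. A polynomial with \<open>N\<close>
  coefficients annihilates a point if it is orthogonal to all its blocks of \<open>N\<close> consecutive coordinates.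

  The height of a polynomial determined by the points that it annihilates is bounded from above by a
  determinant whose rows are blocks of these points: all rows are nearly multiples of
  \<open>(1, \<xi>, \<xi>\<^sup>2, \<dots>)\<close>, so the determinant is small. It is bounded from below because a polynomial that
  annihilates one point but not the preceding one takes a non-zero integer value there. Comparing both
  bounds shows first that large points have no annihilator of degree at most \<open>m\<close>. On the subsequence \<open>y\<close>
  of points at which the plane through two consecutive best approximations changes, it then shows that
  the annihilators of degree \<open>m + 1\<close> of \<open>y k\<close> and \<open>y (k + 1)\<close> differ, and that three consecutive points
  have exactly one common annihilator of degree at most \<open>m + 2\<close>. No polynomial annihilates all points, so
  the latter changes infinitely often; wherever it changes, the bounds are linear inequalities between
  logarithms of heights that have no solution if \<open>\<lambda> > alpha m\<close>.
\<close>

section \<open>Integer linear forms\<close>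

text \<open>For \<open>n = 2 * m + 1\<close>, a point without annihilator of degree at most
  \<open>m\<close> has spaces of annihilators of dimension exactly 1 and 3 for \<open>m + 2\<close>
  and \<open>m + 3\<close> coefficients; the proof studies how these meet for different points. One
  obstacle is that an annihilator p is often known only through a kernel spanned by p, Tp, ...,
  T^(q-1)p. The Toeplitz minors of p then serve as Pluecker coordinates: they are coprime if p is
  primitive, and one of them is of the order of the q-th power of the height, so integer minors
  proportional to them dominate that power. The second device concerns the passage from
  \<open>y k\<close> to \<open>y (k + 1)\<close>. Their plane also contains the best approximation
  right after \<open>y k\<close>. Rows of these two neighbours clear the rows of
  \<open>y (k + 1)\<close>, so that the determinant involves the height of the neighbour and not the
  possibly much larger one of \<open>y (k + 1)\<close>. The slack between \<lambda> and
  \<open>l\<close> finally absorbs all constants.\<close>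

definition dotp :: "nat \<Rightarrow> (nat \<Rightarrow> int) \<Rightarrow> (nat \<Rightarrow> int) \<Rightarrow> int" where
  "dotp N r p = (\<Sum>j<N. r j * p j)"

definition nonzero_below :: "nat \<Rightarrow> (nat \<Rightarrow> int) \<Rightarrow> bool" where
  "nonzero_below N p \<longleftrightarrow> (\<exists>j<N. p j \<noteq> 0)"

definition killed :: "nat \<Rightarrow> (nat \<Rightarrow> int) set \<Rightarrow> (nat \<Rightarrow> int) \<Rightarrow> bool" where
  "killed N R p \<longleftrightarrow> (\<forall>r\<in>R. dotp N r p = 0)"

text \<open>Integer coefficients are enough because a rational relation can be cleared of
  denominators. For the same reason membership in a span is always expressed by a nonzero multiple
  \<open>a * p j\<close> being an integer combination.\<close>

definition lin_indep :: "nat \<Rightarrow> (nat \<Rightarrow> int) list \<Rightarrow> bool" where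
  "lin_indep N rs \<longleftrightarrow> (\<forall>c. (\<forall>j<N. (\<Sum>i<length rs. c i * (rs ! i) j) = 0) \<longrightarrow> (\<forall>i<length rs. c i = (0::int)))"

definition rows_mat :: "nat \<Rightarrow> (nat \<Rightarrow> int) list \<Rightarrow> int mat" where
  "rows_mat N rs = mat N N (\<lambda>(i, j). (rs ! i) j)"

lemma rows_mat_carrier [simp]: "rows_mat N rs \<in> carrier_mat N N"
  by (simp add: rows_mat_def)

lemma dotp_commute: "dotp N r p = dotp N p r"
  by (simp add: dotp_def mult.commute)

lemma dotp_sum_left: "dotp N (\<lambda>j. \<Sum>i\<in>I. c i * f i j) p = (\<Sum>i\<in>I. c i * dotp N (f i) p)"
  unfolding dotp_def sum_distrib_left sum_distrib_right
  by (subst sum.swap) (simp add: mult.assoc)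

lemma dotp_sum_right: "dotp N r (\<lambda>j. \<Sum>i\<in>I. c i * f i j) = (\<Sum>i\<in>I. c i * dotp N r (f i))"
  by (simp add: dotp_commute[of N r] dotp_sum_left)

lemma dotp_lincomb_left:
  "dotp N (\<lambda>j. a * r j + b * s j) p = a * dotp N r p + b * dotp N s p"
  by (simp add: dotp_def sum.distrib sum_distrib_left algebra_simps)

lemma dotp_lincomb_right:
  "dotp N r (\<lambda>j. a * p j + b * q j) = a * dotp N r p + b * dotp N r q"
  by (simp add: dotp_def sum.distrib sum_distrib_left algebra_simps)

lemma dotp_scale_left: "dotp N (\<lambda>j. a * r j) p = a * dotp N r p"
  by (simp add: dotp_def sum_distrib_left algebra_simps)

lemma dotp_scale_right: "dotp N r (\<lambda>j. a * p j) = a * dotp N r p"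
  by (simp add: dotp_def sum_distrib_left algebra_simps)

lemma dotp_cong: "(\<And>j. j < N \<Longrightarrow> r j = r' j) \<Longrightarrow> (\<And>j. j < N \<Longrightarrow> p j = p' j) \<Longrightarrow> dotp N r p = dotp N r' p'"
  by (simp add: dotp_def)

lemma killed_Un: "killed N (R \<union> R') p \<longleftrightarrow> killed N R p \<and> killed N R' p"
  by (auto simp: killed_def)

lemma killed_mono: "R \<subseteq> R' \<Longrightarrow> killed N R' p \<Longrightarrow> killed N R p"
  by (auto simp: killed_def)

lemma rows_mat_mult_vec_zero_iff:
  assumes "length rs = N"
  shows "rows_mat N rs *\<^sub>v vec N p = 0\<^sub>v N \<longleftrightarrow> killed N (set rs) p"
proof -
  have "rows_mat N rs *\<^sub>v vec N p = 0\<^sub>v N \<longleftrightarrow> (\<forall>i<N. dotp N (rs ! i) p = 0)"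
    by (auto simp: vec_eq_iff rows_mat_def scalar_prod_def dotp_def lessThan_atLeast0)
  then show ?thesis using assms by (metis in_set_conv_nth killed_def)
qed

lemma det_rows_mat_eq_0_iff:
  assumes "length rs = N"
  shows "det (rows_mat N rs) = 0 \<longleftrightarrow> (\<exists>p. nonzero_below N p \<and> killed N (set rs) p)"
proof
  assume "det (rows_mat N rs) = 0"
  then obtain v where v: "v \<in> carrier_vec N" "v \<noteq> 0\<^sub>v N" "rows_mat N rs *\<^sub>v v = 0\<^sub>v N"
    using det_0_iff_vec_prod_zero[OF rows_mat_carrier] by blast
  define p where "p = (\<lambda>j. v $ j)"
  have vp: "v = vec N p" using v(1) by (auto simp: p_def)
  have "nonzero_below N p" using v(1,2) by (auto simp: p_def nonzero_below_def vec_eq_iff)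
  moreover have "killed N (set rs) p" using v(3) rows_mat_mult_vec_zero_iff[OF assms] vp by simp
  ultimately show "\<exists>p. nonzero_below N p \<and> killed N (set rs) p" by blast
next
  assume "\<exists>p. nonzero_below N p \<and> killed N (set rs) p"
  then obtain p where p: "nonzero_below N p" "killed N (set rs) p" by blast
  have "vec N p \<noteq> 0\<^sub>v N" using p(1) by (auto simp: nonzero_below_def vec_eq_iff)
  moreover have "rows_mat N rs *\<^sub>v vec N p = 0\<^sub>v N" using p(2) rows_mat_mult_vec_zero_iff[OF assms] by simp
  ultimately show "det (rows_mat N rs) = 0"
    using det_0_iff_vec_prod_zero[OF rows_mat_carrier, of N rs] by (metis vec_carrier)
qed

text \<open>Padding with zero rows makes the matrix square. Its transpose then kills the last unit
  vector, so the determinant vanishes and the matrix itself has a kernel vector.\<close>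

lemma exists_killed:
  assumes "length rs < N"
  shows "\<exists>p. nonzero_below N p \<and> killed N (set rs) p"
proof -
  define rs' where "rs' = rs @ replicate (N - length rs) (\<lambda>_. 0)"
  have len: "length rs' = N" using assms by (simp add: rs'_def)
  have z: "(\<lambda>_. 0) = rs' ! (N - 1)" 
  proof -
    have "\<not> N - 1 < length rs" "N - 1 - length rs < N - length rs" using assms by linarith+
    then show ?thesis by (simp add: rs'_def nth_append)
  qed
  have "det (transpose_mat (rows_mat N rs')) = 0"
  proof -
    have "transpose_mat (rows_mat N rs') *\<^sub>v unit_vec N (N - 1) = 0\<^sub>v N"
      using assms z[symmetric]
      by (auto simp: vec_eq_iff rows_mat_def scalar_prod_def unit_vec_def if_distrib sum.delta cong: if_cong)
    moreover have "unit_vec N (N - 1) \<noteq> (0\<^sub>v N :: int vec)" using assms by simp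
    moreover have "transpose_mat (rows_mat N rs') \<in> carrier_mat N N" by simp
    ultimately show ?thesis using det_0_iff_vec_prod_zero by (metis unit_vec_carrier)
  qed
  then have "det (rows_mat N rs') = 0" using det_transpose[OF rows_mat_carrier] by metis
  then obtain p where "nonzero_below N p" "killed N (set rs') p"
    using det_rows_mat_eq_0_iff[OF len] by blast
  then show ?thesis by (auto simp: rs'_def killed_def)
qed

lemma lin_indep_det:
  assumes "lin_indep N rs" "length rs = N"
  shows "det (rows_mat N rs) \<noteq> 0"
proof
  assume "det (rows_mat N rs) = 0"
  then have "det (transpose_mat (rows_mat N rs)) = 0" using det_transpose[OF rows_mat_carrier] by metis
  moreover have "transpose_mat (rows_mat N rs) \<in> carrier_mat N N" by simp
  ultimately obtain v where v: "v \<in> carrier_vec N" "v \<noteq> 0\<^sub>v N" "transpose_mat (rows_mat N rs) *\<^sub>v v = 0\<^sub>v N"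
    using det_0_iff_vec_prod_zero by blast
  have "(\<Sum>i<length rs. v $ i * (rs ! i) j) = 0" if "j < N" for j
  proof -
    have "(transpose_mat (rows_mat N rs) *\<^sub>v v) $ j = 0" using v(3) that by simp
    then show ?thesis using that v(1) assms(2)
      by (auto simp: rows_mat_def scalar_prod_def lessThan_atLeast0 mult.commute)
  qed
  then have "\<forall>i<length rs. v $ i = 0"
    using assms(1) unfolding lin_indep_def by (elim allE[of _ "\<lambda>i. v $ i"]) blast
  then show False using v(1,2) assms(2) by (auto simp: vec_eq_iff)
qed

text \<open>More rows than columns leave the transposed system underdetermined, and a kernel vector
  of it is a relation between the rows.\<close>

lemma lin_indep_length_le:
  assumes "lin_indep N rs"
  shows "length rs \<le> N"
proof (rule ccontr)
  assume "\<not> length rs \<le> N"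
  define cs where "cs = map (\<lambda>j i. (rs ! i) j) [0..<N]"
  have "length cs < length rs" using \<open>\<not> length rs \<le> N\<close> by (simp add: cs_def)
  then obtain p where p: "nonzero_below (length rs) p" "killed (length rs) (set cs) p"
    using exists_killed by blast
  have "(\<Sum>i<length rs. p i * (rs ! i) j) = 0" if "j < N" for j
    using p(2) that by (auto simp: killed_def cs_def dotp_def mult.commute)
  then have "\<forall>i<length rs. p i = 0" using assms unfolding lin_indep_def by blast
  then show False using p(1) by (auto simp: nonzero_below_def)
qed

text \<open>\<open>p\<close> is a certificate: applied to a relation it leaves only the coefficient
  of \<open>r\<close>. In the applications the certificate is an annihilator of the earlier
  rows.\<close>

lemma lin_indep_snoc:
  assumes "lin_indep N rs" "killed N (set rs) p" "dotp N r p \<noteq> 0"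
  shows "lin_indep N (rs @ [r])"
  unfolding lin_indep_def
proof (intro allI impI)
  fix c :: "nat \<Rightarrow> int" and i
  assume c: "\<forall>j<N. (\<Sum>i<length (rs @ [r]). c i * ((rs @ [r]) ! i) j) = 0" and i: "i < length (rs @ [r])"
  have eq: "(\<Sum>i<length rs. c i * (rs ! i) j) + c (length rs) * r j = 0" if "j < N" for j
    using c that by (simp add: nth_append)
  have "0 = dotp N (\<lambda>j. (\<Sum>i<length rs. c i * (rs ! i) j) + c (length rs) * r j) p"
    by (simp add: dotp_def eq)
  also have "\<dots> = (\<Sum>i<length rs. c i * dotp N (rs ! i) p) + c (length rs) * dotp N r p"
    using dotp_lincomb_left[of N 1 "\<lambda>j. \<Sum>i<length rs. c i * (rs ! i) j" "c (length rs)" r p]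
    by (simp add: dotp_sum_left)
  also have "(\<Sum>i<length rs. c i * dotp N (rs ! i) p) = 0"
    using assms(2) by (intro sum.neutral) (auto simp: killed_def)
  finally have last: "c (length rs) = 0" using assms(3) by simp
  then have "\<forall>j<N. (\<Sum>i<length rs. c i * (rs ! i) j) = 0" using eq by auto
  then have "\<forall>i<length rs. c i = 0" using assms(1) unfolding lin_indep_def by blast
  then show "c i = 0" using i last by (cases "i < length rs") (auto simp: less_Suc_eq)
qed

text \<open>Greedy completion: any \<open>r\<close> in \<open>R\<close> on which some vector killed
  by the list does not vanish may be appended, and \<open>lin_indep_length_le\<close> bounds the
  number of steps. Keeping \<open>rs\<close> in front matters, since the later determinants
  prescribe their first rows.\<close>

lemma lin_indep_extend:
  assumes "lin_indep N rs"
  shows "\<exists>ts. set ts \<subseteq> R \<and> lin_indep N (rs @ ts) \<and> (\<forall>p. killed N (set (rs @ ts)) p \<longrightarrow> killed N R p)"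
  using assms
proof (induction "N - length rs" arbitrary: rs rule: less_induct)
  case less
  show ?case
  proof (cases "\<forall>p. killed N (set rs) p \<longrightarrow> killed N R p")
    case True
    then show ?thesis using less.prems by (intro exI[of _ "[]"]) auto
  next
    case False
    then obtain p r where p: "killed N (set rs) p" "r \<in> R" "dotp N r p \<noteq> 0"
      by (auto simp: killed_def)
    have ind: "lin_indep N (rs @ [r])" using lin_indep_snoc less.prems p by blast
    have "length (rs @ [r]) \<le> N" using lin_indep_length_le[OF ind] .
    then have "N - length (rs @ [r]) < N - length rs" by simp
    then obtain ts where "set ts \<subseteq> R" "lin_indep N ((rs @ [r]) @ ts)"
      "\<forall>p. killed N (set ((rs @ [r]) @ ts)) p \<longrightarrow> killed N R p"
      using less.hyps[of "rs @ [r]"] ind by blast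
    then show ?thesis using p(2) by (intro exI[of _ "r # ts"]) auto
  qed
qed

text \<open>The form \<open>dotp\<close> is definite on integer vectors: a relation gives
  \<open>w + u = 0\<close> with \<open>w\<close> orthogonal to \<open>u\<close>, so \<open>u\<close>
  is orthogonal to itself and vanishes. Together with \<open>exists_killed\<close> this takes the
  place of rank-nullity.\<close>

lemma lin_indep_orthogonal_length:
  assumes "lin_indep N rs" "lin_indep N gs" "\<And>g. g \<in> set gs \<Longrightarrow> killed N (set rs) g"
  shows "length rs + length gs \<le> N"
proof -
  have "lin_indep N (rs @ gs)"
    unfolding lin_indep_def
  proof (intro allI impI)
    fix c :: "nat \<Rightarrow> int" and i
    assume c: "\<forall>j<N. (\<Sum>i<length (rs @ gs). c i * ((rs @ gs) ! i) j) = 0" and i: "i < length (rs @ gs)"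
    define u where "u = (\<lambda>j. \<Sum>i<length gs. c (length rs + i) * (gs ! i) j)"
    define w where "w = (\<lambda>j. \<Sum>i<length rs. c i * (rs ! i) j)"
    have split: "w j + u j = 0" if "j < N" for j
    proof -
      have "0 = (\<Sum>i<length rs + length gs. c i * ((rs @ gs) ! i) j)" using c that by simp
      also have "\<dots> = w j + u j"
        unfolding w_def u_def lessThan_atLeast0 
        by (subst sum.atLeastLessThan_concat[of 0 "length rs", symmetric])
          (auto simp: nth_append sum.shift_bounds_nat_ivl[of _ 0 "length rs" "length gs", simplified] 
             add.commute intro!: sum.cong)
      finally show ?thesis by simp
    qed
    have "dotp N w u = 0"
      unfolding w_def dotp_sum_left u_def dotp_sum_right
      using assms(3) by (auto simp: killed_def intro!: sum.neutral)
    moreover have "dotp N w u = - dotp N u u"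
      unfolding dotp_def by (auto simp flip: sum_negf intro!: sum.cong) (use split in \<open>metis add_eq_0_iff2 mult_minus_left\<close>)
    ultimately have "(\<Sum>j<N. u j * u j) = 0" by (simp add: dotp_def)
    then have u0: "u j = 0" if "j < N" for j
      using that by (subst (asm) sum_nonneg_eq_0_iff) auto
    then have w0: "w j = 0" if "j < N" for j using split that by fastforce
    have "\<forall>i<length rs. c i = 0" using assms(1) w0 unfolding lin_indep_def w_def by blast
    moreover have "\<forall>i<length gs. c (length rs + i) = 0"
      using assms(2) u0 unfolding lin_indep_def u_def
      by (elim allE[of _ "\<lambda>i. c (length rs + i)"]) blast
    ultimately show "c i = 0" using i
      by (cases "i < length rs") (auto, metis add_diff_inverse_nat nat_add_left_cancel_less)
  qed
  then show ?thesis using lin_indep_length_le by fastforce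
qed

section \<open>Heights and Toeplitz minors\<close>

text \<open>Coefficients of T^i times the polynomial with coefficients \<open>p\<close>.\<close>

definition tmult :: "nat \<Rightarrow> (nat \<Rightarrow> int) \<Rightarrow> nat \<Rightarrow> int" where
  "tmult i p = (\<lambda>j. if j < i then 0 else p (j - i))"

definition unit_row :: "nat \<Rightarrow> nat \<Rightarrow> int" where
  "unit_row h = (\<lambda>j. if j = h then 1 else 0)"

definition unit_rows :: "nat \<Rightarrow> nat \<Rightarrow> (nat \<Rightarrow> int) list" where
  "unit_rows h q = map unit_row [h..<h + q]"

definition hgt :: "nat \<Rightarrow> (nat \<Rightarrow> int) \<Rightarrow> real" where
  "hgt N p = (\<Sum>j<N. \<bar>real_of_int (p j)\<bar>)"

text \<open>The content is tested by primes because the Gauss type argument for Toeplitz minors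
  works one prime at a time.\<close>

definition primitive :: "(nat \<Rightarrow> int) \<Rightarrow> bool" where
  "primitive p \<longleftrightarrow> (\<forall>\<pi>. Factorial_Ring.prime \<pi> \<longrightarrow> (\<exists>j. \<not> \<pi> dvd p j))"

definition supp_below :: "nat \<Rightarrow> (nat \<Rightarrow> int) \<Rightarrow> bool" where
  "supp_below N p \<longleftrightarrow> (\<forall>j\<ge>N. p j = 0)"

text \<open>The rows are p, Tp, ..., T^(q-1)p, restricted to the window of columns \<open>h\<close>,
  ..., \<open>h + q - 1\<close>; the diagonal is constantly \<open>p h\<close>.\<close>

definition toeplitz_det :: "nat \<Rightarrow> (nat \<Rightarrow> int) \<Rightarrow> nat \<Rightarrow> int" where
  "toeplitz_det q p h = det (mat q q (\<lambda>(i, j). tmult i p (h + j)))"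

lemma tmult_0 [simp]: "tmult 0 p = p"
  by (simp add: tmult_def)

lemma length_unit_rows [simp]: "length (unit_rows h q) = q"
  by (simp add: unit_rows_def)

lemma dotp_unit_row: "h < N \<Longrightarrow> dotp N (unit_row h) p = p h"
  by (simp add: dotp_def unit_row_def sum.delta if_distrib[of "\<lambda>x. x * _"] cong: if_cong)

lemma abs_le_hgt: "j < N \<Longrightarrow> \<bar>real_of_int (p j)\<bar> \<le> hgt N p"
  unfolding hgt_def by (rule member_le_sum) auto

lemma hgt_nonneg: "0 \<le> hgt N p"
  by (simp add: hgt_def sum_nonneg)

lemma hgt_ge_1: "nonzero_below N p \<Longrightarrow> 1 \<le> hgt N p"
proof -
  assume "nonzero_below N p"
  then obtain j where j: "j < N" "p j \<noteq> 0" by (auto simp: nonzero_below_def)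
  then have "1 \<le> \<bar>p j\<bar>" by linarith
  then have "1 \<le> \<bar>real_of_int (p j)\<bar>" by linarith
  then show ?thesis using abs_le_hgt[OF j(1), of p] by linarith
qed

lemma toeplitz_det_Leibniz:
  "toeplitz_det q p h = p h ^ q + (\<Sum>\<sigma> | \<sigma> permutes {0..<q} \<and> \<sigma> \<noteq> id.
     signof \<sigma> * (\<Prod>i = 0..<q. tmult i p (h + \<sigma> i)))"
proof -
  let ?S = "{\<sigma>. \<sigma> permutes {0..<q}}"
  let ?f = "\<lambda>\<sigma>. signof \<sigma> * (\<Prod>i = 0..<q. tmult i p (h + \<sigma> i))"
  have "toeplitz_det q p h = (\<Sum>\<sigma>\<in>?S. signof \<sigma> * (\<Prod>i = 0..<q. mat q q (\<lambda>(i, j). tmult i p (h + j)) $$ (i, \<sigma> i)))"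
    unfolding toeplitz_det_def by (subst det_def'[of _ q]) auto
  also have "\<dots> = (\<Sum>\<sigma>\<in>?S. ?f \<sigma>)"
  proof (rule sum.cong[OF refl])
    fix \<sigma> assume "\<sigma> \<in> ?S"
    then have "\<sigma> i < q" if "i < q" for i
      using permutes_in_image[of \<sigma> "{0..<q}" i] that by auto
    then show "signof \<sigma> * (\<Prod>i = 0..<q. mat q q (\<lambda>(i, j). tmult i p (h + j)) $$ (i, \<sigma> i)) = ?f \<sigma>"
      by (auto intro!: prod.cong)
  qed
  also have "\<dots> = ?f id + (\<Sum>\<sigma>\<in>?S - {id}. ?f \<sigma>)"
    by (intro sum.remove) (auto simp: finite_permutations permutes_id)
  also have "?f id = p h ^ q" by (simp add: tmult_def)
  also have "?S - {id} = {\<sigma>. \<sigma> permutes {0..<q} \<and> \<sigma> \<noteq> id}" by auto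
  finally show ?thesis .
qed

lemma permutes_descent:
  fixes q :: nat
  assumes "\<sigma> permutes {0..<q}" "\<sigma> \<noteq> id"
  shows "\<exists>i<q. \<sigma> i < i"
proof (rule ccontr)
  assume "\<not> ?thesis"
  then have "\<forall>i\<in>{0..<q}. i \<le> \<sigma> i" by force
  then show False using permutes_natset_ge[OF assms(1)] assms(2) by blast
qed

text \<open>Modulo \<pi> the window starting at the first coefficient not divisible by \<pi> is
  triangular with diagonal \<open>p h\<close>. Hence the Toeplitz minors of a primitive polynomial
  have no common prime factor.\<close>

lemma toeplitz_det_not_dvd:
  assumes "Factorial_Ring.prime \<pi>" "\<not> \<pi> dvd p h" "\<And>j. j < h \<Longrightarrow> \<pi> dvd p j"
  shows "\<not> \<pi> dvd toeplitz_det q p h"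
proof -
  have "\<pi> dvd (\<Sum>\<sigma> | \<sigma> permutes {0..<q} \<and> \<sigma> \<noteq> id.
     signof \<sigma> * (\<Prod>i = 0..<q. tmult i p (h + \<sigma> i)))"
  proof (intro dvd_sum dvd_mult)
    fix \<sigma> assume \<sigma>: "\<sigma> \<in> {\<sigma>. \<sigma> permutes {0..<q} \<and> \<sigma> \<noteq> id}"
    then have \<sigma>: "\<sigma> permutes {0..<q}" "\<sigma> \<noteq> id" by auto
    then obtain i where i: "i < q" "\<sigma> i < i"
      using permutes_descent[OF \<sigma>] by blast
    have "\<pi> dvd tmult i p (h + \<sigma> i)"
      using i assms(3) by (auto simp: tmult_def)
    then show "\<pi> dvd (\<Prod>i = 0..<q. tmult i p (h + \<sigma> i))"
      using i by (meson atLeastLessThan_iff dvd_prod_eqI dvd_prodI dvd_trans finite_atLeastLessThan zero_le)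
  qed
  moreover have "\<not> \<pi> dvd p h ^ q" using assms(1,2) prime_dvd_power by blast
  ultimately show ?thesis unfolding toeplitz_det_Leibniz by (simp add: dvd_add_left_iff)
qed

text \<open>The window is not placed at the largest coefficient but where |p j| A^(j^2) is largest.
  Along a permutation the index shifts sum to zero, so by strict convexity of the square each term
  other than the diagonal one loses at least a factor \<open>A\<close>. With
  \<open>A = 2 * fact q\<close> all of them together stay below half of the diagonal term.\<close>

lemma toeplitz_det_large:
  fixes q d :: nat
  defines "A \<equiv> 2 * fact q :: real"
  assumes "supp_below (Suc d) p" "nonzero_below (Suc d) p"
  shows "\<exists>h\<le>d. hgt (Suc d) p ^ q \<le> 2 * ((real d + 1) * A powr (real d ^ 2)) ^ q * \<bar>real_of_int (toeplitz_det q p h)\<bar>"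
proof -
  have A: "A \<ge> 2" by (simp add: A_def)
  define g where "g = (\<lambda>j. \<bar>real_of_int (p j)\<bar> * A powr (real j ^ 2))"
  obtain h where h: "h \<le> d" and hmax: "\<And>j. j \<le> d \<Longrightarrow> g j \<le> g h"
  proof -
    have "finite (g ` {..d})" "g ` {..d} \<noteq> {}" by auto
    then have "Max (g ` {..d}) \<in> g ` {..d}" by (rule Max_in)
    then obtain h where "h \<le> d" "g h = Max (g ` {..d})" by (metis atMost_iff imageE)
    then show thesis using that by (metis Max_ge \<open>finite (g ` {..d})\<close> atMost_iff image_eqI)
  qed
  have bd: "\<bar>real_of_int (p j)\<bar> \<le> \<bar>real_of_int (p h)\<bar> * A powr (real h ^ 2 - real j ^ 2)" for j
  proof (cases "j \<le> d")
    case True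
    have "\<bar>real_of_int (p j)\<bar> * A powr (real j ^ 2) \<le> \<bar>real_of_int (p h)\<bar> * A powr (real h ^ 2)"
      using hmax[OF True] by (simp add: g_def)
    then show ?thesis using A by (simp add: powr_diff field_simps)
  next
    case False
    then have "p j = 0" using assms by (simp add: supp_below_def)
    then show ?thesis using A by simp
  qed
  have "p h \<noteq> 0"
  proof
    assume "p h = 0"
    then have "p j = 0" for j using bd[of j] by simp
    then show False using assms(3) by (auto simp: nonzero_below_def)
  qed
  then have ph: "0 < \<bar>real_of_int (p h)\<bar>" by simp
  have summand: "\<bar>real_of_int (signof \<sigma> * (\<Prod>i = 0..<q. tmult i p (h + \<sigma> i)))\<bar> \<le> \<bar>real_of_int (p h)\<bar> ^ q * (1 / A)"
    if \<sigma>: "\<sigma> permutes {0..<q}" "\<sigma> \<noteq> id" for \<sigma>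
  proof -
    define k where "k = (\<lambda>i. real (\<sigma> i) - real i)"
    have "\<bar>real_of_int (tmult i p (h + \<sigma> i))\<bar> \<le> \<bar>real_of_int (p h)\<bar> * A powr (real h ^ 2 - (real h + k i) ^ 2)" for i
    proof (cases "h + \<sigma> i < i")
      case True then show ?thesis using A by (simp add: tmult_def)
    next
      case False
      then have e: "real (h + \<sigma> i - i) = real h + k i" by (simp add: k_def of_nat_diff)
      show ?thesis using bd[of "h + \<sigma> i - i", unfolded e] False unfolding tmult_def by (simp only: if_False)
    qed
    then have "(\<Prod>i = 0..<q. \<bar>real_of_int (tmult i p (h + \<sigma> i))\<bar>)
       \<le> (\<Prod>i = 0..<q. \<bar>real_of_int (p h)\<bar> * A powr (real h ^ 2 - (real h + k i) ^ 2))"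
      by (intro prod_mono) auto
    also have "\<dots> = \<bar>real_of_int (p h)\<bar> ^ q * A powr (\<Sum>i = 0..<q. real h ^ 2 - (real h + k i) ^ 2)"
      using A by (simp add: prod.distrib powr_sum)
    also have "(\<Sum>i = 0..<q. real h ^ 2 - (real h + k i) ^ 2) = - 2 * real h * (\<Sum>i = 0..<q. k i) - (\<Sum>i = 0..<q. k i ^ 2)"
      by (simp add: power2_eq_square algebra_simps sum_subtractf sum.distrib sum_distrib_left sum_negf)
    also have "(\<Sum>i = 0..<q. k i) = 0"
    proof -
      have "(\<Sum>i\<in>{0..<q}. real (\<sigma> i)) = (\<Sum>i\<in>{0..<q}. real i)"
        using sum.permute[OF \<sigma>(1), of real] by (simp add: o_def)
      then show ?thesis by (simp add: k_def sum_subtractf)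
    qed
    also have "A powr (- 2 * real h * 0 - (\<Sum>i = 0..<q. k i ^ 2)) \<le> A powr (-1)"
    proof (rule powr_mono)
      obtain i where i: "i < q" "\<sigma> i < i"
        using permutes_descent[OF \<sigma>] by blast
      have "1 \<le> \<bar>k i\<bar>" using i by (simp add: k_def)
      then have "1 \<le> k i ^ 2" by (metis abs_le_square_iff abs_one one_power2)
      also have "\<dots> \<le> (\<Sum>i = 0..<q. k i ^ 2)" using i by (intro member_le_sum) auto
      finally show "- 2 * real h * 0 - (\<Sum>i = 0..<q. k i ^ 2) \<le> - 1" by simp
    qed (use A in simp)
    finally have "(\<Prod>i = 0..<q. \<bar>real_of_int (tmult i p (h + \<sigma> i))\<bar>) \<le> \<bar>real_of_int (p h)\<bar> ^ q * A powr (-1)"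
      by (simp add: mult_left_mono)
    moreover have "A powr (-1) = 1 / A" using A by (simp add: powr_minus_divide)
    moreover have "\<bar>real_of_int (signof \<sigma>)\<bar> = 1" by (simp add: sign_def)
    ultimately show ?thesis by (simp add: abs_mult abs_prod)
  qed
  let ?P = "{\<sigma>. \<sigma> permutes {0..<q} \<and> \<sigma> \<noteq> id}"
  have cP: "real (card ?P) \<le> fact q"
  proof -
    have "card ?P \<le> card {\<sigma>. \<sigma> permutes {0..<q}}" by (intro card_mono) (auto simp: finite_permutations)
    also have "\<dots> = fact q" by (rule card_permutations) auto
    finally show ?thesis by (metis of_nat_fact of_nat_le_iff)
  qed
  have "\<bar>real_of_int (\<Sum>\<sigma>\<in>?P. signof \<sigma> * (\<Prod>i = 0..<q. tmult i p (h + \<sigma> i)))\<bar>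
     \<le> (\<Sum>\<sigma>\<in>?P. \<bar>real_of_int (p h)\<bar> ^ q * (1 / A))"
    unfolding of_int_sum by (rule order.trans[OF sum_abs]) (intro sum_mono, use summand in auto)
  also have "\<dots> = real (card ?P) * (\<bar>real_of_int (p h)\<bar> ^ q * (1 / A))" by simp
  also have "\<dots> \<le> fact q * (\<bar>real_of_int (p h)\<bar> ^ q * (1 / A))"
    using cP A by (intro mult_right_mono) auto
  also have "\<dots> = \<bar>real_of_int (p h)\<bar> ^ q / 2" by (simp add: A_def)
  finally have small: "\<bar>real_of_int (\<Sum>\<sigma>\<in>?P. signof \<sigma> * (\<Prod>i = 0..<q. tmult i p (h + \<sigma> i)))\<bar>
     \<le> \<bar>real_of_int (p h)\<bar> ^ q / 2" .
  have "real_of_int (toeplitz_det q p h) = real_of_int (p h) ^ q +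
      real_of_int (\<Sum>\<sigma>\<in>?P. signof \<sigma> * (\<Prod>i = 0..<q. tmult i p (h + \<sigma> i)))"
    unfolding toeplitz_det_Leibniz by simp
  moreover have "\<bar>real_of_int (p h) ^ q\<bar> = \<bar>real_of_int (p h)\<bar> ^ q" by (simp add: power_abs)
  ultimately have D: "\<bar>real_of_int (p h)\<bar> ^ q \<le> 2 * \<bar>real_of_int (toeplitz_det q p h)\<bar>"
    using small by linarith
  have "hgt (Suc d) p \<le> (\<Sum>j<Suc d. \<bar>real_of_int (p h)\<bar> * A powr (real d ^ 2))"
    unfolding hgt_def
  proof (rule sum_mono)
    fix j
    have "real h ^ 2 \<le> real d ^ 2" using h by simp
    then have "real h ^ 2 - real j ^ 2 \<le> real d ^ 2" by (meson diff_le_eq le_add_same_cancel1 order_trans zero_le_power2)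
    then have "A powr (real h ^ 2 - real j ^ 2) \<le> A powr (real d ^ 2)" using A by (intro powr_mono) auto
    then show "\<bar>real_of_int (p j)\<bar> \<le> \<bar>real_of_int (p h)\<bar> * A powr (real d ^ 2)"
      using bd[of j] by (meson abs_ge_zero mult_left_mono order_trans)
  qed
  also have "\<dots> = \<bar>real_of_int (p h)\<bar> * ((real d + 1) * A powr (real d ^ 2))" by (simp add: algebra_simps)
  finally have "hgt (Suc d) p ^ q \<le> (\<bar>real_of_int (p h)\<bar> * ((real d + 1) * A powr (real d ^ 2))) ^ q"
    using hgt_nonneg by (intro power_mono)
  also have "\<dots> = \<bar>real_of_int (p h)\<bar> ^ q * ((real d + 1) * A powr (real d ^ 2)) ^ q"
    by (rule power_mult_distrib)
  also have "\<dots> \<le> (2 * \<bar>real_of_int (toeplitz_det q p h)\<bar>) * ((real d + 1) * A powr (real d ^ 2)) ^ q"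
    using D A by (intro mult_right_mono) auto
  finally show ?thesis using h by (auto simp: algebra_simps)
qed

text \<open>
  Both determinants are compared with a single auxiliary matrix whose last \<open>q\<close> columns are
  \<open>p, Tp, \<dots>, T\<^sup>q\<^sup>-\<^sup>1p\<close>.
\<close>

lemma det_unit_rows_proportional:
  assumes len: "length rs = d"
    and kill: "\<And>i. i < q \<Longrightarrow> killed (d + q) (set rs) (tmult i p)"
    and h0: "h0 \<le> d" "toeplitz_det q p h0 \<noteq> 0"
  shows "\<exists>z w. z \<noteq> 0 \<and> (\<forall>h\<le>d. det (rows_mat (d + q) (rs @ unit_rows h q)) * z = w * toeplitz_det q p h)"
proof -
  define N where "N = d + q"
  \<comment> \<open>\<open>E\<close> enumerates the \<open>d\<close> indices outside the window
    starting at \<open>h0\<close>, so that \<open>det Z\<close> is up to sign the Toeplitz minor at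
    \<open>h0\<close>. The matrix \<open>Z\<close> does not depend on \<open>h\<close>, which makes
    the factor of proportionality uniform.\<close>
  define E where "E = (\<lambda>(c::nat). if c < h0 then c else c + q)"
  define Z :: "int mat" where "Z = mat N N (\<lambda>(r, c). if c < d then (if r = E c then 1 else 0) else tmult (c - d) p r)"
  have Zc: "Z \<in> carrier_mat N N" by (simp add: Z_def)
  have z: "det Z \<noteq> 0"
  proof
    assume "det Z = 0"
    then obtain v where v: "v \<in> carrier_vec N" "v \<noteq> 0\<^sub>v N" "Z *\<^sub>v v = 0\<^sub>v N"
      using det_0_iff_vec_prod_zero[OF Zc] by blast
    have eq: "(\<Sum>c<d. (if r = E c then v $ c else 0)) + (\<Sum>i<q. tmult i p r * v $ (d + i)) = 0" if "r < N" for r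
    proof -
      have "0 = (Z *\<^sub>v v) $ r" using v(3) that by simp
      also have "\<dots> = (\<Sum>c = 0..<N. (if c < d then (if r = E c then 1 else 0) else tmult (c - d) p r) * v $ c)"
        using that v(1) by (auto simp: Z_def scalar_prod_def)
      also have "\<dots> = (\<Sum>c = 0..<d. (if c < d then (if r = E c then 1 else 0) else tmult (c - d) p r) * v $ c)
          + (\<Sum>c = d..<d + q. (if c < d then (if r = E c then 1 else 0) else tmult (c - d) p r) * v $ c)"
        unfolding N_def by (rule sum.atLeastLessThan_concat[symmetric]) auto
      also have "(\<Sum>c = d..<d + q. (if c < d then (if r = E c then 1 else 0) else tmult (c - d) p r) * v $ c)
          = (\<Sum>i<q. tmult i p r * v $ (d + i))"
        using sum.shift_bounds_nat_ivl[of "\<lambda>c. (if c < d then (if r = E c then 1 else 0) else tmult (c - d) p r) * v $ c" 0 d q]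
        by (simp add: add.commute lessThan_atLeast0)
      also have "(\<Sum>c = 0..<d. (if c < d then (if r = E c then 1 else 0) else tmult (c - d) p r) * v $ c)
          = (\<Sum>c<d. (if r = E c then v $ c else 0))"
        by (auto simp: lessThan_atLeast0 intro!: sum.cong)
      finally show ?thesis by simp
    qed
    have v2: "v $ (d + i) = 0" if "i < q" for i
    proof -
      define T where "T = mat q q (\<lambda>(i, j). tmult i p (h0 + j))"
      define u where "u = vec q (\<lambda>i. v $ (d + i))"
      have "transpose_mat T *\<^sub>v u = 0\<^sub>v q"
      proof (rule eq_vecI)
        fix j assume "j < dim_vec (0\<^sub>v q :: int vec)"
        then have j: "j < q" by simp
        have "h0 + j \<noteq> E c" if "c < d" for c using j by (auto simp: E_def)
        then have z0: "(\<Sum>c<d. (if h0 + j = E c then v $ c else 0)) = 0" by (intro sum.neutral) auto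
        have "h0 + j < N" using h0(1) j by (simp add: N_def)
        from eq[OF this] z0 have "(\<Sum>i<q. tmult i p (h0 + j) * v $ (d + i)) = 0" by simp
        then show "(transpose_mat T *\<^sub>v u) $ j = 0\<^sub>v q $ j"
          using j by (simp add: T_def u_def scalar_prod_def lessThan_atLeast0)
      qed (simp add: T_def)
      moreover have "det (transpose_mat T) \<noteq> 0"
        using h0(2) det_transpose[of T q] by (simp add: T_def toeplitz_det_def)
      moreover have "transpose_mat T \<in> carrier_mat q q" "u \<in> carrier_vec q" by (simp_all add: T_def u_def)
      ultimately have "u = 0\<^sub>v q" using det_0_iff_vec_prod_zero by blast
      then show ?thesis using that by (auto simp: u_def vec_eq_iff)
    qed
    have v1: "v $ c = 0" if "c < d" for c
    proof -
      have EN: "E c < N" using that h0(1) by (auto simp: E_def N_def)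
      have inj: "E c = E c' \<longleftrightarrow> c = c'" for c' by (auto simp: E_def)
      have "(\<Sum>c'<d. (if E c = E c' then v $ c' else 0)) = v $ c"
        unfolding inj using that by (simp add: sum.delta)
      then show ?thesis using eq[OF EN] v2 by simp
    qed
    have "v $ c = 0" if "c < N" for c
      using v1[of c] v2[of "c - d"] that by (cases "c < d") (auto simp: N_def)
    then show False using v(1,2) by (auto simp: vec_eq_iff)
  qed
  define A1 where "A1 = mat d d (\<lambda>(i, c). (rs ! i) (E c))"
  have main: "det (rows_mat N (rs @ unit_rows h q)) * det Z = det A1 * toeplitz_det q p h" if h: "h \<le> d" for h
  proof -
    define A3 where "A3 = mat q d (\<lambda>(i, c). if h + i = E c then 1 else 0 :: int)"
    define A4 where "A4 = mat q q (\<lambda>(i, c). tmult c p (h + i))"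
    have EN: "E c < N" if "c < d" for c using that h0(1) by (auto simp: E_def N_def)
    \<comment> \<open>The columns of \<open>Z\<close> that are multiples of \<open>p\<close> are
      killed by \<open>rs\<close>, which gives the zero block; the unit rows cut out the Toeplitz
      window at \<open>h\<close>.\<close>
    have "rows_mat N (rs @ unit_rows h q) * Z = four_block_mat A1 (0\<^sub>m d q) A3 A4"
    proof (rule eq_matI)
      fix i c assume "i < dim_row (four_block_mat A1 (0\<^sub>m d q) A3 A4)" "c < dim_col (four_block_mat A1 (0\<^sub>m d q) A3 A4)"
      then have i: "i < N" and c: "c < N" by (auto simp: A1_def A4_def N_def)
      define r where "r = (rs @ unit_rows h q) ! i"
      have ent: "(rows_mat N (rs @ unit_rows h q) * Z) $$ (i, c) = dotp N r (\<lambda>k. Z $$ (k, c))"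
        using i c by (auto simp: rows_mat_def Z_def scalar_prod_def dotp_def r_def lessThan_atLeast0 intro!: sum.cong)
      have col1: "dotp N r (\<lambda>k. Z $$ (k, c)) = r (E c)" if "c < d"
      proof -
        have "dotp N r (\<lambda>k. Z $$ (k, c)) = dotp N r (unit_row (E c))"
          using that c by (intro dotp_cong) (auto simp: Z_def unit_row_def)
        then show ?thesis using dotp_unit_row[OF EN[OF that]] by (simp add: dotp_commute)
      qed
      have col2: "dotp N r (\<lambda>k. Z $$ (k, c)) = dotp N r (tmult (c - d) p)" if "\<not> c < d"
        using that c by (intro dotp_cong) (auto simp: Z_def)
      have r1: "r = rs ! i" if "i < d" using that len by (simp add: r_def nth_append)
      have r2: "r = unit_row (h + (i - d))" if "\<not> i < d"
        using that len i by (simp add: r_def nth_append unit_rows_def N_def)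
      have hN: "h + (i - d) < N" if "\<not> i < d" using that i h by (simp add: N_def)
      have "dotp N r (\<lambda>k. Z $$ (k, c)) = four_block_mat A1 (0\<^sub>m d q) A3 A4 $$ (i, c)"
      proof (cases "i < d"; cases "c < d")
        assume "i < d" "c < d"
        then show ?thesis using col1 r1 by (simp add: A1_def A4_def)
      next
        assume a: "i < d" "\<not> c < d"
        have "c - d < q" using a c by (simp add: N_def)
        then have "dotp N (rs ! i) (tmult (c - d) p) = 0"
          using kill[of "c - d"] a len by (simp add: killed_def N_def)
        then show ?thesis using a c col2 r1 by (simp add: A1_def A4_def N_def)
      next
        assume a: "\<not> i < d" "c < d"
        then show ?thesis using col1 r2 i by (auto simp: A1_def A3_def A4_def unit_row_def N_def)
      next
        assume a: "\<not> i < d" "\<not> c < d"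
        then show ?thesis using col2 r2 dotp_unit_row[OF hN] i c
          by (auto simp: A1_def A4_def N_def)
      qed
      then show "(rows_mat N (rs @ unit_rows h q) * Z) $$ (i, c) = four_block_mat A1 (0\<^sub>m d q) A3 A4 $$ (i, c)"
        using ent by simp
    qed (auto simp: A1_def A4_def N_def rows_mat_def Z_def)
    then have "det (rows_mat N (rs @ unit_rows h q)) * det Z = det (four_block_mat A1 (0\<^sub>m d q) A3 A4)"
      using det_mult[OF rows_mat_carrier Zc] by metis
    also have "\<dots> = det A1 * det A4"
      by (rule det_four_block_mat_upper_right_zero[of _ d _ q]) (auto simp: A1_def A3_def A4_def)
    also have "det A4 = toeplitz_det q p h"
    proof -
      have "A4 = transpose_mat (mat q q (\<lambda>(i, j). tmult i p (h + j)))" by (auto simp: A4_def)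
      then show ?thesis using det_transpose[of "mat q q (\<lambda>(i, j). tmult i p (h + j))" q] by (simp add: toeplitz_det_def)
    qed
    finally show ?thesis .
  qed
  show ?thesis using z main unfolding N_def by blast
qed

text \<open>In this form the constant depends on \<open>d\<close> and \<open>q\<close> only. The
  last premise says that the kernel of \<open>rs\<close> is spanned by the first \<open>q\<close>
  multiples of \<open>p\<close>; the unit rows extract the minor of \<open>rs\<close> complementary
  to a window of \<open>q\<close> columns.\<close>

definition height_det_bound :: "nat \<Rightarrow> nat \<Rightarrow> real \<Rightarrow> bool" where
  "height_det_bound d q K \<longleftrightarrow> (\<forall>p rs. primitive p \<longrightarrow> supp_below (Suc d) p \<longrightarrow> length rs = d \<longrightarrow>
     (\<forall>i<q. killed (d + q) (set rs) (tmult i p)) \<longrightarrow>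
     (\<forall>x. killed (d + q) (set rs) x \<longrightarrow> (\<exists>a c. a \<noteq> 0 \<and> (\<forall>j<d + q. a * x j = (\<Sum>i<q. c i * tmult i p j)))) \<longrightarrow>
     (\<exists>h\<le>d. hgt (Suc d) p ^ q \<le> K * \<bar>real_of_int (det (rows_mat (d + q) (rs @ unit_rows h q)))\<bar>))"

text \<open>The minors of \<open>rs\<close> are proportional to the Toeplitz minors of
  \<open>p\<close>. The latter are coprime because \<open>p\<close> is primitive, so each divides
  its counterpart, and one of them is of the order of the \<open>q\<close>-th power of the
  height.\<close>

lemma height_power_le_det: "\<exists>K>0. height_det_bound d q K"
proof -
  define K where "K = 2 * ((real d + 1) * (2 * fact q) powr (real d ^ 2)) ^ q"
  have "K > 0" by (simp add: K_def)
  moreover have "\<exists>h\<le>d. hgt (Suc d) p ^ q \<le> K * \<bar>real_of_int (det (rows_mat (d + q) (rs @ unit_rows h q)))\<bar>"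
    if prim: "primitive p" and supp: "supp_below (Suc d) p" and len: "length rs = d"
      and kill: "\<forall>i<q. killed (d + q) (set rs) (tmult i p)"
      and span: "\<forall>x. killed (d + q) (set rs) x \<longrightarrow> (\<exists>a c. a \<noteq> 0 \<and> (\<forall>j<d + q. a * x j = (\<Sum>i<q. c i * tmult i p j)))"
    for p rs
  proof -
    have nz: "nonzero_below (Suc d) p"
    proof (rule ccontr)
      assume "\<not> nonzero_below (Suc d) p"
      then have "p j = 0" for j using supp by (cases "j < Suc d") (auto simp: nonzero_below_def supp_below_def)
      then have "(2::int) dvd p j" for j by simp
      moreover have "Factorial_Ring.prime (2::int)" by simp
      ultimately show False using prim unfolding primitive_def by blast
    qed
    obtain h where h: "h \<le> d" "hgt (Suc d) p ^ q \<le> K * \<bar>real_of_int (toeplitz_det q p h)\<bar>"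
      using toeplitz_det_large[OF supp nz, of q] unfolding K_def by blast
    have "0 < hgt (Suc d) p ^ q" using hgt_ge_1[OF nz] by simp
    then have Dh: "toeplitz_det q p h \<noteq> 0" using h(2) by auto
    let ?\<Phi> = "\<lambda>h. det (rows_mat (d + q) (rs @ unit_rows h q))"
    let ?D = "toeplitz_det q p"
    obtain z w where zw: "z \<noteq> 0" "\<And>h. h \<le> d \<Longrightarrow> ?\<Phi> h * z = w * ?D h"
      using det_unit_rows_proportional[OF len _ h(1) Dh] kill by blast
    have cross: "?\<Phi> h * ?D h' = ?\<Phi> h' * ?D h" if "h' \<le> d" for h'
    proof -
      have "z * (?\<Phi> h * ?D h') = z * (?\<Phi> h' * ?D h)"
        using zw(2)[OF h(1)] zw(2)[OF that] by (metis mult.assoc mult.commute)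
      then show ?thesis using zw(1) by simp
    qed
    \<comment> \<open>A kernel vector of the full matrix would be a combination of the multiples of
      \<open>p\<close> vanishing on the window, which the nonzero Toeplitz minor excludes.\<close>
    have \<Phi>: "?\<Phi> h \<noteq> 0"
    proof
      assume "?\<Phi> h = 0"
      then obtain x where x: "nonzero_below (d + q) x" "killed (d + q) (set (rs @ unit_rows h q)) x"
        using det_rows_mat_eq_0_iff[of "rs @ unit_rows h q" "d + q"] len by auto
      obtain a c where ac: "a \<noteq> 0" "\<And>j. j < d + q \<Longrightarrow> a * x j = (\<Sum>i<q. c i * tmult i p j)"
        using span x(2) by (metis killed_Un set_append)
      have "x (h + j) = 0" if "j < q" for j
      proof -
        have "unit_row (h + j) \<in> set (unit_rows h q)" using that by (auto simp: unit_rows_def)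
        then have "dotp (d + q) (unit_row (h + j)) x = 0" using x(2) by (auto simp: killed_def)
        then show ?thesis using dotp_unit_row[of "h + j" "d + q" x] that h(1) by simp
      qed
      then have s0: "(\<Sum>i<q. c i * tmult i p (h + j)) = 0" if "j < q" for j
        using ac(2)[of "h + j"] that h(1) by simp
      define T where "T = mat q q (\<lambda>(i, j). tmult i p (h + j))"
      have "transpose_mat T *\<^sub>v vec q c = 0\<^sub>v q"
        by (rule eq_vecI) (use s0 in \<open>auto simp: T_def scalar_prod_def lessThan_atLeast0 mult.commute\<close>)
      moreover have "det (transpose_mat T) \<noteq> 0"
        using Dh det_transpose[of T q] by (simp add: T_def toeplitz_det_def)
      moreover have "transpose_mat T \<in> carrier_mat q q" by (simp add: T_def)
      ultimately have "vec q c = 0\<^sub>v q" using det_0_iff_vec_prod_zero by (metis vec_carrier)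
      then have "c i = 0" if "i < q" for i using that by (auto simp: vec_eq_iff)
      then have "x j = 0" if "j < d + q" for j using ac that by simp
      then show False using x(1) by (auto simp: nonzero_below_def)
    qed
    define g where "g = Gcd (?D ` {..d})"
    have "is_unit g"
    proof (rule ccontr)
      assume nu: "\<not> is_unit g"
      have "g \<noteq> 0" using Dh h(1) by (auto simp: g_def)
      then obtain \<pi> where \<pi>: "Factorial_Ring.prime \<pi>" "\<pi> dvd g" using nu prime_divisor_exists by blast
      have ex: "\<exists>j. \<not> \<pi> dvd p j" using prim \<pi>(1) by (auto simp: primitive_def)
      define l where "l = (LEAST j. \<not> \<pi> dvd p j)"
      have l: "\<not> \<pi> dvd p l" "\<And>j. j < l \<Longrightarrow> \<pi> dvd p j"
        unfolding l_def using LeastI_ex[OF ex] not_less_Least by blast+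
      have "l \<le> d" using l(1) supp by (metis dvd_0_right not_less_eq_eq supp_below_def)
      moreover have "\<not> \<pi> dvd ?D l" using toeplitz_det_not_dvd[of \<pi> p l q] \<pi>(1) l by blast
      moreover have "\<pi> dvd ?D l" if "l \<le> d" using \<pi>(2) that unfolding g_def
        by (meson Gcd_dvd atMost_iff dvd_trans image_eqI)
      ultimately show False by blast
    qed
    then have "Gcd (?D ` {..d}) = 1"
      by (metis Gcd_int_greater_eq_0 g_def is_unit_normalize normalize_Gcd)
    \<comment> \<open>By proportionality \<open>?D h\<close> divides \<open>?\<Phi> h\<close> times
      every Toeplitz minor, hence \<open>?\<Phi> h\<close> times their gcd 1.\<close>
    moreover have "?D h dvd Gcd ((\<lambda>x. ?\<Phi> h * x) ` (?D ` {..d}))"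
      by (rule Gcd_greatest) (use cross in auto)
    ultimately have "?D h dvd ?\<Phi> h" by (simp add: Gcd_mult)
    then have "\<bar>?D h\<bar> \<le> \<bar>?\<Phi> h\<bar>" using \<Phi> by (simp add: dvd_imp_le_int)
    then have "\<bar>real_of_int (?D h)\<bar> \<le> \<bar>real_of_int (?\<Phi> h)\<bar>" by linarith
    then have "K * \<bar>real_of_int (?D h)\<bar> \<le> K * \<bar>real_of_int (?\<Phi> h)\<bar>" using \<open>K > 0\<close> by simp
    then show ?thesis using h by (meson order_trans)
  qed
  ultimately show ?thesis unfolding height_det_bound_def by blast
qed

section \<open>Determinants with rows close to a curve\<close>

lemma abs_det_le:
  fixes B :: "real mat"
  assumes B: "B \<in> carrier_mat N N"
    and bd: "\<And>i j. i < N \<Longrightarrow> j < N \<Longrightarrow> \<bar>B $$ (i, j)\<bar> \<le> E i * F j"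
    and nn: "\<And>i. i < N \<Longrightarrow> 0 \<le> E i" "\<And>i. i < N \<Longrightarrow> 0 \<le> F i"
  shows "\<bar>det B\<bar> \<le> fact N * (\<Prod>i<N. E i) * (\<Prod>j<N. F j)"
proof -
  have "\<bar>det B\<bar> \<le> (\<Sum>\<sigma> | \<sigma> permutes {0..<N}. \<bar>signof \<sigma> * (\<Prod>i = 0..<N. B $$ (i, \<sigma> i))\<bar>)"
    unfolding det_def'[OF B] by (rule sum_abs)
  also have "\<dots> \<le> (\<Sum>\<sigma> | \<sigma> permutes {0..<N}. (\<Prod>i<N. E i) * (\<Prod>j<N. F j))"
  proof (rule sum_mono)
    fix \<sigma> assume "\<sigma> \<in> {\<sigma>. \<sigma> permutes {0..<N}}"
    then have \<sigma>: "\<sigma> permutes {0..<N}" by simp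
    have \<sigma>N: "\<sigma> i < N" if "i < N" for i
      using permutes_in_image[OF \<sigma>, of i] that by auto
    have "\<bar>signof \<sigma> * (\<Prod>i = 0..<N. B $$ (i, \<sigma> i))\<bar> = (\<Prod>i = 0..<N. \<bar>B $$ (i, \<sigma> i)\<bar>)"
      by (simp add: abs_mult abs_prod sign_def)
    also have "\<dots> \<le> (\<Prod>i = 0..<N. E i * F (\<sigma> i))"
      by (intro prod_mono) (use bd \<sigma>N in auto)
    also have "\<dots> = (\<Prod>i = 0..<N. E i) * (\<Prod>i = 0..<N. F (\<sigma> i))"
      by (rule prod.distrib)
    also have "(\<Prod>i = 0..<N. F (\<sigma> i)) = (\<Prod>i = 0..<N. F i)"
      using prod.permute[OF \<sigma>, of F] by (simp add: o_def)
    finally show "\<bar>signof \<sigma> * (\<Prod>i = 0..<N. B $$ (i, \<sigma> i))\<bar> \<le> (\<Prod>i<N. E i) * (\<Prod>j<N. F j)"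
      by (simp add: lessThan_atLeast0)
  qed
  also have "\<dots> = fact N * (\<Prod>i<N. E i) * (\<Prod>j<N. F j)"
    by (simp add: card_permutations)
  finally show ?thesis .
qed

text \<open>
  Rows close to multiples of \<open>(1, \<xi>, \<xi>\<^sup>2, \<dots>)\<close> contribute their distance to that line, apart from one
  row contributing its full size; \<open>Q\<close> bounds the quotient of the two.
\<close>

lemma abs_det_rows_le:
  fixes \<xi> Q :: real and e :: "nat \<Rightarrow> nat \<Rightarrow> real"
  assumes N: "1 \<le> N" and Q: "0 \<le> Q"
    and E0: "\<And>i. i < N \<Longrightarrow> 0 \<le> E i"
    and b: "\<And>i j. i < N \<Longrightarrow> j < N \<Longrightarrow> b i j = real_of_int ((rs ! i) j) + (\<Sum>l<i. e i l * real_of_int ((rs ! l) j))"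
    and bQ: "\<And>i. i < N \<Longrightarrow> \<bar>b i 0\<bar> \<le> Q * E i"
    and bE: "\<And>i j. i < N \<Longrightarrow> j < N \<Longrightarrow> \<bar>b i j - \<xi> ^ j * b i 0\<bar> \<le> E i"
  shows "\<bar>real_of_int (det (rows_mat N rs))\<bar> \<le> fact N * Q * (\<Prod>i<N. E i)"
proof -
  define A where "A = map_mat real_of_int (rows_mat N rs)"
  define L :: "real mat" where "L = mat N N (\<lambda>(i, l). if l = i then 1 else if l < i then e i l else 0)"
  define U :: "real mat" where "U = mat N N (\<lambda>(l, j). if l = j then 1 else if l = 0 then -(\<xi> ^ j) else 0)"
  have c: "A \<in> carrier_mat N N" "L \<in> carrier_mat N N" "U \<in> carrier_mat N N"
    by (simp_all add: A_def L_def U_def)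
  have dL: "det L = 1"
  proof -
    have "det L = prod_list (diag_mat L)"
      by (rule det_lower_triangular[OF _ c(2)]) (auto simp: L_def)
    also have "\<dots> = 1" by (auto simp: prod_list_diag_prod L_def intro!: prod.neutral)
    finally show ?thesis .
  qed
  have dU: "det U = 1"
  proof -
    have "det U = prod_list (diag_mat U)"
      by (rule det_upper_triangular[OF _ c(3)]) (auto simp: U_def)
    also have "\<dots> = 1" by (auto simp: prod_list_diag_prod U_def intro!: prod.neutral)
    finally show ?thesis .
  qed
  have "det (L * A * U) = det A"
    using det_mult[OF mult_carrier_mat[OF c(2,1)] c(3)] det_mult[OF c(2,1)] dL dU by simp
  moreover have "det A = real_of_int (det (rows_mat N rs))"
    unfolding A_def by (rule of_int_hom.hom_det)
  ultimately have d: "real_of_int (det (rows_mat N rs)) = det (L * A * U)" by simp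
  have LA: "(L * A) $$ (i, j) = b i j" if "i < N" "j < N" for i j
  proof -
    have "(L * A) $$ (i, j) = (\<Sum>l = 0..<N. (if l = i then 1 else if l < i then e i l else 0) * real_of_int ((rs ! l) j))"
      using that by (auto simp: L_def A_def rows_mat_def scalar_prod_def intro!: sum.cong)
    also have "\<dots> = (\<Sum>l \<in> {0..<Suc i}. (if l = i then 1 else if l < i then e i l else 0) * real_of_int ((rs ! l) j))"
      using that by (intro sum.mono_neutral_right) auto
    also have "\<dots> = b i j"
      unfolding b[OF that] by (simp add: lessThan_atLeast0)
    finally show ?thesis .
  qed
  have LAU: "(L * A * U) $$ (i, j) = (if j = 0 then b i 0 else b i j - \<xi> ^ j * b i 0)" if "i < N" "j < N" for i j
  proof -
    define G where "G = L * A"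
    have G: "G \<in> carrier_mat N N" "\<And>l. l < N \<Longrightarrow> G $$ (i, l) = b i l"
      using c LA that by (auto simp: G_def)
    have "(L * A * U) $$ (i, j) = (\<Sum>l = 0..<N. b i l * (if l = j then 1 else if l = 0 then -(\<xi> ^ j) else 0))"
      unfolding G_def[symmetric] using that G by (auto simp: scalar_prod_def U_def intro!: sum.cong)
    also have "\<dots> = (\<Sum>l \<in> {0, j}. b i l * (if l = j then 1 else if l = 0 then -(\<xi> ^ j) else 0))"
      using that by (intro sum.mono_neutral_right) auto
    also have "\<dots> = (if j = 0 then b i 0 else b i j - \<xi> ^ j * b i 0)" by simp
    finally show ?thesis .
  qed
  have "\<bar>det (L * A * U)\<bar> \<le> fact N * (\<Prod>i<N. E i) * (\<Prod>j<N. if j = 0 then Q else 1)"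
  proof (rule abs_det_le)
    show "L * A * U \<in> carrier_mat N N" using c by simp
    show "\<bar>(L * A * U) $$ (i, j)\<bar> \<le> E i * (if j = 0 then Q else 1)" if "i < N" "j < N" for i j
      using LAU[OF that] bQ[OF that(1)] bE[OF that] by (simp add: mult.commute)
  qed (use E0 Q in auto)
  also have "(\<Prod>j<N. if j = 0 then Q else 1) = Q"
    using N by (subst prod.delta) auto
  finally show ?thesis using d by (simp add: algebra_simps)
qed

definition shift :: "nat \<Rightarrow> (nat \<Rightarrow> int) \<Rightarrow> nat \<Rightarrow> int" where
  "shift k x = (\<lambda>j. x (k + j))"

text \<open>The polynomial with coefficients \<open>r\<close> acting on the sequence
  \<open>v\<close> through its shifts. Mostly it is a single shift, but the argument with three
  spanning points needs sums of two shifts.\<close>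

definition comb_shift :: "nat \<Rightarrow> (nat \<Rightarrow> int) \<Rightarrow> (nat \<Rightarrow> int) \<Rightarrow> nat \<Rightarrow> int" where
  "comb_shift R r v = (\<lambda>j. \<Sum>k<R. r k * v (k + j))"

definition near_curve :: "nat \<Rightarrow> real \<Rightarrow> (nat \<Rightarrow> int) \<Rightarrow> real \<Rightarrow> bool" where
  "near_curve n \<xi> x L \<longleftrightarrow> (\<forall>i\<le>n. \<bar>real_of_int (x i) - real_of_int (x 0) * \<xi> ^ i\<bar> \<le> L)"

lemma near_curve_mono: "near_curve n \<xi> x L \<Longrightarrow> L \<le> L' \<Longrightarrow> near_curve n \<xi> x L'"
  unfolding near_curve_def by (meson order_trans)

lemma near_curve_nonneg: "near_curve n \<xi> x L \<Longrightarrow> 0 \<le> L"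
  unfolding near_curve_def by (elim allE[of _ 0]) auto

lemma prod_lessThan_append:
  fixes f g h :: "nat \<Rightarrow> real"
  shows "(\<Prod>i<a + b + c. if i < a then f i else if i < a + b then g (i - a) else h (i - a - b))
     = (\<Prod>i<a. f i) * (\<Prod>i<b. g i) * (\<Prod>i<c. h i)"
proof -
  let ?F = "\<lambda>i. if i < a then f i else if i < a + b then g (i - a) else h (i - a - b)"
  have "(\<Prod>i = 0..<a + b + c. ?F i) = (\<Prod>i = 0..<a. ?F i) * (\<Prod>i = a..<a + b. ?F i) * (\<Prod>i = a + b..<a + b + c. ?F i)"
    (is "_ = ?P1 * _ * _")
    using prod.atLeastLessThan_concat[of 0 "a + b" "a + b + c" ?F] prod.atLeastLessThan_concat[of 0 a "a + b" ?F] by simp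
  also have "(\<Prod>i = a..<a + b. ?F i) = (\<Prod>i = 0..<b. g i)"
    using prod.shift_bounds_nat_ivl[of ?F 0 a b] by (simp add: add.commute)
  also have "(\<Prod>i = a + b..<a + b + c. ?F i) = (\<Prod>i = 0..<c. h i)"
    using prod.shift_bounds_nat_ivl[of ?F 0 "a + b" c] by (simp add: add.commute)
  finally show ?thesis by (simp add: lessThan_atLeast0)
qed

text \<open>Each row of \<open>y\<close> costs only \<open>M\<close>, even in its first coordinate.
  As \<open>y\<close> is a combination of the \<open>vs\<close>, the action of \<open>r\<close> on
  \<open>y\<close> is a combination of the first rows. Its main part is \<open>y 0\<close> times the
  value of \<open>r\<close> at \<xi>, which stays away from zero, so a multiple of it cancels the
  main part of any shift of \<open>y\<close>. The coefficients \<open>c\<close> do not enter the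
  estimate and may be arbitrary reals.\<close>

lemma det_point_rows_bound:
  fixes n :: nat and \<xi> \<rho> :: real
  assumes \<rho>: "0 < \<rho>"
  shows "\<exists>C\<ge>1. \<forall>N R r vs y c ks ws ev M Ew Q.
     1 \<le> N \<longrightarrow> N \<le> n + 1 \<longrightarrow> R + N \<le> n + 2 \<longrightarrow> (\<forall>k<R. \<bar>r k\<bar> \<le> 1) \<longrightarrow>
     \<rho> \<le> \<bar>\<Sum>k<R. real_of_int (r k) * \<xi> ^ k\<bar> \<longrightarrow> 1 \<le> Q \<longrightarrow>
     (\<forall>i<length vs. \<bar>real_of_int ((vs ! i) 0)\<bar> \<le> Q * ev i \<and> near_curve n \<xi> (vs ! i) (ev i)) \<longrightarrow>
     (\<forall>l\<le>n. real_of_int (y l) = (\<Sum>i<length vs. c i * real_of_int ((vs ! i) l))) \<longrightarrow>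
     near_curve n \<xi> y M \<longrightarrow> (\<forall>k\<in>set ks. k + N \<le> n + 1) \<longrightarrow>
     (\<forall>i<length ws. 0 \<le> Ew i \<and> \<bar>real_of_int ((ws ! i) 0)\<bar> \<le> Q * Ew i \<and>
        (\<forall>j<N. \<bar>real_of_int ((ws ! i) j) - \<xi> ^ j * real_of_int ((ws ! i) 0)\<bar> \<le> Ew i)) \<longrightarrow>
     length vs + length ks + length ws = N \<longrightarrow>
     \<bar>real_of_int (det (rows_mat N (map (comb_shift R r) vs @ map (\<lambda>k. shift k y) ks @ ws)))\<bar>
       \<le> C * Q * (\<Prod>i<length vs. ev i) * M ^ length ks * (\<Prod>i<length ws. Ew i)"
proof -
  define Xi where "Xi = (1 + \<bar>\<xi>\<bar>) ^ n"
  have X1: "1 \<le> Xi" unfolding Xi_def by (rule one_le_power) auto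
  have pw: "\<bar>\<xi> ^ k\<bar> \<le> Xi" if "k \<le> n" for k
  proof -
    have "\<bar>\<xi> ^ k\<bar> \<le> (1 + \<bar>\<xi>\<bar>) ^ k" by (simp add: power_abs power_mono)
    also have "\<dots> \<le> Xi" unfolding Xi_def using that by (intro power_increasing) auto
    finally show ?thesis .
  qed
  define C1 where "C1 = (real n + 1) * (1 + Xi)"
  define C2 where "C2 = 1 + Xi / \<rho> * (real n + 1)"
  define C3 where "C3 = C2 * (1 + Xi)"
  define Cm where "Cm = max C1 C3"
  have C21: "1 \<le> C2" using X1 \<rho> by (simp add: C2_def)
  have C11: "1 \<le> C1" unfolding C1_def using X1 by (simp add: mult_ge1_I)
  have Cm1: "1 \<le> Cm" using C11 by (simp add: Cm_def)
  define C where "C = fact (n + 1) * Cm ^ (n + 1)"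
  have "1 \<le> C" unfolding C_def using Cm1 by (intro mult_ge1_I one_le_power fact_ge_1)
  moreover have "\<bar>real_of_int (det (rows_mat N (map (comb_shift R r) vs @ map (\<lambda>k. shift k y) ks @ ws)))\<bar>
       \<le> C * Q * (\<Prod>i<length vs. ev i) * M ^ length ks * (\<Prod>i<length ws. Ew i)"
    if N: "1 \<le> N" "N \<le> n + 1" "R + N \<le> n + 2" and r: "\<forall>k<R. \<bar>r k\<bar> \<le> 1"
      and r\<rho>: "\<rho> \<le> \<bar>\<Sum>k<R. real_of_int (r k) * \<xi> ^ k\<bar>" and Q: "1 \<le> Q"
      and vs: "\<forall>i<length vs. \<bar>real_of_int ((vs ! i) 0)\<bar> \<le> Q * ev i \<and> near_curve n \<xi> (vs ! i) (ev i)"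
      and y: "\<forall>l\<le>n. real_of_int (y l) = (\<Sum>i<length vs. c i * real_of_int ((vs ! i) l))"
      and yM: "near_curve n \<xi> y M" and ks: "\<forall>k\<in>set ks. k + N \<le> n + 1"
      and ws: "\<forall>i<length ws. 0 \<le> Ew i \<and> \<bar>real_of_int ((ws ! i) 0)\<bar> \<le> Q * Ew i \<and>
        (\<forall>j<N. \<bar>real_of_int ((ws ! i) j) - \<xi> ^ j * real_of_int ((ws ! i) 0)\<bar> \<le> Ew i)"
      and len: "length vs + length ks + length ws = N"
    for N R r vs y c ks ws ev M Ew Q
  proof -
    define rx where "rx = (\<Sum>k<R. real_of_int (r k) * \<xi> ^ k)"
    have rx: "rx \<noteq> 0" "\<rho> \<le> \<bar>rx\<bar>" using r\<rho> \<rho> by (auto simp: rx_def)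
    define rs where "rs = map (comb_shift R r) vs @ map (\<lambda>k. shift k y) ks @ ws"
    define a where "a = length vs"
    define b where "b = length ks"
    \<comment> \<open>Row operation for the middle block: subtract \<open>\<xi> ^ k / rx\<close>
      times the action of \<open>r\<close> on \<open>y\<close>, written in terms of the first
      \<open>a\<close> rows.\<close>
    define e where "e = (\<lambda>i l. if a \<le> i \<and> i < a + b \<and> l < a then - (\<xi> ^ (ks ! (i - a)) / rx) * c l else 0)"
    define B where "B = (\<lambda>i j. real_of_int ((rs ! i) j) + (\<Sum>l<i. e i l * real_of_int ((rs ! l) j)))"
    define E where "E = (\<lambda>i. if i < a then Cm * ev i else if i < a + b then Cm * M else Ew (i - a - b))"
    have rs1: "rs ! i = comb_shift R r (vs ! i)" if "i < a" for i
      using that by (simp add: rs_def a_def nth_append)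
    have rs2: "rs ! i = shift (ks ! (i - a)) y" if "a \<le> i" "i < a + b" for i
      using that by (auto simp: rs_def a_def b_def nth_append)
    have rs3: "rs ! i = ws ! (i - a - b)" if "a + b \<le> i" for i
      using that by (auto simp: rs_def a_def b_def nth_append)
    have Rn: "R \<le> n + 1" using N by simp
    have ev0: "0 \<le> ev i" if "i < a" for i using vs that near_curve_nonneg by (auto simp: a_def)
    have M0: "0 \<le> M" using yM near_curve_nonneg by blast
    have B1: "\<bar>B i 0\<bar> \<le> Q * E i \<and> (\<forall>j<N. \<bar>B i j - \<xi> ^ j * B i 0\<bar> \<le> E i)" if i: "i < a" for i
    proof -
      define v where "v = vs ! i"
      define L where "L = ev i"
      have v: "\<bar>real_of_int (v 0)\<bar> \<le> Q * L" "near_curve n \<xi> v L" using vs i by (auto simp: v_def L_def a_def)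
      have L0: "0 \<le> L" using v(2) near_curve_nonneg by blast
      define er where "er = (\<lambda>l. real_of_int (v l) - real_of_int (v 0) * \<xi> ^ l)"
      have er: "\<bar>er l\<bar> \<le> L" if "l \<le> n" for l using v(2) that by (simp add: near_curve_def er_def)
      have Bi: "B i j = (\<Sum>k<R. real_of_int (r k) * real_of_int (v (k + j)))" for j
        using i by (simp add: B_def e_def rs1 comb_shift_def v_def)
      have r': "\<bar>real_of_int (r k)\<bar> \<le> 1" if "k < R" for k using r that by (metis of_int_abs of_int_le_1_iff)
      have "\<bar>B i 0\<bar> \<le> (\<Sum>k<R. \<bar>real_of_int (r k) * real_of_int (v k)\<bar>)"
        unfolding Bi using sum_abs[of "\<lambda>k. real_of_int (r k) * real_of_int (v (k + 0))" "{..<R}"] by simp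
      also have "\<dots> \<le> (\<Sum>k<R. Q * L * (1 + Xi))"
      proof (rule sum_mono)
        fix k assume k: "k \<in> {..<R}"
        then have kn: "k \<le> n" using Rn by simp
        have "real_of_int (v k) = real_of_int (v 0) * \<xi> ^ k + er k" by (simp add: er_def)
        then have "\<bar>real_of_int (v k)\<bar> \<le> \<bar>real_of_int (v 0)\<bar> * \<bar>\<xi> ^ k\<bar> + \<bar>er k\<bar>"
          by (metis abs_mult abs_triangle_ineq)
        also have "\<dots> \<le> Q * L * Xi + L"
          using v(1) pw[OF kn] er[OF kn] L0 Q by (intro add_mono mult_mono) auto
        also have "\<dots> \<le> Q * L * (1 + Xi)" using mult_left_mono[OF Q L0] by (simp add: algebra_simps)
        finally have "\<bar>real_of_int (v k)\<bar> \<le> Q * L * (1 + Xi)" .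
        moreover have "\<bar>real_of_int (r k)\<bar> * \<bar>real_of_int (v k)\<bar> \<le> 1 * \<bar>real_of_int (v k)\<bar>"
          using r'[of k] k by (intro mult_right_mono) auto
        ultimately show "\<bar>real_of_int (r k) * real_of_int (v k)\<bar> \<le> Q * L * (1 + Xi)"
          by (simp add: abs_mult)
      qed
      also have "\<dots> = real R * (Q * L * (1 + Xi))" by simp
      also have "\<dots> \<le> (real n + 1) * (Q * L * (1 + Xi))"
        using Rn Q L0 X1 by (intro mult_right_mono) auto
      also have "\<dots> = Q * (C1 * L)" by (simp add: C1_def)
      also have "\<dots> \<le> Q * (Cm * L)" using Q L0 by (intro mult_left_mono mult_right_mono) (auto simp: Cm_def)
      finally have 1: "\<bar>B i 0\<bar> \<le> Q * E i" using i by (simp add: E_def L_def)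
      have "\<bar>B i j - \<xi> ^ j * B i 0\<bar> \<le> E i" if j: "j < N" for j
      proof -
        have "B i j - \<xi> ^ j * B i 0 = (\<Sum>k<R. real_of_int (r k) * (er (k + j) - \<xi> ^ j * er k))"
          unfolding Bi sum_distrib_left sum_subtractf[symmetric]
          by (intro sum.cong) (auto simp: er_def algebra_simps power_add)
        also have "\<bar>\<dots>\<bar> \<le> (\<Sum>k<R. \<bar>real_of_int (r k) * (er (k + j) - \<xi> ^ j * er k)\<bar>)" by (rule sum_abs)
        also have "\<dots> \<le> (\<Sum>k<R. L * (1 + Xi))"
        proof (rule sum_mono)
          fix k assume k: "k \<in> {..<R}"
          then have kj: "k + j \<le> n" "k \<le> n" "j \<le> n" using N j by auto
          have "\<bar>er (k + j) - \<xi> ^ j * er k\<bar> \<le> \<bar>er (k + j)\<bar> + \<bar>\<xi> ^ j\<bar> * \<bar>er k\<bar>"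
            by (metis abs_mult abs_triangle_ineq4)
          also have "\<dots> \<le> L + Xi * L" using er kj pw L0 X1 by (intro add_mono mult_mono) auto
          finally have "\<bar>er (k + j) - \<xi> ^ j * er k\<bar> \<le> L * (1 + Xi)" by (simp add: algebra_simps)
          moreover have "\<bar>real_of_int (r k)\<bar> * \<bar>er (k + j) - \<xi> ^ j * er k\<bar> \<le> 1 * \<bar>er (k + j) - \<xi> ^ j * er k\<bar>"
            using r'[of k] k by (intro mult_right_mono) auto
          ultimately show "\<bar>real_of_int (r k) * (er (k + j) - \<xi> ^ j * er k)\<bar> \<le> L * (1 + Xi)"
            by (simp add: abs_mult)
        qed
        also have "\<dots> = real R * (L * (1 + Xi))" by simp
        also have "\<dots> \<le> (real n + 1) * (L * (1 + Xi))" using Rn L0 X1 by (intro mult_right_mono) auto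
        also have "\<dots> = C1 * L" by (simp add: C1_def)
        also have "\<dots> \<le> Cm * L" using L0 by (intro mult_right_mono) (auto simp: Cm_def)
        finally show ?thesis using i by (simp add: E_def L_def)
      qed
      then show ?thesis using 1 by blast
    qed
    have B2: "\<bar>B i 0\<bar> \<le> Q * E i \<and> (\<forall>j<N. \<bar>B i j - \<xi> ^ j * B i 0\<bar> \<le> E i)" if i: "a \<le> i" "i < a + b" for i
    proof -
      define k where "k = ks ! (i - a)"
      have k: "k + N \<le> n + 1" using ks i by (auto simp: k_def b_def)
      define er where "er = (\<lambda>l. real_of_int (y l) - real_of_int (y 0) * \<xi> ^ l)"
      have er: "\<bar>er l\<bar> \<le> M" if "l \<le> n" for l using yM that by (simp add: near_curve_def er_def)
      \<comment> \<open>The main terms \<open>y 0 * \<xi> ^ (k + j)\<close> cancel and only errors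
        of \<open>y\<close> remain.\<close>
      have ex: "B i j = er (k + j) - \<xi> ^ k / rx * (\<Sum>l<R. real_of_int (r l) * er (l + j))" if j: "j < N" for j
      proof -
        have "(\<Sum>l<i. e i l * real_of_int ((rs ! l) j)) = (\<Sum>l<a. e i l * real_of_int ((rs ! l) j))"
          using i by (intro sum.mono_neutral_right) (auto simp: e_def)
        also have "\<dots> = (\<Sum>l<a. - (\<xi> ^ k / rx) * (c l * real_of_int (comb_shift R r (vs ! l) j)))"
          using i by (intro sum.cong) (auto simp: e_def rs1 k_def)
        also have "\<dots> = - (\<xi> ^ k / rx) * (\<Sum>l<a. c l * real_of_int (comb_shift R r (vs ! l) j))"
          by (simp add: sum_distrib_left)
        also have "(\<Sum>l<a. c l * real_of_int (comb_shift R r (vs ! l) j)) = 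
            (\<Sum>t<R. real_of_int (r t) * (\<Sum>l<a. c l * real_of_int ((vs ! l) (t + j))))"
          unfolding comb_shift_def sum_distrib_left of_int_sum of_int_mult
          by (subst sum.swap) (simp add: algebra_simps)
        also have "\<dots> = (\<Sum>t<R. real_of_int (r t) * real_of_int (y (t + j)))"
          using y N j by (intro sum.cong) (auto simp: a_def)
        also have "\<dots> = (\<Sum>t<R. real_of_int (r t) * er (t + j)) + real_of_int (y 0) * \<xi> ^ j * rx"
        proof -
          have "real_of_int (y 0) * \<xi> ^ j * rx = (\<Sum>t<R. real_of_int (r t) * (real_of_int (y 0) * \<xi> ^ (t + j)))"
            unfolding rx_def sum_distrib_left by (intro sum.cong) (auto simp: power_add)
          then show ?thesis by (simp add: er_def sum.distrib[symmetric] distrib_left[symmetric])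
        qed
        finally have "B i j = real_of_int (y (k + j)) - \<xi> ^ k / rx * ((\<Sum>t<R. real_of_int (r t) * er (t + j)) + real_of_int (y 0) * \<xi> ^ j * rx)"
          using i by (simp add: B_def rs2 shift_def k_def)
        also have "\<dots> = er (k + j) - \<xi> ^ k / rx * (\<Sum>l<R. real_of_int (r l) * er (l + j))"
        proof -
          have "\<xi> ^ k / rx * (real_of_int (y 0) * \<xi> ^ j * rx) = real_of_int (y 0) * \<xi> ^ (k + j)"
            using rx(1) by (simp add: power_add)
          then show ?thesis unfolding distrib_left by (simp add: er_def)
        qed
        finally show ?thesis .
      qed
      have small: "\<bar>B i j\<bar> \<le> C2 * M" if j: "j < N" for j
      proof -
        have "\<bar>\<Sum>l<R. real_of_int (r l) * er (l + j)\<bar> \<le> (\<Sum>l<R. \<bar>real_of_int (r l) * er (l + j)\<bar>)" by (rule sum_abs)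
        also have "\<dots> \<le> (\<Sum>l<R. M)"
        proof (rule sum_mono)
          fix l assume l: "l \<in> {..<R}"
          then have "l + j \<le> n" using N j by auto
          moreover have "\<bar>real_of_int (r l)\<bar> \<le> 1" using r l by (metis lessThan_iff of_int_abs of_int_le_1_iff)
          ultimately have "\<bar>real_of_int (r l)\<bar> * \<bar>er (l + j)\<bar> \<le> 1 * M" using er M0 by (intro mult_mono) auto
          then show "\<bar>real_of_int (r l) * er (l + j)\<bar> \<le> M" by (simp add: abs_mult)
        qed
        also have "\<dots> = real R * M" by simp
        also have "\<dots> \<le> (real n + 1) * M" using Rn M0 by (intro mult_right_mono) auto
        finally have s: "\<bar>\<Sum>l<R. real_of_int (r l) * er (l + j)\<bar> \<le> (real n + 1) * M" .
        have "\<bar>\<xi> ^ k / rx\<bar> \<le> Xi / \<rho>"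
          unfolding abs_divide using pw[of k] k N rx \<rho> X1 by (intro frac_le) auto
        then have "\<bar>\<xi> ^ k / rx\<bar> * \<bar>\<Sum>l<R. real_of_int (r l) * er (l + j)\<bar> \<le> Xi / \<rho> * ((real n + 1) * M)"
          using s X1 \<rho> by (intro mult_mono) auto
        moreover have "\<bar>er (k + j)\<bar> \<le> M" using er k j by auto
        ultimately have "\<bar>er (k + j)\<bar> + \<bar>\<xi> ^ k / rx\<bar> * \<bar>\<Sum>l<R. real_of_int (r l) * er (l + j)\<bar> \<le> C2 * M"
          by (simp add: C2_def algebra_simps)
        moreover have "\<bar>B i j\<bar> \<le> \<bar>er (k + j)\<bar> + \<bar>\<xi> ^ k / rx\<bar> * \<bar>\<Sum>l<R. real_of_int (r l) * er (l + j)\<bar>"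
          unfolding ex[OF j] abs_mult[symmetric] by (rule abs_triangle_ineq4)
        ultimately show ?thesis by linarith
      qed
      have "C2 \<le> C3" using C21 X1 by (simp add: C3_def)
      then have CC: "C2 * M \<le> C3 * M" "C3 * M \<le> Cm * M"
        using M0 by (auto simp: Cm_def intro!: mult_right_mono)
      have "\<bar>B i 0\<bar> \<le> Cm * M" using small[of 0] N CC by linarith
      also have "\<dots> \<le> Q * (Cm * M)" using mult_right_mono[OF Q, of "Cm * M"] M0 Cm1 by simp
      finally have 1: "\<bar>B i 0\<bar> \<le> Q * E i" using i by (simp add: E_def)
      have "\<bar>B i j - \<xi> ^ j * B i 0\<bar> \<le> E i" if j: "j < N" for j
      proof -
        have "\<bar>B i j - \<xi> ^ j * B i 0\<bar> \<le> \<bar>B i j\<bar> + \<bar>\<xi> ^ j\<bar> * \<bar>B i 0\<bar>" by (metis abs_mult abs_triangle_ineq4)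
        also have "\<dots> \<le> C2 * M + Xi * (C2 * M)"
          using small[OF j] small[of 0] pw[of j] j N X1 by (intro add_mono mult_mono) auto
        also have "\<dots> = C3 * M" by (simp add: C3_def algebra_simps)
        finally show ?thesis using i CC by (simp add: E_def)
      qed
      then show ?thesis using 1 by blast
    qed
    have B3: "0 \<le> E i \<and> \<bar>B i 0\<bar> \<le> Q * E i \<and> (\<forall>j<N. \<bar>B i j - \<xi> ^ j * B i 0\<bar> \<le> E i)" if i: "a + b \<le> i" "i < N" for i
    proof -
      have "i - a - b < length ws" using i len by (simp add: a_def b_def)
      then show ?thesis using ws i by (auto simp: B_def e_def E_def rs3)
    qed
    have all: "\<bar>B i 0\<bar> \<le> Q * E i \<and> (\<forall>j<N. \<bar>B i j - \<xi> ^ j * B i 0\<bar> \<le> E i)" if "i < N" for i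
      using B1[of i] B2[of i] B3[of i] that by (cases "i < a"; cases "i < a + b") auto
    have E0: "0 \<le> E i" if "i < N" for i
      using B3[of i] ev0[of i] M0 Cm1 that by (cases "i < a"; cases "i < a + b") (auto simp: E_def)
    have "\<bar>real_of_int (det (rows_mat N rs))\<bar> \<le> fact N * Q * (\<Prod>i<N. E i)"
      by (rule abs_det_rows_le[where b = B and e = e and \<xi> = \<xi>]) (use N Q E0 all B_def in auto)
    also have "(\<Prod>i<N. E i) = (\<Prod>i<a + b + length ws. if i < a then Cm * ev i else if i < a + b then Cm * M else Ew (i - a - b))"
      using len by (auto simp: E_def a_def b_def)
    also have "\<dots> = (\<Prod>i<a. Cm * ev i) * (\<Prod>i<b. Cm * M) * (\<Prod>i<length ws. Ew i)"
      by (rule prod_lessThan_append)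
    also have "\<dots> = Cm ^ (a + b) * ((\<Prod>i<a. ev i) * M ^ b * (\<Prod>i<length ws. Ew i))"
      by (simp add: prod.distrib power_mult_distrib power_add)
    finally have "\<bar>real_of_int (det (rows_mat N rs))\<bar> \<le> (fact N * Cm ^ (a + b)) * (Q * ((\<Prod>i<a. ev i) * M ^ b * (\<Prod>i<length ws. Ew i)))"
      by (simp add: algebra_simps)
    also have "\<dots> \<le> C * (Q * ((\<Prod>i<a. ev i) * M ^ b * (\<Prod>i<length ws. Ew i)))"
    proof (rule mult_right_mono)
      have "(fact N :: real) \<le> fact (n + 1)" using N by (intro fact_mono) auto
      moreover have "Cm ^ (a + b) \<le> Cm ^ (n + 1)" using Cm1 len N by (intro power_increasing) (auto simp: a_def b_def)
      ultimately show "fact N * Cm ^ (a + b) \<le> C" unfolding C_def using Cm1 by (intro mult_mono) auto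
      show "0 \<le> Q * ((\<Prod>i<a. ev i) * M ^ b * (\<Prod>i<length ws. Ew i))"
        using Q ev0 M0 ws by (intro mult_nonneg_nonneg prod_nonneg) auto
    qed
    finally show ?thesis by (simp add: rs_def a_def b_def algebra_simps)
  qed
  ultimately show ?thesis by blast
qed

section \<open>Annihilators of points\<close>

text \<open>The polynomial \<open>p 0 + p 1 T + \<dots> + p (N - 1) T\<^sup>N\<^sup>-\<^sup>1\<close> is orthogonal to all blocks of length \<open>N\<close> of \<open>x 0, \<dots>, x n\<close>.\<close>

definition annih :: "nat \<Rightarrow> nat \<Rightarrow> (nat \<Rightarrow> int) \<Rightarrow> (nat \<Rightarrow> int) \<Rightarrow> bool" where
  "annih n N x p \<longleftrightarrow> (\<forall>k. k + N \<le> n + 1 \<longrightarrow> dotp N (shift k x) p = 0)"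

definition shift_rows :: "nat \<Rightarrow> nat \<Rightarrow> (nat \<Rightarrow> int) \<Rightarrow> (nat \<Rightarrow> int) list" where
  "shift_rows n N x = map (\<lambda>k. shift k x) [0..<n + 2 - N]"

text \<open>For \<open>n = 2 * m + 1\<close> the second part says that the Hankel matrix of
  \<open>x\<close> with \<open>m + 1\<close> columns has full column rank. The support condition
  allows points to be compared as functions.\<close>

definition full_rank :: "nat \<Rightarrow> nat \<Rightarrow> (nat \<Rightarrow> int) \<Rightarrow> bool" where
  "full_rank n m x \<longleftrightarrow> supp_below (n + 1) x \<and> (\<forall>p. annih n (m + 1) x p \<longrightarrow> (\<forall>j<m + 1. p j = 0))"

lemma length_shift_rows [simp]: "length (shift_rows n N x) = n + 2 - N"
  by (simp add: shift_rows_def)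

lemma nth_shift_rows: "i < n + 2 - N \<Longrightarrow> shift_rows n N x ! i = shift i x"
  by (simp add: shift_rows_def)

lemma set_shift_rows: "N \<le> n + 1 \<Longrightarrow> set (shift_rows n N x) = {shift k x | k. k + N \<le> n + 1}"
  by (auto simp: shift_rows_def image_iff)

lemma killed_shift_rows: "N \<le> n + 1 \<Longrightarrow> killed N (set (shift_rows n N x)) p \<longleftrightarrow> annih n N x p"
  unfolding set_shift_rows by (auto simp: killed_def annih_def)

lemma annih_scale: "annih n N x p \<Longrightarrow> annih n N x (\<lambda>j. a * p j)"
  by (simp add: annih_def dotp_scale_right)

lemma annih_cong: "(\<And>j. j < N \<Longrightarrow> p j = q j) \<Longrightarrow> annih n N x p \<longleftrightarrow> annih n N x q"
  unfolding annih_def by (metis dotp_cong)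

lemma annih_sum: "(\<And>i. i \<in> I \<Longrightarrow> annih n N x (f i)) \<Longrightarrow> annih n N x (\<lambda>j. \<Sum>i\<in>I. c i * f i j)"
  by (simp add: annih_def dotp_sum_right)

lemma annih_lincomb: "annih n N x p \<Longrightarrow> annih n N x q \<Longrightarrow> annih n N x (\<lambda>j. a * p j + b * q j)"
  by (simp add: annih_def dotp_lincomb_right)

lemma annih_scale_cancel: "a \<noteq> 0 \<Longrightarrow> annih n N x (\<lambda>j. a * p j) \<longleftrightarrow> annih n N x p"
  by (simp add: annih_def dotp_scale_right)

lemma shift_lincomb: "shift k (\<lambda>j. a * x j + b * y j) = (\<lambda>j. a * shift k x j + b * shift k y j)"
  by (simp add: shift_def)

lemma annih_point_lincomb: "annih n N x p \<Longrightarrow> annih n N y p \<Longrightarrow> annih n N (\<lambda>j. a * x j + b * y j) p"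
  by (simp add: annih_def shift_lincomb dotp_lincomb_left)

lemma annih_point_scale_cancel: "a \<noteq> 0 \<Longrightarrow> annih n N (\<lambda>j. a * x j) p \<longleftrightarrow> annih n N x p"
  using dotp_scale_left by (simp add: annih_def shift_def)

lemma dotp_Suc_supp: "supp_below N p \<Longrightarrow> dotp (Suc N) r p = dotp N r p"
  by (simp add: dotp_def supp_below_def)

lemma dotp_Suc_tmult: "dotp (Suc N) (shift k x) (tmult (Suc 0) p) = dotp N (shift (Suc k) x) p"
proof -
  have "dotp (Suc N) (shift k x) (tmult (Suc 0) p) = shift k x 0 * tmult (Suc 0) p 0 + (\<Sum>j<N. shift k x (Suc j) * tmult (Suc 0) p (Suc j))"
    unfolding dotp_def by (rule sum.lessThan_Suc_shift)
  then show ?thesis by (simp add: dotp_def tmult_def shift_def)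
qed

lemma annih_Suc: "supp_below N p \<Longrightarrow> annih n N x p \<Longrightarrow> annih n (Suc N) x p"
  by (auto simp: annih_def dotp_Suc_supp)

lemma annih_Suc_tmult: "annih n N x p \<Longrightarrow> annih n (Suc N) x (tmult (Suc 0) p)"
  by (auto simp: annih_def dotp_Suc_tmult)

text \<open>One coefficient more means one block less. With \<open>N + 1\<close> coefficients,
  \<open>p\<close> still tests all blocks but the last, and T times \<open>p\<close> all blocks but
  the first.\<close>

lemma annih_of_Suc:
  assumes "supp_below N p" "N \<le> n" "annih n (Suc N) x p" "annih n (Suc N) x (tmult (Suc 0) p)"
  shows "annih n N x p"
  unfolding annih_def
proof (intro allI impI)
  fix k assume k: "k + N \<le> n + 1"
  show "dotp N (shift k x) p = 0"
  proof (cases "k + Suc N \<le> n + 1")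
    case True
    then show ?thesis using assms(1,3) by (auto simp: annih_def dotp_Suc_supp)
  next
    case False
    then have "0 < k" "k - 1 + Suc N \<le> n + 1" using k assms(2) by auto
    then have "dotp (Suc N) (shift (k - 1) x) (tmult (Suc 0) p) = 0" using assms(4) by (simp add: annih_def)
    then show ?thesis using \<open>0 < k\<close> by (simp add: dotp_Suc_tmult)
  qed
qed

text \<open>Hankel symmetry: a relation between the \<open>n + 2 - N\<close> blocks of length
  \<open>N\<close> is an annihilator with \<open>n + 2 - N\<close> coefficients.\<close>

lemma shift_rows_indep:
  assumes "1 \<le> N" "N \<le> n + 1" "\<And>p. annih n (n + 2 - N) x p \<Longrightarrow> (\<forall>j<n + 2 - N. p j = 0)"
  shows "lin_indep N (shift_rows n N x)"
  unfolding lin_indep_def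
proof (rule allI, rule impI)
  fix c :: "nat \<Rightarrow> int"
  assume c: "\<forall>j<N. (\<Sum>i<length (shift_rows n N x). c i * (shift_rows n N x ! i) j) = 0"
  have "annih n (n + 2 - N) x c"
    unfolding annih_def
  proof (intro allI impI)
    fix k assume "k + (n + 2 - N) \<le> n + 1"
    then have "k < N" using assms by simp
    then have "(\<Sum>i<n + 2 - N. c i * x (i + k)) = 0"
      using c by (auto simp: shift_rows_def shift_def)
    then show "dotp (n + 2 - N) (shift k x) c = 0" by (simp add: dotp_def shift_def mult.commute add.commute)
  qed
  then show "\<forall>i<length (shift_rows n N x). c i = 0" using assms(3) by simp
qed

lemma full_rank_indep:
  assumes "full_rank n m x" "1 \<le> N" "N \<le> n + 1" "n + 2 - N \<le> m + 1"
  shows "lin_indep N (shift_rows n N x)"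
proof (rule shift_rows_indep[OF assms(2,3)])
  fix p assume p: "annih n (n + 2 - N) x p"
  define q where "q = (\<lambda>j. if j < n + 2 - N then p j else 0)"
  have "dotp (m + 1) r q = dotp (n + 2 - N) r p" for r
  proof -
    have "dotp (m + 1) r q = (\<Sum>j<n + 2 - N. r j * q j)"
      unfolding dotp_def using assms(4) by (intro sum.mono_neutral_right) (auto simp: q_def)
    then show ?thesis by (simp add: dotp_def q_def)
  qed
  then have "annih n (m + 1) x q" using p assms(4) by (auto simp: annih_def)
  then have q0: "\<forall>j<m + 1. q j = 0" using assms(1) by (auto simp: full_rank_def)
  show "\<forall>j<n + 2 - N. p j = 0"
  proof (intro allI impI)
    fix j assume j: "j < n + 2 - N"
    then have "j < m + 1" using assms(4) by linarith
    then have "q j = 0" using q0 by blast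
    then show "p j = 0" using j by (simp only: q_def if_True)
  qed
qed

section \<open>Spans, kernels and duality of integer rows\<close>

lemma lin_indep_singleton: "nonzero_below N p \<Longrightarrow> lin_indep N [p]"
  by (auto simp: lin_indep_def nonzero_below_def)

lemma lin_indep_append_or_span:
  assumes "lin_indep N gs"
  shows "lin_indep N (gs @ [p]) \<or> (\<exists>a c. a \<noteq> 0 \<and> (\<forall>j<N. a * p j = (\<Sum>i<length gs. c i * (gs ! i) j)))"
proof (rule disjCI)
  assume no: "\<nexists>a c. a \<noteq> 0 \<and> (\<forall>j<N. a * p j = (\<Sum>i<length gs. c i * (gs ! i) j))"
  show "lin_indep N (gs @ [p])"
    unfolding lin_indep_def
  proof (intro allI impI)
    fix c :: "nat \<Rightarrow> int" and i
    assume c: "\<forall>j<N. (\<Sum>i<length (gs @ [p]). c i * ((gs @ [p]) ! i) j) = 0" and i: "i < length (gs @ [p])"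
    have eq: "(\<Sum>i<length gs. c i * (gs ! i) j) + c (length gs) * p j = 0" if "j < N" for j
      using c that by (simp add: nth_append)
    have last: "c (length gs) = 0"
    proof (rule ccontr)
      assume nz: "c (length gs) \<noteq> 0"
      have "- c (length gs) * p j = (\<Sum>i<length gs. c i * (gs ! i) j)" if "j < N" for j
        using eq[OF that] by simp
      then show False using no nz by (metis neg_equal_0_iff_equal)
    qed
    then have "\<forall>i<length gs. c i = 0" using assms eq unfolding lin_indep_def by auto
    then show "c i = 0" using i last by (cases "i < length gs") (auto simp: less_Suc_eq)
  qed
qed

lemma dependent_append_span:
  assumes "lin_indep N gs" "\<not> lin_indep N (gs @ [p])"
  shows "\<exists>a c. a \<noteq> 0 \<and> (\<forall>j<N. a * p j = (\<Sum>i<length gs. c i * (gs ! i) j))"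
  using lin_indep_append_or_span[OF assms(1), of p] assms(2) by satx

text \<open>Dimension count: one more independent vector in the kernel of \<open>rs\<close> would
  violate \<open>lin_indep_orthogonal_length\<close>.\<close>

lemma killed_in_span:
  assumes "lin_indep N rs" "lin_indep N gs" "\<And>g. g \<in> set gs \<Longrightarrow> killed N (set rs) g"
    "N \<le> length rs + length gs" "killed N (set rs) p"
  shows "\<exists>a c. a \<noteq> 0 \<and> (\<forall>j<N. a * p j = (\<Sum>i<length gs. c i * (gs ! i) j))"
proof -
  have "\<not> lin_indep N (gs @ [p])"
  proof
    assume "lin_indep N (gs @ [p])"
    moreover have "killed N (set rs) g" if "g \<in> set (gs @ [p])" for g using that assms(3,5) by auto
    ultimately have "length rs + length (gs @ [p]) \<le> N"
      using lin_indep_orthogonal_length[OF assms(1)] by blast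
    then show False using assms(4) by simp
  qed
  then show ?thesis using lin_indep_append_or_span[OF assms(2)] by blast
qed

text \<open>Complete the list by unit rows to \<open>N\<close> independent rows and drop
  \<open>r\<close>. The remaining rows have a kernel vector, on which \<open>r\<close> cannot vanish
  as well.\<close>

lemma lin_indep_dual:
  assumes "lin_indep N (rs @ [r])"
  shows "\<exists>p. killed N (set rs) p \<and> dotp N r p \<noteq> 0"
proof -
  obtain ts where ts: "lin_indep N ((rs @ [r]) @ ts)"
    "\<forall>p. killed N (set ((rs @ [r]) @ ts)) p \<longrightarrow> killed N {unit_row h | h. h < N} p"
    using lin_indep_extend[OF assms, of "{unit_row h | h. h < N}"] by blast
  have z: "\<not> nonzero_below N p" if p: "killed N (set ((rs @ [r]) @ ts)) p" for p
  proof
    assume "nonzero_below N p"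
    then obtain j where j: "j < N" "p j \<noteq> 0" by (auto simp: nonzero_below_def)
    have "killed N {unit_row h | h. h < N} p" using ts(2) p by blast
    then have "dotp N (unit_row j) p = 0" using j(1) unfolding killed_def by blast
    then show False using dotp_unit_row[OF j(1)] j(2) by simp
  qed
  have "length ((rs @ [r]) @ ts) = N"
    using lin_indep_length_le[OF ts(1)] exists_killed[of "(rs @ [r]) @ ts" N] z by (meson le_neq_implies_less)
  then have "length (rs @ ts) < N" by simp
  then obtain p where p: "nonzero_below N p" "killed N (set (rs @ ts)) p" using exists_killed by blast
  then have "dotp N r p \<noteq> 0" using z[of p] by (auto simp: killed_def)
  then show ?thesis using p(2) by (auto simp: killed_def)
qed

lemma primitive_part:
  assumes "nonzero_below N p"
  shows "\<exists>g p'. g \<noteq> 0 \<and> primitive p' \<and> supp_below N p' \<and> (\<forall>j<N. p j = g * p' j)"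
proof -
  define g where "g = Gcd (p ` {..<N})"
  have g0: "g \<noteq> 0" using assms by (auto simp: g_def nonzero_below_def)
  define p' where "p' = (\<lambda>j. if j < N then p j div g else 0)"
  have dv: "g dvd p j" if "j < N" for j using that by (auto simp: g_def)
  have eq: "p j = g * p' j" if "j < N" for j using dv[OF that] that by (simp add: p'_def)
  have "primitive p'"
    unfolding primitive_def
  proof (intro allI impI)
    fix \<pi> :: int assume \<pi>: "Factorial_Ring.prime \<pi>"
    show "\<exists>j. \<not> \<pi> dvd p' j"
    proof (rule ccontr)
      assume "\<nexists>j. \<not> \<pi> dvd p' j"
      then have "g * \<pi> dvd p j" if "j < N" for j using eq[OF that] by simp
      then have "g * \<pi> dvd g" unfolding g_def by (intro Gcd_greatest) (auto simp: g_def)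
      then have "is_unit \<pi>" using g0 by (metis dvd_mult_cancel_left mult_1_right)
      then show False using \<pi> not_prime_unit by blast
    qed
  qed
  moreover have "supp_below N p'" by (simp add: supp_below_def p'_def)
  ultimately show ?thesis using g0 eq by blast
qed

lemma primitive_nonzero: "primitive p \<Longrightarrow> supp_below N p \<Longrightarrow> nonzero_below N p"
proof (rule ccontr)
  assume a: "primitive p" "supp_below N p" "\<not> nonzero_below N p"
  then have "p j = 0" for j by (cases "j < N") (auto simp: nonzero_below_def supp_below_def)
  then have "(2::int) dvd p j" for j by simp
  moreover have "Factorial_Ring.prime (2::int)" by simp
  ultimately show False using a(1) unfolding primitive_def by blast
qed

lemma lin_indep_tmult:
  assumes "supp_below N p" "nonzero_below N p"
  shows "lin_indep (Suc N) [p, tmult (Suc 0) p]"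
  unfolding lin_indep_def
proof (rule allI, rule impI)
  fix c :: "nat \<Rightarrow> int"
  assume "\<forall>j<Suc N. (\<Sum>i<length [p, tmult (Suc 0) p]. c i * ([p, tmult (Suc 0) p] ! i) j) = 0"
  then have c: "c 0 * p j + c 1 * tmult (Suc 0) p j = 0" if "j < Suc N" for j
    using that by (simp add: numeral_2_eq_2)
  define l where "l = (LEAST j. p j \<noteq> 0)"
  have ex: "\<exists>j. p j \<noteq> 0" using assms(2) by (auto simp: nonzero_below_def)
  have l: "p l \<noteq> 0" "\<And>j. j < l \<Longrightarrow> p j = 0"
    unfolding l_def using LeastI_ex[OF ex] not_less_Least by blast+
  have lN: "l < N" using l(1) assms(1) by (metis not_le supp_below_def)
  have "tmult (Suc 0) p l = 0" using l(2) by (auto simp: tmult_def)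
  then have c0: "c 0 = 0" using c[of l] l(1) lN by simp
  have "tmult (Suc 0) p (Suc l) = p l" by (simp add: tmult_def)
  then have "c 1 = 0" using c[of "Suc l"] c0 l(1) lN by simp
  then show "\<forall>i<length [p, tmult (Suc 0) p]. c i = 0" using c0 by (auto simp: less_Suc_eq numeral_2_eq_2)
qed

text \<open>Solutions are geometric progressions and form a line. If \<open>d = 0\<close>, they
  vanish except possibly at the last index \<open>L - 1\<close>, where the recurrence imposes
  nothing, and they are proportional again.\<close>

lemma first_order_recurrence_proportional:
  fixes f g :: "nat \<Rightarrow> int"
  assumes cd: "c \<noteq> 0 \<or> d \<noteq> 0"
    and f: "\<And>k. Suc k < L \<Longrightarrow> c * f k + d * f (Suc k) = 0"
    and g: "\<And>k. Suc k < L \<Longrightarrow> c * g k + d * g (Suc k) = 0"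
  shows "\<exists>s t. (s \<noteq> 0 \<or> t \<noteq> 0) \<and> (\<forall>k<L. s * f k + t * g k = 0)"
proof (cases "d = 0")
  case True
  then have c0: "c \<noteq> 0" using cd by simp
  have z: "f k = 0 \<and> g k = 0" if "Suc k < L" for k
    using f[OF that] g[OF that] True c0 by simp
  show ?thesis
  proof (cases "f (L - 1) = 0 \<and> g (L - 1) = 0")
    case True
    have "f k = 0" if "k < L" for k
    proof (cases "Suc k < L")
      case False
      then have "k = L - 1" using that by simp
      then show ?thesis using True by simp
    qed (use z in simp)
    then show ?thesis by (intro exI[of _ 1] exI[of _ 0]) auto
  next
    case False
    have "g (L - 1) * f k + (- f (L - 1)) * g k = 0" if "k < L" for k
    proof (cases "Suc k < L")
      case True then show ?thesis using z by simp
    next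
      case False
      then have "k = L - 1" using that by simp
      then show ?thesis by simp
    qed
    then show ?thesis using False by (intro exI[of _ "g (L - 1)"] exI[of _ "- f (L - 1)"]) auto
  qed
next
  case False
  have pr: "g 0 * f k - f 0 * g k = 0" if "k < L" for k
    using that
  proof (induction k)
    case (Suc k)
    have "d * (g 0 * f (Suc k) - f 0 * g (Suc k)) = - c * (g 0 * f k - f 0 * g k)"
    proof -
      have df: "d * f (Suc k) = - c * f k" and dg: "d * g (Suc k) = - c * g k"
        using f[OF Suc.prems] g[OF Suc.prems] by linarith+
      have "d * (g 0 * f (Suc k) - f 0 * g (Suc k)) = g 0 * (d * f (Suc k)) - f 0 * (d * g (Suc k))"
        by (simp add: algebra_simps)
      then show ?thesis unfolding df dg by (simp add: algebra_simps)
    qed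
    also have "\<dots> = 0" using Suc by simp
    finally show ?case using False by simp
  qed simp
  have zero: "f k = 0" if "k < L" "f 0 = 0" for k
    using that(1)
  proof (induction k)
    case (Suc k)
    then show ?case using f[of k] False by simp
  qed (use that in simp)
  show ?thesis
  proof (cases "f 0 = 0")
    case True
    then show ?thesis using zero by (intro exI[of _ 1] exI[of _ 0]) auto
  next
    case False
    then show ?thesis using pr by (intro exI[of _ "g 0"] exI[of _ "- f 0"]) auto
  qed
qed

lemma exists_primitive_annih:
  assumes "N = n + 2 - N + d" "1 \<le> d" "N \<le> n + 1" 
  shows "\<exists>P. primitive P \<and> supp_below N P \<and> annih n N x P"
proof -
  have "length (shift_rows n N x) < N" using assms by simp
  then obtain p where p: "nonzero_below N p" "killed N (set (shift_rows n N x)) p" using exists_killed by blast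
  obtain g p' where g: "g \<noteq> 0" "primitive p'" "supp_below N p'" "\<forall>j<N. p j = g * p' j"
    using primitive_part[OF p(1)] by blast
  have "annih n N x p" using p(2) killed_shift_rows[OF assms(3)] by blast
  then have "annih n N x (\<lambda>j. g * p' j)" using g(4) annih_cong[of N p "\<lambda>j. g * p' j" n x] by blast
  then show ?thesis using g annih_scale_cancel by blast
qed

text \<open>
  Writing the shifts of \<open>u\<close> in terms of those of \<open>x\<close> and comparing overlapping shifts makes the
  coefficient matrix scalar.
\<close>

lemma annih_determines_point:
  assumes n: "n = 2 * m + 1" and m: "2 \<le> m" and x: "full_rank n m x" and u: "supp_below (n + 1) u"
    and sub: "\<And>p. annih n (m + 3) x p \<Longrightarrow> annih n (m + 3) u p"
  shows "\<exists>a b. a \<noteq> 0 \<and> (\<forall>j. a * u j = b * x j)"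
proof -
  have ind3: "lin_indep (m + 3) (shift_rows n (m + 3) x)"
    by (rule full_rank_indep[OF x]) (use n m in auto)
  have ind2: "lin_indep (m + 2) (shift_rows n (m + 2) x)"
    by (rule full_rank_indep[OF x]) (use n m in auto)
  have N3: "m + 3 \<le> n + 1" using n m by simp
  have "\<exists>a c. a \<noteq> 0 \<and> (\<forall>j<m + 3. a * u (k + j) = (\<Sum>i<m. c i * x (i + j)))" if k: "k < m" for k
  proof -
    have "\<not> lin_indep (m + 3) (shift_rows n (m + 3) x @ [shift k u])"
    proof
      assume "lin_indep (m + 3) (shift_rows n (m + 3) x @ [shift k u])"
      then obtain p where p: "killed (m + 3) (set (shift_rows n (m + 3) x)) p" "dotp (m + 3) (shift k u) p \<noteq> 0"
        using lin_indep_dual by blast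
      then have "annih n (m + 3) u p" using sub killed_shift_rows[OF N3] by blast
      then show False using p(2) k n by (auto simp: annih_def)
    qed
    then obtain a c where "a \<noteq> 0" and
      ac: "\<forall>j<m + 3. a * shift k u j = (\<Sum>i<length (shift_rows n (m + 3) x). c i * (shift_rows n (m + 3) x ! i) j)"
      using lin_indep_append_or_span[OF ind3] by blast
    moreover have "n + 2 - (m + 3) = m" using n by simp
    ultimately show ?thesis by (auto simp: shift_rows_def shift_def intro!: exI[of _ a] exI[of _ c])
  qed
  then obtain a c where a: "\<And>k. k < m \<Longrightarrow> a k \<noteq> (0::int)"
    and ac: "\<And>k j. k < m \<Longrightarrow> j < m + 3 \<Longrightarrow> a k * u (k + j) = (\<Sum>i<m. c k i * x (i + j))"
    by metis
  define A where "A = (\<Prod>k<m. a k)"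
  have A0: "A \<noteq> 0" using a by (simp add: A_def)
  define C where "C = (\<lambda>k i. (A div a k) * c k i)"
  have AC: "A * u (k + j) = (\<Sum>i<m. C k i * x (i + j))" if "k < m" "j < m + 3" for k j
  proof -
    have "a k dvd A" unfolding A_def using that by (intro dvd_prodI) auto
    then have "A = (A div a k) * a k" by simp
    then have "A * u (k + j) = (A div a k) * (a k * u (k + j))" by (metis mult.assoc)
    then show ?thesis using ac[OF that] by (simp add: C_def sum_distrib_left mult.assoc)
  qed
  \<comment> \<open>The blocks of \<open>u\<close> starting at \<open>k\<close> and at
    \<open>k + 1\<close> overlap in \<open>m + 2\<close> places. Comparing their expansions yields a
    relation between the \<open>m + 1\<close> blocks of \<open>x\<close> of length
    \<open>m + 2\<close>, and these are independent.\<close>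
  have step: "C (Suc k) 0 = 0 \<and> C k (m - 1) = 0 \<and> (\<forall>i. Suc i < m \<longrightarrow> C (Suc k) (Suc i) = C k i)" if k: "Suc k < m" for k
  proof -
    define e where "e = (\<lambda>i. (if i = 0 then 0 else C k (i - 1)) - (if i < m then C (Suc k) i else 0))"
    have "(\<Sum>i<m + 1. e i * x (i + j)) = 0" if j: "j < m + 2" for j
    proof -
      have "(\<Sum>i<Suc m. (if i = 0 then 0 else C k (i - 1)) * x (i + j)) = (\<Sum>i<m. C k i * x (i + Suc j))"
        by (subst sum.lessThan_Suc_shift) simp
      also have "\<dots> = A * u (k + Suc j)" using AC[of k "Suc j"] k j by simp
      also have "\<dots> = A * u (Suc k + j)" by simp
      also have "\<dots> = (\<Sum>i<m. C (Suc k) i * x (i + j))" using AC[of "Suc k" j] k j by simp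
      also have "\<dots> = (\<Sum>i<Suc m. (if i < m then C (Suc k) i else 0) * x (i + j))" by simp
      finally show ?thesis by (simp add: e_def left_diff_distrib sum_subtractf)
    qed
    moreover have "(\<Sum>i<length (shift_rows n (m + 2) x). e i * (shift_rows n (m + 2) x ! i) j) = (\<Sum>i<m + 1. e i * x (i + j))" for j
      using n by (intro sum.cong) (auto simp: nth_shift_rows shift_def)
    ultimately have "\<forall>j<m + 2. (\<Sum>i<length (shift_rows n (m + 2) x). e i * (shift_rows n (m + 2) x ! i) j) = 0"
      by presburger
    then have "\<forall>i<length (shift_rows n (m + 2) x). e i = 0" using ind2 unfolding lin_indep_def by blast
    then have e0: "e i = 0" if "i < m + 1" for i using that n by simp
    show ?thesis
    proof (intro conjI allI impI)
      show "C (Suc k) 0 = 0" using e0[of 0] m by (simp add: e_def)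
      show "C k (m - 1) = 0" using e0[of m] m by (simp add: e_def)
      show "C (Suc k) (Suc i) = C k i" if "Suc i < m" for i using e0[of "Suc i"] that by (simp add: e_def)
    qed
  qed
  have diag: "C t (i + t) = C 0 i" if "i + t < m" for i t
    using that
  proof (induction t)
    case (Suc t)
    then show ?case using step[of t] by simp
  qed simp
  \<comment> \<open>\<open>C\<close> is constant along diagonals, so an entry of the first row right
    of the corner is carried down to the last column, where it vanishes.\<close>
  have base: "C 0 i = 0" if "0 < i" "i < m" for i
  proof -
    have "C (m - 1 - i) (i + (m - 1 - i)) = C 0 i" by (rule diag) (use that in simp)
    moreover have "i + (m - 1 - i) = m - 1" "Suc (m - 1 - i) < m" using that by auto
    ultimately show ?thesis using step[of "m - 1 - i"] by simp
  qed
  have Cd: "C k i = (if i = k then C 0 0 else 0)" if "k < m" "i < m" for k i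
    using that
  proof (induction k arbitrary: i)
    case 0 then show ?case using base by auto
  next
    case (Suc k)
    then show ?case using step[of k] by (cases i) auto
  qed
  have final: "A * u (k + j) = C 0 0 * x (k + j)" if "k < m" "j < m + 3" for k j
  proof -
    have "(\<Sum>i<m. C k i * x (i + j)) = (\<Sum>i<m. if i = k then C 0 0 * x (i + j) else 0)"
    proof (intro sum.cong refl)
      fix i assume "i \<in> {..<m}"
      then show "C k i * x (i + j) = (if i = k then C 0 0 * x (i + j) else 0)"
        using Cd[OF that(1), of i] by (cases "i = k") auto
    qed
    then show ?thesis using AC[OF that] that by simp
  qed
  have "A * u j = C 0 0 * x j" for j
  proof (cases "j < n + 1")
    case True
    show ?thesis
    proof (cases "j < m")
      case True then show ?thesis using final[of j 0] by simp
    next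
      case False
      have "m - 1 + (j - (m - 1)) = j" "j - (m - 1) < m + 3" "m - 1 < m" using False True n m by auto
      then show ?thesis using final[of "m - 1" "j - (m - 1)"] by metis
    qed
  next
    case False
    then show ?thesis using x u by (simp add: full_rank_def supp_below_def)
  qed
  then show ?thesis using A0 by blast
qed

text \<open>
  If \<open>P\<close> generates the annihilators of \<open>y\<close> of degree at most \<open>m + 1\<close>, then some linear multiple of
  \<open>P\<close> lies in the pencil of \<open>G1\<close>, \<open>G2\<close>, so \<open>P\<close> maps both \<open>u\<close> and \<open>y'\<close> to geometric progressions of
  the same ratio.
\<close>

lemma annih_pencil_plane:
  assumes n: "n = 2 * m + 1" and m: "2 \<le> m" and y: "full_rank n m y"
    and y': "supp_below (n + 1) y'" and u: "supp_below (n + 1) u"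
    and P: "supp_below (m + 2) P" "annih n (m + 2) y P" "\<not> annih n (m + 2) y' P"
    and G: "lin_indep (m + 3) [G1, G2]"
      "\<And>G. G \<in> {G1, G2} \<Longrightarrow> annih n (m + 3) y G \<and> annih n (m + 3) y' G \<and> annih n (m + 3) u G"
  shows "\<exists>a b c. a \<noteq> 0 \<and> (\<forall>j. a * u j = b * y j + c * y' j)"
proof -
  have N3: "m + 3 \<le> n + 1" using n m by simp
  have ind3: "lin_indep (m + 3) (shift_rows n (m + 3) y)"
    by (rule full_rank_indep[OF y]) (use n m in auto)
  have len3: "length (shift_rows n (m + 3) y) = m" using n by simp
  have S2: "Suc (m + 2) = m + 3" by simp
  define TP where "TP = tmult (Suc 0) P"
  have Pk: "annih n (m + 3) x P" if "annih n (m + 2) x P" for x using annih_Suc[OF P(1) that] unfolding S2 .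
  have TPk: "annih n (m + 3) x TP" if "annih n (m + 2) x P" for x using annih_Suc_tmult[OF that] unfolding S2 TP_def .
  have nzP: "nonzero_below (m + 2) P"
  proof (rule ccontr)
    assume "\<not> nonzero_below (m + 2) P"
    then have "dotp (m + 2) r P = 0" for r by (simp add: nonzero_below_def dotp_def)
    then show False using P(3) by (simp add: annih_def)
  qed
  \<comment> \<open>If \<open>P\<close> and \<open>TP\<close> both depended on \<open>G1\<close> and
    \<open>G2\<close>, they would annihilate \<open>y'\<close>, and then \<open>P\<close> would do
    so already with \<open>m + 2\<close> coefficients.\<close>
  have notin: "\<exists>G3\<in>{P, TP}. lin_indep (m + 3) ([G1, G2] @ [G3])"
  proof (rule ccontr)
    assume no: "\<not> (\<exists>G3\<in>{P, TP}. lin_indep (m + 3) ([G1, G2] @ [G3]))"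
    have "annih n (m + 3) y' G3" if G3: "G3 \<in> {P, TP}" for G3
    proof -
      have "\<not> lin_indep (m + 3) ([G1, G2] @ [G3])" using no G3 by blast
      from dependent_append_span[OF G(1) this] obtain a c where "a \<noteq> 0"
        and ac: "\<forall>j<m + 3. a * G3 j = (\<Sum>i<length [G1, G2]. c i * ([G1, G2] ! i) j)" by blast
      have "annih n (m + 3) y' (\<lambda>j. \<Sum>i<length [G1, G2]. c i * ([G1, G2] ! i) j)"
        by (rule annih_sum) (use G(2) in \<open>auto simp: less_Suc_eq numeral_2_eq_2\<close>)
      then have "annih n (m + 3) y' (\<lambda>j. a * G3 j)" using ac annih_cong[of "m + 3" "\<lambda>j. a * G3 j"] by auto
      then show ?thesis using \<open>a \<noteq> 0\<close> annih_scale_cancel by blast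
    qed
    then have "annih n (Suc (m + 2)) y' P" "annih n (Suc (m + 2)) y' (tmult (Suc 0) P)" by (auto simp: TP_def numeral_3_eq_3)
    then show False using annih_of_Suc[OF P(1)] P(3) n m by auto
  qed
  then obtain G3 where G3: "G3 \<in> {P, TP}" "lin_indep (m + 3) [G1, G2, G3]" by auto
  have spanA: "\<exists>a c. a \<noteq> 0 \<and> (\<forall>j<m + 3. a * p j = (\<Sum>i<length [G1, G2, G3]. c i * ([G1, G2, G3] ! i) j))"
    if p: "annih n (m + 3) y p" for p
  proof (rule killed_in_span[OF ind3 G3(2)])
    show "killed (m + 3) (set (shift_rows n (m + 3) y)) g" if "g \<in> set [G1, G2, G3]" for g
      unfolding killed_shift_rows[OF N3] using that G(2) G3(1) Pk[OF P(2)] TPk[OF P(2)] by auto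
    show "m + 3 \<le> length (shift_rows n (m + 3) y) + length [G1, G2, G3]" using len3 by simp
    show "killed (m + 3) (set (shift_rows n (m + 3) y)) p" using p killed_shift_rows[OF N3] by blast
  qed
  \<comment> \<open>The annihilators of \<open>y\<close> with \<open>m + 3\<close> coefficients have
    dimension 3, so \<open>G1\<close>, \<open>G2\<close>, \<open>P\<close>, \<open>TP\<close> are
    dependent.\<close>
  have "\<exists>a b. (a \<noteq> 0 \<or> b \<noteq> 0) \<and> (\<forall>x. annih n (m + 3) x G1 \<longrightarrow> annih n (m + 3) x G2 \<longrightarrow>
      annih n (m + 3) x (\<lambda>j. a * P j + b * TP j))"
  proof -
    define gs where "gs = [G1, G2, P, TP]"
    have "\<not> lin_indep (m + 3) gs"
    proof
      assume a: "lin_indep (m + 3) gs"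
      have "killed (m + 3) (set (shift_rows n (m + 3) y)) g" if "g \<in> set gs" for g
        unfolding killed_shift_rows[OF N3] using that G(2) Pk[OF P(2)] TPk[OF P(2)] by (auto simp: gs_def)
      from lin_indep_orthogonal_length[OF ind3 a this] show False using len3 by (simp add: gs_def)
    qed
    then have "\<exists>c. (\<forall>j<m + 3. (\<Sum>i<length gs. c i * (gs ! i) j) = 0) \<and> (\<exists>i<length gs. c i \<noteq> (0::int))"
      unfolding lin_indep_def by blast
    then obtain c i where c: "\<And>j. j < m + 3 \<Longrightarrow> (\<Sum>i<length gs. c i * (gs ! i) j) = 0"
      and i: "i < length gs" "c i \<noteq> (0::int)" by blast
    have c': "c 2 * P j + c 3 * TP j = - c 0 * G1 j + - c 1 * G2 j" if "j < m + 3" for j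
      using c[OF that] by (simp add: gs_def eval_nat_numeral)
    have nz: "c 2 \<noteq> 0 \<or> c 3 \<noteq> 0"
    proof (rule ccontr)
      assume "\<not> (c 2 \<noteq> 0 \<or> c 3 \<noteq> 0)"
      then have "\<forall>j<m + 3. (\<Sum>i<length [G1, G2]. c i * ([G1, G2] ! i) j) = 0"
      proof (intro allI impI)
        fix j assume "j < m + 3"
        then have "c 0 * G1 j + c 1 * G2 j = 0" using c'[of j] \<open>\<not> (c 2 \<noteq> 0 \<or> c 3 \<noteq> 0)\<close> by simp
        then show "(\<Sum>i<length [G1, G2]. c i * ([G1, G2] ! i) j) = 0" by (simp add: numeral_2_eq_2)
      qed
      then have "\<forall>i<length [G1, G2]. c i = 0" using G(1) unfolding lin_indep_def by blast
      then have "c 0 = 0" "c 1 = 0" by auto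
      then show False using i \<open>\<not> (c 2 \<noteq> 0 \<or> c 3 \<noteq> 0)\<close> by (auto simp: gs_def eval_nat_numeral less_Suc_eq)
    qed
    have "annih n (m + 3) x (\<lambda>j. c 2 * P j + c 3 * TP j)" if "annih n (m + 3) x G1" "annih n (m + 3) x G2" for x
      using annih_lincomb[OF that, of "- c 0" "- c 1"] c' annih_cong[of "m + 3" "\<lambda>j. c 2 * P j + c 3 * TP j"] by auto
    then show ?thesis using nz by blast
  qed
  then obtain \<alpha> \<beta> where \<alpha>\<beta>: "\<alpha> \<noteq> 0 \<or> \<beta> \<noteq> 0" and
    F: "\<And>x. annih n (m + 3) x G1 \<Longrightarrow> annih n (m + 3) x G2 \<Longrightarrow> annih n (m + 3) x (\<lambda>j. \<alpha> * P j + \<beta> * TP j)" by blast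
  define f where "f = (\<lambda>x k. dotp (m + 2) (shift k x) P)"
  have rec: "\<alpha> * f x k + \<beta> * f x (Suc k) = 0" if "annih n (m + 3) x G1" "annih n (m + 3) x G2" "Suc k < m + 1" for x k
  proof -
    have "dotp (Suc (m + 2)) (shift k x) (\<lambda>j. \<alpha> * P j + \<beta> * TP j) = 0"
      using F[OF that(1,2)] that(3) n by (auto simp: annih_def numeral_3_eq_3)
    then show ?thesis
      unfolding dotp_lincomb_right TP_def dotp_Suc_tmult dotp_Suc_supp[OF P(1)] f_def .
  qed
  obtain s t where st: "s \<noteq> 0 \<or> t \<noteq> 0" "\<And>k. k < m + 1 \<Longrightarrow> s * f u k + t * f y' k = 0"
    using first_order_recurrence_proportional[OF \<alpha>\<beta>, of "m + 1" "f u" "f y'"] rec G(2) by blast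
  have "s \<noteq> 0"
  proof
    assume "s = 0"
    then have "f y' k = 0" if "k < m + 1" for k using st that by auto
    then show False using P(3) n by (auto simp: annih_def f_def)
  qed
  \<comment> \<open>\<open>P\<close> annihilates this combination of \<open>u\<close> and
    \<open>y'\<close>. Together with \<open>G1\<close> and \<open>G2\<close> this covers all
    annihilators of \<open>y\<close>, so the combination is a multiple of \<open>y\<close>.\<close>
  define u' where "u' = (\<lambda>j. s * u j + t * y' j)"
  have u'P: "annih n (m + 2) u' P"
    using st(2) n by (auto simp: annih_def u'_def shift_lincomb dotp_lincomb_left f_def)
  have u'G: "annih n (m + 3) u' G1" "annih n (m + 3) u' G2"
    unfolding u'_def using G(2) by (auto intro!: annih_point_lincomb)
  have u'G3: "annih n (m + 3) u' G3" using G3(1) Pk[OF u'P] TPk[OF u'P] by auto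
  have "annih n (m + 3) u' p" if p: "annih n (m + 3) y p" for p
  proof -
    from spanA[OF p] obtain a c where "a \<noteq> 0"
      and ac: "\<forall>j<m + 3. a * p j = (\<Sum>i<length [G1, G2, G3]. c i * ([G1, G2, G3] ! i) j)" by blast
    have "annih n (m + 3) u' (\<lambda>j. \<Sum>i<length [G1, G2, G3]. c i * ([G1, G2, G3] ! i) j)"
      by (rule annih_sum) (use u'G u'G3 in \<open>auto simp: eval_nat_numeral less_Suc_eq\<close>)
    then have "annih n (m + 3) u' (\<lambda>j. a * p j)" using ac annih_cong[of "m + 3" "\<lambda>j. a * p j"] by auto
    then show ?thesis using \<open>a \<noteq> 0\<close> annih_scale_cancel by blast
  qed
  moreover have "supp_below (n + 1) u'" using u y' by (simp add: u'_def supp_below_def)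
  ultimately obtain a b where ab: "a \<noteq> 0" "\<And>j. a * u' j = b * y j"
    using annih_determines_point[OF n m y] by blast
  have "(a * s) * u j = b * y j + (- a * t) * y' j" for j
    using ab(2)[of j] by (simp add: u'_def algebra_simps)
  then show ?thesis using ab(1) \<open>s \<noteq> 0\<close> by (metis mult_eq_0_iff)
qed

text \<open>The matrices with rows \<open>(a1 k, a2 k)\<close> and \<open>(b1 k, b2 k)\<close> span
  a linear space, and \<open>H\<close> is the polarised determinant: all members are singular. Such
  a space has a common left or right kernel vector. Subtracting a multiple of the first row turns
  the second into \<open>(e1 k, e2 k)\<close>, which vanishes at the pivot \<open>i\<close>. Either
  it vanishes for all \<open>k\<close>, giving a left kernel, or all rows are proportional to
  \<open>(a1 i, a2 i)\<close>, giving a right kernel.\<close>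

lemma singular_pencil_aux:
  fixes a1 a2 b1 b2 :: "nat \<Rightarrow> int"
  assumes H: "\<And>i j. i < m \<Longrightarrow> j < m \<Longrightarrow> a1 i * b2 j + a1 j * b2 i = a2 i * b1 j + a2 j * b1 i"
    and i: "i < m" "a1 i \<noteq> 0"
  shows "(\<exists>s t. (s \<noteq> 0 \<or> t \<noteq> 0) \<and> (\<forall>k<m. s * a1 k + t * b1 k = 0 \<and> s * a2 k + t * b2 k = 0)) \<or>
         (\<exists>c d. (c \<noteq> 0 \<or> d \<noteq> 0) \<and> (\<forall>k<m. c * a1 k + d * a2 k = 0 \<and> c * b1 k + d * b2 k = 0))"
proof -
  define e1 where "e1 = (\<lambda>k. a1 i * b1 k - b1 i * a1 k)"
  define e2 where "e2 = (\<lambda>k. a1 i * b2 k - b1 i * a2 k)"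
  have He: "a1 k * e2 j + a1 j * e2 k = a2 k * e1 j + a2 j * e1 k" if "k < m" "j < m" for k j
  proof -
    have "a1 k * e2 j + a1 j * e2 k - (a2 k * e1 j + a2 j * e1 k) =
      a1 i * ((a1 k * b2 j + a1 j * b2 k) - (a2 k * b1 j + a2 j * b1 k))"
      by (simp add: e1_def e2_def algebra_simps)
    also have "\<dots> = 0" using H[OF that] by simp
    finally show ?thesis by simp
  qed
  have ei: "e1 i = 0" "e2 i = 0" using H[OF i(1) i(1)] by (auto simp: e1_def e2_def algebra_simps)
  have par: "a1 i * e2 k = a2 i * e1 k" if "k < m" for k using He[OF i(1) that] ei by simp
  show ?thesis
  proof (cases "\<forall>k<m. e1 k = 0")
    case True
    then have "e2 k = 0" if "k < m" for k using par[OF that] i(2) that by simp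
    then have e: "\<forall>k<m. (- b1 i) * a1 k + a1 i * b1 k = 0 \<and> (- b1 i) * a2 k + a1 i * b2 k = 0"
      using True by (auto simp: e1_def e2_def)
    show ?thesis
      by (rule disjI1, rule exI[of _ "- b1 i"], rule exI[of _ "a1 i"]) (use e i(2) in simp)
  next
    case False
    then obtain j where j: "j < m" "e1 j \<noteq> 0" by blast
    have w: "a2 i * a1 k = a1 i * a2 k" if k: "k < m" for k
    proof (cases "e1 k = 0")
      case False
      have "a1 k * e2 k = a2 k * e1 k" using He[OF k k] by simp
      then have eq: "a2 k * e1 k = a1 k * e2 k" by simp
      have "(a2 i * a1 k - a1 i * a2 k) * e1 k = a1 k * (a2 i * e1 k) - a1 i * (a2 k * e1 k)"
        by (simp add: algebra_simps)
      also have "\<dots> = 0" unfolding eq par[OF k, symmetric] by (simp add: algebra_simps)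
      finally have "(a2 i * a1 k - a1 i * a2 k) * e1 k = 0" .
      then show ?thesis using False by simp
    next
      case True
      then have "e2 k = 0" using par[OF k] i(2) by simp
      then have "a1 k * e2 j = a2 k * e1 j" using He[OF k j(1)] True by simp
      then have eq: "a2 k * e1 j = a1 k * e2 j" by simp
      have "(a2 i * a1 k - a1 i * a2 k) * e1 j = a1 k * (a2 i * e1 j) - a1 i * (a2 k * e1 j)"
        by (simp add: algebra_simps)
      also have "\<dots> = 0" unfolding eq par[OF j(1), symmetric] by (simp add: algebra_simps)
      finally have "(a2 i * a1 k - a1 i * a2 k) * e1 j = 0" .
      then show ?thesis using j(2) by simp
    qed
    have "a2 i * b1 k = a1 i * b2 k" if k: "k < m" for k
    proof -
      have "a1 i * (a2 i * b1 k - a1 i * b2 k) = (a2 i * e1 k - a1 i * e2 k) + b1 i * (a2 i * a1 k - a1 i * a2 k)"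
        by (simp add: e1_def e2_def algebra_simps)
      then have "a1 i * (a2 i * b1 k - a1 i * b2 k) = 0" using par[OF k] w[OF k] by simp
      then show ?thesis using i(2) by simp
    qed
    then have e: "\<forall>k<m. a2 i * a1 k + (- a1 i) * a2 k = 0 \<and> a2 i * b1 k + (- a1 i) * b2 k = 0" using w by auto
    show ?thesis
      by (rule disjI2, rule exI[of _ "a2 i"], rule exI[of _ "- a1 i"]) (use e i(2) in simp)
  qed
qed

lemma singular_pencil:
  fixes a1 a2 b1 b2 :: "nat \<Rightarrow> int"
  assumes H: "\<And>i j. i < m \<Longrightarrow> j < m \<Longrightarrow> a1 i * b2 j + a1 j * b2 i = a2 i * b1 j + a2 j * b1 i"
  shows "(\<exists>s t. (s \<noteq> 0 \<or> t \<noteq> 0) \<and> (\<forall>k<m. s * a1 k + t * b1 k = 0 \<and> s * a2 k + t * b2 k = 0)) \<or>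
         (\<exists>c d. (c \<noteq> 0 \<or> d \<noteq> 0) \<and> (\<forall>k<m. c * a1 k + d * a2 k = 0 \<and> c * b1 k + d * b2 k = 0))"
proof -
  consider i where "i < m" "a1 i \<noteq> 0" | i where "i < m" "a2 i \<noteq> 0" | "\<forall>k<m. a1 k = 0 \<and> a2 k = 0" by blast
  then show ?thesis
  proof cases
    case 1 show ?thesis by (rule singular_pencil_aux[of m a1 b2 a2 b1, OF _ 1]) (rule H)
  next
    case 2
    have H': "a2 i * b1 j + a2 j * b1 i = a1 i * b2 j + a1 j * b2 i" if "i < m" "j < m" for i j using H[OF that] by simp
    from singular_pencil_aux[of m a2 b1 a1 b2, OF H' 2] show ?thesis
    proof
      assume "\<exists>s t. (s \<noteq> 0 \<or> t \<noteq> 0) \<and> (\<forall>k<m. s * a2 k + t * b2 k = 0 \<and> s * a1 k + t * b1 k = 0)"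
      then show ?thesis by (intro disjI1) blast
    next
      assume "\<exists>c d. (c \<noteq> 0 \<or> d \<noteq> 0) \<and> (\<forall>k<m. c * a2 k + d * a1 k = 0 \<and> c * b2 k + d * b1 k = 0)"
      then obtain c d where "c \<noteq> 0 \<or> d \<noteq> 0" "\<forall>k<m. c * a2 k + d * a1 k = 0 \<and> c * b2 k + d * b1 k = 0" by blast
      then show ?thesis
        by (intro disjI2 exI[of _ d] exI[of _ c]) (auto simp: add.commute)
    qed
  next
    case 3
    show ?thesis by (rule disjI1, rule exI[of _ 1], rule exI[of _ 0]) (use 3 in simp)
  qed
qed

lemma dotp_comb_shift:
  "dotp N (comb_shift R r v) p = (\<Sum>k<R. r k * dotp N (shift k v) p)"
proof -
  have "comb_shift R r v = (\<lambda>j. \<Sum>k<R. r k * shift k v j)" by (simp add: comb_shift_def shift_def)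
  then show ?thesis by (simp add: dotp_sum_left)
qed

lemma comb_shift_unit_row: "k < R \<Longrightarrow> comb_shift R (unit_row k) v = shift k v"
proof -
  assume k: "k < R"
  have "(\<Sum>i<R. unit_row k i * v (i + j)) = (\<Sum>i<R. if i = k then v (i + j) else 0)" for j
    by (intro sum.cong) (auto simp: unit_row_def)
  then show ?thesis using k by (simp add: comb_shift_def shift_def)
qed

lemma dotp_self_pos: "nonzero_below N p \<Longrightarrow> dotp N p p \<noteq> 0"
proof
  assume "nonzero_below N p" "dotp N p p = 0"
  then have "(\<Sum>j<N. p j * p j) = 0" by (simp add: dotp_def)
  then have "\<forall>j\<in>{..<N}. p j * p j = 0" by (subst (asm) sum_nonneg_eq_0_iff) auto
  then show False using \<open>nonzero_below N p\<close> by (auto simp: nonzero_below_def)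
qed

text \<open>The kernel has dimension 3. Each new vector is chosen orthogonal to the earlier ones as
  well, so it certifies its own independence.\<close>

lemma annih_basis3:
  assumes n: "n = 2 * m + 1" and m: "2 \<le> m" and y: "full_rank n m y"
    and S: "nonzero_below (m + 3) S" "annih n (m + 3) y S"
  shows "\<exists>F1 F2. annih n (m + 3) y F1 \<and> annih n (m + 3) y F2 \<and> lin_indep (m + 3) [S, F1, F2] \<and>
    (\<forall>p. annih n (m + 3) y p \<longrightarrow> (\<exists>a c0 c1 c2. a \<noteq> 0 \<and> (\<forall>j<m + 3. a * p j = c0 * S j + c1 * F1 j + c2 * F2 j)))"
proof -
  have N3: "m + 3 \<le> n + 1" using n m by simp
  define rs where "rs = shift_rows n (m + 3) y"
  have len: "length rs = m" using n by (simp add: rs_def)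
  have ind: "lin_indep (m + 3) rs" unfolding rs_def by (rule full_rank_indep[OF y]) (use n m in auto)
  have kl: "killed (m + 3) (set rs) p \<longleftrightarrow> annih n (m + 3) y p" for p
    unfolding rs_def by (rule killed_shift_rows[OF N3])
  have "length (rs @ [S]) < m + 3" using len by simp
  then obtain F1 where F1: "nonzero_below (m + 3) F1" "killed (m + 3) (set (rs @ [S])) F1"
    using exists_killed by blast
  have "length (rs @ [S, F1]) < m + 3" using len by simp
  then obtain F2 where F2: "nonzero_below (m + 3) F2" "killed (m + 3) (set (rs @ [S, F1])) F2"
    using exists_killed by blast
  have i1: "lin_indep (m + 3) ([S] @ [F1])"
    by (rule lin_indep_snoc[OF lin_indep_singleton[OF S(1)] _ dotp_self_pos[OF F1(1)]])
      (use F1(2) in \<open>auto simp: killed_def\<close>)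
  have i2: "lin_indep (m + 3) ([S, F1] @ [F2])"
    by (rule lin_indep_snoc[OF _ _ dotp_self_pos[OF F2(1)]])
      (use i1 F2(2) in \<open>auto simp: killed_def\<close>)
  have a: "annih n (m + 3) y F1" "annih n (m + 3) y F2"
    using F1(2) F2(2) kl by (auto simp: killed_def)
  have sp: "\<exists>a c0 c1 c2. a \<noteq> 0 \<and> (\<forall>j<m + 3. a * p j = c0 * S j + c1 * F1 j + c2 * F2 j)"
    if p: "annih n (m + 3) y p" for p
  proof -
    have "\<exists>a c. a \<noteq> 0 \<and> (\<forall>j<m + 3. a * p j = (\<Sum>i<length [S, F1, F2]. c i * ([S, F1, F2] ! i) j))"
    proof (rule killed_in_span[OF ind])
      show "lin_indep (m + 3) [S, F1, F2]" using i2 by simp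
      show "killed (m + 3) (set rs) g" if "g \<in> set [S, F1, F2]" for g using that S(2) a kl by auto
      show "m + 3 \<le> length rs + length [S, F1, F2]" using len by simp
      show "killed (m + 3) (set rs) p" using p kl by blast
    qed
    then obtain a c where "a \<noteq> 0" "\<forall>j<m + 3. a * p j = (\<Sum>i<length [S, F1, F2]. c i * ([S, F1, F2] ! i) j)" by blast
    then have "a \<noteq> 0 \<and> (\<forall>j<m + 3. a * p j = c 0 * S j + c 1 * F1 j + c 2 * F2 j)"
      by (simp add: numeral_2_eq_2)
    then show ?thesis by blast
  qed
  show ?thesis by (rule exI[of _ F1], rule exI[of _ F2]) (use a i2 sp in simp)
qed

lemma supp_lincomb: "supp_below N p \<Longrightarrow> supp_below N q \<Longrightarrow> supp_below N (\<lambda>j. a * p j + b * q j)"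
  by (simp add: supp_below_def)

text \<open>
  The \<open>2 \<times> 2\<close> matrices of the values of \<open>F1\<close>, \<open>F2\<close> on the shifts of \<open>u1\<close>, \<open>u2\<close> form a linear space;
  were they all singular, they would have a common left or right kernel.
\<close>

lemma exists_generic_shift:
  assumes n: "n = 2 * m + 1" and m: "2 \<le> m" and y: "full_rank n m y"
    and u: "supp_below (n + 1) u1" "supp_below (n + 1) u2"
    and ind: "\<And>a b c. (\<And>j. a * y j + b * u1 j + c * u2 j = 0) \<Longrightarrow> a = 0 \<and> b = 0 \<and> c = 0"
    and S: "nonzero_below (m + 3) S" "annih n (m + 3) y S" "annih n (m + 3) u1 S" "annih n (m + 3) u2 S"
    and uniq: "\<And>p. annih n (m + 3) y p \<Longrightarrow> annih n (m + 3) u1 p \<Longrightarrow> annih n (m + 3) u2 p \<Longrightarrow>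
       \<exists>a b. a \<noteq> 0 \<and> (\<forall>j<m + 3. a * p j = b * S j)"
  shows "\<exists>i<m. \<exists>j<m. \<exists>r \<in> {unit_row i, (\<lambda>k. unit_row i k + unit_row j k)}. (i \<noteq> j \<or> r = unit_row i) \<and>
    (\<forall>p. annih n (m + 3) y p \<longrightarrow> dotp (m + 3) (comb_shift m r u1) p = 0 \<longrightarrow> dotp (m + 3) (comb_shift m r u2) p = 0 \<longrightarrow>
       (\<exists>a b. a \<noteq> 0 \<and> (\<forall>j<m + 3. a * p j = b * S j)))"
proof -
  obtain F1 F2 where F: "annih n (m + 3) y F1" "annih n (m + 3) y F2" "lin_indep (m + 3) [S, F1, F2]"
    and basis': "\<forall>p. annih n (m + 3) y p \<longrightarrow> (\<exists>a c0 c1 c2. a \<noteq> 0 \<and> (\<forall>j<m + 3. a * p j = c0 * S j + c1 * F1 j + c2 * F2 j))"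
    using annih_basis3[OF n m y S(1,2)] by (elim exE conjE) blast
  have basis: "\<exists>a c0 c1 c2. a \<noteq> 0 \<and> (\<forall>j<m + 3. a * p j = c0 * S j + c1 * F1 j + c2 * F2 j)"
    if "annih n (m + 3) y p" for p using basis' that by blast
  define a1 where "a1 = (\<lambda>k. dotp (m + 3) (shift k u1) F1)"
  define a2 where "a2 = (\<lambda>k. dotp (m + 3) (shift k u1) F2)"
  define b1 where "b1 = (\<lambda>k. dotp (m + 3) (shift k u2) F1)"
  define b2 where "b2 = (\<lambda>k. dotp (m + 3) (shift k u2) F2)"
  have kS: "dotp (m + 3) (shift k u1) S = 0" "dotp (m + 3) (shift k u2) S = 0" if "k < m" for k
    using S(3,4) that n by (auto simp: annih_def)
  have linF: "dotp (m + 3) v (\<lambda>j. c0 * S j + c1 * F1 j + c2 * F2 j) =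
      c0 * dotp (m + 3) v S + c1 * dotp (m + 3) v F1 + c2 * dotp (m + 3) v F2" for v c0 c1 c2
    by (simp add: dotp_def sum.distrib sum_distrib_left algebra_simps)
  define good where "good = (\<lambda>r. \<forall>p. annih n (m + 3) y p \<longrightarrow> dotp (m + 3) (comb_shift m r u1) p = 0 \<longrightarrow>
       dotp (m + 3) (comb_shift m r u2) p = 0 \<longrightarrow> (\<exists>a b. a \<noteq> 0 \<and> (\<forall>j<m + 3. a * p j = b * S j)))"
  define A where "A = (\<lambda>f r. \<Sum>k<m. r k * f k :: int)"
  \<comment> \<open>An annihilator of \<open>y\<close> off the line of \<open>S\<close> that
    vanishes on the \<open>r\<close>-combinations of \<open>u1\<close> and \<open>u2\<close>
    provides a kernel vector of the 2 by 2 matrix of values.\<close>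
  have det0: "A a1 r * A b2 r = A a2 r * A b1 r" if bad: "\<not> good r" for r
  proof -
    obtain p where p: "annih n (m + 3) y p" "dotp (m + 3) (comb_shift m r u1) p = 0"
       "dotp (m + 3) (comb_shift m r u2) p = 0" "\<not> (\<exists>a b. a \<noteq> 0 \<and> (\<forall>j<m + 3. a * p j = b * S j))"
      using bad unfolding good_def by blast
    obtain a c0 c1 c2 where a: "a \<noteq> 0" and c: "\<And>j. j < m + 3 \<Longrightarrow> a * p j = c0 * S j + c1 * F1 j + c2 * F2 j"
      using basis[OF p(1)] by blast
    have nz: "c1 \<noteq> 0 \<or> c2 \<noteq> 0" using p(4) a c by fastforce
    have eq: "a * dotp (m + 3) v p = c0 * dotp (m + 3) v S + c1 * dotp (m + 3) v F1 + c2 * dotp (m + 3) v F2" for v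
    proof -
      have "a * dotp (m + 3) v p = dotp (m + 3) v (\<lambda>j. a * p j)" by (simp add: dotp_scale_right)
      also have "\<dots> = dotp (m + 3) v (\<lambda>j. c0 * S j + c1 * F1 j + c2 * F2 j)" using c by (intro dotp_cong) auto
      finally show ?thesis by (simp add: linF)
    qed
    have "dotp (m + 3) (comb_shift m r u1) S = 0" "dotp (m + 3) (comb_shift m r u2) S = 0"
      unfolding dotp_comb_shift using kS by (auto intro!: sum.neutral)
    then have e1: "c1 * A a1 r + c2 * A a2 r = 0" and e2: "c1 * A b1 r + c2 * A b2 r = 0"
      using eq[of "comb_shift m r u1"] eq[of "comb_shift m r u2"] p(2,3)
      by (auto simp: dotp_comb_shift A_def a1_def a2_def b1_def b2_def)
    show ?thesis
    proof (cases "c1 = 0")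
      case True
      then show ?thesis using nz e1 e2 by simp
    next
      case False
      have "c1 * (A a1 r * A b2 r - A a2 r * A b1 r) = (c1 * A a1 r) * A b2 r - A a2 r * (c1 * A b1 r)"
        by (simp add: algebra_simps)
      also have "\<dots> = (- c2 * A a2 r) * A b2 r - A a2 r * (- c2 * A b2 r)"
        using e1 e2 by (metis add_eq_0_iff2 mult_minus_left)
      also have "\<dots> = 0" by simp
      finally show ?thesis using False by simp
    qed
  qed
  have Au: "A f (unit_row i) = f i" if "i < m" for f i
  proof -
    have "A f (unit_row i) = (\<Sum>k<m. if k = i then f k else 0)" unfolding A_def by (intro sum.cong) (auto simp: unit_row_def)
    then show ?thesis using that by simp
  qed
  have Auu: "A f (\<lambda>k. unit_row i k + unit_row j k) = f i + f j" if "i < m" "j < m" for f i j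
    using Au[OF that(1), of f] Au[OF that(2), of f] by (simp add: A_def distrib_right sum.distrib)
  show ?thesis
  proof (rule ccontr)
    assume neg: "\<not> ?thesis"
    have bad1: "\<not> good (unit_row i)" if "i < m" for i using neg that m unfolding good_def by blast
    have bad2: "\<not> good (\<lambda>k. unit_row i k + unit_row j k)" if "i < m" "j < m" "i \<noteq> j" for i j
      using neg that unfolding good_def by blast
    have H1: "a1 i * b2 i = a2 i * b1 i" if "i < m" for i
      using det0[OF bad1[OF that]] Au[OF that] by simp
    \<comment> \<open>Single shifts make the determinant vanish on the generators, sums of two
      shifts then make its polarisation vanish.\<close>
    have H: "a1 i * b2 j + a1 j * b2 i = a2 i * b1 j + a2 j * b1 i" if "i < m" "j < m" for i j
    proof (cases "i = j")
      case True then show ?thesis using H1 that by simp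
    next
      case False
      have "(a1 i + a1 j) * (b2 i + b2 j) = (a2 i + a2 j) * (b1 i + b1 j)"
        using det0[OF bad2[OF that False]] Auu[OF that] by simp
      then show ?thesis using H1[OF that(1)] H1[OF that(2)] by (simp add: algebra_simps)
    qed
    consider s t where "s \<noteq> 0 \<or> t \<noteq> 0" "\<forall>k<m. s * a1 k + t * b1 k = 0 \<and> s * a2 k + t * b2 k = 0"
      | c d where "c \<noteq> 0 \<or> d \<noteq> 0" "\<forall>k<m. c * a1 k + d * a2 k = 0 \<and> c * b1 k + d * b2 k = 0"
      using singular_pencil[of m a1 b2 a2 b1, OF H] by blast
    then show False
    proof cases
      \<comment> \<open>Left kernel: a combination of \<open>u1\<close> and \<open>u2\<close> is
        annihilated by everything that annihilates \<open>y\<close>, hence is a multiple of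
        \<open>y\<close>.\<close>
      case 1
      define w where "w = (\<lambda>j. s * u1 j + t * u2 j)"
      have Fw: "annih n (m + 3) w F1" "annih n (m + 3) w F2" "annih n (m + 3) w S"
        using 1(2) n S(3,4) by (auto simp: annih_def w_def shift_lincomb dotp_lincomb_left a1_def a2_def b1_def b2_def)
      have "annih n (m + 3) w p" if p: "annih n (m + 3) y p" for p
      proof -
        obtain a c0 c1 c2 where a: "a \<noteq> 0" and c: "\<And>j. j < m + 3 \<Longrightarrow> a * p j = c0 * S j + c1 * F1 j + c2 * F2 j"
          using basis[OF p] by blast
        have "annih n (m + 3) w (\<lambda>j. c0 * S j + c1 * F1 j + c2 * F2 j)"
          using Fw by (simp add: annih_def linF)
        then have "annih n (m + 3) w (\<lambda>j. a * p j)"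
          using annih_cong[of "m + 3" "\<lambda>j. a * p j" "\<lambda>j. c0 * S j + c1 * F1 j + c2 * F2 j" n w] c by blast
        then show ?thesis using a annih_scale_cancel by blast
      qed
      then obtain a b where ab: "a \<noteq> 0" "\<And>j. a * w j = b * y j"
        using annih_determines_point[OF n m y supp_lincomb[OF u, of s t]] unfolding w_def by blast
      have "(- b) * y j + (a * s) * u1 j + (a * t) * u2 j = 0" for j
        using ab(2)[of j] by (simp add: w_def algebra_simps)
      then show False using ind[of "- b" "a * s" "a * t"] ab(1) 1(1) by auto
    next
      \<comment> \<open>Right kernel: a combination of \<open>F1\<close> and \<open>F2\<close> is a
        common annihilator independent of \<open>S\<close>.\<close>
      case 2
      define F where "F = (\<lambda>j. 0 * S j + c * F1 j + d * F2 j)"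
      have kF: "annih n (m + 3) y F" "annih n (m + 3) u1 F" "annih n (m + 3) u2 F"
        using 2(2) n F(1,2) unfolding annih_def F_def linF by (auto simp: a1_def a2_def b1_def b2_def)
      obtain a b where ab: "a \<noteq> 0" "\<And>j. j < m + 3 \<Longrightarrow> a * F j = b * S j" using uniq[OF kF] by blast
      define g where "g = (\<lambda>i::nat. if i = 0 then - b else if i = 1 then a * c else a * d)"
      have "\<forall>j<m + 3. (\<Sum>i<length [S, F1, F2]. g i * ([S, F1, F2] ! i) j) = 0"
        using ab(2) by (auto simp: g_def F_def numeral_2_eq_2 algebra_simps)
      then have "\<forall>i<length [S, F1, F2]. g i = 0" using F(3) unfolding lin_indep_def by blast
      then have "g 1 = 0" "g 2 = 0" by (auto simp del: One_nat_def)
      then show False using ab(1) 2(1) by (auto simp: g_def)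
    qed
  qed
qed

text \<open>The \<open>m\<close> rows \<open>rs\<close> leave a kernel of dimension 4, which is
  generated by \<open>S\<close> and \<open>G\<close> and their multiples by T. If a combination
  involving \<open>G\<close> or TG annihilates \<open>u1\<close> and \<open>u2\<close>, then
  \<open>G\<close> acts on both as geometric progressions of the same ratio. Hence some combination
  of \<open>u1\<close> and \<open>u2\<close> is annihilated by \<open>S\<close> and
  \<open>G\<close>, and \<open>annih_pencil_plane\<close> puts it into the plane of \<open>y\<close>
  and \<open>y'\<close>, against independence.\<close>

lemma annih_four_points:
  assumes n: "n = 2 * m + 1" and m: "2 \<le> m" and y: "full_rank n m y" and y': "full_rank n m y'"
    and u: "supp_below (n + 1) u1" "supp_below (n + 1) u2"
    and ind: "\<And>a b c d. (\<And>j. a * y j + b * y' j + c * u1 j + d * u2 j = 0) \<Longrightarrow> a = 0 \<and> b = 0 \<and> c = 0 \<and> d = 0"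
    and P: "supp_below (m + 2) P" "annih n (m + 2) y P" "\<not> annih n (m + 2) y' P"
    and S: "supp_below (m + 3) S" "\<And>x. x \<in> {y, y', u1, u2} \<Longrightarrow> annih n (m + 3) x S"
    and G: "supp_below (m + 3) G" "annih n (m + 3) y G" "annih n (m + 3) y' G"
    and SG: "lin_indep (m + 3) [S, G]"
    and rs: "lin_indep (m + 4) rs" "length rs = m" "\<And>p. annih n (m + 4) y p \<Longrightarrow> annih n (m + 4) y' p \<Longrightarrow> killed (m + 4) (set rs) p"
  shows "\<And>p. annih n (m + 4) u1 p \<Longrightarrow> annih n (m + 4) u2 p \<Longrightarrow> killed (m + 4) (set rs) p \<Longrightarrow>
      \<exists>a c0 c1. a \<noteq> 0 \<and> (\<forall>j<m + 4. a * p j = c0 * S j + c1 * tmult (Suc 0) S j)"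
    and "\<And>p. killed (m + 4) (set rs) p \<Longrightarrow> \<exists>a c0 c1 c2 c3. a \<noteq> 0 \<and>
      (\<forall>j<m + 4. a * p j = c0 * S j + c1 * tmult (Suc 0) S j + c2 * G j + c3 * tmult (Suc 0) G j)"
proof -
  let ?TS = "tmult (Suc 0) S" and ?TG = "tmult (Suc 0) G"
  have e4: "m + 4 = Suc (m + 3)" by simp
  have lift: "annih n (m + 4) x q" "annih n (m + 4) x (tmult (Suc 0) q)"
    if "supp_below (m + 3) q" "annih n (m + 3) x q" for x q
    unfolding e4 using annih_Suc[OF that] annih_Suc_tmult[OF that(2)] by auto
  have lin4: "dotp N v (\<lambda>j. c0 * S j + c1 * ?TS j + c2 * G j + c3 * ?TG j) =
     c0 * dotp N v S + c1 * dotp N v ?TS + c2 * dotp N v G + c3 * dotp N v ?TG" for N v c0 c1 c2 c3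
    by (simp add: dotp_def sum.distrib sum_distrib_left algebra_simps)
  have key: "c2 = 0 \<and> c3 = 0"
    if k: "annih n (m + 4) u1 (\<lambda>j. c0 * S j + c1 * ?TS j + c2 * G j + c3 * ?TG j)"
      "annih n (m + 4) u2 (\<lambda>j. c0 * S j + c1 * ?TS j + c2 * G j + c3 * ?TG j)" for c0 c1 c2 c3
  proof (rule ccontr)
    assume "\<not> (c2 = 0 \<and> c3 = 0)"
    then have nz: "c2 \<noteq> 0 \<or> c3 \<noteq> 0" by blast
    define f where "f = (\<lambda>x k. dotp (m + 3) (shift k x) G)"
    have rec: "c2 * f x k + c3 * f x (Suc k) = 0" if x: "x \<in> {u1, u2}" and kk: "Suc k < m" for x k
    proof -
      have kn: "k + (m + 4) \<le> n + 1" using kk n by simp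
      have "dotp (m + 4) (shift k x) (\<lambda>j. c0 * S j + c1 * ?TS j + c2 * G j + c3 * ?TG j) = 0"
        using k x kn by (auto simp: annih_def)
      moreover have "annih n (m + 4) x S" "annih n (m + 4) x ?TS" using lift[OF S(1)] S(2) x by auto
      then have "dotp (m + 4) (shift k x) S = 0" "dotp (m + 4) (shift k x) ?TS = 0" using kn by (auto simp: annih_def)
      moreover have "dotp (m + 4) (shift k x) G = f x k" unfolding e4 f_def by (rule dotp_Suc_supp[OF G(1)])
      moreover have "dotp (m + 4) (shift k x) ?TG = f x (Suc k)" unfolding e4 f_def by (rule dotp_Suc_tmult)
      ultimately show ?thesis unfolding lin4 by simp
    qed
    obtain s t where st: "s \<noteq> 0 \<or> t \<noteq> 0" "\<And>k. k < m \<Longrightarrow> s * f u1 k + t * f u2 k = 0"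
      using first_order_recurrence_proportional[OF nz, of m "f u1" "f u2"] rec by blast
    define w where "w = (\<lambda>j. s * u1 j + t * u2 j)"
    have wG: "annih n (m + 3) w G"
      using st(2) n by (auto simp: annih_def w_def shift_lincomb dotp_lincomb_left f_def)
    have wS: "annih n (m + 3) w S" unfolding w_def by (rule annih_point_lincomb) (use S(2) in auto)
    have "\<exists>a b c. a \<noteq> 0 \<and> (\<forall>j. a * w j = b * y j + c * y' j)"
    proof (rule annih_pencil_plane[OF n m y _ _ P SG])
      show "supp_below (n + 1) y'" using y' by (simp add: full_rank_def)
      show "supp_below (n + 1) w" unfolding w_def by (rule supp_lincomb[OF u])
      show "annih n (m + 3) y Ga \<and> annih n (m + 3) y' Ga \<and> annih n (m + 3) w Ga" if "Ga \<in> {S, G}" for Ga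
        using that S(2) G(2,3) wG wS by auto
    qed
    then obtain a b c where abc: "a \<noteq> 0" "\<And>j. a * w j = b * y j + c * y' j" by blast
    have "(- b) * y j + (- c) * y' j + (a * s) * u1 j + (a * t) * u2 j = 0" for j
      using abc(2)[of j] by (simp add: w_def algebra_simps)
    then show False using ind[of "- b" "- c" "a * s" "a * t"] abc(1) st(1) by auto
  qed
  have nzS: "nonzero_below (m + 3) S"
  proof (rule ccontr)
    assume "\<not> nonzero_below (m + 3) S"
    then have "\<forall>j<m + 3. (\<Sum>i<length [S, G]. (if i = 0 then 1 else 0) * ([S, G] ! i) j) = 0"
      by (simp add: nonzero_below_def)
    then have "\<forall>i<length [S, G]. (if i = 0 then 1 else 0) = (0::int)"
      using SG unfolding lin_indep_def by (elim allE[of _ "\<lambda>i. if i = 0 then 1 else 0"]) blast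
    then show False by auto
  qed
  have gs: "lin_indep (m + 4) [S, ?TS, G, ?TG]"
    unfolding lin_indep_def
  proof (rule allI, rule impI)
    fix c :: "nat \<Rightarrow> int"
    assume "\<forall>j<m + 4. (\<Sum>i<length [S, ?TS, G, ?TG]. c i * ([S, ?TS, G, ?TG] ! i) j) = 0"
    then have c: "c 0 * S j + c 1 * ?TS j + c 2 * G j + c 3 * ?TG j = 0" if "j < m + 4" for j
      using that by (simp add: eval_nat_numeral)
    then have "annih n (m + 4) x (\<lambda>j. c 0 * S j + c 1 * ?TS j + c 2 * G j + c 3 * ?TG j)" for x
      by (simp add: annih_def dotp_def)
    then have c23: "c 2 = 0" "c 3 = 0" using key[of "c 0" "c 1" "c 2" "c 3"] by blast+
    have "\<forall>j<Suc (m + 3). (\<Sum>i<length [S, ?TS]. c i * ([S, ?TS] ! i) j) = 0"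
      using c c23 by (auto simp: numeral_2_eq_2)
    then have "\<forall>i<length [S, ?TS]. c i = 0"
      using lin_indep_tmult[OF S(1) nzS] unfolding lin_indep_def by blast
    then have "c 0 = 0" "c 1 = 0" by auto
    then show "\<forall>i<length [S, ?TS, G, ?TG]. c i = 0" using c23 by (auto simp: less_Suc_eq eval_nat_numeral)
  qed
  show two: "\<exists>a c0 c1 c2 c3. a \<noteq> 0 \<and> (\<forall>j<m + 4. a * p j = c0 * S j + c1 * ?TS j + c2 * G j + c3 * ?TG j)"
    if p: "killed (m + 4) (set rs) p" for p
  proof -
    have "\<exists>a c. a \<noteq> 0 \<and> (\<forall>j<m + 4. a * p j = (\<Sum>i<length [S, ?TS, G, ?TG]. c i * ([S, ?TS, G, ?TG] ! i) j))"
    proof (rule killed_in_span[OF rs(1) gs _ _ p])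
      show "killed (m + 4) (set rs) g" if "g \<in> set [S, ?TS, G, ?TG]" for g
        using that lift[OF S(1)] lift[OF G(1)] S(2) G(2,3) by (intro rs(3)) auto
      show "m + 4 \<le> length rs + length [S, ?TS, G, ?TG]" using rs(2) by simp
    qed
    then obtain a c where "a \<noteq> 0" "\<forall>j<m + 4. a * p j = (\<Sum>i<length [S, ?TS, G, ?TG]. c i * ([S, ?TS, G, ?TG] ! i) j)" by blast
    then have "a \<noteq> 0 \<and> (\<forall>j<m + 4. a * p j = c 0 * S j + c 1 * ?TS j + c 2 * G j + c 3 * ?TG j)"
      by (simp add: eval_nat_numeral)
    then show ?thesis by blast
  qed
  show "\<exists>a c0 c1. a \<noteq> 0 \<and> (\<forall>j<m + 4. a * p j = c0 * S j + c1 * ?TS j)"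
    if p: "annih n (m + 4) u1 p" "annih n (m + 4) u2 p" "killed (m + 4) (set rs) p" for p
  proof -
    obtain a c0 c1 c2 c3 where a: "a \<noteq> 0"
      and c: "\<And>j. j < m + 4 \<Longrightarrow> a * p j = c0 * S j + c1 * ?TS j + c2 * G j + c3 * ?TG j" using two[OF p(3)] by blast
    have "annih n (m + 4) x (\<lambda>j. c0 * S j + c1 * ?TS j + c2 * G j + c3 * ?TG j)" if "annih n (m + 4) x p" for x
      using annih_scale[OF that, of a] c annih_cong[of "m + 4" "\<lambda>j. a * p j" "\<lambda>j. c0 * S j + c1 * ?TS j + c2 * G j + c3 * ?TG j" n x]
      by blast
    then have "c2 = 0" "c3 = 0" using key p by blast+
    then have "\<forall>j<m + 4. a * p j = c0 * S j + c1 * ?TS j" using c by simp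
    then show ?thesis using a by blast
  qed
qed

section \<open>Heights of annihilators\<close>

text \<open>\<open>e\<close> is what the row contributes to the product in
  \<open>abs_det_rows_le\<close>; the single factor \<open>Q\<close> is shared by all rows.\<close>

definition row_ok :: "nat \<Rightarrow> real \<Rightarrow> real \<Rightarrow> (nat \<Rightarrow> int) \<Rightarrow> real \<Rightarrow> bool" where
  "row_ok N \<xi> Q w e \<longleftrightarrow> 0 \<le> e \<and> \<bar>real_of_int (w 0)\<bar> \<le> Q * e \<and>
     (\<forall>j<N. \<bar>real_of_int (w j) - \<xi> ^ j * real_of_int (w 0)\<bar> \<le> e)"

lemma row_ok_mono: "row_ok N \<xi> Q w e \<Longrightarrow> e \<le> e' \<Longrightarrow> 0 \<le> Q \<Longrightarrow> row_ok N \<xi> Q w e'"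
  unfolding row_ok_def by (meson mult_left_mono order_trans)

lemma power_bound_ex: "\<exists>Xi\<ge>1. \<forall>k\<le>n. \<bar>\<xi> ^ k\<bar> \<le> (Xi::real)"
proof (intro exI[of _ "(1 + \<bar>\<xi>\<bar>) ^ n"] conjI allI impI)
  show "1 \<le> (1 + \<bar>\<xi>\<bar>) ^ n" by (rule one_le_power) auto
  fix k assume "k \<le> n"
  have "\<bar>\<xi> ^ k\<bar> \<le> (1 + \<bar>\<xi>\<bar>) ^ k" by (simp add: power_abs power_mono)
  also have "\<dots> \<le> (1 + \<bar>\<xi>\<bar>) ^ n" using \<open>k \<le> n\<close> by (intro power_increasing) auto
  finally show "\<bar>\<xi> ^ k\<bar> \<le> (1 + \<bar>\<xi>\<bar>) ^ n" .
qed

lemma row_ok_ex: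
  fixes \<xi> :: real
  shows "\<exists>C\<ge>1. (\<forall>N Q h. N \<le> n + 1 \<longrightarrow> 1 \<le> Q \<longrightarrow> row_ok N \<xi> Q (unit_row h) C) \<and>
     (\<forall>N Q l x L. l + N \<le> n + 1 \<longrightarrow> 1 \<le> N \<longrightarrow> 1 \<le> Q \<longrightarrow> \<bar>real_of_int (x 0)\<bar> \<le> Q * L \<longrightarrow> near_curve n \<xi> x L \<longrightarrow>
        row_ok N \<xi> Q (shift l x) (C * L))"
proof -
  obtain Xi where Xi: "1 \<le> Xi" "\<And>k. k \<le> n \<Longrightarrow> \<bar>\<xi> ^ k\<bar> \<le> Xi" using power_bound_ex[of n \<xi>] by blast
  have "row_ok N \<xi> Q (unit_row h) (1 + Xi)" if "N \<le> n + 1" "1 \<le> Q" for N Q h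
  proof -
    have "\<bar>real_of_int (unit_row h 0)\<bar> \<le> Q * (1 + Xi)"
      using that(2) Xi(1) mult_mono[of 1 Q 1 "1 + Xi"] by (auto simp: unit_row_def)
    moreover have "\<bar>real_of_int (unit_row h j) - \<xi> ^ j * real_of_int (unit_row h 0)\<bar> \<le> 1 + Xi" if "j < N" for j
      using Xi(2)[of j] Xi(1) that \<open>N \<le> n + 1\<close> by (auto simp: unit_row_def)
    ultimately show ?thesis using Xi(1) by (simp add: row_ok_def)
  qed
  moreover have "row_ok N \<xi> Q (shift l x) ((1 + Xi) * L)"
    if l: "l + N \<le> n + 1" and N: "1 \<le> N" and Q: "1 \<le> Q" and x: "\<bar>real_of_int (x 0)\<bar> \<le> Q * L" "near_curve n \<xi> x L" for N Q l x L
  proof -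
    have L0: "0 \<le> L" using near_curve_nonneg[OF x(2)] .
    define er where "er = (\<lambda>i. real_of_int (x i) - real_of_int (x 0) * \<xi> ^ i)"
    have er: "\<bar>er i\<bar> \<le> L" if "i \<le> n" for i using x(2) that by (simp add: near_curve_def er_def)
    have xi: "real_of_int (x i) = real_of_int (x 0) * \<xi> ^ i + er i" for i by (simp add: er_def)
    have "\<bar>real_of_int (x l)\<bar> \<le> \<bar>real_of_int (x 0)\<bar> * \<bar>\<xi> ^ l\<bar> + \<bar>er l\<bar>"
      unfolding xi[of l] abs_mult[symmetric] by (rule abs_triangle_ineq)
    also have "\<dots> \<le> Q * L * Xi + L"
      using x(1) Xi er l N L0 Q by (intro add_mono mult_mono) auto
    also have "\<dots> \<le> Q * ((1 + Xi) * L)" using mult_right_mono[OF Q L0] by (simp add: algebra_simps)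
    finally have "\<bar>real_of_int (shift l x 0)\<bar> \<le> Q * ((1 + Xi) * L)" by (simp add: shift_def)
    moreover have "\<bar>real_of_int (shift l x j) - \<xi> ^ j * real_of_int (shift l x 0)\<bar> \<le> (1 + Xi) * L" if j: "j < N" for j
    proof -
      have "real_of_int (shift l x j) - \<xi> ^ j * real_of_int (shift l x 0) = er (l + j) - \<xi> ^ j * er l"
        by (simp add: er_def shift_def power_add algebra_simps)
      also have "\<bar>\<dots>\<bar> \<le> \<bar>er (l + j)\<bar> + \<bar>\<xi> ^ j\<bar> * \<bar>er l\<bar>"
        unfolding abs_mult[symmetric] by (rule abs_triangle_ineq4)
      also have "\<dots> \<le> L + Xi * L" using er Xi l j L0 by (intro add_mono mult_mono) auto
      finally show ?thesis by (simp add: algebra_simps)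
    qed
    ultimately show ?thesis using L0 Xi(1) by (simp add: row_ok_def)
  qed
  ultimately show ?thesis using Xi(1) by (intro exI[of _ "1 + Xi"]) auto
qed

lemma prod_nth_prod_list: "(\<Prod>i<length es. es ! i) = (prod_list es :: real)"
  by (simp add: prod.list_conv_set_nth lessThan_atLeast0)

text \<open>A further vector orthogonal to both lists would lie in the span of \<open>gs\<close> and
  so be orthogonal to itself. The equality counts how many rows a greedy extension has
  added.\<close>

lemma killed_span_length:
  assumes "lin_indep N rs" "lin_indep N gs" "\<And>g. g \<in> set gs \<Longrightarrow> killed N (set rs) g"
    and span: "\<And>p. killed N (set rs) p \<Longrightarrow> \<exists>a c. a \<noteq> 0 \<and> (\<forall>j<N. a * p j = (\<Sum>i<length gs. c i * (gs ! i) j))"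
  shows "length rs + length gs = N"
proof (rule ccontr)
  assume "length rs + length gs \<noteq> N"
  then have "length (rs @ gs) < N" using lin_indep_orthogonal_length[OF assms(1,2,3)] by simp
  then obtain p where p: "nonzero_below N p" "killed N (set (rs @ gs)) p" using exists_killed by blast
  then have "killed N (set rs) p" by (simp add: killed_Un)
  from span[OF this] obtain a c where a: "a \<noteq> 0" and c: "\<forall>j<N. a * p j = (\<Sum>i<length gs. c i * (gs ! i) j)" by blast
  have "a * dotp N p p = dotp N (\<lambda>j. a * p j) p" by (simp add: dotp_scale_left)
  also have "\<dots> = dotp N (\<lambda>j. \<Sum>i<length gs. c i * (gs ! i) j) p" using c by (intro dotp_cong) auto
  also have "\<dots> = 0" unfolding dotp_sum_left using p(2) by (auto simp: killed_def intro!: sum.neutral)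
  finally show False using a dotp_self_pos[OF p(1)] by simp
qed

lemma lin_indep_tmults:
  assumes p: "supp_below (Suc d) p" "nonzero_below (Suc d) p"
  shows "lin_indep (d + q) (map (\<lambda>i. tmult i p) [0..<q])"
  unfolding lin_indep_def
proof (rule allI, rule impI)
  fix c :: "nat \<Rightarrow> int"
  assume "\<forall>j<d + q. (\<Sum>i<length (map (\<lambda>i. tmult i p) [0..<q]). c i * (map (\<lambda>i. tmult i p) [0..<q] ! i) j) = 0"
  moreover have "(\<Sum>i<length (map (\<lambda>i. tmult i p) [0..<q]). c i * (map (\<lambda>i. tmult i p) [0..<q] ! i) j) = (\<Sum>i<q. c i * tmult i p j)" for j
    by (intro sum.cong) auto
  ultimately have c: "(\<Sum>i<q. c i * tmult i p j) = 0" if "j < d + q" for j using that by simp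
  define l where "l = (LEAST j. p j \<noteq> 0)"
  have ex: "\<exists>j. p j \<noteq> 0" using p(2) by (auto simp: nonzero_below_def)
  have l: "p l \<noteq> 0" "\<And>j. j < l \<Longrightarrow> p j = 0"
    unfolding l_def using LeastI_ex[OF ex] not_less_Least by blast+
  have ld: "l \<le> d" using l(1) p(1) by (metis not_less_eq_eq supp_below_def)
  have "c i = 0" if "i < q" for i
    using that
  proof (induction i rule: less_induct)
    case (less i)
    have "(\<Sum>i'<q. c i' * tmult i' p (l + i)) = (\<Sum>i'<q. if i' = i then c i * p l else 0)"
    proof (rule sum.cong[OF refl])
      fix i' assume i': "i' \<in> {..<q}"
      show "c i' * tmult i' p (l + i) = (if i' = i then c i * p l else 0)"
      proof (cases i' i rule: linorder_cases)
        case less then show ?thesis using \<open>i' < i\<close> less.IH[of i'] i' by simp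
      next
        case equal then show ?thesis by (simp add: tmult_def)
      next
        case greater then show ?thesis using l(2)[of "l + i - i'"] by (auto simp: tmult_def)
      qed
    qed
    also have "\<dots> = c i * p l" using less.prems by simp
    finally show ?case using c[of "l + i"] ld less.prems l(1) by simp
  qed
  then show "\<forall>i<length (map (\<lambda>i. tmult i p) [0..<q]). c i = 0" by simp
qed

lemma dotp_tmult_le:
  assumes "supp_below N p" "i + N \<le> N'"
  shows "dotp N' (shift k x) (tmult i p) = dotp N (shift (k + i) x) p"
proof -
  have "dotp N' (shift k x) (tmult i p) = (\<Sum>j<N'. if j < i then 0 else x (k + j) * p (j - i))"
    unfolding dotp_def by (intro sum.cong) (auto simp: tmult_def shift_def)
  also have "\<dots> = (\<Sum>j\<in>{i..<i + N}. x (k + j) * p (j - i))"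
    using assms by (intro sum.mono_neutral_cong_right) (auto simp: supp_below_def)
  also have "\<dots> = (\<Sum>j<N. x (k + i + j) * p j)"
    using sum.shift_bounds_nat_ivl[of "\<lambda>j. x (k + j) * p (j - i)" 0 i N] by (simp add: ac_simps lessThan_atLeast0)
  finally show ?thesis by (simp add: dotp_def shift_def)
qed

definition det_bound :: "nat \<Rightarrow> real \<Rightarrow> real \<Rightarrow> real \<Rightarrow> bool" where
  "det_bound n \<xi> \<rho> C \<longleftrightarrow> (\<forall>N R r vs y c ks ws ev M Ew Q.
     1 \<le> N \<longrightarrow> N \<le> n + 1 \<longrightarrow> R + N \<le> n + 2 \<longrightarrow> (\<forall>k<R. \<bar>r k\<bar> \<le> 1) \<longrightarrow>
     \<rho> \<le> \<bar>\<Sum>k<R. real_of_int (r k) * \<xi> ^ k\<bar> \<longrightarrow> 1 \<le> Q \<longrightarrow>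
     (\<forall>i<length vs. \<bar>real_of_int ((vs ! i) 0)\<bar> \<le> Q * ev i \<and> near_curve n \<xi> (vs ! i) (ev i)) \<longrightarrow>
     (\<forall>l\<le>n. real_of_int (y l) = (\<Sum>i<length vs. c i * real_of_int ((vs ! i) l))) \<longrightarrow>
     near_curve n \<xi> y M \<longrightarrow> (\<forall>k\<in>set ks. k + N \<le> n + 1) \<longrightarrow>
     (\<forall>i<length ws. 0 \<le> Ew i \<and> \<bar>real_of_int ((ws ! i) 0)\<bar> \<le> Q * Ew i \<and>
        (\<forall>j<N. \<bar>real_of_int ((ws ! i) j) - \<xi> ^ j * real_of_int ((ws ! i) 0)\<bar> \<le> Ew i)) \<longrightarrow>
     length vs + length ks + length ws = N \<longrightarrow>
     \<bar>real_of_int (det (rows_mat N (map (comb_shift R r) vs @ map (\<lambda>k. shift k y) ks @ ws)))\<bar>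
       \<le> C * Q * (\<Prod>i<length vs. ev i) * M ^ length ks * (\<Prod>i<length ws. Ew i))"

lemma det_bound_ex: "0 < \<rho> \<Longrightarrow> \<exists>C\<ge>1. det_bound n \<xi> \<rho> C"
  unfolding det_bound_def by (rule det_point_rows_bound)

lemma det_boundD:
  assumes "det_bound n \<xi> \<rho> C" "1 \<le> N" "N \<le> n + 1" "R + N \<le> n + 2" "\<And>k. k < R \<Longrightarrow> \<bar>r k\<bar> \<le> 1"
    "\<rho> \<le> \<bar>\<Sum>k<R. real_of_int (r k) * \<xi> ^ k\<bar>" "1 \<le> Q"
    "\<And>i. i < length vs \<Longrightarrow> \<bar>real_of_int ((vs ! i) 0)\<bar> \<le> Q * ev i \<and> near_curve n \<xi> (vs ! i) (ev i)"
    "\<And>l. l \<le> n \<Longrightarrow> real_of_int (y l) = (\<Sum>i<length vs. c i * real_of_int ((vs ! i) l))"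
    "near_curve n \<xi> y M" "\<And>k. k \<in> set ks \<Longrightarrow> k + N \<le> n + 1"
    "\<And>i. i < length ws \<Longrightarrow> row_ok N \<xi> Q (ws ! i) (Ew i)"
    "length vs + length ks + length ws = N"
  shows "\<bar>real_of_int (det (rows_mat N (map (comb_shift R r) vs @ map (\<lambda>k. shift k y) ks @ ws)))\<bar>
       \<le> C * Q * (\<Prod>i<length vs. ev i) * M ^ length ks * (\<Prod>i<length ws. Ew i)"
  by (rule assms(1)[unfolded det_bound_def, rule_format])
    (use assms(2-) in \<open>auto simp: row_ok_def\<close>)

definition single_height_bound :: "nat \<Rightarrow> real \<Rightarrow> nat \<Rightarrow> real \<Rightarrow> bool" where
  "single_height_bound n \<xi> d C \<longleftrightarrow> (\<forall>x p L. primitive p \<longrightarrow> supp_below (Suc d) p \<longrightarrow> annih n (Suc d) x p \<longrightarrow>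
     (\<forall>q. annih n d x q \<longrightarrow> (\<forall>j<d. q j = 0)) \<longrightarrow> 0 < L \<longrightarrow> L \<le> \<bar>real_of_int (x 0)\<bar> \<longrightarrow> near_curve n \<xi> x L \<longrightarrow>
     hgt (Suc d) p ^ (n + 2 - 2 * d) \<le> C * \<bar>real_of_int (x 0)\<bar> * L ^ (d - 1))"

text \<open>For \<open>N = n + 2 - d\<close> the point has exactly \<open>d\<close> blocks, and
  their kernel is spanned by the \<open>n + 2 - 2 * d\<close> multiples of \<open>p\<close>. One
  block pays for the size of \<open>x 0\<close>, each of the others only for
  \<open>L\<close>.\<close>

lemma single_point_height:
  assumes d: "1 \<le> d" "2 * d \<le> n + 1"
  shows "\<exists>C\<ge>1. single_height_bound n \<xi> d C"
proof -
  define q where "q = n + 2 - 2 * d"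
  define N where "N = d + q"
  have N: "1 \<le> N" "N \<le> n + 1" "n + 2 - N = d" using d by (auto simp: N_def q_def)
  obtain K where K: "K > 0" and GM: "height_det_bound d q K" using height_power_le_det by blast
  obtain C1 where C1: "1 \<le> C1" "det_bound n \<xi> 1 C1" using det_bound_ex[of 1 n \<xi>] by auto
  obtain C2 where C2: "1 \<le> C2" and U: "\<forall>N Q h. N \<le> n + 1 \<longrightarrow> 1 \<le> Q \<longrightarrow> row_ok N \<xi> Q (unit_row h) C2"
    using row_ok_ex[of n \<xi>] by blast
  define C where "C = max 1 (K * (C1 * C2 ^ q))"
  have "hgt (Suc d) p ^ q \<le> C * \<bar>real_of_int (x 0)\<bar> * L ^ (d - 1)"
    if p: "primitive p" "supp_below (Suc d) p" "annih n (Suc d) x p"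
      and min: "\<forall>q. annih n d x q \<longrightarrow> (\<forall>j<d. q j = 0)" and L: "0 < L" "L \<le> \<bar>real_of_int (x 0)\<bar>"
      and near: "near_curve n \<xi> x L" for x p L
  proof -
    define rs where "rs = shift_rows n N x"
    have len: "length rs = d" using N by (simp add: rs_def)
    have ind: "lin_indep N rs" unfolding rs_def by (rule shift_rows_indep[OF N(1,2)]) (use min N in auto)
    have nz: "nonzero_below (Suc d) p" using primitive_nonzero[OF p(1,2)] .
    have kp: "killed N (set rs) (tmult i p)" if i: "i < q" for i
      unfolding rs_def killed_shift_rows[OF N(2)] annih_def
    proof (intro allI impI)
      fix k assume k: "k + N \<le> n + 1"
      have "dotp N (shift k x) (tmult i p) = dotp (Suc d) (shift (k + i) x) p"
        by (rule dotp_tmult_le[OF p(2)]) (use i N_def in simp)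
      also have "\<dots> = 0" using p(3) k i by (simp add: annih_def N_def)
      finally show "dotp N (shift k x) (tmult i p) = 0" .
    qed
    have span: "\<exists>a c. a \<noteq> 0 \<and> (\<forall>j<N. a * x' j = (\<Sum>i<q. c i * tmult i p j))" if x': "killed N (set rs) x'" for x'
    proof -
      have "\<exists>a c. a \<noteq> 0 \<and> (\<forall>j<N. a * x' j = (\<Sum>i<length (map (\<lambda>i. tmult i p) [0..<q]). c i * (map (\<lambda>i. tmult i p) [0..<q] ! i) j))"
        by (rule killed_in_span[OF ind _ _ _ x']) (use lin_indep_tmults[OF p(2) nz, of q] kp len N_def in auto)
      then obtain a c where "a \<noteq> 0" and ac: "\<forall>j<N. a * x' j = (\<Sum>i<length (map (\<lambda>i. tmult i p) [0..<q]). c i * (map (\<lambda>i. tmult i p) [0..<q] ! i) j)" by blast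
      moreover have "(\<Sum>i<length (map (\<lambda>i. tmult i p) [0..<q]). c i * (map (\<lambda>i. tmult i p) [0..<q] ! i) j) = (\<Sum>i<q. c i * tmult i p j)" for j
        by (intro sum.cong) auto
      ultimately show ?thesis by auto
    qed
    obtain h where h: "h \<le> d" "hgt (Suc d) p ^ q \<le> K * \<bar>real_of_int (det (rows_mat N (rs @ unit_rows h q)))\<bar>"
      using GM[unfolded height_det_bound_def, rule_format, OF p(1,2) len kp[unfolded N_def] span[unfolded N_def]] unfolding N_def by blast
    have rs_split: "rs @ unit_rows h q = map (comb_shift 1 (unit_row 0)) [x] @ map (\<lambda>k. shift k x) [1..<d] @ unit_rows h q"
    proof -
      have "[0..<d] = 0 # [1..<d]" using d(1) by (simp add: upt_conv_Cons)
      then show ?thesis using N by (simp add: rs_def shift_rows_def comb_shift_unit_row)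
    qed
    define Q where "Q = \<bar>real_of_int (x 0)\<bar> / L"
    have Q1: "1 \<le> Q" using L by (simp add: Q_def)
    have "\<bar>real_of_int (det (rows_mat N (map (comb_shift 1 (unit_row 0)) [x] @ map (\<lambda>k. shift k x) [1..<d] @ unit_rows h q)))\<bar>
       \<le> C1 * Q * (\<Prod>i<length [x]. L) * L ^ length [1..<d] * (\<Prod>i<length (unit_rows h q). C2)"
    proof (rule det_boundD[OF C1(2)])
      show "1 \<le> N" "N \<le> n + 1" by (rule N)+
      show "1 + N \<le> n + 2" using N by simp
      show "\<bar>unit_row 0 k\<bar> \<le> 1" for k by (simp add: unit_row_def)
      show "1 \<le> \<bar>\<Sum>k<1. real_of_int (unit_row 0 k) * \<xi> ^ k\<bar>" by (simp add: unit_row_def)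
      show "1 \<le> Q" by (rule Q1)
      show "\<bar>real_of_int (([x] ! i) 0)\<bar> \<le> Q * L \<and> near_curve n \<xi> ([x] ! i) L" if "i < length [x]" for i
        using that near L by (simp add: Q_def)
      show "real_of_int (x l) = (\<Sum>i<length [x]. (\<lambda>_. 1) i * real_of_int (([x] ! i) l))" for l by simp
      show "near_curve n \<xi> x L" by (rule near)
      show "k + N \<le> n + 1" if "k \<in> set [1..<d]" for k
      proof -
        have "k < n + 2 - N" using that N(3) by simp
        then show ?thesis by linarith
      qed
      show "row_ok N \<xi> Q (unit_rows h q ! i) C2" if "i < length (unit_rows h q)" for i
        using U N(2) Q1 that by (simp add: unit_rows_def)
      show "length [x] + length [1..<d] + length (unit_rows h q) = N" using d by (simp add: N_def)
    qed
    also have "\<dots> = C1 * (Q * L) * L ^ (d - 1) * C2 ^ q" by simp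
    also have "Q * L = \<bar>real_of_int (x 0)\<bar>" using L by (simp add: Q_def)
    finally have "\<bar>real_of_int (det (rows_mat N (rs @ unit_rows h q)))\<bar> \<le> (C1 * C2 ^ q) * (\<bar>real_of_int (x 0)\<bar> * L ^ (d - 1))"
      unfolding rs_split by (simp add: algebra_simps)
    then have "K * \<bar>real_of_int (det (rows_mat N (rs @ unit_rows h q)))\<bar> \<le> K * ((C1 * C2 ^ q) * (\<bar>real_of_int (x 0)\<bar> * L ^ (d - 1)))"
      using K by (intro mult_left_mono) auto
    also have "\<dots> = (K * (C1 * C2 ^ q)) * (\<bar>real_of_int (x 0)\<bar> * L ^ (d - 1))" by simp
    also have "\<dots> \<le> C * (\<bar>real_of_int (x 0)\<bar> * L ^ (d - 1))"
      using L by (intro mult_right_mono) (auto simp: C_def)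
    finally show ?thesis using h(2) by (simp add: mult.assoc)
  qed
  then show ?thesis unfolding single_height_bound_def q_def by (intro exI[of _ C]) (auto simp: C_def)
qed

definition value_bound :: "nat \<Rightarrow> real \<Rightarrow> real \<Rightarrow> bool" where
  "value_bound n \<xi> C \<longleftrightarrow> (\<forall>N x x' p L L'. N \<le> n + 1 \<longrightarrow> 1 \<le> N \<longrightarrow> annih n N x p \<longrightarrow> \<not> annih n N x' p \<longrightarrow>
     near_curve n \<xi> x L \<longrightarrow> near_curve n \<xi> x' L' \<longrightarrow> L \<le> L' \<longrightarrow>
     0 < \<bar>real_of_int (x 0)\<bar> \<longrightarrow> \<bar>real_of_int (x' 0)\<bar> \<le> \<bar>real_of_int (x 0)\<bar> \<longrightarrow> 1 \<le> C * (hgt N p * L'))"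

text \<open>Some block of \<open>x'\<close> has a nonzero integer value under \<open>p\<close>. As
  \<open>p\<close> kills \<open>x\<close>, its value at \<xi> is at most the height of
  \<open>p\<close> times \<open>L\<close>, divided by the size of \<open>x 0\<close>. Since
  \<open>x'\<close> is not larger than \<open>x\<close>, the main part of that integer is of the
  order of the height times \<open>L\<close>, and the rest is at most the height times
  \<open>L'\<close>.\<close>

lemma annih_value_bound: "\<exists>C\<ge>1. value_bound n \<xi> C"
proof -
  obtain Xi where Xi: "1 \<le> Xi" "\<And>k. k \<le> n \<Longrightarrow> \<bar>\<xi> ^ k\<bar> \<le> Xi" using power_bound_ex[of n \<xi>] by blast
  have "1 \<le> (1 + Xi) * (hgt N p * L')"
    if N: "N \<le> n + 1" "1 \<le> N" and p: "annih n N x p" "\<not> annih n N x' p" and near: "near_curve n \<xi> x L" "near_curve n \<xi> x' L'"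
      and LL: "L \<le> L'" and x0: "0 < \<bar>real_of_int (x 0)\<bar>" "\<bar>real_of_int (x' 0)\<bar> \<le> \<bar>real_of_int (x 0)\<bar>" for N x x' p L L'
  proof -
    define v where "v = (\<Sum>j<N. real_of_int (p j) * \<xi> ^ j)"
    have expand: "\<bar>real_of_int (dotp N (shift k z) p) - real_of_int (z 0) * \<xi> ^ k * v\<bar> \<le> hgt N p * l"
      if k: "k + N \<le> n + 1" and z: "near_curve n \<xi> z l" for k z l
    proof -
      have "real_of_int (dotp N (shift k z) p) - real_of_int (z 0) * \<xi> ^ k * v =
        (\<Sum>j<N. real_of_int (p j) * (real_of_int (z (k + j)) - real_of_int (z 0) * \<xi> ^ (k + j)))"
        unfolding v_def dotp_def shift_def of_int_sum of_int_mult sum_distrib_left sum_subtractf[symmetric]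
        by (intro sum.cong) (auto simp: algebra_simps power_add)
      also have "\<bar>\<dots>\<bar> \<le> (\<Sum>j<N. \<bar>real_of_int (p j)\<bar> * l)"
        by (rule order.trans[OF sum_abs]) (intro sum_mono, use k z in \<open>auto simp: abs_mult near_curve_def intro!: mult_left_mono\<close>)
      also have "\<dots> = hgt N p * l" by (simp add: hgt_def sum_distrib_right)
      finally show ?thesis .
    qed
    have "dotp N (shift 0 x) p = 0" using p(1) N by (simp add: annih_def)
    then have v1: "\<bar>real_of_int (x 0)\<bar> * \<bar>v\<bar> \<le> hgt N p * L" using expand[of 0 x L] N near(1) by (simp add: abs_mult)
    obtain k where k: "k + N \<le> n + 1" "dotp N (shift k x') p \<noteq> 0" using p(2) by (auto simp: annih_def)
    have "1 \<le> \<bar>dotp N (shift k x') p\<bar>" using k(2) by linarith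
    then have "1 \<le> \<bar>real_of_int (dotp N (shift k x') p)\<bar>" by linarith
    also have "\<dots> \<le> \<bar>real_of_int (x' 0) * \<xi> ^ k * v\<bar> + hgt N p * L'" using expand[OF k(1) near(2)] by linarith
    also have "\<bar>real_of_int (x' 0) * \<xi> ^ k * v\<bar> = \<bar>\<xi> ^ k\<bar> * (\<bar>real_of_int (x' 0)\<bar> * \<bar>v\<bar>)" by (simp add: abs_mult algebra_simps)
    also have "\<dots> \<le> Xi * (\<bar>real_of_int (x 0)\<bar> * \<bar>v\<bar>)"
      using Xi k N x0 by (intro mult_mono) auto
    also have "\<dots> \<le> Xi * (hgt N p * L')"
      using v1 Xi(1) mult_left_mono[OF LL hgt_nonneg[of N p]] by (intro mult_left_mono) auto
    finally show ?thesis by (simp add: algebra_simps)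
  qed
  then show ?thesis unfolding value_bound_def using Xi(1) by (intro exI[of _ "1 + Xi"]) auto
qed

lemma truncated_sum_nonzero:
  assumes no_root: "\<And>p. nonzero_below (n + 1) p \<Longrightarrow> (\<Sum>j<n + 1. real_of_int (p j) * \<xi> ^ j) \<noteq> (0::real)"
    and p: "nonzero_below N p" "N \<le> n + 1"
  shows "(\<Sum>j<N. real_of_int (p j) * \<xi> ^ j) \<noteq> 0"
proof -
  define g where "g = (\<lambda>j. if j < N then p j else 0)"
  have "nonzero_below (n + 1) g" using p by (auto simp: nonzero_below_def g_def)
  from no_root[OF this] have "(\<Sum>j<n + 1. real_of_int (g j) * \<xi> ^ j) \<noteq> 0" .
  moreover have "(\<Sum>j<n + 1. real_of_int (g j) * \<xi> ^ j) = (\<Sum>j<N. real_of_int (p j) * \<xi> ^ j)"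
    using p(2) by (intro sum.mono_neutral_cong_right) (auto simp: g_def)
  ultimately show ?thesis by simp
qed

text \<open>Dividing the relation \<open>dotp N (x k) p = 0\<close> by \<open>x k 0\<close> makes \<open>\<xi>\<close> a root of \<open>p\<close> in the limit.\<close>

lemma eventually_dotp_nonzero:
  assumes no_root: "\<And>p. nonzero_below (n + 1) p \<Longrightarrow> (\<Sum>j<n + 1. real_of_int (p j) * \<xi> ^ j) \<noteq> (0::real)"
    and p: "nonzero_below N p" "N \<le> n + 1"
    and x: "\<And>k. near_curve n \<xi> (x k) (M k)" "\<And>k. 1 \<le> x k 0" and M0: "M \<longlonglongrightarrow> 0"
  shows "\<exists>K. \<forall>k\<ge>K. dotp N (x k) p \<noteq> 0"
proof -
  define v where "v = (\<Sum>j<N. real_of_int (p j) * \<xi> ^ j)"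
  have "v \<noteq> 0" unfolding v_def by (rule truncated_sum_nonzero[OF no_root p])
  have bd: "\<bar>v\<bar> \<le> hgt N p * M k" if "dotp N (x k) p = 0" for k
  proof -
    have "real_of_int (dotp N (x k) p) = 0" using that by simp
    then have z: "(\<Sum>j<N. real_of_int (p j) * real_of_int (x k j)) = 0" by (simp add: dotp_def mult.commute)
    have "real_of_int (x k 0) * v = (\<Sum>j<N. real_of_int (p j) * (real_of_int (x k 0) * \<xi> ^ j - real_of_int (x k j)))"
      unfolding right_diff_distrib sum_subtractf z v_def sum_distrib_left by (simp add: mult_ac)
    also have "\<bar>\<dots>\<bar> \<le> (\<Sum>j<N. \<bar>real_of_int (p j)\<bar> * M k)"
      by (rule order.trans[OF sum_abs], intro sum_mono)
        (use x(1)[of k] p(2) in \<open>auto simp: abs_mult near_curve_def abs_minus_commute intro!: mult_left_mono\<close>)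
    also have "\<dots> = hgt N p * M k" by (simp add: hgt_def sum_distrib_right)
    finally have "\<bar>real_of_int (x k 0)\<bar> * \<bar>v\<bar> \<le> hgt N p * M k" by (simp add: abs_mult)
    moreover have "1 * \<bar>v\<bar> \<le> \<bar>real_of_int (x k 0)\<bar> * \<bar>v\<bar>" using x(2)[of k] by (intro mult_right_mono) auto
    ultimately show ?thesis by linarith
  qed
  have "(\<lambda>k. hgt N p * M k) \<longlonglongrightarrow> hgt N p * 0" by (intro tendsto_mult tendsto_const M0)
  then have "\<forall>\<^sub>F k in sequentially. hgt N p * M k < \<bar>v\<bar>" using order_tendstoD(2)[of _ "hgt N p * 0" _ "\<bar>v\<bar>"] \<open>v \<noteq> 0\<close> by simp
  then obtain K where "\<forall>k\<ge>K. hgt N p * M k < \<bar>v\<bar>" unfolding eventually_sequentially by blast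
  then have "\<forall>k\<ge>K. dotp N (x k) p \<noteq> 0" using bd by (meson not_le)
  then show ?thesis by blast
qed

section \<open>Sequences of points spanning consecutive planes\<close>

text \<open>
  In the application \<open>y k\<close> is a best approximation that is independent of its two neighbours, \<open>yp k\<close> is
  the best approximation following \<open>y k\<close>, \<open>H (Suc k)\<close> is the height of \<open>yp k\<close>, and \<open>M k\<close> is the distance
  of \<open>y k\<close> from the curve; \<open>H 0\<close> is a dummy.
\<close>

locale point_sequence =
  fixes n m :: nat and \<xi> :: real and y yp :: "nat \<Rightarrow> nat \<Rightarrow> int" and H M :: "nat \<Rightarrow> real"
  assumes n: "n = 2 * m + 1" and m: "2 \<le> m"
    and no_root: "\<And>p. nonzero_below (n + 1) p \<Longrightarrow> (\<Sum>j<n + 1. real_of_int (p j) * \<xi> ^ j) \<noteq> 0"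
    and fr: "\<And>k. full_rank n m (y k)"
    and prim: "\<And>k. primitive (y k)"
    and y_pos: "\<And>k. 1 \<le> y k 0"
    and y_mono: "\<And>k. y k 0 \<le> y (Suc k) 0"
    and y_le: "\<And>k. real_of_int (y k 0) \<le> H (Suc k)"
    and yp_le: "\<And>k. \<bar>real_of_int (yp k 0)\<bar> \<le> H (Suc k)"
    and supp_yp: "\<And>k. supp_below (n + 1) (yp k)"
    and near: "\<And>k. near_curve n \<xi> (y k) (M k)"
    and near_p: "\<And>k. near_curve n \<xi> (yp k) (M k)"
    and plane: "\<And>k. \<exists>a b c. a \<noteq> 0 \<and> (\<forall>j. a * y (Suc k) j = b * y k j + c * yp k j)"
    and indep3: "\<And>k a b c. (\<And>j. a * y k j + b * y (Suc k) j + c * y (Suc (Suc k)) j = 0) \<Longrightarrow> a = 0 \<and> b = 0 \<and> c = 0"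
    and H_ge_1: "\<And>k. 1 \<le> H k" and H_mono: "\<And>k. H k \<le> H (Suc k)"
    and M_pos: "\<And>k. 0 < M k" and M_le_1: "\<And>k. M k \<le> 1" and M_mono: "\<And>k. M (Suc k) \<le> M k"
begin

section \<open>Determinants adapted to the plane of two consecutive points\<close>

lemma supp_y: "supp_below (n + 1) (y k)"
  using fr by (simp add: full_rank_def)

lemma H_mono': "i \<le> j \<Longrightarrow> H i \<le> H j"
  by (induction j rule: dec_induct) (auto intro: order_trans H_mono)

lemma M_mono': "i \<le> j \<Longrightarrow> M j \<le> M i"
  by (induction j rule: dec_induct) (auto intro: order_trans M_mono)

lemma y_nonprop: "\<not> (\<exists>a b. a \<noteq> 0 \<and> (\<forall>j. a * y k j = b * y (Suc k) j))"
proof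
  assume "\<exists>a b. a \<noteq> 0 \<and> (\<forall>j. a * y k j = b * y (Suc k) j)"
  then obtain a b where ab: "a \<noteq> 0" "\<forall>j. a * y k j = b * y (Suc k) j" by blast
  then have "a * y k j + (- b) * y (Suc k) j + 0 * y (Suc (Suc k)) j = 0" for j by simp
  then show False using indep3[of a k "- b" 0] ab(1) by blast
qed

lemma plane': "\<exists>a b c. a \<noteq> 0 \<and> c \<noteq> 0 \<and> (\<forall>j. a * y (Suc k) j = b * y k j + c * yp k j)"
proof -
  obtain a b c where abc: "a \<noteq> 0" "\<forall>j. a * y (Suc k) j = b * y k j + c * yp k j" using plane by blast
  have "c \<noteq> 0"
  proof
    assume "c = 0"
    then have "(- b) * y k j + a * y (Suc k) j + 0 * y (Suc (Suc k)) j = 0" for j using abc(2) by simp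
    then show False using indep3[of "- b" k a 0] abc(1) by blast
  qed
  then show ?thesis using abc by blast
qed

text \<open>The shift \<open>k0\<close> of \<open>y (Suc k)\<close> is left out since it is a
  combination of the two leading rows. The kernel is that of all blocks of \<open>y (Suc k)\<close>
  together with one block of \<open>y k\<close>, but the row of full size now costs only
  \<open>H (Suc k)\<close>.\<close>

definition pair_list :: "nat \<Rightarrow> nat \<Rightarrow> nat \<Rightarrow> (nat \<Rightarrow> int) list" where
  "pair_list k N k0 = [shift k0 (y k), shift k0 (yp k)] @ map (\<lambda>l. shift l (y (Suc k))) (filter (\<lambda>l. l \<noteq> k0) [0..<n + 2 - N])"

lemma length_filter_neq: "k0 < K \<Longrightarrow> length (filter (\<lambda>l. l \<noteq> k0) [0..<K]) = K - 1"
proof -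
  assume k0: "k0 < K"
  have "length (filter (\<lambda>l. l \<noteq> k0) [0..<K]) = card {l. l < K \<and> l \<noteq> k0}"
    by (subst distinct_card[symmetric]) (auto intro!: arg_cong[of _ _ card])
  also have "{l. l < K \<and> l \<noteq> k0} = {..<K} - {k0}" by auto
  finally show ?thesis using k0 by simp
qed

lemma length_pair_list: "k0 < n + 2 - N \<Longrightarrow> length (pair_list k N k0) = n + 3 - N"
  using length_filter_neq[of k0 "n + 2 - N"] by (simp add: pair_list_def)

lemma pair_list_killedD:
  assumes "killed N (set (pair_list k N k0)) p" "N \<le> n + 1" "k0 < n + 2 - N"
  shows "annih n N (y (Suc k)) p" "dotp N (shift k0 (y k)) p = 0"
proof -
  show k1: "dotp N (shift k0 (y k)) p = 0" using assms(1) by (simp add: killed_def pair_list_def)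
  have k2: "dotp N (shift k0 (yp k)) p = 0" using assms(1) by (simp add: killed_def pair_list_def)
  obtain a b c where abc: "a \<noteq> 0" "\<forall>j. a * y (Suc k) j = b * y k j + c * yp k j" using plane by blast
  have "a * dotp N (shift k0 (y (Suc k))) p = dotp N (\<lambda>j. a * shift k0 (y (Suc k)) j) p" by (simp add: dotp_scale_left)
  also have "\<dots> = dotp N (\<lambda>j. b * shift k0 (y k) j + c * shift k0 (yp k) j) p" using abc(2) by (simp add: shift_def)
  also have "\<dots> = 0" using k1 k2 by (simp add: dotp_lincomb_left)
  finally have k3: "dotp N (shift k0 (y (Suc k))) p = 0" using abc(1) by simp
  show "annih n N (y (Suc k)) p"
    unfolding annih_def
  proof (intro allI impI)
    fix l assume l: "l + N \<le> n + 1"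
    show "dotp N (shift l (y (Suc k))) p = 0"
    proof (cases "l = k0")
      case False
      then have "shift l (y (Suc k)) \<in> set (pair_list k N k0)" using l by (auto simp: pair_list_def)
      then show ?thesis using assms(1) by (simp add: killed_def)
    qed (use k3 in simp)
  qed
qed

lemma annih_yp:
  assumes "annih n N (y k) p" "annih n N (y (Suc k)) p"
  shows "annih n N (yp k) p"
proof -
  obtain a b c where abc: "a \<noteq> 0" "c \<noteq> 0" "\<forall>j. a * y (Suc k) j = b * y k j + c * yp k j" using plane' by blast
  have "annih n N (\<lambda>j. a * y (Suc k) j + (- b) * y k j) p" by (rule annih_point_lincomb[OF assms(2,1)])
  moreover have "(\<lambda>j. a * y (Suc k) j + (- b) * y k j) = (\<lambda>j. c * yp k j)" using abc(3) by auto
  ultimately show ?thesis using annih_point_scale_cancel[OF abc(2)] by simp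
qed

lemma pair_list_killed:
  assumes "annih n N (y k) p" "annih n N (y (Suc k)) p" "k0 < n + 2 - N"
  shows "killed N (set (pair_list k N k0)) p"
  using assms annih_yp[OF assms(1,2)] unfolding killed_def pair_list_def annih_def by auto

text \<open>These are the values at \<xi> of T^i and T^i + T^j, the polynomials used as
  \<open>r\<close>. They are finitely many, and none of them is zero.\<close>

lemma rho_ex: "\<exists>\<rho>>0. \<forall>i\<le>n. \<forall>j\<le>n. \<rho> \<le> \<bar>\<xi> ^ i\<bar> \<and> \<rho> \<le> \<bar>\<xi> ^ i + \<xi> ^ j\<bar>"
proof -
  define V where "V = (\<lambda>i. \<bar>\<xi> ^ i\<bar>) ` {..n} \<union> (\<lambda>(i, j). \<bar>\<xi> ^ i + \<xi> ^ j\<bar>) ` ({..n} \<times> {..n})"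
  have ev: "(\<Sum>j<n + 1. real_of_int (unit_row i j) * \<xi> ^ j) = \<xi> ^ i" if "i \<le> n" for i
  proof -
    have "(\<Sum>j<n + 1. real_of_int (unit_row i j) * \<xi> ^ j) = (\<Sum>j<n + 1. if j = i then \<xi> ^ j else 0)"
      by (intro sum.cong) (auto simp: unit_row_def)
    then show ?thesis using that by (simp add: sum.delta)
  qed
  have "0 < v" if "v \<in> V" for v
  proof -
    have "\<xi> ^ i \<noteq> 0" if "i \<le> n" for i
      using no_root[of "unit_row i"] ev[OF that] that by (auto simp: nonzero_below_def unit_row_def)
    moreover have "\<xi> ^ i + \<xi> ^ j \<noteq> 0" if "i \<le> n" "j \<le> n" for i j
    proof -
      have "nonzero_below (n + 1) (\<lambda>k. unit_row i k + unit_row j k)"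
        unfolding nonzero_below_def by (rule exI[of _ i]) (use that in \<open>auto simp: unit_row_def\<close>)
      from no_root[OF this] show ?thesis using ev[OF that(1)] ev[OF that(2)] by (simp add: distrib_right sum.distrib)
    qed
    ultimately show ?thesis using that by (auto simp: V_def)
  qed
  moreover have fin: "finite V" "V \<noteq> {}" by (auto simp: V_def)
  ultimately have "0 < Min V" using Min_in[OF fin] by blast
  moreover have "Min V \<le> v" if "v \<in> V" for v using fin that by simp
  moreover have "\<bar>\<xi> ^ i\<bar> \<in> V" "\<bar>\<xi> ^ i + \<xi> ^ j\<bar> \<in> V" if "i \<le> n" "j \<le> n" for i j
    using that by (auto simp: V_def image_iff)
  ultimately show ?thesis by (intro exI[of _ "Min V"] conjI allI impI) simp_all
qed

lemma Q_ge_1: "1 \<le> H (Suc k) / M k"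
proof -
  have "M k \<le> H (Suc k)" using M_le_1[of k] H_ge_1[of "Suc k"] by linarith
  then show ?thesis using M_pos[of k] by simp
qed

text \<open>Of the \<open>n + 3 - N\<close> rows of the list, one pays \<open>H (Suc k)\<close>, one
  pays \<open>M k\<close>, and the \<open>n + 1 - N\<close> rows of \<open>y (Suc k)\<close> pay
  \<open>M (Suc k)\<close> each.\<close>

definition pair_det_bound :: "real \<Rightarrow> bool" where
  "pair_det_bound C \<longleftrightarrow> (\<forall>k N k0 ws es. m + 2 \<le> N \<longrightarrow> N \<le> m + 4 \<longrightarrow> k0 < n + 2 - N \<longrightarrow> length ws = length es \<longrightarrow>
     n + 3 - N + length ws = N \<longrightarrow> (\<forall>i<length ws. row_ok N \<xi> (H (Suc k) / M k) (ws ! i) (es ! i)) \<longrightarrow>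
     \<bar>real_of_int (det (rows_mat N (pair_list k N k0 @ ws)))\<bar> \<le> C * (H (Suc k) * M k * M (Suc k) ^ (n + 1 - N)) * prod_list es)"

lemma pair_det: "\<exists>C\<ge>1. pair_det_bound C"
proof -
  obtain \<rho> where \<rho>: "0 < \<rho>" "\<And>i. i \<le> n \<Longrightarrow> \<rho> \<le> \<bar>\<xi> ^ i\<bar>" using rho_ex by blast
  obtain C where C: "1 \<le> C" "det_bound n \<xi> \<rho> C" using det_bound_ex[OF \<rho>(1)] by blast
  have "\<bar>real_of_int (det (rows_mat N (pair_list k N k0 @ ws)))\<bar> \<le> C * (H (Suc k) * M k * M (Suc k) ^ (n + 1 - N)) * prod_list es"
    if N: "m + 2 \<le> N" "N \<le> m + 4" and k0: "k0 < n + 2 - N" and len: "length ws = length es" "n + 3 - N + length ws = N"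
      and ok: "\<forall>i<length ws. row_ok N \<xi> (H (Suc k) / M k) (ws ! i) (es ! i)" for k N k0 ws es
  proof -
    define R where "R = n + 2 - N"
    define ks where "ks = filter (\<lambda>l. l \<noteq> k0) [0..<R]"
    have NN: "1 \<le> N" "N \<le> n + 1" "R + N = n + 2" using N n m by (auto simp: R_def)
    have lks: "length ks = R - 1" unfolding ks_def by (rule length_filter_neq) (use k0 R_def in simp)
    obtain a b c where abc: "a \<noteq> 0" "\<forall>j. a * y (Suc k) j = b * y k j + c * yp k j" using plane by blast
    define cc where "cc = (\<lambda>i::nat. if i = 0 then real_of_int b / real_of_int a else real_of_int c / real_of_int a)"
    define Q where "Q = H (Suc k) / M k"
    have QM: "Q * M k = H (Suc k)" using M_pos[of k] by (simp add: Q_def)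
    have pl: "pair_list k N k0 = map (comb_shift R (unit_row k0)) [y k, yp k] @ map (\<lambda>l. shift l (y (Suc k))) ks"
      using k0 by (simp add: pair_list_def ks_def R_def comb_shift_unit_row)
    have "\<bar>real_of_int (det (rows_mat N (map (comb_shift R (unit_row k0)) [y k, yp k] @ map (\<lambda>l. shift l (y (Suc k))) ks @ ws)))\<bar>
       \<le> C * Q * (\<Prod>i<length [y k, yp k]. M k) * M (Suc k) ^ length ks * (\<Prod>i<length ws. es ! i)"
    proof (rule det_boundD[OF C(2), where c = cc])
      show "1 \<le> N" "N \<le> n + 1" by (rule NN)+
      show "R + N \<le> n + 2" using NN by simp
      show "\<bar>unit_row k0 k\<bar> \<le> 1" for k by (simp add: unit_row_def)
      have "(\<Sum>k<R. real_of_int (unit_row k0 k) * \<xi> ^ k) = (\<Sum>k<R. if k = k0 then \<xi> ^ k else 0)"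
        by (intro sum.cong) (auto simp: unit_row_def)
      also have "\<dots> = \<xi> ^ k0" using k0 by (simp add: R_def)
      finally show "\<rho> \<le> \<bar>\<Sum>k<R. real_of_int (unit_row k0 k) * \<xi> ^ k\<bar>" using \<rho>(2)[of k0] k0 N n by simp
      show "1 \<le> Q" unfolding Q_def by (rule Q_ge_1)
      show "\<bar>real_of_int (([y k, yp k] ! i) 0)\<bar> \<le> Q * M k \<and> near_curve n \<xi> ([y k, yp k] ! i) (M k)" if "i < length [y k, yp k]" for i
        using that y_le[of k] yp_le[of k] y_pos[of k] near near_p unfolding QM by (auto simp: less_Suc_eq)
      show "real_of_int (y (Suc k) l) = (\<Sum>i<length [y k, yp k]. cc i * real_of_int (([y k, yp k] ! i) l))" for l
      proof -
        have "real_of_int a * real_of_int (y (Suc k) l) = real_of_int b * real_of_int (y k l) + real_of_int c * real_of_int (yp k l)"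
          using abc(2) by (metis of_int_add of_int_mult)
        then have "real_of_int (y (Suc k) l) = (real_of_int b * real_of_int (y k l) + real_of_int c * real_of_int (yp k l)) / real_of_int a"
          using abc(1) by (simp add: field_simps)
        then show ?thesis by (simp add: cc_def add_divide_distrib)
      qed
      show "near_curve n \<xi> (y (Suc k)) (M (Suc k))" by (rule near)
      show "l + N \<le> n + 1" if "l \<in> set ks" for l
      proof -
        have "l < n + 2 - N" using that by (simp add: ks_def R_def)
        then show ?thesis by linarith
      qed
      show "row_ok N \<xi> Q (ws ! i) (es ! i)" if "i < length ws" for i using ok that by (simp add: Q_def)
      show "length [y k, yp k] + length ks + length ws = N" using lks len NN k0 by (simp add: R_def)
    qed
    also have "\<dots> = C * ((Q * M k) * M k * M (Suc k) ^ (R - 1)) * prod_list es"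
      using len(1) lks by (simp add: prod_nth_prod_list numeral_2_eq_2)
    also have "R - 1 = n + 1 - N" by (simp add: R_def)
    finally show ?thesis unfolding QM pl by simp
  qed
  then show ?thesis unfolding pair_det_bound_def using C(1) by (intro exI[of _ C] conjI allI impI) auto
qed

lemma row_const_ex:
  "\<exists>C\<ge>1. (\<forall>N k h. N \<le> n + 1 \<longrightarrow> row_ok N \<xi> (H (Suc k) / M k) (unit_row h) C) \<and>
     (\<forall>N k l i i0. l + N \<le> n + 1 \<longrightarrow> 1 \<le> N \<longrightarrow> i \<le> k \<longrightarrow> i0 \<le> i \<longrightarrow> row_ok N \<xi> (H (Suc k) / M k) (shift l (y i)) (C * M i0))"
proof -
  obtain C where C: "1 \<le> C" "\<And>N Q h. N \<le> n + 1 \<Longrightarrow> 1 \<le> Q \<Longrightarrow> row_ok N \<xi> Q (unit_row h) C"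
     "\<And>N Q l x L. l + N \<le> n + 1 \<Longrightarrow> 1 \<le> N \<Longrightarrow> 1 \<le> Q \<Longrightarrow> \<bar>real_of_int (x 0)\<bar> \<le> Q * L \<Longrightarrow> near_curve n \<xi> x L \<Longrightarrow>
        row_ok N \<xi> Q (shift l x) (C * L)"
    using row_ok_ex[of n \<xi>] by blast
  have "row_ok N \<xi> (H (Suc k) / M k) (shift l (y i)) (C * M i0)" if "l + N \<le> n + 1" "1 \<le> N" "i \<le> k" "i0 \<le> i" for N k l i i0
  proof -
    have "M k \<le> M i" "M i \<le> M i0" using M_mono' that by auto
    have "\<bar>real_of_int (y i 0)\<bar> \<le> H (Suc i)" using y_le[of i] y_pos[of i] by simp
    also have "\<dots> \<le> H (Suc k)" using H_mono' that by simp
    also have "\<dots> = H (Suc k) / M k * M k" using M_pos[of k] by simp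
    also have "\<dots> \<le> H (Suc k) / M k * M i" using \<open>M k \<le> M i\<close> Q_ge_1[of k] by (intro mult_left_mono) auto
    finally have "row_ok N \<xi> (H (Suc k) / M k) (shift l (y i)) (C * M i)"
      by (intro C(3) that Q_ge_1 near)
    then show ?thesis by (rule row_ok_mono) (use \<open>M i \<le> M i0\<close> C(1) Q_ge_1[of k] in \<open>auto intro!: mult_left_mono\<close>)
  qed
  then show ?thesis using C(1,2) Q_ge_1 by (intro exI[of _ C]) auto
qed

text \<open>Independence is proved for the natural rows, whereas the estimate holds for
  \<open>pair_list\<close>. Whatever the latter kills is killed by the former, so the integer
  determinant to be estimated is nonzero.\<close>

lemma det_ge_1_of_lin_indep:
  assumes "lin_indep N (shift_rows n N (y (Suc k)) @ [shift k0 (y k)] @ ts)" "N \<le> n + 1" "k0 < n + 2 - N"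
    "n + 3 - N + length ts = N"
  shows "1 \<le> \<bar>real_of_int (det (rows_mat N (pair_list k N k0 @ ts)))\<bar>"
proof -
  define ol where "ol = shift_rows n N (y (Suc k)) @ [shift k0 (y k)] @ ts"
  have len: "length ol = N" using assms(2,4) by (simp add: ol_def)
  have len': "length (pair_list k N k0 @ ts) = N" using assms(4) length_pair_list[OF assms(3)] by simp
  have "det (rows_mat N ol) \<noteq> 0" by (rule lin_indep_det[OF _ len]) (use assms(1) in \<open>simp add: ol_def\<close>)
  then have no: "\<not> (nonzero_below N p \<and> killed N (set ol) p)" for p using det_rows_mat_eq_0_iff[OF len] by blast
  have "\<not> (nonzero_below N p \<and> killed N (set (pair_list k N k0 @ ts)) p)" for p
  proof
    assume p: "nonzero_below N p \<and> killed N (set (pair_list k N k0 @ ts)) p"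
    then have "killed N (set (pair_list k N k0)) p" "killed N (set ts) p" by (auto simp: killed_Un)
    moreover from this have "annih n N (y (Suc k)) p" "dotp N (shift k0 (y k)) p = 0"
      using pair_list_killedD[OF _ assms(2,3)] by blast+
    moreover from this have "killed N (set (shift_rows n N (y (Suc k)))) p" using killed_shift_rows[OF assms(2)] by simp
    ultimately have "killed N (set ol) p" by (auto simp: ol_def killed_def)
    then show False using no p by blast
  qed
  then have "det (rows_mat N (pair_list k N k0 @ ts)) \<noteq> 0" using det_rows_mat_eq_0_iff[OF len'] by blast
  then have "1 \<le> \<bar>det (rows_mat N (pair_list k N k0 @ ts))\<bar>" by linarith
  then show ?thesis by linarith
qed

text \<open>The \<open>m + 1\<close> blocks of \<open>y (Suc k)\<close> of length
  \<open>m + 2\<close> and a block of \<open>y k\<close> on which \<open>p\<close> does not vanish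
  form a nonsingular square system. In logarithms the bound says that heights grow at most by the
  factor \<open>t\<close>.\<close>

lemma plane_height_growth:
  "\<exists>C\<ge>1. \<forall>k p. annih n (m + 2) (y (Suc k)) p \<longrightarrow> \<not> annih n (m + 2) (y k) p \<longrightarrow>
     1 \<le> C * (H (Suc k) * M k * M (Suc k) ^ m)"
proof -
  obtain C where C: "1 \<le> C" and PD: "pair_det_bound C" using pair_det by blast
  have "1 \<le> C * (H (Suc k) * M k * M (Suc k) ^ m)"
    if p: "annih n (m + 2) (y (Suc k)) p" "\<not> annih n (m + 2) (y k) p" for k p
  proof -
    obtain k0 where k0: "k0 + (m + 2) \<le> n + 1" "dotp (m + 2) (shift k0 (y k)) p \<noteq> 0" using p(2) by (auto simp: annih_def)
    have N: "m + 2 \<le> n + 1" using n by simp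
    have k0': "k0 < n + 2 - (m + 2)" using k0(1) by simp
    have len: "n + 3 - (m + 2) + length ([] :: (nat \<Rightarrow> int) list) = m + 2" using n by simp
    have "lin_indep (m + 2) (shift_rows n (m + 2) (y (Suc k)))"
      by (rule full_rank_indep[OF fr]) (use n in auto)
    then have "lin_indep (m + 2) (shift_rows n (m + 2) (y (Suc k)) @ [shift k0 (y k)])"
      by (rule lin_indep_snoc) (use p(1) killed_shift_rows[OF N] k0(2) in auto)
    then have "1 \<le> \<bar>real_of_int (det (rows_mat (m + 2) (pair_list k (m + 2) k0 @ [])))\<bar>"
      by (intro det_ge_1_of_lin_indep N k0' len) simp
    also have "\<dots> \<le> C * (H (Suc k) * M k * M (Suc k) ^ (n + 1 - (m + 2))) * prod_list []"
      by (rule PD[unfolded pair_det_bound_def, rule_format]) (use k0' len in auto)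
    also have "n + 1 - (m + 2) = m" using n by simp
    finally show ?thesis by simp
  qed
  then show ?thesis using C by (intro exI[of _ C] conjI allI impI) auto
qed

text \<open>Otherwise every annihilator of \<open>y (Suc k)\<close> would annihilate
  \<open>y k\<close>, and \<open>annih_determines_point\<close> would make the points proportional.
  From \<open>m + 4\<close> coefficients one descends to \<open>m + 3\<close> by testing both q and
  Tq.\<close>

lemma exists_indep_shift:
  assumes N: "N = m + 3 \<or> N = m + 4"
  shows "\<exists>k0<n + 2 - N. lin_indep N (shift_rows n N (y (Suc k)) @ [shift k0 (y k)])"
proof -
  have Nn: "N \<le> n + 1" using N n m by auto
  have ind: "lin_indep N (shift_rows n N (y (Suc k)))" by (rule full_rank_indep[OF fr]) (use N n m in auto)
  have "\<exists>p. annih n N (y (Suc k)) p \<and> \<not> annih n N (y k) p"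
  proof (rule ccontr)
    assume "\<not> ?thesis"
    then have sub: "annih n N (y (Suc k)) p \<Longrightarrow> annih n N (y k) p" for p by blast
    have "annih n (m + 3) (y k) p" if p: "annih n (m + 3) (y (Suc k)) p" for p
    proof (cases "N = m + 3")
      case True then show ?thesis using sub p by simp
    next
      case False
      then have N4: "N = Suc (m + 3)" using N by simp
      define q where "q = (\<lambda>j. if j < m + 3 then p j else 0)"
      have supp: "supp_below (m + 3) q" by (simp add: q_def supp_below_def)
      have cg: "annih n (m + 3) x p \<longleftrightarrow> annih n (m + 3) x q" for x by (rule annih_cong) (simp add: q_def)
      have "annih n N (y k) q" "annih n N (y k) (tmult (Suc 0) q)"
        using sub annih_Suc[OF supp] annih_Suc_tmult cg p unfolding N4 by blast+
      then have "annih n (m + 3) (y k) q" using annih_of_Suc[OF supp] n m unfolding N4 by simp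
      then show ?thesis using cg by blast
    qed
    then have "\<exists>a b. a \<noteq> 0 \<and> (\<forall>j. a * y k j = b * y (Suc k) j)"
      by (rule annih_determines_point[OF n m fr supp_y])
    then show False using y_nonprop by blast
  qed
  then obtain p k0 where "annih n N (y (Suc k)) p" "k0 + N \<le> n + 1" "dotp N (shift k0 (y k)) p \<noteq> 0"
    by (auto simp: annih_def)
  then show ?thesis
    using lin_indep_snoc[OF ind, of p "shift k0 (y k)"] killed_shift_rows[OF Nn] by (intro exI[of _ k0]) auto
qed

definition row_set :: "nat \<Rightarrow> nat set \<Rightarrow> (nat \<Rightarrow> int) set" where
  "row_set N I = {shift l (y i) | l i. l + N \<le> n + 1 \<and> i \<in> I}"

lemma killed_row_set: "killed N (row_set N I) p \<longleftrightarrow> (\<forall>i\<in>I. annih n N (y i) p)"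
  by (auto simp: killed_def row_set_def annih_def)

text \<open>Without a common annihilator the blocks of length \<open>m + 3\<close> of the three
  points have rank \<open>m + 3\<close>. Besides the \<open>m + 1\<close> rows tied to the last two
  points exactly two more are needed, and each costs at most a multiple of \<open>M k\<close>. In
  logarithms the result is incompatible with growth by the factor \<open>t\<close>.\<close>

lemma common_annih_exists:
  "\<exists>C\<ge>1. \<forall>k. (\<nexists>p. nonzero_below (m + 3) p \<and> annih n (m + 3) (y k) p \<and> annih n (m + 3) (y (Suc k)) p \<and> annih n (m + 3) (y (Suc (Suc k))) p) \<longrightarrow>
     1 \<le> C * (H (Suc (Suc k)) * M (Suc k) * M (Suc (Suc k)) ^ (m - 1) * M k ^ 2)"
proof -
  obtain C where C: "1 \<le> C" and PD: "pair_det_bound C" using pair_det by blast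
  obtain D where D: "1 \<le> D" and RO: "\<forall>N k l i i0. l + N \<le> n + 1 \<longrightarrow> 1 \<le> N \<longrightarrow> i \<le> k \<longrightarrow> i0 \<le> i \<longrightarrow>
      row_ok N \<xi> (H (Suc k) / M k) (shift l (y i)) (D * M i0)"
    using row_const_ex by (elim exE conjE)
  have "1 \<le> (C * D ^ 2) * (H (Suc (Suc k)) * M (Suc k) * M (Suc (Suc k)) ^ (m - 1) * M k ^ 2)"
    if no: "\<nexists>p. nonzero_below (m + 3) p \<and> annih n (m + 3) (y k) p \<and> annih n (m + 3) (y (Suc k)) p \<and> annih n (m + 3) (y (Suc (Suc k))) p" for k
  proof -
    have N: "m + 3 \<le> n + 1" using n m by simp
    obtain k0 where k0: "k0 < n + 2 - (m + 3)"
      "lin_indep (m + 3) (shift_rows n (m + 3) (y (Suc (Suc k))) @ [shift k0 (y (Suc k))])"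
      using exists_indep_shift[of "m + 3" "Suc k"] by blast
    obtain ts where ts: "set ts \<subseteq> row_set (m + 3) {k, Suc k}"
      "lin_indep (m + 3) ((shift_rows n (m + 3) (y (Suc (Suc k))) @ [shift k0 (y (Suc k))]) @ ts)"
      "\<forall>p. killed (m + 3) (set ((shift_rows n (m + 3) (y (Suc (Suc k))) @ [shift k0 (y (Suc k))]) @ ts)) p \<longrightarrow>
         killed (m + 3) (row_set (m + 3) {k, Suc k}) p"
      using lin_indep_extend[OF k0(2), of "row_set (m + 3) {k, Suc k}"] by blast
    define ol where "ol = (shift_rows n (m + 3) (y (Suc (Suc k))) @ [shift k0 (y (Suc k))]) @ ts"
    have "\<not> (nonzero_below (m + 3) p \<and> killed (m + 3) (set ol) p)" for p
    proof
      assume p: "nonzero_below (m + 3) p \<and> killed (m + 3) (set ol) p"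
      then have "killed (m + 3) (row_set (m + 3) {k, Suc k}) p" using ts(3) by (simp add: ol_def)
      then have "annih n (m + 3) (y k) p" "annih n (m + 3) (y (Suc k)) p" by (simp_all add: killed_row_set)
      moreover have "killed (m + 3) (set (shift_rows n (m + 3) (y (Suc (Suc k))))) p"
        using p by (auto simp: ol_def killed_def)
      then have "annih n (m + 3) (y (Suc (Suc k))) p" using killed_shift_rows[OF N] by simp
      ultimately show False using no p by blast
    qed
    then have "length ol = m + 3"
      using exists_killed[of ol "m + 3"] lin_indep_length_le[OF ts(2)] unfolding ol_def[symmetric] by (meson le_neq_implies_less)
    then have lts: "length ts = 2" using n by (simp add: ol_def)
    have len: "n + 3 - (m + 3) + length ts = m + 3" using n lts by simp
    have "1 \<le> \<bar>real_of_int (det (rows_mat (m + 3) (pair_list (Suc k) (m + 3) k0 @ ts)))\<bar>"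
      by (rule det_ge_1_of_lin_indep) (use ts(2) N k0 len in auto)
    also have "\<dots> \<le> C * (H (Suc (Suc k)) * M (Suc k) * M (Suc (Suc k)) ^ (n + 1 - (m + 3))) * prod_list [D * M k, D * M k]"
    proof (rule PD[unfolded pair_det_bound_def, rule_format])
      fix i assume i: "i < length ts"
      then have "ts ! i \<in> row_set (m + 3) {k, Suc k}" using ts(1) nth_mem by blast
      then obtain l i' where "ts ! i = shift l (y i')" "l + (m + 3) \<le> n + 1" "i' \<in> {k, Suc k}" by (auto simp: row_set_def)
      then have "row_ok (m + 3) \<xi> (H (Suc (Suc k)) / M (Suc k)) (ts ! i) (D * M k)" using RO by auto
      moreover have "[D * M k, D * M k] ! i = D * M k" using i lts by (auto simp: less_Suc_eq numeral_2_eq_2)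
      ultimately show "row_ok (m + 3) \<xi> (H (Suc (Suc k)) / M (Suc k)) (ts ! i) ([D * M k, D * M k] ! i)" by simp
    qed (use k0 len lts in auto)
    also have "n + 1 - (m + 3) = m - 1" using n by simp
    finally show ?thesis by (simp add: power2_eq_square algebra_simps)
  qed
  moreover have "1 \<le> C * D ^ 2" using C D by (intro mult_ge1_I one_le_power) auto
  ultimately show ?thesis by (intro exI[of _ "C * D ^ 2"] conjI allI impI) auto
qed

section \<open>Height bounds for annihilators of several points\<close>

definition pair_height_bound :: "nat \<Rightarrow> nat \<Rightarrow> nat \<Rightarrow> real \<Rightarrow> bool" where
  "pair_height_bound N d q C \<longleftrightarrow> (\<forall>k k0 p ts es. primitive p \<longrightarrow> supp_below (Suc d) p \<longrightarrow> k0 < n + 2 - N \<longrightarrow> length ts = length es \<longrightarrow>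
     n + 3 - N + length ts = d \<longrightarrow> (\<forall>i<length ts. row_ok N \<xi> (H (Suc k) / M k) (ts ! i) (es ! i)) \<longrightarrow>
     (\<forall>i<q. killed N (set (pair_list k N k0 @ ts)) (tmult i p)) \<longrightarrow>
     (\<forall>x. killed N (set (pair_list k N k0 @ ts)) x \<longrightarrow> (\<exists>a c. a \<noteq> 0 \<and> (\<forall>j<N. a * x j = (\<Sum>i<q. c i * tmult i p j)))) \<longrightarrow>
     hgt (Suc d) p ^ q \<le> C * (H (Suc k) * M k * M (Suc k) ^ (n + 1 - N)) * prod_list es)"

lemma pair_height:
  assumes N: "N = d + q" "m + 2 \<le> N" "N \<le> m + 4"
  shows "\<exists>C\<ge>1. pair_height_bound N d q C"
proof -
  obtain C where C: "1 \<le> C" and PD: "pair_det_bound C" using pair_det by blast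
  obtain D where D: "1 \<le> D" and RU: "\<forall>N k h. N \<le> n + 1 \<longrightarrow> row_ok N \<xi> (H (Suc k) / M k) (unit_row h) D"
    using row_const_ex by (elim exE conjE)
  obtain K where K: "K > 0" and GM: "height_det_bound d q K" using height_power_le_det by blast
  define CC where "CC = max 1 (K * (C * D ^ q))"
  have "hgt (Suc d) p ^ q \<le> CC * (H (Suc k) * M k * M (Suc k) ^ (n + 1 - N)) * prod_list es"
    if p: "primitive p" "supp_below (Suc d) p" and k0: "k0 < n + 2 - N" and len: "length ts = length es" "n + 3 - N + length ts = d"
      and ok: "\<forall>i<length ts. row_ok N \<xi> (H (Suc k) / M k) (ts ! i) (es ! i)"
      and kp: "\<forall>i<q. killed N (set (pair_list k N k0 @ ts)) (tmult i p)"
      and span: "\<forall>x. killed N (set (pair_list k N k0 @ ts)) x \<longrightarrow> (\<exists>a c. a \<noteq> 0 \<and> (\<forall>j<N. a * x j = (\<Sum>i<q. c i * tmult i p j)))"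
    for k k0 p ts es
  proof -
    have lrs: "length (pair_list k N k0 @ ts) = d" using length_pair_list[OF k0] len(2) by simp
    obtain h where h: "hgt (Suc d) p ^ q \<le> K * \<bar>real_of_int (det (rows_mat N ((pair_list k N k0 @ ts) @ unit_rows h q)))\<bar>"
      using GM[unfolded height_det_bound_def, folded N(1), rule_format, OF p lrs kp[rule_format] span[rule_format]] by blast
    have "\<bar>real_of_int (det (rows_mat N (pair_list k N k0 @ (ts @ unit_rows h q))))\<bar>
       \<le> C * (H (Suc k) * M k * M (Suc k) ^ (n + 1 - N)) * prod_list (es @ replicate q D)"
    proof (rule PD[unfolded pair_det_bound_def, rule_format, OF N(2,3) k0])
      show "length (ts @ unit_rows h q) = length (es @ replicate q D)" using len by simp
      show "n + 3 - N + length (ts @ unit_rows h q) = N" using len(2) N(1) by simp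
      fix i assume i: "i < length (ts @ unit_rows h q)"
      have "N \<le> n + 1" using N n m by simp
      then have "row_ok N \<xi> (H (Suc k) / M k) (unit_row h') D" for h' using RU by blast
      then show "row_ok N \<xi> (H (Suc k) / M k) ((ts @ unit_rows h q) ! i) ((es @ replicate q D) ! i)"
        using i ok len(1) by (cases "i < length ts") (auto simp: nth_append unit_rows_def)
    qed
    then have "K * \<bar>real_of_int (det (rows_mat N ((pair_list k N k0 @ ts) @ unit_rows h q)))\<bar>
       \<le> K * (C * (H (Suc k) * M k * M (Suc k) ^ (n + 1 - N)) * prod_list (es @ replicate q D))"
      using K by (intro mult_left_mono) auto
    also have "\<dots> = (K * (C * D ^ q)) * ((H (Suc k) * M k * M (Suc k) ^ (n + 1 - N)) * prod_list es)"
      by simp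
    also have "\<dots> \<le> CC * ((H (Suc k) * M k * M (Suc k) ^ (n + 1 - N)) * prod_list es)"
    proof (rule mult_right_mono)
      have "0 \<le> e" if "e \<in> set es" for e using that ok len(1) by (auto simp: in_set_conv_nth row_ok_def)
      then have "0 \<le> prod_list es" by (induction es) auto
      moreover have "0 \<le> H (Suc k)" "0 \<le> M k" "0 \<le> M (Suc k)"
        using H_ge_1[of "Suc k"] M_pos[of k] M_pos[of "Suc k"] by auto
      ultimately show "0 \<le> (H (Suc k) * M k * M (Suc k) ^ (n + 1 - N)) * prod_list es" by simp
    qed (simp add: CC_def)
    finally show ?thesis using h by (simp add: mult.assoc)
  qed
  then show ?thesis unfolding pair_height_bound_def by (intro exI[of _ CC] conjI allI impI) (auto simp: CC_def)
qed

text \<open>Here \<open>q = 1\<close>: the \<open>m + 1\<close> rows tied to \<open>y k\<close> and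
  \<open>y (Suc k)\<close> need one more row, from a point in \<open>I\<close>, to leave only the
  line of \<open>S\<close>. That row costs at most a multiple of \<open>M i0\<close>, as
  \<open>i0\<close> is a lower bound of \<open>I\<close>.\<close>

lemma unique_annih_height:
  "\<exists>C\<ge>1. \<forall>k I i0 S. primitive S \<longrightarrow> supp_below (m + 3) S \<longrightarrow> annih n (m + 3) (y (Suc k)) S \<longrightarrow> annih n (m + 3) (y k) S \<longrightarrow>
     (\<forall>i\<in>I. i0 \<le> i \<and> i \<le> k \<and> annih n (m + 3) (y i) S) \<longrightarrow>
     (\<forall>p. annih n (m + 3) (y (Suc k)) p \<longrightarrow> (\<forall>i\<in>I. annih n (m + 3) (y i) p) \<longrightarrow> (\<exists>a b. a \<noteq> 0 \<and> (\<forall>j<m + 3. a * p j = b * S j))) \<longrightarrow>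
     hgt (m + 3) S \<le> C * (H (Suc k) * M k * M (Suc k) ^ (m - 1) * M i0)"
proof -
  have N3: "m + 3 = (m + 2) + 1" "m + 2 \<le> m + 3" "m + 3 \<le> m + 4" by auto
  obtain C where C: "1 \<le> C" and PH: "pair_height_bound (m + 3) (m + 2) 1 C" using pair_height[OF N3] by blast
  obtain D where D: "1 \<le> D" and RO: "\<forall>N k l i i0. l + N \<le> n + 1 \<longrightarrow> 1 \<le> N \<longrightarrow> i \<le> k \<longrightarrow> i0 \<le> i \<longrightarrow>
      row_ok N \<xi> (H (Suc k) / M k) (shift l (y i)) (D * M i0)"
    using row_const_ex by (elim exE conjE)
  have "hgt (m + 3) S \<le> (C * D) * (H (Suc k) * M k * M (Suc k) ^ (m - 1) * M i0)"
    if S: "primitive S" "supp_below (m + 3) S" "annih n (m + 3) (y (Suc k)) S" "annih n (m + 3) (y k) S"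
      and I: "\<forall>i\<in>I. i0 \<le> i \<and> i \<le> k \<and> annih n (m + 3) (y i) S"
      and uniq: "\<forall>p. annih n (m + 3) (y (Suc k)) p \<longrightarrow> (\<forall>i\<in>I. annih n (m + 3) (y i) p) \<longrightarrow> (\<exists>a b. a \<noteq> 0 \<and> (\<forall>j<m + 3. a * p j = b * S j))"
    for k I i0 S
  proof -
    have N: "m + 3 \<le> n + 1" using n m by simp
    obtain k0 where k0: "k0 < n + 2 - (m + 3)"
      "lin_indep (m + 3) (shift_rows n (m + 3) (y (Suc k)) @ [shift k0 (y k)])"
      using exists_indep_shift[of "m + 3" k] by blast
    define bl where "bl = shift_rows n (m + 3) (y (Suc k)) @ [shift k0 (y k)]"
    obtain ts where ts: "set ts \<subseteq> row_set (m + 3) I" "lin_indep (m + 3) (bl @ ts)"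
      "\<forall>p. killed (m + 3) (set (bl @ ts)) p \<longrightarrow> killed (m + 3) (row_set (m + 3) I) p"
      using lin_indep_extend[OF k0(2), of "row_set (m + 3) I"] unfolding bl_def by blast
    have span: "\<exists>a b. a \<noteq> 0 \<and> (\<forall>j<m + 3. a * p j = b * S j)" if p: "killed (m + 3) (set (bl @ ts)) p" for p
    proof -
      have "killed (m + 3) (set (shift_rows n (m + 3) (y (Suc k)))) p" using p by (auto simp: bl_def killed_def)
      then have "annih n (m + 3) (y (Suc k)) p" using killed_shift_rows[OF N] by simp
      moreover have "\<forall>i\<in>I. annih n (m + 3) (y i) p" using ts(3) p killed_row_set by blast
      ultimately show ?thesis using uniq by blast
    qed
    have nzS: "nonzero_below (m + 3) S" using primitive_nonzero[OF S(1,2)] .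
    have kS: "killed (m + 3) (set (bl @ ts)) S"
    proof -
      have "killed (m + 3) (set (shift_rows n (m + 3) (y (Suc k)))) S" using S(3) killed_shift_rows[OF N] by simp
      moreover have "dotp (m + 3) (shift k0 (y k)) S = 0" using S(4) k0(1) unfolding annih_def by (simp add: less_diff_conv)
      moreover have "killed (m + 3) (row_set (m + 3) I) S" using I killed_row_set by blast
      ultimately show ?thesis using ts(1) by (auto simp: bl_def killed_def)
    qed
    have "length (bl @ ts) + length [S] = m + 3"
    proof (rule killed_span_length[OF ts(2) lin_indep_singleton[OF nzS]])
      show "killed (m + 3) (set (bl @ ts)) g" if "g \<in> set [S]" for g using kS that by simp
      show "\<exists>a c. a \<noteq> 0 \<and> (\<forall>j<m + 3. a * p j = (\<Sum>i<length [S]. c i * ([S] ! i) j))" if p: "killed (m + 3) (set (bl @ ts)) p" for p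
      proof -
        obtain a b where ab: "a \<noteq> 0" "\<forall>j<m + 3. a * p j = b * S j" using span[OF p] by blast
        show ?thesis by (rule exI[of _ a], rule exI[of _ "\<lambda>_. b"]) (use ab in simp)
      qed
    qed
    then have lts: "length ts = 1" using n by (simp add: bl_def)
    obtain t where t: "ts = [t]" using lts by (metis One_nat_def length_0_conv length_Suc_conv)
    have krs: "killed (m + 3) (set (bl @ ts)) p" if p: "killed (m + 3) (set (pair_list k (m + 3) k0 @ ts)) p" for p
    proof -
      have "killed (m + 3) (set (pair_list k (m + 3) k0)) p" "killed (m + 3) (set ts) p" using p by (auto simp: killed_Un)
      moreover from this have "annih n (m + 3) (y (Suc k)) p" "dotp (m + 3) (shift k0 (y k)) p = 0"
        using pair_list_killedD[OF _ N k0(1)] by blast+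
      moreover from this have "killed (m + 3) (set (shift_rows n (m + 3) (y (Suc k)))) p" using killed_shift_rows[OF N] by simp
      ultimately show ?thesis by (auto simp: bl_def killed_def)
    qed
    have "hgt (Suc (m + 2)) S ^ 1 \<le> C * (H (Suc k) * M k * M (Suc k) ^ (n + 1 - (m + 3))) * prod_list [D * M i0]"
    proof (rule PH[unfolded pair_height_bound_def, rule_format, OF S(1) _ k0(1)])
      show "supp_below (Suc (m + 2)) S" using S(2) by (simp add: eval_nat_numeral)
      show "length ts = length [D * M i0]" "n + 3 - (m + 3) + length ts = m + 2" using lts n by auto
      show "row_ok (m + 3) \<xi> (H (Suc k) / M k) (ts ! i) ([D * M i0] ! i)" if "i < length ts" for i
      proof -
        have "t \<in> row_set (m + 3) I" using ts(1) t by simp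
        then obtain l i' where "t = shift l (y i')" "l + (m + 3) \<le> n + 1" "i' \<in> I" by (auto simp: row_set_def)
        then have "row_ok (m + 3) \<xi> (H (Suc k) / M k) t (D * M i0)" using RO I by auto
        then show ?thesis using that t by simp
      qed
      show "killed (m + 3) (set (pair_list k (m + 3) k0 @ ts)) (tmult i S)" if "i < 1" for i
      proof -
        have "killed (m + 3) (set (pair_list k (m + 3) k0)) S" by (rule pair_list_killed[OF S(4,3) k0(1)])
        moreover have "killed (m + 3) (set ts) S" using kS by (auto simp: killed_def)
        ultimately show ?thesis using that by (simp add: killed_Un)
      qed
      show "\<exists>a c. a \<noteq> 0 \<and> (\<forall>j<m + 3. a * x j = (\<Sum>i<1. c i * tmult i S j))"
        if x: "killed (m + 3) (set (pair_list k (m + 3) k0 @ ts)) x" for x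
      proof -
        obtain a b where ab: "a \<noteq> 0" "\<forall>j<m + 3. a * x j = b * S j" using span[OF krs[OF x]] by blast
        show ?thesis by (rule exI[of _ a], rule exI[of _ "\<lambda>_. b"]) (use ab in simp)
      qed
    qed
    also have "n + 1 - (m + 3) = m - 1" using n by simp
    finally show ?thesis by (simp add: mult_ac eval_nat_numeral)
  qed
  moreover have "1 \<le> C * D" using C D by (intro mult_ge1_I) auto
  ultimately show ?thesis by (intro exI[of _ "C * D"] conjI allI impI) auto
qed

text \<open>Here \<open>q = 2\<close>: the \<open>m + 1\<close> rows of length \<open>m + 3\<close>
  tied to both points already have the kernel spanned by P and TP, so the square of the height is
  bounded without any further row.\<close>

lemma annih_double_height:
  "\<exists>C\<ge>1. \<forall>k P. primitive P \<longrightarrow> supp_below (m + 2) P \<longrightarrow> annih n (m + 2) (y k) P \<longrightarrow> annih n (m + 2) (y (Suc k)) P \<longrightarrow>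
     hgt (m + 2) P ^ 2 \<le> C * (H (Suc k) * M k * M (Suc k) ^ (m - 1))"
proof -
  have N3: "m + 3 = (m + 1) + 2" "m + 2 \<le> m + 3" "m + 3 \<le> m + 4" by auto
  obtain C where C: "1 \<le> C" and PH: "pair_height_bound (m + 3) (m + 1) 2 C" using pair_height[OF N3] by blast
  have "hgt (m + 2) P ^ 2 \<le> C * (H (Suc k) * M k * M (Suc k) ^ (m - 1))"
    if P: "primitive P" "supp_below (m + 2) P" "annih n (m + 2) (y k) P" "annih n (m + 2) (y (Suc k)) P" for k P
  proof -
    have N: "m + 3 \<le> n + 1" using n m by simp
    have e: "m + 3 = Suc (m + 2)" by simp
    obtain k0 where k0: "k0 < n + 2 - (m + 3)" "lin_indep (m + 3) (shift_rows n (m + 3) (y (Suc k)) @ [shift k0 (y k)])"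
      using exists_indep_shift[of "m + 3" k] by blast
    define bl where "bl = shift_rows n (m + 3) (y (Suc k)) @ [shift k0 (y k)]"
    have an: "annih n (m + 3) (y i) P" "annih n (m + 3) (y i) (tmult (Suc 0) P)" if "i = k \<or> i = Suc k" for i
      unfolding e using annih_Suc[OF P(2)] annih_Suc_tmult P(3,4) that by blast+
    have kbl: "killed (m + 3) (set bl) p" if p: "annih n (m + 3) (y k) p" "annih n (m + 3) (y (Suc k)) p" for p
    proof -
      have "killed (m + 3) (set (shift_rows n (m + 3) (y (Suc k)))) p" using p(2) killed_shift_rows[OF N] by simp
      moreover have "dotp (m + 3) (shift k0 (y k)) p = 0" using p(1) k0(1) unfolding annih_def by (simp add: less_diff_conv)
      ultimately show ?thesis by (auto simp: bl_def killed_def)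
    qed
    have nz: "nonzero_below (m + 2) P" by (rule primitive_nonzero[OF P(1,2)])
    have "hgt (Suc (m + 1)) P ^ 2 \<le> C * (H (Suc k) * M k * M (Suc k) ^ (n + 1 - (m + 3))) * prod_list []"
    proof (rule PH[unfolded pair_height_bound_def, rule_format, OF P(1) _ k0(1)])
      show "supp_below (Suc (m + 1)) P" using P(2) by simp
      show "n + 3 - (m + 3) + length ([] :: (nat \<Rightarrow> int) list) = m + 1" using n by simp
      show "killed (m + 3) (set (pair_list k (m + 3) k0 @ [])) (tmult i P)" if "i < 2" for i
      proof -
        have "i = 0 \<or> i = Suc 0" using that by auto
        then have "annih n (m + 3) (y k) (tmult i P)" "annih n (m + 3) (y (Suc k)) (tmult i P)" using an by auto
        from pair_list_killed[OF this k0(1)] show ?thesis by simp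
      qed
      show "\<exists>a c. a \<noteq> 0 \<and> (\<forall>j<m + 3. a * x j = (\<Sum>i<2. c i * tmult i P j))" if x: "killed (m + 3) (set (pair_list k (m + 3) k0 @ [])) x" for x
      proof -
        have x1: "annih n (m + 3) (y (Suc k)) x" "dotp (m + 3) (shift k0 (y k)) x = 0"
          using pair_list_killedD[OF _ N k0(1)] x by simp_all
        then have "killed (m + 3) (set (shift_rows n (m + 3) (y (Suc k)))) x" using killed_shift_rows[OF N] by simp
        then have kx: "killed (m + 3) (set bl) x" using x1(2) by (auto simp: bl_def killed_def)
        have "\<exists>a c. a \<noteq> 0 \<and> (\<forall>j<m + 3. a * x j = (\<Sum>i<length [P, tmult (Suc 0) P]. c i * ([P, tmult (Suc 0) P] ! i) j))"
        proof (rule killed_in_span[OF _ _ _ _ kx])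
          show "lin_indep (m + 3) bl" using k0(2) by (simp add: bl_def)
          show "lin_indep (m + 3) [P, tmult (Suc 0) P]" unfolding e by (rule lin_indep_tmult[OF P(2) nz])
          show "killed (m + 3) (set bl) g" if "g \<in> set [P, tmult (Suc 0) P]" for g
            using that kbl an by auto
          show "m + 3 \<le> length bl + length [P, tmult (Suc 0) P]" using n by (simp add: bl_def)
        qed
        then show ?thesis by (simp add: numeral_2_eq_2)
      qed
    qed auto
    also have "n + 1 - (m + 3) = m - 1" using n by simp
    finally show ?thesis by simp
  qed
  then show ?thesis using C by (intro exI[of _ C] conjI allI impI) auto
qed

text \<open>Points and polynomials exchange roles. The \<open>m\<close> multiples of
  \<open>S1\<close>, the \<open>m\<close> multiples of \<open>S2\<close> and one multiple of
  \<open>P\<close> are \<open>n\<close> rows of length \<open>n + 1\<close>. By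
  \<open>annih_pencil_plane\<close> the first \<open>2 * m\<close> leave the plane of both points,
  and T^l P, chosen not to vanish on \<open>y k\<close>, leaves the line of
  \<open>y (Suc k)\<close>. So the size of this point is bounded by a product of heights; inserting
  the single point bound for the height of \<open>P\<close> lets the size of the point
  cancel.\<close>

lemma pair_annih_heights_ge:
  "\<exists>C\<ge>1. \<forall>k S1 S2 P. supp_below (m + 3) S1 \<longrightarrow> supp_below (m + 3) S2 \<longrightarrow> lin_indep (m + 3) [S1, S2] \<longrightarrow>
     (\<forall>S\<in>{S1, S2}. annih n (m + 3) (y k) S \<and> annih n (m + 3) (y (Suc k)) S) \<longrightarrow>
     primitive P \<longrightarrow> supp_below (m + 2) P \<longrightarrow> annih n (m + 2) (y (Suc k)) P \<longrightarrow> \<not> annih n (m + 2) (y k) P \<longrightarrow>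
     1 \<le> C * (hgt (m + 3) S1 * hgt (m + 3) S2 * M (Suc k)) ^ m"
proof -
  obtain K where K: "K > 0" and GM: "height_det_bound n 1 K" using height_power_le_det by blast
  have m1: "1 \<le> m + 1" "2 * (m + 1) \<le> n + 1" using n by auto
  obtain C where C: "1 \<le> C" and SP: "single_height_bound n \<xi> (m + 1) C" using single_point_height[OF m1] by blast
  define CC where "CC = max 1 (K * fact (n + 1) * C)"
  have "1 \<le> CC * (hgt (m + 3) S1 * hgt (m + 3) S2 * M (Suc k)) ^ m"
    if S: "supp_below (m + 3) S1" "supp_below (m + 3) S2" "lin_indep (m + 3) [S1, S2]"
      "\<forall>S\<in>{S1, S2}. annih n (m + 3) (y k) S \<and> annih n (m + 3) (y (Suc k)) S"
      and P: "primitive P" "supp_below (m + 2) P" "annih n (m + 2) (y (Suc k)) P" "\<not> annih n (m + 2) (y k) P"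
    for k S1 S2 P
  proof -
    obtain l where l: "l + (m + 2) \<le> n + 1" "dotp (m + 2) (shift l (y k)) P \<noteq> 0" using P(4) by (auto simp: annih_def)
    define rs where "rs = map (\<lambda>i. tmult i S1) [0..<m] @ map (\<lambda>i. tmult i S2) [0..<m] @ [tmult l P]"
    have lrs: "length rs = n" using n by (simp add: rs_def)
    have d3: "dotp (n + 1) (tmult i S) x = dotp (m + 3) (shift i x) S" if "i < m" "supp_below (m + 3) S" for i S x
    proof -
      have "i + (m + 3) \<le> n + 1" using that n by simp
      from dotp_tmult_le[OF that(2) this, of 0 x] show ?thesis by (simp add: dotp_commute shift_def)
    qed
    have d2: "dotp (n + 1) (tmult l P) x = dotp (m + 2) (shift l x) P" for x
      using dotp_tmult_le[OF P(2) l(1), of 0 x] by (simp add: dotp_commute shift_def)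
    have krs: "killed (n + 1) (set rs) x \<longleftrightarrow> annih n (m + 3) x S1 \<and> annih n (m + 3) x S2 \<and> dotp (m + 2) (shift l x) P = 0" for x
    proof -
      have im: "i + (m + 3) \<le> n + 1 \<longleftrightarrow> i < m" for i using n by auto
      have "killed (n + 1) (set rs) x \<longleftrightarrow> (\<forall>i<m. dotp (n + 1) (tmult i S1) x = 0) \<and> (\<forall>i<m. dotp (n + 1) (tmult i S2) x = 0)
          \<and> dotp (n + 1) (tmult l P) x = 0"
        unfolding killed_def rs_def by auto
      then show ?thesis unfolding annih_def im using d3 S(1,2) d2 by simp
    qed
    have "\<exists>h\<le>n. hgt (Suc n) (y (Suc k)) ^ 1 \<le> K * \<bar>real_of_int (det (rows_mat (n + 1) (rs @ unit_rows h 1)))\<bar>"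
    proof (rule GM[unfolded height_det_bound_def, rule_format, OF prim])
      show "supp_below (Suc n) (y (Suc k))" using supp_y[of "Suc k"] by simp
      show "length rs = n" by (rule lrs)
      show "killed (n + 1) (set rs) (tmult i (y (Suc k)))" if "i < 1" for i
        using that S(4) P(3) l(1) unfolding krs annih_def by simp
      show "\<exists>a c. a \<noteq> 0 \<and> (\<forall>j<n + 1. a * x j = (\<Sum>i<1. c i * tmult i (y (Suc k)) j))" if x: "killed (n + 1) (set rs) x" for x
      proof -
        define u where "u = (\<lambda>j. if j < n + 1 then x j else 0)"
        have su: "supp_below (n + 1) u" by (simp add: supp_below_def u_def)
        have "killed (n + 1) (set rs) u" using x unfolding killed_def by (simp add: dotp_def u_def)
        then have ku: "annih n (m + 3) u S1" "annih n (m + 3) u S2" "dotp (m + 2) (shift l u) P = 0" using krs by auto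
        have "\<exists>a b c. a \<noteq> 0 \<and> (\<forall>j. a * u j = b * y (Suc k) j + c * y k j)"
          by (rule annih_pencil_plane[OF n m fr supp_y su P(2,3,4) S(3)]) (use S(4) ku in auto)
        then obtain a b c where abc: "a \<noteq> 0" "\<And>j. a * u j = b * y (Suc k) j + c * y k j" by blast
        have "a * dotp (m + 2) (shift l u) P = dotp (m + 2) (\<lambda>j. a * shift l u j) P" by (simp add: dotp_scale_left)
        also have "\<dots> = dotp (m + 2) (\<lambda>j. b * shift l (y (Suc k)) j + c * shift l (y k) j) P" using abc(2) by (simp add: shift_def)
        also have "\<dots> = b * dotp (m + 2) (shift l (y (Suc k))) P + c * dotp (m + 2) (shift l (y k)) P" by (rule dotp_lincomb_left)
        also have "dotp (m + 2) (shift l (y (Suc k))) P = 0" using P(3) l(1) by (simp add: annih_def)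
        finally have "c = 0" using ku(3) l(2) by simp
        then have "a * x j = b * y (Suc k) j" if "j < n + 1" for j using abc(2)[of j] that by (simp add: u_def)
        then show ?thesis using abc(1) by (intro exI[of _ a] exI[of _ "\<lambda>_. b"] conjI) auto
      qed
    qed
    then obtain h where h: "hgt (Suc n) (y (Suc k)) \<le> K * \<bar>real_of_int (det (rows_mat (n + 1) (rs @ [unit_row h])))\<bar>"
      by (auto simp: unit_rows_def)
    define es where "es = replicate m (hgt (m + 3) S1) @ replicate m (hgt (m + 3) S2) @ [hgt (m + 2) P, 1]"
    have les: "length es = n + 1" using n by (simp add: es_def)
    have tm: "\<bar>real_of_int (tmult i S j)\<bar> \<le> hgt N S" if "supp_below N S" for i S j N
    proof (cases "j < i \<or> N \<le> j - i")
      case True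
      then have "tmult i S j = 0" using that by (auto simp: tmult_def supp_below_def)
      then show ?thesis using hgt_nonneg by simp
    next
      case False
      then show ?thesis using abs_le_hgt[of "j - i" N S] by (simp add: tmult_def)
    qed
    have ent: "\<bar>real_of_int (((rs @ [unit_row h]) ! i) j)\<bar> \<le> es ! i" if i: "i < n + 1" for i j
    proof -
      have "i < m \<or> (m \<le> i \<and> i < 2 * m) \<or> i = 2 * m \<or> i = 2 * m + 1" using i n by linarith
      then show ?thesis
      proof (elim disjE conjE)
        assume "i < m" then show ?thesis using tm[OF S(1)] by (simp add: rs_def es_def nth_append)
      next
        assume i: "m \<le> i" "i < 2 * m"
        then have i': "i - m < m" "\<not> i < m" by linarith+
        show ?thesis using tm[OF S(2), of "i - m" j] i' by (simp add: rs_def es_def nth_append)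
      next
        assume "i = 2 * m"
        then have i': "\<not> i < m" "\<not> i - m < m" "i - m - m = 0" using m by linarith+
        show ?thesis using tm[OF P(2), of l j] i' by (simp add: rs_def es_def nth_append)
      next
        assume "i = 2 * m + 1"
        then have i': "\<not> i < m" "\<not> i - m < m" "i - m - m = 1" using m by linarith+
        show ?thesis using i' by (simp add: rs_def es_def nth_append unit_row_def)
      qed
    qed
    define B where "B = map_mat real_of_int (rows_mat (n + 1) (rs @ [unit_row h]))"
    have "\<bar>det B\<bar> \<le> fact (n + 1) * (\<Prod>i<n + 1. es ! i) * (\<Prod>j<n + 1. 1)"
    proof (rule abs_det_le)
      show "B \<in> carrier_mat (n + 1) (n + 1)" by (simp add: B_def)
      show "\<bar>B $$ (i, j)\<bar> \<le> es ! i * 1" if "i < n + 1" "j < n + 1" for i j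
        using ent[OF that(1), of j] that by (simp add: B_def rows_mat_def)
      show "0 \<le> es ! i" if "i < n + 1" for i using ent[OF that, of 0] by linarith
    qed simp
    moreover have "det B = real_of_int (det (rows_mat (n + 1) (rs @ [unit_row h])))"
      unfolding B_def by (rule of_int_hom.hom_det)
    moreover have "(\<Prod>i<n + 1. es ! i) = hgt (m + 3) S1 ^ m * hgt (m + 3) S2 ^ m * hgt (m + 2) P"
      using prod_nth_prod_list[of es] unfolding les by (simp add: es_def)
    ultimately have "\<bar>real_of_int (det (rows_mat (n + 1) (rs @ [unit_row h])))\<bar> \<le> fact (n + 1) * (hgt (m + 3) S1 ^ m * hgt (m + 3) S2 ^ m * hgt (m + 2) P)"
      by (simp only: prod.neutral_const mult_1_right)
    then have "K * \<bar>real_of_int (det (rows_mat (n + 1) (rs @ [unit_row h])))\<bar> \<le> K * (fact (n + 1) * (hgt (m + 3) S1 ^ m * hgt (m + 3) S2 ^ m * hgt (m + 2) P))"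
      using K by (intro mult_left_mono) auto
    moreover have "real_of_int (y (Suc k) 0) \<le> hgt (Suc n) (y (Suc k))" using abs_le_hgt[of 0 "Suc n" "y (Suc k)"] by simp
    ultimately have y1: "real_of_int (y (Suc k) 0) \<le> K * fact (n + 1) * (hgt (m + 3) S1 ^ m * hgt (m + 3) S2 ^ m) * hgt (m + 2) P"
      using h by (simp add: mult.assoc)
    have y0: "1 \<le> real_of_int (y (Suc k) 0)" using y_pos[of "Suc k"] by linarith
    have "hgt (Suc (m + 1)) P ^ (n + 2 - 2 * (m + 1)) \<le> C * \<bar>real_of_int (y (Suc k) 0)\<bar> * M (Suc k) ^ (m + 1 - 1)"
    proof (rule SP[unfolded single_height_bound_def, rule_format, OF P(1)])
      show "supp_below (Suc (m + 1)) P" "annih n (Suc (m + 1)) (y (Suc k)) P" using P(2,3) by simp_all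
      show "q j = 0" if "annih n (m + 1) (y (Suc k)) q" "j < m + 1" for q j using fr[of "Suc k"] that unfolding full_rank_def by blast
      show "M (Suc k) \<le> \<bar>real_of_int (y (Suc k) 0)\<bar>" using M_le_1[of "Suc k"] y0 by linarith
    qed (use M_pos near in auto)
    moreover have "n + 2 - 2 * (m + 1) = 1" using n by simp
    ultimately have "hgt (m + 2) P \<le> C * real_of_int (y (Suc k) 0) * M (Suc k) ^ m" using y0 by simp
    then have "K * fact (n + 1) * (hgt (m + 3) S1 ^ m * hgt (m + 3) S2 ^ m) * hgt (m + 2) P
       \<le> K * fact (n + 1) * (hgt (m + 3) S1 ^ m * hgt (m + 3) S2 ^ m) * (C * real_of_int (y (Suc k) 0) * M (Suc k) ^ m)"
      using K by (intro mult_left_mono) (auto simp: hgt_nonneg)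
    with y1 have "1 * real_of_int (y (Suc k) 0) \<le> (K * fact (n + 1) * C) * (hgt (m + 3) S1 * hgt (m + 3) S2 * M (Suc k)) ^ m * real_of_int (y (Suc k) 0)"
      by (simp add: power_mult_distrib mult_ac)
    then have "1 \<le> (K * fact (n + 1) * C) * (hgt (m + 3) S1 * hgt (m + 3) S2 * M (Suc k)) ^ m"
      by (rule mult_right_le_imp_le) (use y0 in linarith)
    also have "\<dots> \<le> CC * (hgt (m + 3) S1 * hgt (m + 3) S2 * M (Suc k)) ^ m"
    proof (rule mult_right_mono)
      show "0 \<le> (hgt (m + 3) S1 * hgt (m + 3) S2 * M (Suc k)) ^ m"
        using hgt_nonneg[of "m + 3" S1] hgt_nonneg[of "m + 3" S2] M_pos[of "Suc k"] by simp
    qed (simp add: CC_def)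
    finally show ?thesis .
  qed
  then show ?thesis by (intro exI[of _ CC] conjI allI impI) (auto simp: CC_def)
qed

section \<open>Points in the span of three consecutive ones\<close>

definition in_span3 :: "nat \<Rightarrow> nat \<Rightarrow> bool" where
  "in_span3 a c \<longleftrightarrow> (\<exists>d g1 g2 g3. d \<noteq> 0 \<and> (\<forall>j. d * y c j = g1 * y a j + g2 * y (Suc a) j + g3 * y (Suc (Suc a)) j))"

text \<open>Exchange: \<open>y c\<close> can replace one of the three spanning points, called
  \<open>u3\<close>, whose coefficient is nonzero. Which one it is remains open, so the
  \<open>u1\<close>, \<open>u2\<close>, \<open>u3\<close> are known only as a set.\<close>

lemma in_span3_exchange:
  assumes "in_span3 a c"
  shows "\<exists>u1 u2 u3 d g1 g2 g3. {u1, u2, u3} = {y a, y (Suc a), y (Suc (Suc a))} \<and>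
    (\<forall>b1 b2 b3. (\<forall>j. b1 * u1 j + b2 * u2 j + b3 * u3 j = 0) \<longrightarrow> b1 = 0 \<and> b2 = 0 \<and> b3 = 0) \<and>
    d \<noteq> 0 \<and> g3 \<noteq> 0 \<and> (\<forall>j. d * y c j = g1 * u1 j + g2 * u2 j + g3 * u3 j)"
proof -
  obtain d g1 g2 g3 where d: "d \<noteq> 0" and g: "\<And>j. d * y c j = g1 * y a j + g2 * y (Suc a) j + g3 * y (Suc (Suc a)) j"
    using assms unfolding in_span3_def by blast
  have "g1 \<noteq> 0 \<or> g2 \<noteq> 0 \<or> g3 \<noteq> 0" using g[of 0] d y_pos[of c] by auto
  then consider "g3 \<noteq> 0" | "g2 \<noteq> 0" | "g1 \<noteq> 0" by blast
  then show ?thesis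
  proof cases
    case 1
    show ?thesis
      by (rule exI[of _ "y a"], rule exI[of _ "y (Suc a)"], rule exI[of _ "y (Suc (Suc a))"], rule exI[of _ d],
          rule exI[of _ g1], rule exI[of _ g2], rule exI[of _ g3], intro conjI allI impI refl d 1 g)
        (use indep3[of _ a] in blast)+
  next
    case 2
    have "b1 = 0 \<and> b3 = 0 \<and> b2 = 0" if "\<forall>j. b1 * y a j + b2 * y (Suc (Suc a)) j + b3 * y (Suc a) j = 0" for b1 b2 b3
      by (rule indep3[of _ a]) (use that in \<open>simp add: algebra_simps\<close>)
    then have i: "\<forall>b1 b2 b3. (\<forall>j. b1 * y a j + b2 * y (Suc (Suc a)) j + b3 * y (Suc a) j = 0) \<longrightarrow> b1 = 0 \<and> b2 = 0 \<and> b3 = 0" by blast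
    have s: "{y a, y (Suc (Suc a)), y (Suc a)} = {y a, y (Suc a), y (Suc (Suc a))}" by blast
    have e: "\<forall>j. d * y c j = g1 * y a j + g3 * y (Suc (Suc a)) j + g2 * y (Suc a) j" using g by simp
    show ?thesis
      by (rule exI[of _ "y a"], rule exI[of _ "y (Suc (Suc a))"], rule exI[of _ "y (Suc a)"], rule exI[of _ d],
          rule exI[of _ g1], rule exI[of _ g3], rule exI[of _ g2], rule conjI[OF s], rule conjI[OF i], rule conjI[OF d], rule conjI[OF 2], rule e)
  next
    case 3
    have "b3 = 0 \<and> b2 = 0 \<and> b1 = 0" if "\<forall>j. b1 * y (Suc (Suc a)) j + b2 * y (Suc a) j + b3 * y a j = 0" for b1 b2 b3
      by (rule indep3[of _ a]) (use that in \<open>simp add: algebra_simps\<close>)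
    then have i: "\<forall>b1 b2 b3. (\<forall>j. b1 * y (Suc (Suc a)) j + b2 * y (Suc a) j + b3 * y a j = 0) \<longrightarrow> b1 = 0 \<and> b2 = 0 \<and> b3 = 0" by blast
    have s: "{y (Suc (Suc a)), y (Suc a), y a} = {y a, y (Suc a), y (Suc (Suc a))}" by blast
    have e: "\<forall>j. d * y c j = g3 * y (Suc (Suc a)) j + g2 * y (Suc a) j + g1 * y a j" using g by simp
    show ?thesis
      by (rule exI[of _ "y (Suc (Suc a))"], rule exI[of _ "y (Suc a)"], rule exI[of _ "y a"], rule exI[of _ d],
          rule exI[of _ g3], rule exI[of _ g2], rule exI[of _ g1], rule conjI[OF s], rule conjI[OF i], rule conjI[OF d], rule conjI[OF 3], rule e)
  qed
qed

lemma in_span3_dotp: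
  assumes "in_span3 a c" "\<And>i. i \<in> {a, Suc a, Suc (Suc a)} \<Longrightarrow> dotp N (comb_shift R r (y i)) p = 0"
  shows "dotp N (comb_shift R r (y c)) p = 0"
proof -
  obtain d g1 g2 g3 where d: "d \<noteq> 0" and g: "\<And>j. d * y c j = g1 * y a j + g2 * y (Suc a) j + g3 * y (Suc (Suc a)) j"
    using assms unfolding in_span3_def by blast
  have "d * comb_shift R r (y c) j = g1 * comb_shift R r (y a) j + g2 * comb_shift R r (y (Suc a)) j + g3 * comb_shift R r (y (Suc (Suc a))) j" for j
  proof -
    have "d * comb_shift R r (y c) j = (\<Sum>k<R. r k * (d * y c (k + j)))" by (simp add: comb_shift_def sum_distrib_left mult_ac)
    also have "\<dots> = (\<Sum>k<R. r k * (g1 * y a (k + j) + g2 * y (Suc a) (k + j) + g3 * y (Suc (Suc a)) (k + j)))" unfolding g ..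
    finally show ?thesis by (simp add: comb_shift_def sum_distrib_left sum.distrib algebra_simps)
  qed
  then have "d * dotp N (comb_shift R r (y c)) p = dotp N (\<lambda>j. g1 * comb_shift R r (y a) j + g2 * comb_shift R r (y (Suc a)) j + g3 * comb_shift R r (y (Suc (Suc a))) j) p"
    by (simp add: dotp_scale_left[symmetric])
  also have "\<dots> = g1 * dotp N (comb_shift R r (y a)) p + g2 * dotp N (comb_shift R r (y (Suc a))) p + g3 * dotp N (comb_shift R r (y (Suc (Suc a)))) p"
    by (simp add: dotp_def sum_distrib_left sum.distrib algebra_simps)
  also have "\<dots> = 0" using assms(2) by simp
  finally show ?thesis using d by simp
qed

text \<open>A shift combination \<open>r\<close> from \<open>exists_generic_shift\<close> is applied
  to \<open>y a\<close>, \<open>y (Suc a)\<close> and \<open>yp (Suc a)\<close>, which span the same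
  space as the three consecutive points. These rows recover the action of \<open>r\<close> on
  \<open>y c\<close>. Conversely they clear the other \<open>m - 1\<close> blocks of
  \<open>y c\<close>, which therefore cost only \<open>M c\<close> each. The \<open>m + 2\<close>
  rows together leave the line of \<open>S\<close>.\<close>

lemma span_annih_height:
  "\<exists>C\<ge>1. \<forall>a c S. in_span3 a c \<longrightarrow> primitive S \<longrightarrow> supp_below (m + 3) S \<longrightarrow>
     (\<forall>i\<in>{a, Suc a, Suc (Suc a), c}. annih n (m + 3) (y i) S) \<longrightarrow>
     (\<forall>p. (\<forall>i\<in>{a, Suc a, Suc (Suc a)}. annih n (m + 3) (y i) p) \<longrightarrow> (\<exists>e b. e \<noteq> 0 \<and> (\<forall>j<m + 3. e * p j = b * S j))) \<longrightarrow>
     hgt (m + 3) S \<le> C * (H (Suc (Suc a)) * M (Suc a) * M a * M c ^ (m - 1))"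
proof -
  obtain \<rho> where \<rho>: "0 < \<rho>" "\<And>i j. i \<le> n \<Longrightarrow> j \<le> n \<Longrightarrow> \<rho> \<le> \<bar>\<xi> ^ i\<bar> \<and> \<rho> \<le> \<bar>\<xi> ^ i + \<xi> ^ j\<bar>" using rho_ex by blast
  obtain C where C: "1 \<le> C" "det_bound n \<xi> \<rho> C" using det_bound_ex[OF \<rho>(1)] by blast
  obtain D where D: "1 \<le> D" and RU: "\<forall>N k h. N \<le> n + 1 \<longrightarrow> row_ok N \<xi> (H (Suc k) / M k) (unit_row h) D"
    using row_const_ex by (elim exE conjE)
  obtain K where K: "K > 0" and GM: "height_det_bound (m + 2) 1 K" using height_power_le_det by blast
  define CC where "CC = max 1 (K * (C * D))"
  have "hgt (m + 3) S \<le> CC * (H (Suc (Suc a)) * M (Suc a) * M a * M c ^ (m - 1))"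
    if sp: "in_span3 a c" and S: "primitive S" "supp_below (m + 3) S" "\<forall>i\<in>{a, Suc a, Suc (Suc a), c}. annih n (m + 3) (y i) S"
      and uniq: "\<forall>p. (\<forall>i\<in>{a, Suc a, Suc (Suc a)}. annih n (m + 3) (y i) p) \<longrightarrow> (\<exists>e b. e \<noteq> 0 \<and> (\<forall>j<m + 3. e * p j = b * S j))"
    for a c S
  proof -
    have N: "m + 3 \<le> n + 1" using n m by simp
    have e3: "m + 2 + 1 = m + 3" "Suc (m + 2) = m + 3" by auto
    obtain u1 u2 u3 d g1 g2 g3 where us: "{u1, u2, u3} = {y a, y (Suc a), y (Suc (Suc a))}"
      and ui: "\<forall>b1 b2 b3. (\<forall>j. b1 * u1 j + b2 * u2 j + b3 * u3 j = 0) \<longrightarrow> b1 = 0 \<and> b2 = 0 \<and> b3 = 0"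
      and dg: "d \<noteq> 0" "g3 \<noteq> 0" and g: "\<forall>j. d * y c j = g1 * u1 j + g2 * u2 j + g3 * u3 j"
      using in_span3_exchange[OF sp] by (elim exE conjE)
    have u_in: "u1 \<in> {y a, y (Suc a), y (Suc (Suc a))}" "u2 \<in> {y a, y (Suc a), y (Suc (Suc a))}" using us by blast+
    have su: "supp_below (n + 1) u1" "supp_below (n + 1) u2" using u_in supp_y by auto
    have Su: "annih n (m + 3) u1 S" "annih n (m + 3) u2 S" using u_in S(3) by auto
    have ind: "b0 = 0 \<and> b1 = 0 \<and> b2 = 0" if "\<And>j. b0 * y c j + b1 * u1 j + b2 * u2 j = 0" for b0 b1 b2
    proof -
      have "(b0 * g1 + d * b1) * u1 j + (b0 * g2 + d * b2) * u2 j + (b0 * g3) * u3 j = 0" for j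
      proof -
        have "d * (b0 * y c j + b1 * u1 j + b2 * u2 j) = b0 * (d * y c j) + d * b1 * u1 j + d * b2 * u2 j" by (simp add: algebra_simps)
        also have "\<dots> = (b0 * g1 + d * b1) * u1 j + (b0 * g2 + d * b2) * u2 j + (b0 * g3) * u3 j"
          using g by (simp add: algebra_simps)
        finally show ?thesis using that[of j] by simp
      qed
      then have "b0 * g1 + d * b1 = 0 \<and> b0 * g2 + d * b2 = 0 \<and> b0 * g3 = 0" using ui by blast
      then show ?thesis using dg by auto
    qed
    have all3: "\<forall>i\<in>{a, Suc a, Suc (Suc a)}. annih n (m + 3) (y i) p"
      if p: "annih n (m + 3) (y c) p" "annih n (m + 3) u1 p" "annih n (m + 3) u2 p" for p
    proof -
      have "annih n (m + 3) (\<lambda>j. (- g1) * u1 j + (- g2) * u2 j) p" by (rule annih_point_lincomb[OF p(2,3)])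
      from annih_point_lincomb[OF p(1) this, of d 1]
      have "annih n (m + 3) (\<lambda>j. g3 * u3 j) p" using g by (simp add: algebra_simps)
      then have "annih n (m + 3) u3 p" using annih_point_scale_cancel[OF dg(2)] by blast
      then have "\<forall>u\<in>{u1, u2, u3}. annih n (m + 3) u p" using p by simp
      then show ?thesis unfolding us by simp
    qed
    have nzS: "nonzero_below (m + 3) S" by (rule primitive_nonzero[OF S(1,2)])
    have "\<exists>i<m. \<exists>j<m. \<exists>r \<in> {unit_row i, (\<lambda>k. unit_row i k + unit_row j k)}. (i \<noteq> j \<or> r = unit_row i) \<and>
      (\<forall>p. annih n (m + 3) (y c) p \<longrightarrow> dotp (m + 3) (comb_shift m r u1) p = 0 \<longrightarrow> dotp (m + 3) (comb_shift m r u2) p = 0 \<longrightarrow>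
       (\<exists>a b. a \<noteq> 0 \<and> (\<forall>j<m + 3. a * p j = b * S j)))"
      by (rule exists_generic_shift[OF n m fr su ind nzS _ Su]) (use S(3) all3 uniq in auto)
    then obtain i0 j0 r where ij: "i0 < m" "j0 < m" and r: "r \<in> {unit_row i0, (\<lambda>k. unit_row i0 k + unit_row j0 k)}" "i0 \<noteq> j0 \<or> r = unit_row i0"
      and gen: "\<forall>p. annih n (m + 3) (y c) p \<longrightarrow> dotp (m + 3) (comb_shift m r u1) p = 0 \<longrightarrow> dotp (m + 3) (comb_shift m r u2) p = 0 \<longrightarrow>
       (\<exists>a b. a \<noteq> 0 \<and> (\<forall>j<m + 3. a * p j = b * S j))" by blast
    \<comment> \<open>The block \<open>i0\<close> of \<open>y c\<close> is omitted: it is recovered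
      from the action of \<open>r\<close> on \<open>y c\<close> and, if \<open>r\<close> is a sum of
      two shifts, from the block \<open>j0\<close>.\<close>
    define ks where "ks = filter (\<lambda>l. l \<noteq> i0) [0..<m]"
    have lks: "length ks = m - 1" unfolding ks_def by (rule length_filter_neq[OF ij(1)])
    define vs where "vs = [y a, y (Suc a), yp (Suc a)]"
    define rs where "rs = map (comb_shift m r) vs @ map (\<lambda>k. shift k (y c)) ks"
    have lrs: "length rs = m + 2" using lks m by (simp add: rs_def vs_def)
    obtain pa pb pc where pl: "pa \<noteq> 0" "pc \<noteq> 0" "\<forall>j. pa * y (Suc (Suc a)) j = pb * y (Suc a) j + pc * yp (Suc a) j" using plane' by blast
    have cs0: "dotp (m + 3) (comb_shift m r x) p = 0" if "annih n (m + 3) x p" for x p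
      unfolding dotp_comb_shift using that n by (auto simp: annih_def intro!: sum.neutral)
    have krs: "\<exists>e b. e \<noteq> 0 \<and> (\<forall>j<m + 3. e * p j = b * S j)" if p: "killed (m + 3) (set rs) p" for p
    proof -
      have k1: "dotp (m + 3) (comb_shift m r (y a)) p = 0" "dotp (m + 3) (comb_shift m r (y (Suc a))) p = 0"
        "dotp (m + 3) (comb_shift m r (yp (Suc a))) p = 0"
        using p by (simp_all add: killed_def rs_def vs_def)
      have "comb_shift m r (\<lambda>j. pa * y (Suc (Suc a)) j) = (\<lambda>j. pb * comb_shift m r (y (Suc a)) j + pc * comb_shift m r (yp (Suc a)) j)"
        using pl(3) by (auto simp: comb_shift_def sum_distrib_left sum.distrib algebra_simps)
      moreover have "comb_shift m r (\<lambda>j. pa * y (Suc (Suc a)) j) = (\<lambda>j. pa * comb_shift m r (y (Suc (Suc a))) j)"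
        by (auto simp: comb_shift_def sum_distrib_left mult_ac)
      ultimately have "pa * dotp (m + 3) (comb_shift m r (y (Suc (Suc a)))) p = pb * dotp (m + 3) (comb_shift m r (y (Suc a))) p + pc * dotp (m + 3) (comb_shift m r (yp (Suc a))) p"
        by (metis dotp_lincomb_left dotp_scale_left)
      then have k2: "dotp (m + 3) (comb_shift m r (y (Suc (Suc a)))) p = 0" using k1 pl(1) by simp
      have k3: "dotp (m + 3) (comb_shift m r (y i)) p = 0" if "i \<in> {a, Suc a, Suc (Suc a)}" for i using that k1 k2 by auto
      have kc: "dotp (m + 3) (comb_shift m r (y c)) p = 0" by (rule in_span3_dotp[OF sp k3])
      have sh: "dotp (m + 3) (shift l (y c)) p = 0" if "l < m" "l \<noteq> i0" for l
        using p that by (auto simp: killed_def rs_def ks_def)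
      have "dotp (m + 3) (shift i0 (y c)) p = 0"
      proof (cases "r = unit_row i0")
        case True
        then show ?thesis using kc comb_shift_unit_row[OF ij(1)] by simp
      next
        case False
        then have r': "r = (\<lambda>k. unit_row i0 k + unit_row j0 k)" "i0 \<noteq> j0" using r by auto
        have "comb_shift m r (y c) = (\<lambda>j. 1 * comb_shift m (unit_row i0) (y c) j + 1 * comb_shift m (unit_row j0) (y c) j)"
          by (simp add: r'(1) comb_shift_def distrib_right sum.distrib)
        then have "dotp (m + 3) (comb_shift m r (y c)) p = 1 * dotp (m + 3) (shift i0 (y c)) p + 1 * dotp (m + 3) (shift j0 (y c)) p"
          unfolding comb_shift_unit_row[OF ij(1)] comb_shift_unit_row[OF ij(2)] using dotp_lincomb_left by metis
        then show ?thesis using kc sh[OF ij(2)] r'(2) by simp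
      qed
      then have "dotp (m + 3) (shift l (y c)) p = 0" if "l < m" for l using sh that by (cases "l = i0") auto
      then have "annih n (m + 3) (y c) p" unfolding annih_def using n by simp
      moreover have "dotp (m + 3) (comb_shift m r u1) p = 0" "dotp (m + 3) (comb_shift m r u2) p = 0" using u_in k3 by auto
      ultimately show ?thesis using gen by blast
    qed
    have "annih n (m + 3) (yp (Suc a)) S" by (rule annih_yp) (use S(3) in auto)
    then have kS: "killed (m + 3) (set rs) S"
      using S(3) cs0 n unfolding killed_def rs_def vs_def ks_def by (auto simp: annih_def)
    have "\<exists>h\<le>m + 2. hgt (Suc (m + 2)) S ^ 1 \<le> K * \<bar>real_of_int (det (rows_mat (m + 2 + 1) (rs @ unit_rows h 1)))\<bar>"
    proof (rule GM[unfolded height_det_bound_def, rule_format, OF S(1)])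
      show "supp_below (Suc (m + 2)) S" using S(2) unfolding e3 .
      show "length rs = m + 2" by (rule lrs)
      show "killed (m + 2 + 1) (set rs) (tmult i S)" if "i < 1" for i using that kS unfolding e3 by simp
      show "\<exists>a c. a \<noteq> 0 \<and> (\<forall>j<m + 2 + 1. a * x j = (\<Sum>i<1. c i * tmult i S j))" if x: "killed (m + 2 + 1) (set rs) x" for x
      proof -
        obtain e b where ab: "e \<noteq> 0" "\<forall>j<m + 3. e * x j = b * S j" using krs x unfolding e3 by blast
        show ?thesis by (rule exI[of _ e], rule exI[of _ "\<lambda>_. b"]) (use ab in simp)
      qed
    qed
    then obtain h where h: "hgt (m + 3) S \<le> K * \<bar>real_of_int (det (rows_mat (m + 3) (rs @ [unit_row h])))\<bar>"
      unfolding e3 by (auto simp: unit_rows_def)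
    define Q where "Q = H (Suc (Suc a)) / M (Suc a)"
    have QM: "Q * M (Suc a) = H (Suc (Suc a))" using M_pos[of "Suc a"] by (simp add: Q_def)
    have Q1: "1 \<le> Q" unfolding Q_def by (rule Q_ge_1)
    define ev where "ev = (\<lambda>i::nat. if i = 0 then M a else M (Suc a))"
    obtain d' f1 f2 f3 where d': "d' \<noteq> 0" and f: "\<And>j. d' * y c j = f1 * y a j + f2 * y (Suc a) j + f3 * y (Suc (Suc a)) j"
      using sp unfolding in_span3_def by blast
    \<comment> \<open>Coefficients of \<open>y c\<close> in the list \<open>vs\<close>, after
      \<open>y (Suc (Suc a))\<close> has been expressed by \<open>y (Suc a)\<close> and
      \<open>yp (Suc a)\<close>.\<close>
    define cc where "cc = (\<lambda>i::nat. if i = 0 then real_of_int f1 / real_of_int d'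
       else if i = 1 then (real_of_int f2 + real_of_int f3 * real_of_int pb / real_of_int pa) / real_of_int d'
       else real_of_int f3 * real_of_int pc / real_of_int pa / real_of_int d')"
    have "\<bar>real_of_int (det (rows_mat (m + 3) (map (comb_shift m r) vs @ map (\<lambda>k. shift k (y c)) ks @ [unit_row h])))\<bar>
       \<le> C * Q * (\<Prod>i<length vs. ev i) * M c ^ length ks * (\<Prod>i<length [unit_row h]. D)"
    proof (rule det_boundD[OF C(2), where c = cc])
      show "1 \<le> m + 3" "m + 3 \<le> n + 1" using N by auto
      show "m + (m + 3) \<le> n + 2" using n by simp
      show "\<bar>r k\<bar> \<le> 1" for k
      proof (cases "r = unit_row i0")
        case False
        then show ?thesis using r by (auto simp: unit_row_def)
      qed (simp add: unit_row_def)
      have un: "(\<Sum>k<m. real_of_int (unit_row i k) * \<xi> ^ k) = \<xi> ^ i" if "i < m" for i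
      proof -
        have "(\<Sum>k<m. real_of_int (unit_row i k) * \<xi> ^ k) = (\<Sum>k<m. if k = i then \<xi> ^ k else 0)"
          by (intro sum.cong) (auto simp: unit_row_def)
        then show ?thesis using that by simp
      qed
      have "i0 \<le> n" "j0 \<le> n" using ij n by auto
      show "\<rho> \<le> \<bar>\<Sum>k<m. real_of_int (r k) * \<xi> ^ k\<bar>"
        using r(1) un[OF ij(1)] un[OF ij(2)] \<rho>(2)[OF \<open>i0 \<le> n\<close> \<open>j0 \<le> n\<close>] by (auto simp: distrib_right sum.distrib)
      show "1 \<le> Q" by (rule Q1)
      show "\<bar>real_of_int ((vs ! i) 0)\<bar> \<le> Q * ev i \<and> near_curve n \<xi> (vs ! i) (ev i)" if i: "i < length vs" for i
      proof -
        have "\<bar>real_of_int (y a 0)\<bar> \<le> H (Suc a)" using y_le[of a] y_pos[of a] by simp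
        also have "\<dots> \<le> H (Suc (Suc a))" by (rule H_mono)
        also have "\<dots> \<le> Q * M a" using mult_left_mono[OF M_mono[of a], of Q] Q1 QM by simp
        finally have "\<bar>real_of_int (y a 0)\<bar> \<le> Q * M a" .
        moreover have "\<bar>real_of_int (y (Suc a) 0)\<bar> \<le> Q * M (Suc a)" using y_le[of "Suc a"] y_pos[of "Suc a"] unfolding QM by simp
        moreover have "\<bar>real_of_int (yp (Suc a) 0)\<bar> \<le> Q * M (Suc a)" using yp_le[of "Suc a"] unfolding QM .
        moreover have "i = 0 \<or> i = 1 \<or> i = 2" using i by (auto simp: vs_def)
        ultimately show ?thesis using near near_p by (auto simp: vs_def ev_def)
      qed
      show "real_of_int (y c l) = (\<Sum>i<length vs. cc i * real_of_int ((vs ! i) l))" for l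
      proof -
        have "real_of_int (d' * y c l) = real_of_int (f1 * y a l + f2 * y (Suc a) l + f3 * y (Suc (Suc a)) l)" using f by presburger
        then have 1: "real_of_int (y c l) = (f1 * y a l + f2 * y (Suc a) l + f3 * real_of_int (y (Suc (Suc a)) l)) / d'"
          using d' by (simp add: field_simps)
        have "real_of_int (pa * y (Suc (Suc a)) l) = real_of_int (pb * y (Suc a) l + pc * yp (Suc a) l)" using pl(3) by presburger
        then have 2: "real_of_int (y (Suc (Suc a)) l) = (pb * y (Suc a) l + pc * yp (Suc a) l) / pa"
          using pl(1) by (simp add: field_simps)
        have "real_of_int (y c l) = f1 / d' * y a l + (f2 + f3 * pb / pa) / d' * y (Suc a) l + f3 * pc / pa / d' * yp (Suc a) l"
          unfolding 1 2 by (simp add: divide_inverse algebra_simps)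
        then show ?thesis by (simp add: vs_def cc_def numeral_3_eq_3)
      qed
      show "near_curve n \<xi> (y c) (M c)" by (rule near)
      show "l + (m + 3) \<le> n + 1" if "l \<in> set ks" for l using that n by (simp add: ks_def)
      show "row_ok (m + 3) \<xi> Q ([unit_row h] ! i) D" if "i < length [unit_row h]" for i
        using that RU N unfolding Q_def by simp
      show "length vs + length ks + length [unit_row h] = m + 3" using lks m by (simp add: vs_def)
    qed
    also have "\<dots> = C * ((Q * M (Suc a)) * M (Suc a) * M a * M c ^ (m - 1)) * D"
      unfolding lks by (simp add: vs_def ev_def numeral_3_eq_3 mult_ac)
    finally have "\<bar>real_of_int (det (rows_mat (m + 3) (rs @ [unit_row h])))\<bar> \<le> (C * D) * (H (Suc (Suc a)) * M (Suc a) * M a * M c ^ (m - 1))"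
      unfolding QM by (simp add: rs_def mult_ac)
    then have "K * \<bar>real_of_int (det (rows_mat (m + 3) (rs @ [unit_row h])))\<bar> \<le> K * ((C * D) * (H (Suc (Suc a)) * M (Suc a) * M a * M c ^ (m - 1)))"
      using K by (intro mult_left_mono) auto
    also have "\<dots> = (K * (C * D)) * (H (Suc (Suc a)) * M (Suc a) * M a * M c ^ (m - 1))" by simp
    also have "\<dots> \<le> CC * (H (Suc (Suc a)) * M (Suc a) * M a * M c ^ (m - 1))"
    proof (rule mult_right_mono)
      have "0 \<le> H (Suc (Suc a))" "0 \<le> M (Suc a)" "0 \<le> M a" "0 \<le> M c"
        using H_ge_1[of "Suc (Suc a)"] M_pos[of "Suc a"] M_pos[of a] M_pos[of c] by auto
      then show "0 \<le> H (Suc (Suc a)) * M (Suc a) * M a * M c ^ (m - 1)" by simp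
    qed (simp add: CC_def)
    finally show ?thesis using h by linarith
  qed
  then show ?thesis by (intro exI[of _ CC] conjI allI impI) (auto simp: CC_def)
qed

text \<open>With \<open>m + 4\<close> coefficients and \<open>q = 2\<close>: the \<open>m\<close>
  rows tied to \<open>y c\<close> and \<open>y (Suc c)\<close> leave S, TS, G, TG, and two rows of
  the three initial points remove G and TG by \<open>annih_four_points\<close>. The four independent
  points required there exist because \<open>y (Suc c)\<close> lies outside the span. One of the two
  rows can be taken from \<open>y (Suc a)\<close> or \<open>y (Suc (Suc a))\<close>, which improves
  a factor \<open>M a\<close> to \<open>M (Suc a)\<close>.\<close>

lemma spread_annih_height:
  "\<exists>C\<ge>1. \<forall>a c S G P. Suc (Suc a) \<le> c \<longrightarrow> in_span3 a c \<longrightarrow> \<not> in_span3 a (Suc c) \<longrightarrow>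
     primitive S \<longrightarrow> supp_below (m + 3) S \<longrightarrow> (\<forall>i\<in>{a, Suc a, Suc (Suc a), c, Suc c}. annih n (m + 3) (y i) S) \<longrightarrow>
     supp_below (m + 3) G \<longrightarrow> annih n (m + 3) (y c) G \<longrightarrow> annih n (m + 3) (y (Suc c)) G \<longrightarrow> lin_indep (m + 3) [S, G] \<longrightarrow>
     supp_below (m + 2) P \<longrightarrow> annih n (m + 2) (y (Suc c)) P \<longrightarrow> \<not> annih n (m + 2) (y c) P \<longrightarrow>
     hgt (m + 3) S ^ 2 \<le> C * (H (Suc c) * M c * M (Suc c) ^ (m - 2) * M (Suc a) * M a)"
proof -
  have N4: "m + 4 = (m + 2) + 2" "m + 2 \<le> m + 4" "m + 4 \<le> m + 4" by auto
  obtain C where C: "1 \<le> C" and PH: "pair_height_bound (m + 4) (m + 2) 2 C" using pair_height[OF N4] by blast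
  obtain D where D: "1 \<le> D" and RO: "\<forall>N k l i i0. l + N \<le> n + 1 \<longrightarrow> 1 \<le> N \<longrightarrow> i \<le> k \<longrightarrow> i0 \<le> i \<longrightarrow>
      row_ok N \<xi> (H (Suc k) / M k) (shift l (y i)) (D * M i0)"
    using row_const_ex by (elim exE conjE)
  have "hgt (m + 3) S ^ 2 \<le> (C * D ^ 2) * (H (Suc c) * M c * M (Suc c) ^ (m - 2) * M (Suc a) * M a)"
    if ac: "Suc (Suc a) \<le> c" and sp: "in_span3 a c" and nsp: "\<not> in_span3 a (Suc c)"
      and S: "primitive S" "supp_below (m + 3) S" "\<forall>i\<in>{a, Suc a, Suc (Suc a), c, Suc c}. annih n (m + 3) (y i) S"
      and G: "supp_below (m + 3) G" "annih n (m + 3) (y c) G" "annih n (m + 3) (y (Suc c)) G" and SG: "lin_indep (m + 3) [S, G]"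
      and P: "supp_below (m + 2) P" "annih n (m + 2) (y (Suc c)) P" "\<not> annih n (m + 2) (y c) P" for a c S G P
  proof -
    have N: "m + 4 \<le> n + 1" using n m by simp
    have e: "m + 4 = Suc (m + 3)" by simp
    obtain k0 where k0: "k0 < n + 2 - (m + 4)" "lin_indep (m + 4) (shift_rows n (m + 4) (y (Suc c)) @ [shift k0 (y c)])"
      using exists_indep_shift[of "m + 4" c] by blast
    define bl where "bl = shift_rows n (m + 4) (y (Suc c)) @ [shift k0 (y c)]"
    have lbl: "length bl = m" using n m by (simp add: bl_def)
    have ibl: "lin_indep (m + 4) bl" using k0(2) by (simp add: bl_def)
    have kbl: "killed (m + 4) (set bl) p" if p: "annih n (m + 4) (y (Suc c)) p" "annih n (m + 4) (y c) p" for p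
    proof -
      have "killed (m + 4) (set (shift_rows n (m + 4) (y (Suc c)))) p" using p(1) killed_shift_rows[OF N] by simp
      moreover have "dotp (m + 4) (shift k0 (y c)) p = 0" using p(2) k0(1) unfolding annih_def by (simp add: less_diff_conv)
      ultimately show ?thesis by (auto simp: bl_def killed_def)
    qed
    obtain u1 u2 u3 d g1 g2 g3 where us: "{u1, u2, u3} = {y a, y (Suc a), y (Suc (Suc a))}"
      and ui: "\<forall>b1 b2 b3. (\<forall>j. b1 * u1 j + b2 * u2 j + b3 * u3 j = 0) \<longrightarrow> b1 = 0 \<and> b2 = 0 \<and> b3 = 0"
      and dg: "d \<noteq> 0" "g3 \<noteq> 0" and g: "\<forall>j. d * y c j = g1 * u1 j + g2 * u2 j + g3 * u3 j"
      using in_span3_exchange[OF sp] by (elim exE conjE)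
    have u_in: "u1 \<in> {y a, y (Suc a), y (Suc (Suc a))}" "u2 \<in> {y a, y (Suc a), y (Suc (Suc a))}" "u3 \<in> {y a, y (Suc a), y (Suc (Suc a))}"
      unfolding us[symmetric] by simp_all
    have su: "supp_below (n + 1) u1" "supp_below (n + 1) u2" using u_in supp_y by auto
    have span_u: "in_span3 a k" if "b \<noteq> 0" "\<And>j. b * y k j = b1 * u1 j + b2 * u2 j + b3 * u3 j" for k b b1 b2 b3
    proof -
      have co: "\<exists>c1 c2 c3. \<forall>j. v j = c1 * y a j + c2 * y (Suc a) j + c3 * y (Suc (Suc a)) j" if "v \<in> {y a, y (Suc a), y (Suc (Suc a))}" for v
      proof -
        from that have "v = y a \<or> v = y (Suc a) \<or> v = y (Suc (Suc a))" by simp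
        then show ?thesis
        proof (elim disjE)
          assume v: "v = y a" show ?thesis by (rule exI[of _ 1], rule exI[of _ 0], rule exI[of _ 0]) (simp add: v)
        next
          assume v: "v = y (Suc a)" show ?thesis by (rule exI[of _ 0], rule exI[of _ 1], rule exI[of _ 0]) (simp add: v)
        next
          assume v: "v = y (Suc (Suc a))" show ?thesis by (rule exI[of _ 0], rule exI[of _ 0], rule exI[of _ 1]) (simp add: v)
        qed
      qed
      obtain a1 a2 a3 where A: "\<forall>j. u1 j = a1 * y a j + a2 * y (Suc a) j + a3 * y (Suc (Suc a)) j" using co[OF u_in(1)] by (elim exE)
      obtain f1 f2 f3 where F: "\<forall>j. u2 j = f1 * y a j + f2 * y (Suc a) j + f3 * y (Suc (Suc a)) j" using co[OF u_in(2)] by (elim exE)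
      obtain h1 h2 h3 where Hh: "\<forall>j. u3 j = h1 * y a j + h2 * y (Suc a) j + h3 * y (Suc (Suc a)) j" using co[OF u_in(3)] by (elim exE)
      have "b * y k j = (b1 * a1 + b2 * f1 + b3 * h1) * y a j + (b1 * a2 + b2 * f2 + b3 * h2) * y (Suc a) j
          + (b1 * a3 + b2 * f3 + b3 * h3) * y (Suc (Suc a)) j" for j
        using that(2)[of j] A F Hh by (simp add: algebra_simps)
      then have e: "\<forall>j. b * y k j = (b1 * a1 + b2 * f1 + b3 * h1) * y a j + (b1 * a2 + b2 * f2 + b3 * h2) * y (Suc a) j
          + (b1 * a3 + b2 * f3 + b3 * h3) * y (Suc (Suc a)) j" by blast
      show ?thesis unfolding in_span3_def
        by (rule exI[of _ b], rule exI[of _ "b1 * a1 + b2 * f1 + b3 * h1"], rule exI[of _ "b1 * a2 + b2 * f2 + b3 * h2"],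
            rule exI[of _ "b1 * a3 + b2 * f3 + b3 * h3"], rule conjI[OF that(1) e])
    qed
    have ind4: "b0 = 0 \<and> b = 0 \<and> b1 = 0 \<and> b2 = 0" if b: "\<And>j. b0 * y (Suc c) j + b * y c j + b1 * u1 j + b2 * u2 j = 0" for b0 b b1 b2
    proof -
      have eq: "d * b0 * y (Suc c) j = (- (b * g1 + d * b1)) * u1 j + (- (b * g2 + d * b2)) * u2 j + (- (b * g3)) * u3 j" for j
      proof -
        have "d * b0 * y (Suc c) j = d * (b0 * y (Suc c) j + b * y c j + b1 * u1 j + b2 * u2 j) - b * (d * y c j) - d * b1 * u1 j - d * b2 * u2 j"
          by (simp add: algebra_simps)
        then show ?thesis unfolding b g[rule_format] by (simp add: algebra_simps)
      qed
      have b0: "b0 = 0"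
      proof (rule ccontr)
        assume "b0 \<noteq> 0"
        then have "d * b0 \<noteq> 0" using dg(1) by simp
        from span_u[OF this eq] show False using nsp by blast
      qed
      then have "\<forall>j. (- (b * g1 + d * b1)) * u1 j + (- (b * g2 + d * b2)) * u2 j + (- (b * g3)) * u3 j = 0" using eq by simp
      then have "- (b * g1 + d * b1) = 0 \<and> - (b * g2 + d * b2) = 0 \<and> - (b * g3) = 0" using ui by blast
      then show ?thesis using dg b0 by auto
    qed
    have S4: "annih n (m + 3) x S" if "x \<in> {y (Suc c), y c, u1, u2}" for x using that S(3) u_in by auto
    have ind4': "\<forall>b0 b b1 b2. (\<forall>j. b0 * y (Suc c) j + b * y c j + b1 * u1 j + b2 * u2 j = 0) \<longrightarrow> b0 = 0 \<and> b = 0 \<and> b1 = 0 \<and> b2 = 0"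
      using ind4 by blast
    note four = annih_four_points[OF n m fr fr su ind4'[rule_format] P S(2) S4 G(1,3,2) SG ibl lbl kbl]
    have lift: "annih n (m + 4) x q" "annih n (m + 4) x (tmult (Suc 0) q)"
      if "supp_below (m + 3) q" "annih n (m + 3) x q" for x q
      unfolding e using annih_Suc[OF that] annih_Suc_tmult[OF that(2)] by auto
    \<comment> \<open>Otherwise \<open>G\<close> would annihilate \<open>y (Suc a)\<close> and
      \<open>y (Suc (Suc a))\<close>, and both would lie in the plane of \<open>y c\<close> and
      \<open>y (Suc c)\<close>. Being independent, they would span it, and \<open>y (Suc c)\<close>
      would lie in the span of the three initial points.\<close>
    have "\<exists>i l p. i \<in> {Suc a, Suc (Suc a)} \<and> l + (m + 4) \<le> n + 1 \<and> killed (m + 4) (set bl) p \<and> dotp (m + 4) (shift l (y i)) p \<noteq> 0"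
    proof (rule ccontr)
      assume no: "\<not> ?thesis"
      have ak: "annih n (m + 4) (y i) p" if "i \<in> {Suc a, Suc (Suc a)}" "killed (m + 4) (set bl) p" for i p
        using no that unfolding annih_def by blast
      have kG: "killed (m + 4) (set bl) G" "killed (m + 4) (set bl) (tmult (Suc 0) G)"
        using kbl lift[OF G(1,2)] lift[OF G(1,3)] by blast+
      have GG: "annih n (m + 3) (y i) G" if "i \<in> {Suc a, Suc (Suc a)}" for i
        by (rule annih_of_Suc[OF G(1) _ ak[OF that kG(1), unfolded e] ak[OF that kG(2), unfolded e]]) (use N in simp)
      have pl: "\<exists>a' b c'. a' \<noteq> 0 \<and> (\<forall>j. a' * y i j = b * y (Suc c) j + c' * y c j)" if i: "i \<in> {Suc a, Suc (Suc a)}" for i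
        by (rule annih_pencil_plane[OF n m fr supp_y supp_y P SG]) (use S(3) G GG i in auto)
      obtain a1 b1 c1 where 1: "a1 \<noteq> 0" "\<And>j. a1 * y (Suc a) j = b1 * y (Suc c) j + c1 * y c j" using pl[OF insertI1] by (elim exE conjE) blast
      obtain a2 b2 c2 where 2: "a2 \<noteq> 0" "\<And>j. a2 * y (Suc (Suc a)) j = b2 * y (Suc c) j + c2 * y c j" using pl[OF insertI2[OF singletonI]] by (elim exE conjE) blast
      define \<delta> where "\<delta> = c2 * b1 - c1 * b2"
      have eq: "\<delta> * y (Suc c) j = 0 * y a j + (c2 * a1) * y (Suc a) j + (- (c1 * a2)) * y (Suc (Suc a)) j" for j
      proof -
        have "c2 * (a1 * y (Suc a) j) - c1 * (a2 * y (Suc (Suc a)) j) = \<delta> * y (Suc c) j"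
          unfolding 1 2 \<delta>_def by (simp add: algebra_simps)
        then show ?thesis by (simp add: algebra_simps)
      qed
      have "\<delta> = 0" using nsp eq unfolding in_span3_def by blast
      then have "0 * y a j + (c2 * a1) * y (Suc a) j + (- (c1 * a2)) * y (Suc (Suc a)) j = 0" for j using eq[of j] by simp
      then have "c2 = 0" "c1 = 0" using indep3[of 0 a "c2 * a1" "- (c1 * a2)"] 1(1) 2(1) by auto
      then have "0 * y a j + (b2 * a1) * y (Suc a) j + (- (b1 * a2)) * y (Suc (Suc a)) j = 0" for j
      proof -
        have "b2 * (a1 * y (Suc a) j) - b1 * (a2 * y (Suc (Suc a)) j) = 0"
          unfolding 1 2 using \<open>c1 = 0\<close> \<open>c2 = 0\<close> by simp
        then show ?thesis by (simp add: algebra_simps)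
      qed
      then have "b1 = 0" using indep3[of 0 a "b2 * a1" "- (b1 * a2)"] 1(1) 2(1) by auto
      then show False using 1(1) 1(2)[of 0] \<open>c1 = 0\<close> y_pos[of "Suc a"] by simp
    qed
    then obtain i1 l1 p1 where t1: "i1 \<in> {Suc a, Suc (Suc a)}" "l1 + (m + 4) \<le> n + 1" "killed (m + 4) (set bl) p1" "dotp (m + 4) (shift l1 (y i1)) p1 \<noteq> 0"
      by blast
    define t where "t = shift l1 (y i1)"
    have ibt: "lin_indep (m + 4) (bl @ [t])" unfolding t_def by (rule lin_indep_snoc[OF ibl t1(3,4)])
    define I where "I = {a, Suc a, Suc (Suc a)}"
    obtain ts where ts: "set ts \<subseteq> row_set (m + 4) I" "lin_indep (m + 4) ((bl @ [t]) @ ts)"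
      "\<forall>p. killed (m + 4) (set ((bl @ [t]) @ ts)) p \<longrightarrow> killed (m + 4) (row_set (m + 4) I) p"
      using lin_indep_extend[OF ibt, of "row_set (m + 4) I"] by blast
    have span: "\<exists>a c0 c1. a \<noteq> 0 \<and> (\<forall>j<m + 4. a * p j = c0 * S j + c1 * tmult (Suc 0) S j)" if p: "killed (m + 4) (set ((bl @ [t]) @ ts)) p" for p
    proof -
      have "\<forall>i\<in>I. annih n (m + 4) (y i) p" using ts(3) p killed_row_set by blast
      then have u: "annih n (m + 4) u1 p" "annih n (m + 4) u2 p" using u_in by (auto simp: I_def)
      have k: "killed (m + 4) (set bl) p" using p by (simp add: killed_def)
      show ?thesis by (rule four(1)[OF _ _ _ _ u k]) assumption+
    qed
    have kS: "killed (m + 4) (set ((bl @ [t]) @ ts)) q" if q: "q = S \<or> q = tmult (Suc 0) S" for q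
    proof -
      have an: "annih n (m + 4) (y i) q" if "i \<in> {a, Suc a, Suc (Suc a), c, Suc c}" for i
        using lift[OF S(2), of "y i"] S(3) that q by blast
      have "killed (m + 4) (set bl) q" by (rule kbl) (use an in auto)
      moreover have "dotp (m + 4) t q = 0" using an[of i1] t1(1,2) by (auto simp: t_def annih_def)
      moreover have "killed (m + 4) (set ts) q"
      proof (rule killed_mono[OF ts(1)])
        show "killed (m + 4) (row_set (m + 4) I) q" unfolding killed_row_set using an by (auto simp: I_def)
      qed
      ultimately show ?thesis by (auto simp: killed_def)
    qed
    have nzS: "nonzero_below (m + 3) S" by (rule primitive_nonzero[OF S(1,2)])
    have "length ((bl @ [t]) @ ts) + length [S, tmult (Suc 0) S] = m + 4"
    proof (rule killed_span_length[OF ts(2)])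
      show "lin_indep (m + 4) [S, tmult (Suc 0) S]" unfolding e by (rule lin_indep_tmult[OF S(2) nzS])
      show "killed (m + 4) (set ((bl @ [t]) @ ts)) g" if "g \<in> set [S, tmult (Suc 0) S]" for g using kS that by simp
      show "\<exists>a c. a \<noteq> 0 \<and> (\<forall>j<m + 4. a * p j = (\<Sum>i<length [S, tmult (Suc 0) S]. c i * ([S, tmult (Suc 0) S] ! i) j))"
        if p: "killed (m + 4) (set ((bl @ [t]) @ ts)) p" for p
      proof -
        obtain a c0 c1 where acc: "a \<noteq> 0" "\<forall>j<m + 4. a * p j = c0 * S j + c1 * tmult (Suc 0) S j" using span[OF p] by (elim exE conjE)
        show ?thesis by (rule exI[of _ a], rule exI[of _ "\<lambda>i. if i = 0 then c0 else c1"]) (use acc in \<open>simp add: numeral_2_eq_2\<close>)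
      qed
    qed
    then have "length ts = 1" using lbl by simp
    then obtain t' where t': "ts = [t']" by (metis One_nat_def length_0_conv length_Suc_conv)
    have bl_of: "killed (m + 4) (set ((bl @ [t]) @ ts)) p" if p: "killed (m + 4) (set (pair_list c (m + 4) k0 @ [t, t'])) p" for p
    proof -
      have "killed (m + 4) (set (pair_list c (m + 4) k0)) p" "dotp (m + 4) t p = 0" "dotp (m + 4) t' p = 0" using p by (auto simp: killed_def)
      moreover from this have "annih n (m + 4) (y (Suc c)) p" "dotp (m + 4) (shift k0 (y c)) p = 0"
        using pair_list_killedD[OF _ N k0(1)] by blast+
      moreover from this have "killed (m + 4) (set (shift_rows n (m + 4) (y (Suc c)))) p" using killed_shift_rows[OF N] by simp
      ultimately show ?thesis by (auto simp: bl_def t' killed_def)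
    qed
    have "hgt (Suc (m + 2)) S ^ 2 \<le> C * (H (Suc c) * M c * M (Suc c) ^ (n + 1 - (m + 4))) * prod_list [D * M (Suc a), D * M a]"
    proof (rule PH[unfolded pair_height_bound_def, rule_format, OF S(1) _ k0(1)])
      show "supp_below (Suc (m + 2)) S" using S(2) by (simp add: eval_nat_numeral)
      show "length [t, t'] = length [D * M (Suc a), D * M a]" by simp
      show "n + 3 - (m + 4) + length [t, t'] = m + 2" using n m by simp
      show "row_ok (m + 4) \<xi> (H (Suc c) / M c) ([t, t'] ! i) ([D * M (Suc a), D * M a] ! i)" if i: "i < length [t, t']" for i
      proof -
        have "row_ok (m + 4) \<xi> (H (Suc c) / M c) t (D * M (Suc a))" using RO t1(1,2) ac unfolding t_def by auto
        moreover have "t' \<in> row_set (m + 4) I" using ts(1) t' by simp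
        then have "row_ok (m + 4) \<xi> (H (Suc c) / M c) t' (D * M a)" using RO ac unfolding row_set_def I_def by auto
        moreover have "i = 0 \<or> i = 1" using i by auto
        ultimately show ?thesis by auto
      qed
      show "killed (m + 4) (set (pair_list c (m + 4) k0 @ [t, t'])) (tmult i S)" if "i < 2" for i
      proof -
        have i: "tmult i S = S \<or> tmult i S = tmult (Suc 0) S" using that by (auto simp: less_Suc_eq numeral_2_eq_2)
        have "annih n (m + 4) (y c) (tmult i S)" "annih n (m + 4) (y (Suc c)) (tmult i S)"
          using lift[OF S(2), of "y c"] lift[OF S(2), of "y (Suc c)"] S(3) i by auto
        from pair_list_killed[OF this k0(1)] kS[OF i] show ?thesis by (auto simp: killed_def t')
      qed
      show "\<exists>a c. a \<noteq> 0 \<and> (\<forall>j<m + 4. a * x j = (\<Sum>i<2. c i * tmult i S j))" if x: "killed (m + 4) (set (pair_list c (m + 4) k0 @ [t, t'])) x" for x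
      proof -
        obtain a c0 c1 where acc: "a \<noteq> 0" "\<forall>j<m + 4. a * x j = c0 * S j + c1 * tmult (Suc 0) S j" using span[OF bl_of[OF x]] by (elim exE conjE)
        show ?thesis by (rule exI[of _ a], rule exI[of _ "\<lambda>i. if i = 0 then c0 else c1"]) (use acc in \<open>simp add: numeral_2_eq_2\<close>)
      qed
    qed
    also have "n + 1 - (m + 4) = m - 2" using n by simp
    finally show ?thesis by (simp add: power2_eq_square mult_ac eval_nat_numeral)
  qed
  moreover have "1 \<le> C * D ^ 2" using C D by (intro mult_ge1_I one_le_power) auto
  ultimately show ?thesis by (intro exI[of _ "C * D ^ 2"] conjI allI impI) auto
qed

lemma finitely_many_annihilated:
  assumes p: "nonzero_below N p" "N \<le> n + 1" and M0: "M \<longlonglongrightarrow> 0"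
  shows "\<exists>K. \<forall>k\<ge>K. \<not> annih n N (y k) p"
proof -
  obtain K where K: "\<forall>k\<ge>K. dotp N (y k) p \<noteq> 0" using eventually_dotp_nonzero[OF no_root p near y_pos M0] by blast
  have "dotp N (y k) p = 0" if "annih n N (y k) p" for k
    using that[unfolded annih_def, rule_format, of 0] p(2) by (simp add: shift_def)
  then show ?thesis using K by blast
qed

end

section \<open>Numerical inequalities\<close>

text \<open>
  Writing \<open>1 / \<lambda> = m + 1 + \<mu>\<close> and \<open>t = 1 + \<mu> / m\<close>, the condition \<open>\<lambda> > alpha m\<close> becomes \<open>(1 + \<mu>) * t < 2\<close>.
  In the lemmas below \<open>h0, h1, h2\<close> stand for logarithms of consecutive heights, which grow at most by the
  factor \<open>t\<close>, and \<open>s, s'\<close> for those of the heights of two annihilators.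
\<close>

locale exponent_numbers =
  fixes m t \<mu> :: real
  assumes m2: "2 \<le> m" and t1: "1 < t" and mu: "\<mu> = m * (t - 1)" and mut: "(1 + \<mu>) * t < 2"
begin

text \<open>The condition \<open>mut\<close> as a quadratic in \<open>t\<close> alone. The
  polynomial identities below are arranged to exhibit it as a factor.\<close>

lemma q_neg: "m * t\<^sup>2 - (m - 1) * t - 2 < 0"
  using mut unfolding mu by (simp add: power2_eq_square algebra_simps)

lemma mu_pos: "0 < \<mu>"
  using m2 t1 by (simp add: mu)

lemma mu_lt_1: "\<mu> < 1"
proof -
  have "(1 + \<mu>) * 1 \<le> (1 + \<mu>) * t" using t1 mu_pos by (intro mult_left_mono) auto
  then have "1 + \<mu> \<le> (1 + \<mu>) * t" by (simp only: mult_1_right)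
  then show ?thesis using mut by linarith
qed

text \<open>The quadratic of \<open>q_neg\<close> is already positive at (m + 2)/(m + 1);
  \<open>d\<close> is the scaled excess of \<open>t\<close> over this value.\<close>

lemma t_bound: "(m + 1) * t < m + 2"
proof (rule ccontr)
  assume "\<not> ?thesis"
  then have a: "m + 2 \<le> (m + 1) * t" by simp
  define d where "d = (m + 1) * t - (m + 2)"
  have d0: "0 \<le> d" using a by (simp add: d_def)
  have "(m + 1)\<^sup>2 * ((1 + \<mu>) * t) = (m + 1) * (1 + \<mu>) * ((m + 1) * t)" by (simp add: power2_eq_square algebra_simps)
  also have "(m + 1) * (1 + \<mu>) = 2 * m + 1 + m * d" by (simp add: mu d_def algebra_simps)
  also have "(m + 1) * t = m + 2 + d" by (simp add: d_def)
  finally have e: "(m + 1)\<^sup>2 * ((1 + \<mu>) * t) = (2 * m + 1 + m * d) * (m + 2 + d)" .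
  have "(m + 1)\<^sup>2 * ((1 + \<mu>) * t) < (m + 1)\<^sup>2 * 2" using mut m2 by (intro mult_strict_left_mono) auto
  moreover have "(2 * m + 1) * (m + 2) \<le> (2 * m + 1 + m * d) * (m + 2 + d)" using m2 d0 by (intro mult_mono) auto
  ultimately have "(2 * m + 1) * (m + 2) < (m + 1)\<^sup>2 * 2" using e by linarith
  then show False using m2 by (simp add: power2_eq_square algebra_simps)
qed

text \<open>Eliminate \<open>hc\<close> between the two upper bounds for \<open>s\<close>, then
  \<open>h2\<close> and \<open>h1\<close> by the growth factor. What remains is
  \<open>2 * m + \<mu> \<le> B * t\<close>, whose two sides differ by a positive multiple of the
  quadratic of \<open>q_neg\<close> plus \<open>2 - m\<close>.\<close>

lemma spread_contradiction:
  assumes h: "0 < h0" "h1 \<le> t * h0" "h2 \<le> t * h1" "h0 \<le> h1" and s: "h0 \<le> s" "s \<le> m * t * h2 - h1 - (m - 1) * hc"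
    and ii: "2 * s \<le> (2 + \<mu>) * hc - h2 - h1"
  shows False
proof -
  define A where "A = (2 + \<mu>) * (m * t) - (m - 1)"
  define B where "B = A * t - (m + 1 + \<mu>)"
  have A0: "0 \<le> A"
  proof -
    have "1 * m \<le> t * m" using t1 m2 by (intro mult_right_mono) auto
    then have "2 * m \<le> (2 + \<mu>) * (m * t)" using mu_pos m2 by (intro mult_mono) (auto simp: mult.commute)
    then show ?thesis using m2 unfolding A_def by linarith
  qed
  have "(m - 1) * (2 * s + h2 + h1) \<le> (m - 1) * ((2 + \<mu>) * hc)" using ii m2 by (intro mult_left_mono) auto
  also have "\<dots> = (2 + \<mu>) * ((m - 1) * hc)" by simp
  also have "\<dots> \<le> (2 + \<mu>) * (m * t * h2 - h1 - s)" using s(2) mu_pos by (intro mult_left_mono) auto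
  finally have 1: "(2 * m + \<mu>) * s \<le> A * h2 - (m + 1 + \<mu>) * h1" by (simp add: A_def algebra_simps)
  also have "\<dots> \<le> A * (t * h1) - (m + 1 + \<mu>) * h1" using mult_left_mono[OF h(3) A0] by simp
  also have "\<dots> = B * h1" by (simp add: B_def algebra_simps)
  finally have 2: "(2 * m + \<mu>) * s \<le> B * h1" .
  have 3: "(2 * m + \<mu>) * h0 \<le> (2 * m + \<mu>) * s" using s(1) mu_pos m2 by (intro mult_left_mono) auto
  have 4: "0 < (2 * m + \<mu>) * h0" using h(1) mu_pos m2 by (intro mult_pos_pos) auto
  have B0: "0 < B"
  proof -
    have "0 < B * h1" using 2 3 4 by linarith
    then show ?thesis using h by (simp add: zero_less_mult_iff)
  qed
  have "B * h1 \<le> B * (t * h0)" using h(2) B0 by (intro mult_left_mono) auto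
  then have "(2 * m + \<mu>) * h0 \<le> (B * t) * h0" using 2 3 by (simp add: mult.assoc)
  then have "2 * m + \<mu> \<le> B * t" using h(1) by simp
  moreover have "B * t - (2 * m + \<mu>) = (m * t\<^sup>2 + t + 1) * (m * t\<^sup>2 - (m - 1) * t - 2) + (2 - m)"
    unfolding B_def A_def mu by (simp add: power2_eq_square algebra_simps)
  moreover have "(m * t\<^sup>2 + t + 1) * (m * t\<^sup>2 - (m - 1) * t - 2) < 0"
    using q_neg m2 t1 by (intro mult_pos_neg) (auto intro!: add_nonneg_pos)
  ultimately show False using m2 by linarith
qed

text \<open>\<open>s'\<close> belongs to the annihilator before a change, \<open>s\<close> to the
  one after it, and \<open>hm\<close> precedes \<open>h0\<close> in the growth chain. After
  elimination of \<open>s'\<close> and \<open>hc\<close> the coefficient \<open>k1\<close> of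
  \<open>h1\<close> has no fixed sign: if it is nonnegative, \<open>h1\<close> is replaced by
  \<open>t * h0\<close>, otherwise its term is dropped.\<close>

lemma separated_contradiction:
  assumes h: "0 < h0" "h0 \<le> t * hm" "h0 \<le> h1" "h1 \<le> t * h0" "h2 \<le> t * h1"
    and s: "h0 \<le> s" "s \<le> m * t * h2 - h1 - (m - 1) * hc" "s \<le> \<mu> * hc"
    and s': "h2 \<le> s + s'" "s' \<le> m * t * h0 - (m - 1) * h1 - hm"
  shows False
proof -
  define k1 where "k1 = m * t\<^sup>2 - t - m"
  have mt: "1 \<le> m * t" using mult_mono[of 1 m 1 t] m2 t1 by simp
  have "(m - 1) * h0 \<le> (m - 1) * (\<mu> * hc)" using s(1,3) m2 by (intro mult_left_mono) auto
  also have "\<dots> = \<mu> * ((m - 1) * hc)" by simp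
  also have "\<dots> \<le> \<mu> * ((m * t - 1) * h2 - m * h1 + m * t * h0 - hm)"
    using s(2) s' mu_pos by (intro mult_left_mono) (auto simp: algebra_simps)
  also have "\<dots> \<le> \<mu> * ((m * t - 1) * (t * h1) - m * h1 + m * t * h0 - hm)"
    using mult_left_mono[OF h(5), of "m * t - 1"] mt mu_pos by (intro mult_left_mono) auto
  finally have "t * ((m - 1) * h0) \<le> t * (\<mu> * ((m * t - 1) * (t * h1) - m * h1 + m * t * h0 - hm))"
    using t1 by (intro mult_left_mono) auto
  also have "\<dots> = \<mu> * (t * k1 * h1 + m * t\<^sup>2 * h0 - t * hm)"
    by (simp add: k1_def power2_eq_square algebra_simps)
  also have "\<dots> \<le> \<mu> * (t * k1 * h1 + m * t\<^sup>2 * h0 - h0)"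
    using h(2) mu_pos by (intro mult_left_mono) auto
  finally have main: "(m - 1) * t * h0 \<le> \<mu> * (t * k1 * h1 + (m * t\<^sup>2 - 1) * h0)" by (simp add: algebra_simps)
  show False
  proof (cases "0 \<le> k1")
    case True
    have "t * k1 * h1 \<le> t * k1 * (t * h0)" using h(4) True t1 by (intro mult_left_mono) auto
    then have "\<mu> * (t * k1 * h1 + (m * t\<^sup>2 - 1) * h0) \<le> \<mu> * (t * k1 * (t * h0) + (m * t\<^sup>2 - 1) * h0)"
      using mu_pos by (intro mult_left_mono) auto
    also have "\<dots> = (\<mu> * (t\<^sup>2 * k1 + m * t\<^sup>2 - 1)) * h0" by (simp add: power2_eq_square algebra_simps)
    finally have "(m - 1) * t * h0 \<le> (\<mu> * (t\<^sup>2 * k1 + m * t\<^sup>2 - 1)) * h0" using main by linarith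
    then have "(m - 1) * t \<le> \<mu> * (t\<^sup>2 * k1 + m * t\<^sup>2 - 1)" using h(1) by simp
    then have "0 \<le> m * (\<mu> * (t\<^sup>2 * k1 + m * t\<^sup>2 - 1) - (m - 1) * t)" using m2 by simp
    \<comment> \<open>A multiple of the quadratic of \<open>q_neg\<close> is split off so that the
      rest is nonpositive by \<open>t_bound\<close>.\<close>
    also have "\<dots> = (m\<^sup>2 * t ^ 3 - 2 * m * t\<^sup>2 + (m + 2) * t - 2) * (m * t\<^sup>2 - (m - 1) * t - 2)
        + (m - 2) * (t - 1) * ((m + 1) * t - (m + 2))"
      unfolding k1_def mu by (simp add: power2_eq_square power3_eq_cube algebra_simps)
    finally have f: "0 \<le> (m\<^sup>2 * t ^ 3 - 2 * m * t\<^sup>2 + (m + 2) * t - 2) * (m * t\<^sup>2 - (m - 1) * t - 2)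
        + (m - 2) * (t - 1) * ((m + 1) * t - (m + 2))" .
    have "0 < m\<^sup>2 * t ^ 3 - 2 * m * t\<^sup>2 + (m + 2) * t - 2"
    proof -
      have "2 * 1 \<le> m * t" using m2 t1 by (intro mult_mono) auto
      then have "m * t\<^sup>2 * 2 \<le> m * t\<^sup>2 * (m * t)" using m2 by (intro mult_left_mono) auto
      moreover have "(m + 2) * 1 < (m + 2) * t" using m2 t1 by (intro mult_strict_left_mono) auto
      then have "m + 2 < (m + 2) * t" by (simp only: mult_1_right)
      moreover have "m * t\<^sup>2 * (m * t) = m\<^sup>2 * t ^ 3" "m * t\<^sup>2 * 2 = 2 * m * t\<^sup>2"
        by (simp_all add: power2_eq_square power3_eq_cube)
      ultimately have "2 * m * t\<^sup>2 \<le> m\<^sup>2 * t ^ 3" "m + 2 < (m + 2) * t" by (simp_all only:)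
      then show ?thesis using m2 by linarith
    qed
    then have "(m\<^sup>2 * t ^ 3 - 2 * m * t\<^sup>2 + (m + 2) * t - 2) * (m * t\<^sup>2 - (m - 1) * t - 2) < 0" using q_neg by (rule mult_pos_neg)
    moreover have "(m - 2) * (t - 1) * ((m + 1) * t - (m + 2)) \<le> 0"
      using m2 t1 t_bound by (intro mult_nonneg_nonpos mult_nonneg_nonneg) auto
    ultimately show False using f by linarith
  next
    case False
    have "t * k1 * h1 \<le> 0" using False t1 h(1,3) by (intro mult_nonpos_nonneg mult_nonneg_nonpos) auto
    then have "\<mu> * (t * k1 * h1 + (m * t\<^sup>2 - 1) * h0) \<le> \<mu> * ((m * t\<^sup>2 - 1) * h0)" using mu_pos by (intro mult_left_mono) auto
    then have "(m - 1) * t * h0 \<le> (\<mu> * (m * t\<^sup>2 - 1)) * h0" using main by (simp add: mult.assoc)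
    then have a: "(m - 1) * t \<le> \<mu> * (m * t\<^sup>2 - 1)" using h(1) by simp
    also have "\<dots> < \<mu> * (t + m - 1)" using False mu_pos by (intro mult_strict_left_mono) (auto simp: k1_def)
    finally have "0 < m * (t - 1) * (t + m - 1) - (m - 1) * t" unfolding mu by simp
    also have "\<dots> = k1 + (m - 2) * ((m - 1) * t - m)"
      by (simp add: k1_def power2_eq_square algebra_simps)
    finally have b: "0 < k1 + (m - 2) * ((m - 1) * t - m)" .
    have "(m - 1) * t \<le> m"
    proof -
      have "m * t < m + 1" using mu_lt_1 by (simp add: mu algebra_simps)
      then show ?thesis using t1 by (simp add: algebra_simps)
    qed
    then have "(m - 2) * ((m - 1) * t - m) \<le> 0" using m2 by (intro mult_nonneg_nonpos) auto
    then show False using b False by linarith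
  qed
qed

text \<open>The \<open>h\<close> and the \<open>g\<close> are taken around the two changes between
  which one annihilator lives. The growth condition at the second change makes \<open>g2\<close> at
  least \<open>(t + 1) / 2\<close> times \<open>h2\<close>, and then the upper bound for
  \<open>s\<close> forces \<open>t ^ 3 > 2\<close>. For \<open>m \<ge> 3\<close> this contradicts
  \<open>t < 5 / 4\<close>.\<close>

lemma chained_bound:
  assumes h: "0 < h0" "h1 \<le> t * h0" "h2 \<le> t * h1" "h0 \<le> h1" "h1 \<le> h2"
    and s: "h0 \<le> s" "s \<le> m * t * h2 - h1 - (m - 1) * g2"
    and g: "h2 \<le> g1" "g1 \<le> t * g0" "g1 \<le> g2" "g1 + g0 \<le> (1 + \<mu>) * g2"
  shows "m < 3"
proof (rule ccontr)
  assume "\<not> m < 3"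
  then have m3: "3 \<le> m" by simp
  have t0: "0 < t" using t1 by simp
  have g20: "0 < g2" using h g by linarith
  have "t * (g1 + g0) \<le> (1 + \<mu>) * t * g2" using mult_left_mono[OF g(4), of t] t0 by (simp add: mult_ac)
  also have "\<dots> \<le> 2 * g2" using mut g20 by (intro mult_right_mono) auto
  finally have "(t + 1) * g1 \<le> 2 * g2" using g(2) by (simp add: algebra_simps)
  moreover have "(t + 1) * h2 \<le> (t + 1) * g1" using g(1) t0 by (intro mult_left_mono) auto
  ultimately have 1: "(t + 1) * h2 \<le> 2 * g2" by linarith
  have "(m - 1) * t\<^sup>2 * ((t + 1) * h2) \<le> (m - 1) * t\<^sup>2 * (2 * g2)" using 1 m2 by (intro mult_left_mono) auto
  also have "\<dots> = 2 * (t\<^sup>2 * ((m - 1) * g2))" by simp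
  also have "\<dots> \<le> 2 * (t\<^sup>2 * (m * t * h2 - h1 - h0))" using s by (intro mult_left_mono) auto
  also have "\<dots> \<le> 2 * ((m * t ^ 3 - t - 1) * h2)"
  proof -
    have "t * h2 \<le> t\<^sup>2 * h1" using mult_left_mono[OF h(3), of t] t0 by (simp add: power2_eq_square mult_ac)
    moreover have "t * h1 \<le> t\<^sup>2 * h0" using mult_left_mono[OF h(2), of t] t0 by (simp add: power2_eq_square mult_ac)
    ultimately have "t * h2 + h2 \<le> t\<^sup>2 * h1 + t\<^sup>2 * h0" using h(3) by linarith
    then show ?thesis by (simp add: power2_eq_square power3_eq_cube algebra_simps)
  qed
  finally have "((m - 1) * t\<^sup>2 * (t + 1)) * h2 \<le> (2 * (m * t ^ 3 - t - 1)) * h2" by (simp add: mult_ac)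
  then have "(m - 1) * t\<^sup>2 * (t + 1) \<le> 2 * (m * t ^ 3 - t - 1)" using h by simp
  then have "0 \<le> t * (m * t\<^sup>2 - (m - 1) * t - 2) + t ^ 3 - 2" by (simp add: power2_eq_square power3_eq_cube algebra_simps)
  moreover have "t * (m * t\<^sup>2 - (m - 1) * t - 2) < 0" using q_neg t0 by (rule mult_pos_neg[rotated])
  ultimately have t3: "2 < t ^ 3" by linarith
  have "t < 5 / 4"
  proof (rule ccontr)
    assume "\<not> t < 5 / 4"
    then have t54: "5 / 4 \<le> t" by simp
    then have "3 * ((5 / 4) * (1 / 4)) \<le> m * (t * (t - 1))" using m3 by (intro mult_mono) auto
    moreover have "m * (t * (t - 1)) + t - 2 < 0" using q_neg by (simp add: power2_eq_square algebra_simps)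
    ultimately show False using t54 by linarith
  qed
  then have "t ^ 3 \<le> (5 / 4) ^ 3" using t0 by (intro power_mono) auto
  then show False using t3 by (simp add: power3_eq_cube)
qed

text \<open>The case left open by \<open>chained_bound\<close>. Here the next annihilator, of size
  \<open>s'\<close>, has to be taken into account; \<open>hx\<close> belongs to the end of its span,
  and either alternative in \<open>alt\<close> bounds \<open>hx\<close> from below, while
  \<open>s'\<close> bounds it from above.\<close>

lemma chained_contradiction:
  assumes m: "m = 2" and h: "0 < h0" "h1 \<le> t * h0" "h2 \<le> t * h1" "h0 \<le> h1" "h1 \<le> h2"
    and s: "h0 \<le> s" "s \<le> 2 * t * h2 - h1 - g2"
    and g: "h1 \<le> g0" "h2 \<le> g1"
    and s': "g0 \<le> s'" "s' \<le> 2 * t * g2 - g1 - hx"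
    and alt: "s' \<le> \<mu> * hx \<or> g2 + g1 \<le> (1 + \<mu>) * hx"
  shows False
proof -
  have t0: "0 < t" using t1 by simp
  have mu2: "\<mu> = 2 * t - 2" using mu m by simp
  have q: "2 * t\<^sup>2 < t + 2" using q_neg m by simp
  have g2: "g2 \<le> 2 * t * h2 - h1 - h0" using s by linarith
  then have "t * g2 \<le> t * (2 * t * h2 - h1 - h0)" using t0 by (intro mult_left_mono) auto
  also have "\<dots> \<le> 2 * t\<^sup>2 * h2 - (t + 1) * h1" using h(2) by (simp add: power2_eq_square algebra_simps)
  also have "\<dots> \<le> 2 * t\<^sup>2 * (t * h1) - (t + 1) * h1" using h(3) t0 by (auto intro!: mult_left_mono)
  finally have tg2: "t * g2 \<le> (2 * t ^ 3 - t - 1) * h1" by (simp add: power2_eq_square power3_eq_cube algebra_simps)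
  have h10: "0 < h1" using h by linarith
  from alt show False
  proof
    assume "s' \<le> \<mu> * hx"
    have "(1 + \<mu>) * h1 \<le> (1 + \<mu>) * s'" using g s' mu_pos by (intro mult_left_mono) auto
    also have "\<dots> \<le> \<mu> * hx + \<mu> * (2 * t * g2 - g1 - hx)"
      using \<open>s' \<le> \<mu> * hx\<close> mult_left_mono[OF s'(2), of \<mu>] mu_pos by (simp add: algebra_simps)
    also have "\<dots> = \<mu> * (2 * (t * g2) - g1)" by (simp add: algebra_simps)
    also have "\<dots> \<le> \<mu> * (2 * ((2 * t * (t * h2)) - (t + 1) * h1) - h2)"
    proof -
      have "t * g2 \<le> t * (2 * t * h2 - h1 - h0)" using g2 t0 by (intro mult_left_mono) auto
      also have "\<dots> \<le> 2 * t * (t * h2) - (t + 1) * h1" using h(2) by (simp add: algebra_simps)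
      finally show ?thesis using g(2) mu_pos by (intro mult_left_mono) auto
    qed
    also have "\<dots> = \<mu> * ((4 * t\<^sup>2 - 1) * h2 - 2 * (t + 1) * h1)" by (simp add: power2_eq_square algebra_simps)
    also have "\<dots> \<le> \<mu> * ((4 * t\<^sup>2 - 1) * (t * h1) - 2 * (t + 1) * h1)"
    proof -
      have "1 \<le> t\<^sup>2" using t1 by simp
      then have "(4 * t\<^sup>2 - 1) * h2 \<le> (4 * t\<^sup>2 - 1) * (t * h1)" using h(3) by (intro mult_left_mono) auto
      then show ?thesis using mu_pos by (intro mult_left_mono) auto
    qed
    also have "\<dots> = (\<mu> * (4 * t ^ 3 - 3 * t - 2)) * h1" by (simp add: power2_eq_square power3_eq_cube algebra_simps)
    finally have "1 + \<mu> \<le> \<mu> * (4 * t ^ 3 - 3 * t - 2)" using h10 by simp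
    then have a: "1 \<le> \<mu> * (4 * t ^ 3 - 3 * t - 3)" by (simp add: algebra_simps)
    have "4 * t ^ 3 = 2 * t * (2 * t\<^sup>2)" by (simp add: power2_eq_square power3_eq_cube)
    also have "\<dots> \<le> 2 * t * (t + 2)" using q t0 by (intro mult_left_mono) auto
    also have "\<dots> = 2 * t\<^sup>2 + 4 * t" by (simp add: power2_eq_square algebra_simps)
    finally have "4 * t ^ 3 - 3 * t - 3 \<le> 2 * t - 1" using q by linarith
    then have "\<mu> * (4 * t ^ 3 - 3 * t - 3) \<le> \<mu> * (2 * t - 1)" using mu_pos by (intro mult_left_mono) auto
    then have b: "1 \<le> (2 * t - 2) * (2 * t - 1)" using a mu2 by simp
    show False
    proof (cases "t \<le> 5 / 4")
      case True
      then have "(2 * t - 2) * (2 * t - 1) \<le> (1 / 2) * (3 / 2)" using t1 by (intro mult_mono) auto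
      then show False using b by simp
    next
      case False
      have "(2 * t - 2) * (2 * t - 1) = 2 * (2 * t\<^sup>2) - 6 * t + 2" by (simp add: power2_eq_square algebra_simps)
      then show False using b q False by linarith
    qed
  next
    assume x: "g2 + g1 \<le> (1 + \<mu>) * hx"
    have m1: "1 + \<mu> = 2 * t - 1" using mu2 by simp
    have "(1 + \<mu>) * hx \<le> (2 * t - 1) * (2 * t * g2 - g1 - g0)"
      unfolding m1 using s' t1 by (intro mult_left_mono) auto
    then have "2 * t * g1 + (2 * t - 1) * g0 \<le> (4 * t\<^sup>2 - 2 * t - 1) * g2" using x by (simp add: power2_eq_square algebra_simps)
    moreover have "2 * t * h2 \<le> 2 * t * g1" "(2 * t - 1) * h1 \<le> (2 * t - 1) * g0" using g t1 by (auto intro!: mult_left_mono)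
    ultimately have "2 * t * h2 + (2 * t - 1) * h1 \<le> (4 * t\<^sup>2 - 2 * t - 1) * g2" by linarith
    then have "t * (2 * t * h2 + (2 * t - 1) * h1) \<le> t * ((4 * t\<^sup>2 - 2 * t - 1) * g2)" using t0 by (intro mult_left_mono) auto
    also have "\<dots> = (4 * t\<^sup>2 - 2 * t - 1) * (t * g2)" by simp
    also have "\<dots> \<le> (4 * t\<^sup>2 - 2 * t - 1) * (2 * t\<^sup>2 * h2 - (t + 1) * h1)"
    proof (rule mult_left_mono)
      have "t * g2 \<le> t * (2 * t * h2 - h1 - h0)" using g2 t0 by (intro mult_left_mono) auto
      then show "t * g2 \<le> 2 * t\<^sup>2 * h2 - (t + 1) * h1" using h(2) by (simp add: power2_eq_square algebra_simps)
      have "1 * t \<le> t * t" using t1 by (intro mult_right_mono) auto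
      then show "0 \<le> 4 * t\<^sup>2 - 2 * t - 1" using t1 unfolding power2_eq_square by linarith
    qed
    finally have "((2 * t - 1) * t + (4 * t\<^sup>2 - 2 * t - 1) * (t + 1)) * h1 \<le> ((4 * t\<^sup>2 - 2 * t - 1) * (2 * t\<^sup>2) - 2 * t\<^sup>2) * h2"
      by (simp add: power2_eq_square algebra_simps)
    also have "\<dots> \<le> ((4 * t\<^sup>2 - 2 * t - 1) * (2 * t\<^sup>2) - 2 * t\<^sup>2) * (t * h1)"
    proof (rule mult_left_mono[OF h(3)])
      have "1 * t \<le> t * t" using t1 by (intro mult_right_mono) auto
      then have "1 \<le> 4 * t\<^sup>2 - 2 * t - 1" using t1 unfolding power2_eq_square by linarith
      then have "1 * (2 * t\<^sup>2) \<le> (4 * t\<^sup>2 - 2 * t - 1) * (2 * t\<^sup>2)" by (intro mult_right_mono) auto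
      then show "0 \<le> (4 * t\<^sup>2 - 2 * t - 1) * (2 * t\<^sup>2) - 2 * t\<^sup>2" by simp
    qed
    finally have "((2 * t - 1) * t + (4 * t\<^sup>2 - 2 * t - 1) * (t + 1)) * h1 \<le> (t * ((4 * t\<^sup>2 - 2 * t - 1) * (2 * t\<^sup>2) - 2 * t\<^sup>2)) * h1"
      by (simp add: mult_ac)
    then have "(2 * t - 1) * t + (4 * t\<^sup>2 - 2 * t - 1) * (t + 1) \<le> t * ((4 * t\<^sup>2 - 2 * t - 1) * (2 * t\<^sup>2) - 2 * t\<^sup>2)" using h10 by simp
    then have "0 \<le> 4 * t ^ 3 * (2 * t\<^sup>2 - t - 2) - (4 * t\<^sup>2 - 4 * t - 1)" by (simp add: power2_eq_square power3_eq_cube algebra_simps)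
    moreover have "4 * t ^ 3 * (2 * t\<^sup>2 - t - 2) \<le> 4 * (2 * t\<^sup>2 - t - 2)"
    proof -
      have "1 \<le> t ^ 3" using t1 by (intro one_le_power) auto
      then have "4 * t ^ 3 * (2 * t\<^sup>2 - t - 2) \<le> 4 * 1 * (2 * t\<^sup>2 - t - 2)" using q by (intro mult_right_mono_neg) auto
      then show ?thesis by simp
    qed
    ultimately have "0 \<le> 4 * (2 * t\<^sup>2 - t - 2) - (4 * t\<^sup>2 - 4 * t - 1)" by (rule order.trans[OF _ diff_right_mono])
    then have t2: "7 \<le> 4 * t\<^sup>2" by simp
    moreover have "t < 3 / 2"
    proof (rule ccontr)
      assume "\<not> t < 3 / 2"
      then have "(3 / 2) * t \<le> t * t" using t0 by (intro mult_right_mono) auto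
      then show False using q \<open>\<not> t < 3 / 2\<close> unfolding power2_eq_square by linarith
    qed
    ultimately show False using q by linarith
  qed
qed

end

section \<open>Annihilators of three consecutive points\<close>

lemma annih_proportional:
  assumes "a \<noteq> 0" "\<forall>j<N. a * p j = b * S j" "annih n N x S"
  shows "annih n N x p"
proof -
  have "annih n N x (\<lambda>j. b * S j)" by (rule annih_scale[OF assms(3)])
  moreover have "annih n N x (\<lambda>j. a * p j) \<longleftrightarrow> annih n N x (\<lambda>j. b * S j)" by (rule annih_cong) (use assms(2) in blast)
  ultimately show ?thesis using annih_scale_cancel[OF assms(1)] by blast
qed

lemma lin_indep_pair_or_proportional:
  assumes "nonzero_below N S"
  shows "lin_indep N [S, p] \<or> (\<exists>a b. a \<noteq> 0 \<and> (\<forall>j<N. a * p j = b * S j))"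
proof -
  have "lin_indep N ([S] @ [p]) \<or> (\<exists>a c. a \<noteq> 0 \<and> (\<forall>j<N. a * p j = (\<Sum>i<length [S]. c i * ([S] ! i) j)))"
    by (rule lin_indep_append_or_span[OF lin_indep_singleton[OF assms]])
  then show ?thesis
  proof
    assume "\<exists>a c. a \<noteq> 0 \<and> (\<forall>j<N. a * p j = (\<Sum>i<length [S]. c i * ([S] ! i) j))"
    then obtain a c where ac: "a \<noteq> 0" "\<forall>j<N. a * p j = (\<Sum>i<length [S]. c i * ([S] ! i) j)" by (elim exE conjE)
    show ?thesis by (rule disjI2, rule exI[of _ a], rule exI[of _ "c 0"]) (use ac in simp)
  qed simp
qed

text \<open>That \<open>small\<close> holds for every \<open>C\<close> expresses that the points
  approximate better than the exponent \<open>lam\<close> requires.\<close>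

locale exponent_sequence = point_sequence n m \<xi> y yp H M + exponent_numbers "real m" t \<mu>
  for n m :: nat and \<xi> :: real and y yp :: "nat \<Rightarrow> nat \<Rightarrow> int" and H M :: "nat \<Rightarrow> real" and t \<mu> :: real +
  fixes lam :: real
  assumes lam: "0 < lam" "lam * (real m + 1 + \<mu>) = 1"
    and small: "\<And>C. \<exists>K. \<forall>k\<ge>K. C * M k \<le> H (Suc k) powr (- lam)"
    and M0: "M \<longlonglongrightarrow> 0" and H_gt: "\<And>k. 1 < H k"
begin

definition h :: "nat \<Rightarrow> real" where "h k = ln (H k)"

text \<open>Logarithms of heights are scaled by \<open>1 / lam\<close>, so that \<open>M k\<close> corresponds to \<open>h (Suc k)\<close>.\<close>

definition sz :: "nat \<Rightarrow> (nat \<Rightarrow> int) \<Rightarrow> real" where "sz N p = (real m + 1 + \<mu>) * ln (hgt N p)"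

definition L :: "nat \<Rightarrow> real" where "L k = - ((real m + 1 + \<mu>) * ln (M k))"

section \<open>Logarithmic form of the determinant bounds\<close>

lemma h_pos: "0 < h k"
  using H_gt[of k] by (simp add: h_def)

lemma h_mono: "i \<le> j \<Longrightarrow> h i \<le> h j"
  unfolding h_def using H_mono'[of i j] H_gt[of i] by (subst ln_le_cancel_iff) auto

lemma mt: "real m * t = real m + \<mu>"
  using m2 by (simp add: mu algebra_simps)

lemma E_pos: "0 < real m + 1 + \<mu>"
  using mu_pos by linarith

text \<open>Every bound contains a factor \<open>M k\<close> to which its constant can be attached.
  Hence the logarithmic inequalities hold only for large indices but have no additive
  constants.\<close>

lemma absorb:
  assumes "1 \<le> C"
  shows "\<exists>K. \<forall>k\<ge>K. (real m + 1 + \<mu>) * ln C + h (Suc k) \<le> L k \<and> h (Suc k) \<le> L k"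
proof -
  obtain K where K: "\<forall>k\<ge>K. C * M k \<le> H (Suc k) powr (- lam)" using small by blast
  have "(real m + 1 + \<mu>) * ln C + h (Suc k) \<le> L k \<and> h (Suc k) \<le> L k" if "K \<le> k" for k
  proof -
    have "C * M k \<le> H (Suc k) powr (- lam)" using K that by blast
    then have "ln (C * M k) \<le> ln (H (Suc k) powr (- lam))" using M_pos[of k] assms H_gt[of "Suc k"] by (subst ln_le_cancel_iff) auto
    moreover have "ln (C * M k) = ln C + ln (M k)" using M_pos[of k] assms by (intro ln_mult_pos) auto
    moreover have "ln (H (Suc k) powr (- lam)) = - lam * h (Suc k)" using H_gt[of "Suc k"] by (simp add: h_def ln_powr)
    ultimately have "(real m + 1 + \<mu>) * (ln C + ln (M k)) \<le> (real m + 1 + \<mu>) * (- lam * h (Suc k))"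
      using E_pos by (intro mult_left_mono) auto
    also have "\<dots> = - (lam * (real m + 1 + \<mu>)) * h (Suc k)" by (simp add: algebra_simps)
    also have "\<dots> = - h (Suc k)" unfolding lam(2) by simp
    finally have "(real m + 1 + \<mu>) * ln C + h (Suc k) \<le> L k" by (simp add: L_def algebra_simps)
    moreover have "0 \<le> (real m + 1 + \<mu>) * ln C" using assms E_pos by simp
    ultimately show ?thesis by linarith
  qed
  then show ?thesis by blast
qed

lemma scaled_ln_H: "(real m + 1 + \<mu>) * ln (H k) = (real m * t + 1) * h k"
  unfolding h_def mt by (simp add: algebra_simps)

lemma scaled_ln_M: "(real m + 1 + \<mu>) * ln (M k) = - L k"
  by (simp add: L_def)

lemma scaled_ln_mono: "0 < a \<Longrightarrow> a \<le> b \<Longrightarrow> (real m + 1 + \<mu>) * ln a \<le> (real m + 1 + \<mu>) * ln b"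
  using E_pos by (intro mult_left_mono) auto

lemma scaled_ln_mult: "0 < a \<Longrightarrow> 0 < b \<Longrightarrow> (real m + 1 + \<mu>) * ln (a * b) = (real m + 1 + \<mu>) * ln a + (real m + 1 + \<mu>) * ln b"
  by (simp add: ln_mult_pos distrib_left)

lemma scaled_ln_power: "0 < a \<Longrightarrow> (real m + 1 + \<mu>) * ln (a ^ k) = real k * ((real m + 1 + \<mu>) * ln a)"
  by (simp add: ln_realpow)

lemma H_pos: "0 < H k"
  using H_gt[of k] by linarith

lemma M_neq_0: "M k \<noteq> 0"
  using M_pos[of k] by simp

lemmas scaled_ln_simps = M_neq_0 scaled_ln_mult scaled_ln_power scaled_ln_H scaled_ln_M H_pos M_pos mult_pos_pos zero_less_power

lemma L_mult_mono: "h (Suc k) \<le> L k \<Longrightarrow> real i * h (Suc k) \<le> real i * L k"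
  by (intro mult_left_mono) auto

text \<open>The scaled logarithm of \<open>H (Suc k)\<close> is
  \<open>(m * t + 1) * h (Suc k)\<close>. One summand \<open>h (Suc k)\<close> is used up by
  \<open>M k\<close>, and \<open>m * t * h (Suc k)\<close> is compared with the \<open>m\<close>
  factors \<open>M (Suc k)\<close>; this is the origin of \<open>t\<close>.\<close>

lemma eventually_growth:
  "\<exists>K. \<forall>k\<ge>K. \<forall>p. annih n (m + 2) (y (Suc k)) p \<longrightarrow> \<not> annih n (m + 2) (y k) p \<longrightarrow> h (Suc (Suc k)) \<le> t * h (Suc k)"
proof -
  obtain C where C: "1 \<le> C" and B: "\<forall>k p. annih n (m + 2) (y (Suc k)) p \<longrightarrow> \<not> annih n (m + 2) (y k) p \<longrightarrow>
     1 \<le> C * (H (Suc k) * M k * M (Suc k) ^ m)"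
    using plane_height_growth by (elim exE conjE)
  obtain K where K: "\<forall>k\<ge>K. (real m + 1 + \<mu>) * ln C + h (Suc k) \<le> L k \<and> h (Suc k) \<le> L k" using absorb[OF C] by blast
  have "h (Suc (Suc k)) \<le> t * h (Suc k)" if k: "K \<le> k" and p: "annih n (m + 2) (y (Suc k)) p" "\<not> annih n (m + 2) (y k) p" for k p
  proof -
    have "1 \<le> C * (H (Suc k) * M k * M (Suc k) ^ m)" using B p by blast
    from scaled_ln_mono[OF _ this]
    have "0 \<le> (real m + 1 + \<mu>) * ln C + ((real m * t + 1) * h (Suc k) - L k - real m * L (Suc k))"
      using C by (simp add: scaled_ln_simps)
    moreover have "(real m + 1 + \<mu>) * ln C + h (Suc k) \<le> L k" using K k by blast
    moreover have "real m * h (Suc (Suc k)) \<le> real m * L (Suc k)" by (rule L_mult_mono) (use K k in auto)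
    ultimately have "real m * h (Suc (Suc k)) \<le> real m * (t * h (Suc k))" by (simp add: algebra_simps)
    then show ?thesis using m by simp
  qed
  then show ?thesis by blast
qed

lemma eventually_value:
  "\<exists>K. \<forall>k\<ge>K. \<forall>N p. 1 \<le> N \<longrightarrow> N \<le> n + 1 \<longrightarrow> annih n N (y (Suc k)) p \<longrightarrow> \<not> annih n N (y k) p \<longrightarrow> h (Suc k) \<le> sz N p"
proof -
  obtain C where C: "1 \<le> C" and VB: "value_bound n \<xi> C" using annih_value_bound by blast
  obtain K where K: "\<forall>k\<ge>K. (real m + 1 + \<mu>) * ln C + h (Suc k) \<le> L k \<and> h (Suc k) \<le> L k" using absorb[OF C] by blast
  have "h (Suc k) \<le> sz N p" if k: "K \<le> k" and N: "1 \<le> N" "N \<le> n + 1" and p: "annih n N (y (Suc k)) p" "\<not> annih n N (y k) p" for k N p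
  proof -
    have "0 < y (Suc k) 0" "0 < y k 0" using y_pos[of "Suc k"] y_pos[of k] by linarith+
    then have y1: "0 < \<bar>real_of_int (y (Suc k) 0)\<bar>" "\<bar>real_of_int (y k 0)\<bar> \<le> \<bar>real_of_int (y (Suc k) 0)\<bar>" using y_mono[of k] by auto
    have "1 \<le> C * (hgt N p * M k)" using VB[unfolded value_bound_def, rule_format, OF N(2,1) p near near M_mono y1] .
    moreover from this have "0 < hgt N p"
      using hgt_nonneg[of N p] by (cases "hgt N p = 0") auto
    ultimately have "0 \<le> (real m + 1 + \<mu>) * ln C + (sz N p - L k)"
      using scaled_ln_mono[of 1 "C * (hgt N p * M k)"] C by (simp add: scaled_ln_simps sz_def)
    moreover have "(real m + 1 + \<mu>) * ln C + h (Suc k) \<le> L k" using K k by blast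
    ultimately show ?thesis by linarith
  qed
  then show ?thesis by blast
qed

lemma hgt_pos: "primitive p \<Longrightarrow> supp_below N p \<Longrightarrow> 0 < hgt N p"
  using hgt_ge_1[OF primitive_nonzero, of p N] by linarith

lemma eventually_double:
  "\<exists>K. \<forall>k\<ge>K. \<forall>P. primitive P \<longrightarrow> supp_below (m + 2) P \<longrightarrow> annih n (m + 2) (y k) P \<longrightarrow> annih n (m + 2) (y (Suc k)) P \<longrightarrow>
     2 * sz (m + 2) P \<le> (1 + \<mu>) * h (Suc k)"
proof -
  obtain C where C: "1 \<le> C" and B: "\<forall>k P. primitive P \<longrightarrow> supp_below (m + 2) P \<longrightarrow> annih n (m + 2) (y k) P \<longrightarrow> annih n (m + 2) (y (Suc k)) P \<longrightarrow>
     hgt (m + 2) P ^ 2 \<le> C * (H (Suc k) * M k * M (Suc k) ^ (m - 1))"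
    using annih_double_height by (elim exE conjE)
  obtain K where K: "\<forall>k\<ge>K. (real m + 1 + \<mu>) * ln C + h (Suc k) \<le> L k \<and> h (Suc k) \<le> L k" using absorb[OF C] by blast
  have "2 * sz (m + 2) P \<le> (1 + \<mu>) * h (Suc k)" if k: "K \<le> k"
    and P: "primitive P" "supp_below (m + 2) P" "annih n (m + 2) (y k) P" "annih n (m + 2) (y (Suc k)) P" for k P
  proof -
    have "hgt (m + 2) P ^ 2 \<le> C * (H (Suc k) * M k * M (Suc k) ^ (m - 1))" using B P by blast
    from scaled_ln_mono[OF _ this]
    have "2 * sz (m + 2) P \<le> (real m + 1 + \<mu>) * ln C + ((real m * t + 1) * h (Suc k) - L k - real (m - 1) * L (Suc k))"
      using C hgt_pos[OF P(1,2)] by (simp add: scaled_ln_simps sz_def)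
    moreover have "(real m + 1 + \<mu>) * ln C + h (Suc k) \<le> L k" using K k by blast
    moreover have "real (m - 1) * h (Suc (Suc k)) \<le> real (m - 1) * L (Suc k)" by (rule L_mult_mono) (use K k in auto)
    moreover have "real (m - 1) * h (Suc k) \<le> real (m - 1) * h (Suc (Suc k))" by (intro mult_left_mono h_mono) auto
    ultimately have "2 * sz (m + 2) P \<le> real m * t * h (Suc k) - real (m - 1) * h (Suc k)" by (simp add: algebra_simps)
    then show ?thesis using m unfolding mt by (simp add: algebra_simps of_nat_diff)
  qed
  then show ?thesis by blast
qed

lemma eventually_common:
  "\<exists>K. \<forall>k\<ge>K. (\<nexists>p. nonzero_below (m + 3) p \<and> annih n (m + 3) (y k) p \<and> annih n (m + 3) (y (Suc k)) p \<and> annih n (m + 3) (y (Suc (Suc k))) p) \<longrightarrow>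
     2 * h (Suc k) \<le> (1 + \<mu>) * h (Suc (Suc k))"
proof -
  obtain C where C: "1 \<le> C" and B: "\<forall>k. (\<nexists>p. nonzero_below (m + 3) p \<and> annih n (m + 3) (y k) p \<and> annih n (m + 3) (y (Suc k)) p \<and> annih n (m + 3) (y (Suc (Suc k))) p) \<longrightarrow>
     1 \<le> C * (H (Suc (Suc k)) * M (Suc k) * M (Suc (Suc k)) ^ (m - 1) * M k ^ 2)"
    using common_annih_exists by (elim exE conjE)
  obtain K where K: "\<forall>k\<ge>K. (real m + 1 + \<mu>) * ln C + h (Suc k) \<le> L k \<and> h (Suc k) \<le> L k" using absorb[OF C] by blast
  have "2 * h (Suc k) \<le> (1 + \<mu>) * h (Suc (Suc k))" if k: "K \<le> k"
    and P: "\<nexists>p. nonzero_below (m + 3) p \<and> annih n (m + 3) (y k) p \<and> annih n (m + 3) (y (Suc k)) p \<and> annih n (m + 3) (y (Suc (Suc k))) p" for k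
  proof -
    have "1 \<le> C * (H (Suc (Suc k)) * M (Suc k) * M (Suc (Suc k)) ^ (m - 1) * M k ^ 2)" using B P by blast
    from scaled_ln_mono[OF _ this]
    have "0 \<le> (real m + 1 + \<mu>) * ln C + ((real m * t + 1) * h (Suc (Suc k)) - L (Suc k) - real (m - 1) * L (Suc (Suc k)) - 2 * L k)"
      using C by (simp add: scaled_ln_simps)
    moreover have "(real m + 1 + \<mu>) * ln C + h (Suc (Suc k)) \<le> L (Suc k)" "h (Suc k) \<le> L k" using K k by auto
    moreover have "real (m - 1) * h (Suc (Suc (Suc k))) \<le> real (m - 1) * L (Suc (Suc k))" by (rule L_mult_mono) (use K k in auto)
    moreover have "real (m - 1) * h (Suc (Suc k)) \<le> real (m - 1) * h (Suc (Suc (Suc k)))" by (intro mult_left_mono h_mono) auto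
    ultimately have "2 * h (Suc k) \<le> real m * t * h (Suc (Suc k)) - real (m - 1) * h (Suc (Suc k))" by (simp add: algebra_simps)
    then show ?thesis using m unfolding mt by (simp add: algebra_simps of_nat_diff)
  qed
  then show ?thesis by blast
qed

lemma eventually_unique:
  "\<exists>K. \<forall>k I i0 S. K \<le> i0 \<longrightarrow> i0 \<le> k \<longrightarrow> primitive S \<longrightarrow> supp_below (m + 3) S \<longrightarrow> annih n (m + 3) (y (Suc k)) S \<longrightarrow> annih n (m + 3) (y k) S \<longrightarrow>
     (\<forall>i\<in>I. i0 \<le> i \<and> i \<le> k \<and> annih n (m + 3) (y i) S) \<longrightarrow>
     (\<forall>p. annih n (m + 3) (y (Suc k)) p \<longrightarrow> (\<forall>i\<in>I. annih n (m + 3) (y i) p) \<longrightarrow> (\<exists>a b. a \<noteq> 0 \<and> (\<forall>j<m + 3. a * p j = b * S j))) \<longrightarrow>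
     sz (m + 3) S \<le> real m * t * h (Suc k) - (real m - 1) * h (Suc (Suc k)) - h (Suc i0)"
proof -
  obtain C where C: "1 \<le> C" and B: "\<forall>k I i0 S. primitive S \<longrightarrow> supp_below (m + 3) S \<longrightarrow> annih n (m + 3) (y (Suc k)) S \<longrightarrow> annih n (m + 3) (y k) S \<longrightarrow>
     (\<forall>i\<in>I. i0 \<le> i \<and> i \<le> k \<and> annih n (m + 3) (y i) S) \<longrightarrow>
     (\<forall>p. annih n (m + 3) (y (Suc k)) p \<longrightarrow> (\<forall>i\<in>I. annih n (m + 3) (y i) p) \<longrightarrow> (\<exists>a b. a \<noteq> 0 \<and> (\<forall>j<m + 3. a * p j = b * S j))) \<longrightarrow>
     hgt (m + 3) S \<le> C * (H (Suc k) * M k * M (Suc k) ^ (m - 1) * M i0)"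
    using unique_annih_height by (elim exE conjE)
  obtain K where K: "\<forall>k\<ge>K. (real m + 1 + \<mu>) * ln C + h (Suc k) \<le> L k \<and> h (Suc k) \<le> L k" using absorb[OF C] by blast
  have "sz (m + 3) S \<le> real m * t * h (Suc k) - (real m - 1) * h (Suc (Suc k)) - h (Suc i0)" if k: "K \<le> i0" "i0 \<le> k"
    and S: "primitive S" "supp_below (m + 3) S" "annih n (m + 3) (y (Suc k)) S" "annih n (m + 3) (y k) S"
     "\<forall>i\<in>I. i0 \<le> i \<and> i \<le> k \<and> annih n (m + 3) (y i) S"
     "\<forall>p. annih n (m + 3) (y (Suc k)) p \<longrightarrow> (\<forall>i\<in>I. annih n (m + 3) (y i) p) \<longrightarrow> (\<exists>a b. a \<noteq> 0 \<and> (\<forall>j<m + 3. a * p j = b * S j))" for k I i0 S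
  proof -
    have "hgt (m + 3) S \<le> C * (H (Suc k) * M k * M (Suc k) ^ (m - 1) * M i0)"
      by (rule B[rule_format, OF S(1-4), of I]) (use S(5,6) in auto)
    from scaled_ln_mono[OF _ this]
    have "sz (m + 3) S \<le> (real m + 1 + \<mu>) * ln C + ((real m * t + 1) * h (Suc k) - L k - real (m - 1) * L (Suc k) - L i0)"
      using C hgt_pos[OF S(1,2)] by (simp add: scaled_ln_simps sz_def)
    moreover have "(real m + 1 + \<mu>) * ln C + h (Suc k) \<le> L k" "h (Suc i0) \<le> L i0" using K k by auto
    moreover have "real (m - 1) * h (Suc (Suc k)) \<le> real (m - 1) * L (Suc k)" by (rule L_mult_mono) (use K k in auto)
    ultimately show ?thesis using m by (simp add: algebra_simps of_nat_diff)
  qed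
  then show ?thesis by (intro exI[of _ K] allI impI) blast
qed

lemma eventually_pair:
  "\<exists>K. \<forall>k\<ge>K. \<forall>S1 S2 P. primitive S1 \<longrightarrow> primitive S2 \<longrightarrow> supp_below (m + 3) S1 \<longrightarrow> supp_below (m + 3) S2 \<longrightarrow> lin_indep (m + 3) [S1, S2] \<longrightarrow>
     (\<forall>S\<in>{S1, S2}. annih n (m + 3) (y k) S \<and> annih n (m + 3) (y (Suc k)) S) \<longrightarrow>
     primitive P \<longrightarrow> supp_below (m + 2) P \<longrightarrow> annih n (m + 2) (y (Suc k)) P \<longrightarrow> \<not> annih n (m + 2) (y k) P \<longrightarrow>
     h (Suc (Suc k)) \<le> sz (m + 3) S1 + sz (m + 3) S2"
proof -
  obtain C where C: "1 \<le> C" and B: "\<forall>k S1 S2 P. supp_below (m + 3) S1 \<longrightarrow> supp_below (m + 3) S2 \<longrightarrow> lin_indep (m + 3) [S1, S2] \<longrightarrow>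
     (\<forall>S\<in>{S1, S2}. annih n (m + 3) (y k) S \<and> annih n (m + 3) (y (Suc k)) S) \<longrightarrow>
     primitive P \<longrightarrow> supp_below (m + 2) P \<longrightarrow> annih n (m + 2) (y (Suc k)) P \<longrightarrow> \<not> annih n (m + 2) (y k) P \<longrightarrow>
     1 \<le> C * (hgt (m + 3) S1 * hgt (m + 3) S2 * M (Suc k)) ^ m"
    using pair_annih_heights_ge by (elim exE conjE)
  obtain K where K: "\<forall>k\<ge>K. (real m + 1 + \<mu>) * ln C + h (Suc k) \<le> L k \<and> h (Suc k) \<le> L k" using absorb[OF C] by blast
  have "h (Suc (Suc k)) \<le> sz (m + 3) S1 + sz (m + 3) S2" if k: "K \<le> k"
    and pr: "primitive S1" "primitive S2" and S: "supp_below (m + 3) S1" "supp_below (m + 3) S2" "lin_indep (m + 3) [S1, S2]"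
     "\<forall>S\<in>{S1, S2}. annih n (m + 3) (y k) S \<and> annih n (m + 3) (y (Suc k)) S"
    and P: "primitive P" "supp_below (m + 2) P" "annih n (m + 2) (y (Suc k)) P" "\<not> annih n (m + 2) (y k) P" for k S1 S2 P
  proof -
    define z where "z = hgt (m + 3) S1 * hgt (m + 3) S2 * M (Suc k)"
    have z0: "0 < z" unfolding z_def using hgt_pos[OF pr(1) S(1)] hgt_pos[OF pr(2) S(2)] M_pos[of "Suc k"] by simp
    have "1 \<le> C * z ^ m" unfolding z_def using B[rule_format, OF S(1-3) _ P] S(4) by blast
    from scaled_ln_mono[OF _ this]
    have 1: "0 \<le> (real m + 1 + \<mu>) * ln C + real m * ((real m + 1 + \<mu>) * ln z)" using C z0 by (simp add: scaled_ln_simps)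
    have "0 \<le> (real m + 1 + \<mu>) * ln C" using C E_pos by simp
    \<comment> \<open>The constant occurs once, but \<open>z\<close> to the power \<open>m\<close>.
      Enlarging \<open>C\<close> to its \<open>m\<close>-th power allows the root to be
      taken.\<close>
    then have "1 * ((real m + 1 + \<mu>) * ln C) \<le> real m * ((real m + 1 + \<mu>) * ln C)" using m2 by (intro mult_right_mono) auto
    then have "0 \<le> real m * ((real m + 1 + \<mu>) * ln C + (real m + 1 + \<mu>) * ln z)" using 1 unfolding distrib_left by linarith
    then have "0 \<le> (real m + 1 + \<mu>) * ln C + (real m + 1 + \<mu>) * ln z" using m by (simp add: zero_le_mult_iff)
    moreover have "(real m + 1 + \<mu>) * ln z = sz (m + 3) S1 + sz (m + 3) S2 - L (Suc k)"
      unfolding z_def using hgt_pos[OF pr(1) S(1)] hgt_pos[OF pr(2) S(2)] by (simp add: scaled_ln_simps sz_def)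
    moreover have "(real m + 1 + \<mu>) * ln C + h (Suc (Suc k)) \<le> L (Suc k)" using K k by auto
    ultimately show ?thesis by linarith
  qed
  then show ?thesis by (intro exI[of _ K] allI impI) blast
qed

lemma eventually_span:
  "\<exists>K. \<forall>a c S. K \<le> a \<longrightarrow> K \<le> c \<longrightarrow> in_span3 a c \<longrightarrow> primitive S \<longrightarrow> supp_below (m + 3) S \<longrightarrow>
     (\<forall>i\<in>{a, Suc a, Suc (Suc a), c}. annih n (m + 3) (y i) S) \<longrightarrow>
     (\<forall>p. (\<forall>i\<in>{a, Suc a, Suc (Suc a)}. annih n (m + 3) (y i) p) \<longrightarrow> (\<exists>e b. e \<noteq> 0 \<and> (\<forall>j<m + 3. e * p j = b * S j))) \<longrightarrow>
     sz (m + 3) S \<le> real m * t * h (Suc (Suc a)) - h (Suc a) - (real m - 1) * h (Suc c)"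
proof -
  obtain C where C: "1 \<le> C" and B: "\<forall>a c S. in_span3 a c \<longrightarrow> primitive S \<longrightarrow> supp_below (m + 3) S \<longrightarrow>
     (\<forall>i\<in>{a, Suc a, Suc (Suc a), c}. annih n (m + 3) (y i) S) \<longrightarrow>
     (\<forall>p. (\<forall>i\<in>{a, Suc a, Suc (Suc a)}. annih n (m + 3) (y i) p) \<longrightarrow> (\<exists>e b. e \<noteq> 0 \<and> (\<forall>j<m + 3. e * p j = b * S j))) \<longrightarrow>
     hgt (m + 3) S \<le> C * (H (Suc (Suc a)) * M (Suc a) * M a * M c ^ (m - 1))"
    using span_annih_height by (elim exE conjE)
  obtain K where K: "\<forall>k\<ge>K. (real m + 1 + \<mu>) * ln C + h (Suc k) \<le> L k \<and> h (Suc k) \<le> L k" using absorb[OF C] by blast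
  have "sz (m + 3) S \<le> real m * t * h (Suc (Suc a)) - h (Suc a) - (real m - 1) * h (Suc c)" if k: "K \<le> a" "K \<le> c"
    and S: "in_span3 a c" "primitive S" "supp_below (m + 3) S" "\<forall>i\<in>{a, Suc a, Suc (Suc a), c}. annih n (m + 3) (y i) S"
     "\<forall>p. (\<forall>i\<in>{a, Suc a, Suc (Suc a)}. annih n (m + 3) (y i) p) \<longrightarrow> (\<exists>e b. e \<noteq> 0 \<and> (\<forall>j<m + 3. e * p j = b * S j))" for a c S
  proof -
    have "hgt (m + 3) S \<le> C * (H (Suc (Suc a)) * M (Suc a) * M a * M c ^ (m - 1))" using B S by blast
    from scaled_ln_mono[OF _ this]
    have "sz (m + 3) S \<le> (real m + 1 + \<mu>) * ln C + ((real m * t + 1) * h (Suc (Suc a)) - L (Suc a) - L a - real (m - 1) * L c)"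
      using C hgt_pos[OF S(2,3)] by (simp add: scaled_ln_simps sz_def)
    moreover have "(real m + 1 + \<mu>) * ln C + h (Suc (Suc a)) \<le> L (Suc a)" "h (Suc a) \<le> L a" using K k by auto
    moreover have "real (m - 1) * h (Suc c) \<le> real (m - 1) * L c" by (rule L_mult_mono) (use K k in auto)
    ultimately show ?thesis using m by (simp add: algebra_simps of_nat_diff)
  qed
  then show ?thesis by (intro exI[of _ K] allI impI) blast
qed

lemma eventually_spread:
  "\<exists>K. \<forall>a c S G P. K \<le> a \<longrightarrow> Suc (Suc a) \<le> c \<longrightarrow> in_span3 a c \<longrightarrow> \<not> in_span3 a (Suc c) \<longrightarrow>
     primitive S \<longrightarrow> supp_below (m + 3) S \<longrightarrow> (\<forall>i\<in>{a, Suc a, Suc (Suc a), c, Suc c}. annih n (m + 3) (y i) S) \<longrightarrow>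
     supp_below (m + 3) G \<longrightarrow> annih n (m + 3) (y c) G \<longrightarrow> annih n (m + 3) (y (Suc c)) G \<longrightarrow> lin_indep (m + 3) [S, G] \<longrightarrow>
     supp_below (m + 2) P \<longrightarrow> annih n (m + 2) (y (Suc c)) P \<longrightarrow> \<not> annih n (m + 2) (y c) P \<longrightarrow>
     2 * sz (m + 3) S \<le> (2 + \<mu>) * h (Suc c) - h (Suc (Suc a)) - h (Suc a)"
proof -
  obtain C where C: "1 \<le> C" and B: "\<forall>a c S G P. Suc (Suc a) \<le> c \<longrightarrow> in_span3 a c \<longrightarrow> \<not> in_span3 a (Suc c) \<longrightarrow>
     primitive S \<longrightarrow> supp_below (m + 3) S \<longrightarrow> (\<forall>i\<in>{a, Suc a, Suc (Suc a), c, Suc c}. annih n (m + 3) (y i) S) \<longrightarrow>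
     supp_below (m + 3) G \<longrightarrow> annih n (m + 3) (y c) G \<longrightarrow> annih n (m + 3) (y (Suc c)) G \<longrightarrow> lin_indep (m + 3) [S, G] \<longrightarrow>
     supp_below (m + 2) P \<longrightarrow> annih n (m + 2) (y (Suc c)) P \<longrightarrow> \<not> annih n (m + 2) (y c) P \<longrightarrow>
     hgt (m + 3) S ^ 2 \<le> C * (H (Suc c) * M c * M (Suc c) ^ (m - 2) * M (Suc a) * M a)"
    using spread_annih_height by (elim exE conjE)
  obtain K where K: "\<forall>k\<ge>K. (real m + 1 + \<mu>) * ln C + h (Suc k) \<le> L k \<and> h (Suc k) \<le> L k" using absorb[OF C] by blast
  have "2 * sz (m + 3) S \<le> (2 + \<mu>) * h (Suc c) - h (Suc (Suc a)) - h (Suc a)" if k: "K \<le> a" and ac: "Suc (Suc a) \<le> c"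
    and S: "in_span3 a c" "\<not> in_span3 a (Suc c)" "primitive S" "supp_below (m + 3) S" "\<forall>i\<in>{a, Suc a, Suc (Suc a), c, Suc c}. annih n (m + 3) (y i) S"
    and G: "supp_below (m + 3) G" "annih n (m + 3) (y c) G" "annih n (m + 3) (y (Suc c)) G" "lin_indep (m + 3) [S, G]"
    and P: "supp_below (m + 2) P" "annih n (m + 2) (y (Suc c)) P" "\<not> annih n (m + 2) (y c) P" for a c S G P
  proof -
    have "hgt (m + 3) S ^ 2 \<le> C * (H (Suc c) * M c * M (Suc c) ^ (m - 2) * M (Suc a) * M a)"
      by (rule B[rule_format, OF ac S(1-4) _ G P]) (use S(5) in blast)
    from scaled_ln_mono[OF _ this]
    have "2 * sz (m + 3) S \<le> (real m + 1 + \<mu>) * ln C + ((real m * t + 1) * h (Suc c) - L c - real (m - 2) * L (Suc c) - L (Suc a) - L a)"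
      using C hgt_pos[OF S(3,4)] by (simp add: scaled_ln_simps sz_def)
    moreover have "(real m + 1 + \<mu>) * ln C + h (Suc c) \<le> L c" "h (Suc a) \<le> L a" "h (Suc (Suc a)) \<le> L (Suc a)" using K k ac by auto
    moreover have "real (m - 2) * h (Suc (Suc c)) \<le> real (m - 2) * L (Suc c)" by (rule L_mult_mono) (use K k ac in auto)
    moreover have "real (m - 2) * h (Suc c) \<le> real (m - 2) * h (Suc (Suc c))" by (intro mult_left_mono h_mono) auto
    ultimately have "2 * sz (m + 3) S \<le> real m * t * h (Suc c) - real (m - 2) * h (Suc c) - h (Suc (Suc a)) - h (Suc a)" by (simp add: algebra_simps)
    then show ?thesis using m unfolding mt by (simp add: algebra_simps of_nat_diff)
  qed
  then show ?thesis by (intro exI[of _ K] allI impI) blast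
qed

lemma P_ex: "\<exists>P. primitive P \<and> supp_below (m + 2) P \<and> annih n (m + 2) (y k) P"
  by (rule exists_primitive_annih[of _ _ 1]) (use n in auto)

text \<open>\<open>y k\<close> has \<open>m + 1\<close> independent blocks of length
  \<open>m + 2\<close>, and their kernel is a line.\<close>

lemma P_unique:
  assumes P: "primitive P" "supp_below (m + 2) P" "annih n (m + 2) (y k) P" and p: "annih n (m + 2) (y k) p"
  shows "\<exists>a b. a \<noteq> 0 \<and> (\<forall>j<m + 2. a * p j = b * P j)"
proof -
  have N: "m + 2 \<le> n + 1" using n by simp
  have "\<exists>a c. a \<noteq> 0 \<and> (\<forall>j<m + 2. a * p j = (\<Sum>i<length [P]. c i * ([P] ! i) j))"
  proof (rule killed_in_span)
    show "lin_indep (m + 2) (shift_rows n (m + 2) (y k))" by (rule full_rank_indep[OF fr]) (use n in auto)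
    show "lin_indep (m + 2) [P]" by (rule lin_indep_singleton[OF primitive_nonzero[OF P(1,2)]])
    show "killed (m + 2) (set (shift_rows n (m + 2) (y k))) g" if "g \<in> set [P]" for g
      using that P(3) killed_shift_rows[OF N] by simp
    show "m + 2 \<le> length (shift_rows n (m + 2) (y k)) + length [P]" using n by simp
    show "killed (m + 2) (set (shift_rows n (m + 2) (y k))) p" using p killed_shift_rows[OF N] by simp
  qed
  then obtain a c where ac: "a \<noteq> 0" "\<forall>j<m + 2. a * p j = (\<Sum>i<length [P]. c i * ([P] ! i) j)" by (elim exE conjE)
  show ?thesis by (rule exI[of _ a], rule exI[of _ "c 0"]) (use ac in simp)
qed

text \<open>
  An annihilator common to \<open>y k\<close>, \<open>y (k + 1)\<close> is inherited by \<open>y (k - 1)\<close>; if this happened for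
  arbitrarily large \<open>k\<close>, one annihilator would kill infinitely many points.
\<close>

lemma eventually_not_annih:
  "\<exists>K. \<forall>k\<ge>K. \<forall>P. primitive P \<longrightarrow> supp_below (m + 2) P \<longrightarrow> annih n (m + 2) (y (Suc k)) P \<longrightarrow> \<not> annih n (m + 2) (y k) P"
proof -
  obtain K1 where K1: "\<forall>k\<ge>K1. \<forall>p. annih n (m + 2) (y (Suc k)) p \<longrightarrow> \<not> annih n (m + 2) (y k) p \<longrightarrow> h (Suc (Suc k)) \<le> t * h (Suc k)"
    using eventually_growth by (elim exE)
  obtain K2 where K2: "\<forall>k\<ge>K2. \<forall>N p. 1 \<le> N \<longrightarrow> N \<le> n + 1 \<longrightarrow> annih n N (y (Suc k)) p \<longrightarrow> \<not> annih n N (y k) p \<longrightarrow> h (Suc k) \<le> sz N p"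
    using eventually_value by (elim exE)
  obtain K3 where K3: "\<forall>k\<ge>K3. \<forall>P. primitive P \<longrightarrow> supp_below (m + 2) P \<longrightarrow> annih n (m + 2) (y k) P \<longrightarrow> annih n (m + 2) (y (Suc k)) P \<longrightarrow>
     2 * sz (m + 2) P \<le> (1 + \<mu>) * h (Suc k)"
    using eventually_double by (elim exE)
  define K where "K = max K1 (max K2 K3)"
  have N: "1 \<le> m + 2" "m + 2 \<le> n + 1" using n by auto
  have step: "annih n (m + 2) (y k) P"
    if k: "K \<le> k" and P: "primitive P" "supp_below (m + 2) P" "annih n (m + 2) (y (Suc k)) P" "annih n (m + 2) (y (Suc (Suc k))) P" for k P
  proof (rule ccontr)
    assume no: "\<not> annih n (m + 2) (y k) P"
    have a: "K1 \<le> k" "K2 \<le> k" "K3 \<le> Suc k" using k by (auto simp: K_def)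
    have 1: "h (Suc (Suc k)) \<le> t * h (Suc k)" using K1[rule_format, OF a(1) P(3) no] .
    have 2: "h (Suc k) \<le> sz (m + 2) P" using K2[rule_format, OF a(2) N P(3) no] .
    have 3: "2 * sz (m + 2) P \<le> (1 + \<mu>) * h (Suc (Suc k))" using K3[rule_format, OF a(3) P] .
    \<comment> \<open>Growth by at most \<open>t\<close>, size at least \<open>h (Suc k)\<close> and
      the bound for twice the size are compatible only if
      \<open>(1 + \<mu>) * t \<ge> 2\<close>.\<close>
    have "(1 + \<mu>) * h (Suc (Suc k)) \<le> (1 + \<mu>) * (t * h (Suc k))" using 1 mu_pos by (intro mult_left_mono) auto
    also have "\<dots> = ((1 + \<mu>) * t) * h (Suc k)" by simp
    also have "\<dots> < 2 * h (Suc k)" using mut h_pos by (intro mult_strict_right_mono) auto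
    finally show False using 2 3 by linarith
  qed
  have down: "annih n (m + 2) (y K) P"
    if P: "primitive P" "supp_below (m + 2) P" "annih n (m + 2) (y (K + i)) P" "annih n (m + 2) (y (Suc (K + i))) P" for i P
    using P
  proof (induction i)
    case (Suc i)
    have "annih n (m + 2) (y (K + i)) P" by (rule step[OF _ P(1,2)]) (use Suc.prems in simp_all)
    then show ?case using Suc.IH[OF P(1,2)] Suc.prems by simp
  qed simp
  obtain P0 where P0: "primitive P0" "supp_below (m + 2) P0" "annih n (m + 2) (y K) P0" using P_ex by blast
  obtain K' where K': "\<forall>k\<ge>K'. \<not> annih n (m + 2) (y k) P0"
    using finitely_many_annihilated[OF primitive_nonzero[OF P0(1,2)] N(2) M0] by blast
  have "\<not> annih n (m + 2) (y k) P" if k: "max K K' \<le> k" and P: "primitive P" "supp_below (m + 2) P" "annih n (m + 2) (y (Suc k)) P" for k P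
  proof
    assume a: "annih n (m + 2) (y k) P"
    obtain i where i: "k = K + i" using k by (metis le_Suc_ex max.bounded_iff)
    have "annih n (m + 2) (y K) P" by (rule down[OF P(1,2)]) (use a P(3) i in auto)
    from P_unique[OF P(1,2) this P0(3)] obtain c b where "c \<noteq> 0" "\<forall>j<m + 2. c * P0 j = b * P j" by blast
    then have "annih n (m + 2) (y k) P0" by (rule annih_proportional[OF _ _ a])
    then show False using K' k by simp
  qed
  then show ?thesis by blast
qed

end

text \<open>The eventual statements are assumed from one common index \<open>K\<close> on. What
  follows is then pure combinatorics of annihilators, with the numerical lemmas as the only analytic
  input.\<close>

locale tail_sequence = exponent_sequence +
  fixes K :: nat
  assumes tP: "\<And>k P. K \<le> k \<Longrightarrow> primitive P \<Longrightarrow> supp_below (m + 2) P \<Longrightarrow> annih n (m + 2) (y (Suc k)) P \<Longrightarrow> \<not> annih n (m + 2) (y k) P"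
    and tG: "\<And>k. K \<le> k \<Longrightarrow> h (Suc (Suc k)) \<le> t * h (Suc k)"
    and tV: "\<And>k p. K \<le> k \<Longrightarrow> annih n (m + 3) (y (Suc k)) p \<Longrightarrow> \<not> annih n (m + 3) (y k) p \<Longrightarrow> h (Suc k) \<le> sz (m + 3) p"
    and tF: "\<And>k. K \<le> k \<Longrightarrow> \<exists>p. nonzero_below (m + 3) p \<and> annih n (m + 3) (y k) p \<and> annih n (m + 3) (y (Suc k)) p \<and> annih n (m + 3) (y (Suc (Suc k))) p"
    and tU: "\<And>k I i0 S. K \<le> i0 \<Longrightarrow> i0 \<le> k \<Longrightarrow> primitive S \<Longrightarrow> supp_below (m + 3) S \<Longrightarrow> annih n (m + 3) (y (Suc k)) S \<Longrightarrow> annih n (m + 3) (y k) S \<Longrightarrow>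
     (\<forall>i\<in>I. i0 \<le> i \<and> i \<le> k \<and> annih n (m + 3) (y i) S) \<Longrightarrow>
     (\<forall>p. annih n (m + 3) (y (Suc k)) p \<longrightarrow> (\<forall>i\<in>I. annih n (m + 3) (y i) p) \<longrightarrow> (\<exists>a b. a \<noteq> 0 \<and> (\<forall>j<m + 3. a * p j = b * S j))) \<Longrightarrow>
     sz (m + 3) S \<le> real m * t * h (Suc k) - (real m - 1) * h (Suc (Suc k)) - h (Suc i0)"
    and tN: "\<And>k S1 S2. K \<le> k \<Longrightarrow> primitive S1 \<Longrightarrow> primitive S2 \<Longrightarrow> supp_below (m + 3) S1 \<Longrightarrow> supp_below (m + 3) S2 \<Longrightarrow> lin_indep (m + 3) [S1, S2] \<Longrightarrow>
     (\<forall>S\<in>{S1, S2}. annih n (m + 3) (y k) S \<and> annih n (m + 3) (y (Suc k)) S) \<Longrightarrow>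
     h (Suc (Suc k)) \<le> sz (m + 3) S1 + sz (m + 3) S2"
    and tW: "\<And>a c S. K \<le> a \<Longrightarrow> K \<le> c \<Longrightarrow> in_span3 a c \<Longrightarrow> primitive S \<Longrightarrow> supp_below (m + 3) S \<Longrightarrow>
     (\<forall>i\<in>{a, Suc a, Suc (Suc a), c}. annih n (m + 3) (y i) S) \<Longrightarrow>
     (\<forall>p. (\<forall>i\<in>{a, Suc a, Suc (Suc a)}. annih n (m + 3) (y i) p) \<longrightarrow> (\<exists>e b. e \<noteq> 0 \<and> (\<forall>j<m + 3. e * p j = b * S j))) \<Longrightarrow>
     sz (m + 3) S \<le> real m * t * h (Suc (Suc a)) - h (Suc a) - (real m - 1) * h (Suc c)"
    and tS: "\<And>a c S G. K \<le> a \<Longrightarrow> Suc (Suc a) \<le> c \<Longrightarrow> in_span3 a c \<Longrightarrow> \<not> in_span3 a (Suc c) \<Longrightarrow>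
     primitive S \<Longrightarrow> supp_below (m + 3) S \<Longrightarrow> (\<forall>i\<in>{a, Suc a, Suc (Suc a), c, Suc c}. annih n (m + 3) (y i) S) \<Longrightarrow>
     supp_below (m + 3) G \<Longrightarrow> annih n (m + 3) (y c) G \<Longrightarrow> annih n (m + 3) (y (Suc c)) G \<Longrightarrow> lin_indep (m + 3) [S, G] \<Longrightarrow>
     2 * sz (m + 3) S \<le> (2 + \<mu>) * h (Suc c) - h (Suc (Suc a)) - h (Suc a)"
begin

section \<open>Common annihilators of triples and their changes\<close>

definition tri :: "nat \<Rightarrow> (nat \<Rightarrow> int) \<Rightarrow> bool" where
  "tri k S \<longleftrightarrow> primitive S \<and> supp_below (m + 3) S \<and> annih n (m + 3) (y k) S \<and> annih n (m + 3) (y (Suc k)) S \<and> annih n (m + 3) (y (Suc (Suc k))) S"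

lemma triD:
  assumes "tri k S"
  shows "primitive S" "supp_below (m + 3) S" "nonzero_below (m + 3) S"
    "i \<in> {k, Suc k, Suc (Suc k)} \<Longrightarrow> annih n (m + 3) (y i) S"
  using assms primitive_nonzero[of S "m + 3"] unfolding tri_def by auto

lemma tri_ex:
  assumes "K \<le> k"
  shows "\<exists>S. tri k S"
proof -
  obtain p where p: "nonzero_below (m + 3) p" "annih n (m + 3) (y k) p" "annih n (m + 3) (y (Suc k)) p" "annih n (m + 3) (y (Suc (Suc k))) p"
    using tF[OF assms] by blast
  obtain g p' where g: "g \<noteq> 0" "primitive p'" "supp_below (m + 3) p'" "\<forall>j<m + 3. p j = g * p' j" using primitive_part[OF p(1)] by blast
  have "annih n (m + 3) (y i) p'" if "annih n (m + 3) (y i) p" for i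
    by (rule annih_proportional[OF g(1) _ that, where b = 1]) (use g(4) in simp)
  then have "tri k p'" using p g unfolding tri_def by blast
  then show ?thesis by blast
qed

text \<open>A second annihilator independent of \<open>S\<close> would, by
  \<open>annih_pencil_plane\<close> applied with the generator \<open>P\<close> of the middle point,
  put the third point into the plane of the first two.\<close>

lemma tri_unique:
  assumes k: "K \<le> k" and S: "tri k S" and p: "\<And>i. i \<in> {k, Suc k, Suc (Suc k)} \<Longrightarrow> annih n (m + 3) (y i) p"
  shows "\<exists>a b. a \<noteq> 0 \<and> (\<forall>j<m + 3. a * p j = b * S j)"
proof (rule ccontr)
  assume "\<not> ?thesis"
  then have li: "lin_indep (m + 3) [S, p]" using lin_indep_pair_or_proportional[OF triD(3)[OF S], of p] by satx
  obtain P where P: "primitive P" "supp_below (m + 2) P" "annih n (m + 2) (y (Suc k)) P" using P_ex by blast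
  have "\<exists>a b c. a \<noteq> 0 \<and> (\<forall>j. a * y (Suc (Suc k)) j = b * y (Suc k) j + c * y k j)"
    by (rule annih_pencil_plane[OF n m fr supp_y supp_y P(2,3) tP[OF k P] li]) (use S p in \<open>auto simp: tri_def\<close>)
  then obtain a b c where a: "a \<noteq> 0" and e: "\<forall>j. a * y (Suc (Suc k)) j = b * y (Suc k) j + c * y k j" by (elim exE conjE)
  have "(- c) * y k j + (- b) * y (Suc k) j + a * y (Suc (Suc k)) j = 0" for j using e by simp
  then show False using indep3[of "- c" k "- b" a] a by blast
qed

lemma tri_transfer:
  assumes "K \<le> k" "tri k S" "tri k S'" "annih n (m + 3) (y i) S"
  shows "annih n (m + 3) (y i) S'"
proof -
  obtain a b where "a \<noteq> 0" "\<forall>j<m + 3. a * S' j = b * S j"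
    using tri_unique[OF assms(1,2), of S'] triD(4)[OF assms(3)] by blast
  then show ?thesis by (rule annih_proportional[OF _ _ assms(4)])
qed

text \<open>The common annihilator of three consecutive points changes at \<open>a\<close>.\<close>

definition junction :: "nat \<Rightarrow> (nat \<Rightarrow> int) \<Rightarrow> (nat \<Rightarrow> int) \<Rightarrow> bool" where
  "junction a S' S \<longleftrightarrow> tri a S' \<and> tri (Suc a) S \<and> \<not> annih n (m + 3) (y (a + 3)) S'"

text \<open>If \<open>S\<close> killed \<open>y a\<close> as well, uniqueness at \<open>a\<close>
  would identify it with \<open>S'\<close>; but \<open>S\<close> kills \<open>y (a + 3)\<close> and
  \<open>S'\<close> does not. The same test separates \<open>S\<close> and \<open>S'\<close> as
  vectors.\<close>

lemma junctionD:
  assumes k: "K \<le> a" and j: "junction a S' S"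
  shows "\<not> annih n (m + 3) (y a) S" "lin_indep (m + 3) [S, S']"
proof -
  have S: "tri a S'" "tri (Suc a) S" "\<not> annih n (m + 3) (y (a + 3)) S'" using j by (auto simp: junction_def)
  have S3: "annih n (m + 3) (y (a + 3)) S" using triD(4)[OF S(2), of "a + 3"] by (simp add: eval_nat_numeral)
  show "\<not> annih n (m + 3) (y a) S"
  proof
    assume "annih n (m + 3) (y a) S"
    then have "tri a S" using S(2) by (auto simp: tri_def)
    from tri_transfer[OF k this S(1) S3] show False using S(3) by blast
  qed
  show "lin_indep (m + 3) [S, S']"
  proof (rule ccontr)
    assume "\<not> ?thesis"
    then obtain c b where "c \<noteq> 0" "\<forall>j<m + 3. c * S' j = b * S j"
      using lin_indep_pair_or_proportional[OF triD(3)[OF S(2)], of S'] by blast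
    then have "annih n (m + 3) (y (a + 3)) S'" by (rule annih_proportional[OF _ _ S3])
    then show False using S(3) by blast
  qed
qed

lemma junction_ge: "K \<le> a \<Longrightarrow> junction a S' S \<Longrightarrow> h (Suc a) \<le> sz (m + 3) S"
  by (rule tV[OF _ _ junctionD(1)]) (auto simp: junction_def tri_def)

lemma junction_pair:
  assumes k: "K \<le> a" and j: "junction a S' S"
  shows "h (a + 3) \<le> sz (m + 3) S + sz (m + 3) S'"
proof -
  have S: "tri a S'" "tri (Suc a) S" using j by (auto simp: junction_def)
  have "h (Suc (Suc (Suc a))) \<le> sz (m + 3) S + sz (m + 3) S'"
    by (rule tN) (use k S junctionD(2)[OF k j] in \<open>auto simp: tri_def\<close>)
  then show ?thesis by (simp add: eval_nat_numeral)
qed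

lemma tri_height:
  assumes "K \<le> k" "tri k S"
  shows "sz (m + 3) S \<le> real m * t * h (k + 2) - (real m - 1) * h (k + 3) - h (k + 1)"
proof -
  have "sz (m + 3) S \<le> real m * t * h (Suc (Suc k)) - (real m - 1) * h (Suc (Suc (Suc k))) - h (Suc k)"
  proof (rule tU[where I = "{k, Suc k}"])
    show "\<forall>p. annih n (m + 3) (y (Suc (Suc k))) p \<longrightarrow> (\<forall>i\<in>{k, Suc k}. annih n (m + 3) (y i) p) \<longrightarrow> (\<exists>a b. a \<noteq> 0 \<and> (\<forall>j<m + 3. a * p j = b * S j))"
    proof (intro allI impI)
      fix p assume "annih n (m + 3) (y (Suc (Suc k))) p" "\<forall>i\<in>{k, Suc k}. annih n (m + 3) (y i) p"
      then show "\<exists>a b. a \<noteq> 0 \<and> (\<forall>j<m + 3. a * p j = b * S j)" by (intro tri_unique[OF assms]) auto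
    qed
  qed (use assms in \<open>auto simp: tri_def\<close>)
  then show ?thesis by (simp add: eval_nat_numeral)
qed

text \<open>The lower bound \<open>junction_ge\<close> for the new annihilator is played off against
  the upper bound \<open>tri_height\<close> for the same polynomial.\<close>

lemma junction_growth:
  assumes k: "K \<le> a" and j: "junction a S' S"
  shows "h (a + 2) + h (a + 1) \<le> (1 + \<mu>) * h (a + 3)"
proof -
  have S: "tri (Suc a) S" using j by (auto simp: junction_def)
  have "sz (m + 3) S \<le> real m * t * h (a + 3) - (real m - 1) * h (a + 4) - h (a + 2)"
    using tri_height[OF _ S] k by (simp add: eval_nat_numeral)
  moreover have "(real m - 1) * h (a + 3) \<le> (real m - 1) * h (a + 4)" using m2 by (intro mult_left_mono h_mono) auto
  ultimately have "sz (m + 3) S \<le> real m * t * h (a + 3) - (real m - 1) * h (a + 3) - h (a + 2)" by linarith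
  then show ?thesis using junction_ge[OF k j] unfolding mt by (simp add: algebra_simps)
qed

lemma annih_in_span3:
  assumes "tri b S" "in_span3 b i"
  shows "annih n (m + 3) (y i) S"
  unfolding annih_def
proof (intro allI impI)
  fix k assume k: "k + (m + 3) \<le> n + 1"
  have e: "comb_shift (Suc k) (unit_row k) x = shift k x" for x by (rule comb_shift_unit_row) simp
  have "dotp (m + 3) (comb_shift (Suc k) (unit_row k) (y i)) S = 0"
    by (rule in_span3_dotp[OF assms(2)]) (use triD(4)[OF assms(1)] k in \<open>simp add: e annih_def\<close>)
  then show "dotp (m + 3) (shift k (y i)) S = 0" by (simp add: e)
qed

lemma tri_span_height:
  assumes k: "K \<le> b" "K \<le> c" and S: "tri b S" and c: "in_span3 b c"
  shows "sz (m + 3) S \<le> real m * t * h (b + 2) - h (b + 1) - (real m - 1) * h (c + 1)"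
proof -
  have "sz (m + 3) S \<le> real m * t * h (Suc (Suc b)) - h (Suc b) - (real m - 1) * h (Suc c)"
  proof (rule tW[OF k c])
    show "\<forall>p. (\<forall>i\<in>{b, Suc b, Suc (Suc b)}. annih n (m + 3) (y i) p) \<longrightarrow> (\<exists>e b. e \<noteq> 0 \<and> (\<forall>j<m + 3. e * p j = b * S j))"
    proof (rule allI, rule impI)
      fix p assume "\<forall>i\<in>{b, Suc b, Suc (Suc b)}. annih n (m + 3) (y i) p"
      then show "\<exists>e b. e \<noteq> 0 \<and> (\<forall>j<m + 3. e * p j = b * S j)" by (intro tri_unique[OF k(1) S]) blast
    qed
    show "\<forall>i\<in>{b, Suc b, Suc (Suc b), c}. annih n (m + 3) (y i) S" 
    proof
      fix i assume "i \<in> {b, Suc b, Suc (Suc b), c}"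
      then have "i \<in> {b, Suc b, Suc (Suc b)} \<or> i = c" by blast
      then show "annih n (m + 3) (y i) S" using triD(4)[OF S] annih_in_span3[OF S c] by (elim disjE) simp_all
    qed
  qed (rule triD(1,2)[OF S])+
  then show ?thesis by (simp add: eval_nat_numeral)
qed

lemma in_span3_refl: "i \<in> {b, Suc b, Suc (Suc b)} \<Longrightarrow> in_span3 b i"
proof -
  assume "i \<in> {b, Suc b, Suc (Suc b)}"
  then have "i = b \<or> i = Suc b \<or> i = Suc (Suc b)" by simp
  then show ?thesis unfolding in_span3_def
  proof (elim disjE)
    assume i: "i = b"
    show "\<exists>d g1 g2 g3. d \<noteq> 0 \<and> (\<forall>j. d * y i j = g1 * y b j + g2 * y (Suc b) j + g3 * y (Suc (Suc b)) j)" by (rule exI[of _ 1], rule exI[of _ 1], rule exI[of _ 0], rule exI[of _ 0]) (simp add: i)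
  next
    assume i: "i = Suc b"
    show "\<exists>d g1 g2 g3. d \<noteq> 0 \<and> (\<forall>j. d * y i j = g1 * y b j + g2 * y (Suc b) j + g3 * y (Suc (Suc b)) j)" by (rule exI[of _ 1], rule exI[of _ 0], rule exI[of _ 1], rule exI[of _ 0]) (simp add: i)
  next
    assume i: "i = Suc (Suc b)"
    show "\<exists>d g1 g2 g3. d \<noteq> 0 \<and> (\<forall>j. d * y i j = g1 * y b j + g2 * y (Suc b) j + g3 * y (Suc (Suc b)) j)" by (rule exI[of _ 1], rule exI[of _ 0], rule exI[of _ 0], rule exI[of _ 1]) (simp add: i)
  qed
qed

lemma growth: "Suc K \<le> k \<Longrightarrow> h (Suc k) \<le> t * h k"
  using tG[of "k - 1"] by (cases k) auto

lemma tri_kills_finitely: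
  assumes "tri b S"
  shows "\<exists>i\<ge>b. \<not> annih n (m + 3) (y i) S"
proof -
  obtain K' where "\<forall>k\<ge>K'. \<not> annih n (m + 3) (y k) S"
    using finitely_many_annihilated[OF triD(3)[OF assms] _ M0] n m by auto
  then show ?thesis by (intro exI[of _ "max b K'"]) simp
qed

text \<open>The span cannot contain the whole tail: \<open>S\<close> annihilates every point in it,
  but only finitely many points of the sequence.\<close>

lemma span_top:
  assumes S: "tri b S"
  shows "\<exists>c\<ge>b + 2. (\<forall>i. b \<le> i \<and> i \<le> c \<longrightarrow> in_span3 b i) \<and> \<not> in_span3 b (Suc c)"
proof -
  have ex: "\<exists>i. b \<le> i \<and> \<not> in_span3 b i" using tri_kills_finitely[OF S] annih_in_span3[OF S] by blast
  define i0 where "i0 = (LEAST i. b \<le> i \<and> \<not> in_span3 b i)"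
  have i0: "b \<le> i0" "\<not> in_span3 b i0" using LeastI_ex[OF ex] by (auto simp: i0_def)
  have min: "in_span3 b i" if "b \<le> i" "i < i0" for i using not_less_Least[of i "\<lambda>i. b \<le> i \<and> \<not> in_span3 b i"] that by (auto simp: i0_def)
  have "i0 \<notin> {b, Suc b, Suc (Suc b)}" using i0(2) in_span3_refl by blast
  then have "b + 3 \<le> i0" using i0(1) by auto
  then obtain c where c: "i0 = Suc c" "b + 2 \<le> c" by (cases i0) auto
  show ?thesis by (rule exI[of _ c]) (use c i0 min in auto)
qed

text \<open>\<open>c\<close> is the last index up to which all points stay in the span of the triple
  of \<open>S\<close>. If \<open>S\<close> survives at \<open>y (c + 1)\<close>, there are two
  possibilities. Either it is the only common annihilator of \<open>y c\<close> and
  \<open>y (c + 1)\<close>, which gives the bound by \<mu>, or a second one \<open>G\<close> exists,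
  which \<open>spread_contradiction\<close> rules out.\<close>

lemma junction_cases:
  assumes k: "K \<le> a" and j: "junction a S' S"
  shows "\<exists>c\<ge>a + 3. (\<forall>i. Suc a \<le> i \<and> i \<le> c \<longrightarrow> in_span3 (Suc a) i) \<and> (sz (m + 3) S \<le> \<mu> * h (c + 1) \<or> \<not> annih n (m + 3) (y (c + 1)) S)"
proof -
  have S: "tri (Suc a) S" using j by (simp add: junction_def)
  obtain c where c: "Suc a + 2 \<le> c" "\<forall>i. Suc a \<le> i \<and> i \<le> c \<longrightarrow> in_span3 (Suc a) i" "\<not> in_span3 (Suc a) (Suc c)"
    using span_top[OF S] by blast
  have spc: "in_span3 (Suc a) c" using c by simp
  have Sc: "annih n (m + 3) (y c) S" by (rule annih_in_span3[OF S spc])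
  have Kc: "K \<le> c" using k c by simp
  have "sz (m + 3) S \<le> \<mu> * h (c + 1)" if Sc1: "annih n (m + 3) (y (Suc c)) S"
  proof (cases "\<forall>p. annih n (m + 3) (y (Suc c)) p \<longrightarrow> (\<forall>i\<in>{c}. annih n (m + 3) (y i) p) \<longrightarrow> (\<exists>a b. a \<noteq> 0 \<and> (\<forall>j<m + 3. a * p j = b * S j))")
    case True
    have "sz (m + 3) S \<le> real m * t * h (Suc c) - (real m - 1) * h (Suc (Suc c)) - h (Suc c)"
      by (rule tU[OF Kc order_refl triD(1,2)[OF S] Sc1 Sc _ True]) (use Sc in simp)
    moreover have "(real m - 1) * h (Suc c) \<le> (real m - 1) * h (Suc (Suc c))" using m2 by (intro mult_left_mono h_mono) auto
    ultimately have "sz (m + 3) S \<le> real m * t * h (Suc c) - (real m - 1) * h (Suc c) - h (Suc c)" by linarith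
    then show ?thesis unfolding mt by (simp add: algebra_simps)
  next
    case False
    then obtain p where p: "annih n (m + 3) (y (Suc c)) p" "annih n (m + 3) (y c) p" "\<not> (\<exists>a b. a \<noteq> 0 \<and> (\<forall>j<m + 3. a * p j = b * S j))" by blast
    define G where "G = (\<lambda>j. if j < m + 3 then p j else 0)"
    have sG: "supp_below (m + 3) G" by (simp add: supp_below_def G_def)
    have aG: "annih n (m + 3) x G \<longleftrightarrow> annih n (m + 3) x p" for x by (rule annih_cong) (simp add: G_def)
    have "\<not> (\<exists>a b. a \<noteq> 0 \<and> (\<forall>j<m + 3. a * G j = b * S j))" using p(3) by (simp add: G_def)
    then have li: "lin_indep (m + 3) [S, G]" using lin_indep_pair_or_proportional[OF triD(3)[OF S], of G] by satx
    have "2 * sz (m + 3) S \<le> (2 + \<mu>) * h (Suc c) - h (Suc (Suc (Suc a))) - h (Suc (Suc a))"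
    proof (rule tS[OF _ _ spc c(3) triD(1,2)[OF S] _ sG _ _ li])
      show "\<forall>i\<in>{Suc a, Suc (Suc a), Suc (Suc (Suc a)), c, Suc c}. annih n (m + 3) (y i) S" using S Sc Sc1 by (auto simp: tri_def)
    qed (use k c p aG in auto)
    moreover have "sz (m + 3) S \<le> real m * t * h (Suc a + 2) - h (Suc a + 1) - (real m - 1) * h (c + 1)"
      by (rule tri_span_height[OF _ Kc S spc]) (use k in simp)
    ultimately have False
      using spread_contradiction[of "h (Suc a)" "h (Suc (Suc a))" "h (Suc (Suc (Suc a)))" "sz (m + 3) S" "h (Suc c)"]
        h_pos[of "Suc a"] tG[of a] tG[of "Suc a"] k h_mono[of "Suc a" "Suc (Suc a)"] junction_ge[OF k j] by simp
    then show ?thesis ..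
  qed
  then show ?thesis using c by (intro exI[of _ c]) auto
qed

lemma next_junction:
  assumes k: "K \<le> a" and S: "tri (Suc a) S" and d: "Suc a \<le> d" "\<forall>i. Suc a \<le> i \<and> i \<le> d + 2 \<longrightarrow> in_span3 (Suc a) i"
    and nk: "\<not> annih n (m + 3) (y (d + 3)) S"
  shows "\<exists>S2. junction d S S2"
proof -
  have "annih n (m + 3) (y i) S" if "i \<in> {d, Suc d, Suc (Suc d)}" for i
    by (rule annih_in_span3[OF S d(2)[rule_format]]) (use d(1) that in auto)
  then have "tri d S" using triD(1,2)[OF S] by (simp add: tri_def)
  moreover obtain S2 where "tri (Suc d) S2" using tri_ex[of "Suc d"] k d by auto
  ultimately show ?thesis using nk by (auto simp: junction_def)
qed

text \<open>\<open>S\<close> appears at \<open>a\<close> and is lost at \<open>d\<close>, while the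
  points up to \<open>d + 2\<close> stay in the span of its triple. The two changes alone force
  \<open>m = 2\<close>. In that case the span of the next annihilator \<open>S2\<close> is followed
  to its end, where \<open>junction_cases\<close> supplies the alternative of
  \<open>chained_contradiction\<close>.\<close>

lemma no_chained_junctions:
  assumes k: "K \<le> a" and j: "junction a S' S" and d: "Suc a \<le> d" "\<forall>i. Suc a \<le> i \<and> i \<le> d + 2 \<longrightarrow> in_span3 (Suc a) i"
    and nk: "\<not> annih n (m + 3) (y (d + 3)) S"
  shows False
proof -
  have S: "tri (Suc a) S" using j by (simp add: junction_def)
  obtain S2 where j2: "junction d S S2" using next_junction[OF k S d nk] by blast
  have Kd: "K \<le> d" using k d by simp
  define h0 h1 h2 where "h0 = h (a + 1)" and "h1 = h (a + 2)" and "h2 = h (a + 3)"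
  define g0 g1 g2 where "g0 = h (d + 1)" and "g1 = h (d + 2)" and "g2 = h (d + 3)"
  have hh: "0 < h0" "h1 \<le> t * h0" "h2 \<le> t * h1" "h0 \<le> h1" "h1 \<le> h2"
    unfolding h0_def h1_def h2_def using h_pos growth[of "a + 1"] growth[of "a + 2"] k
    by (auto simp: eval_nat_numeral intro!: h_mono)
  have gg: "h2 \<le> g1" "g1 \<le> t * g0" "g1 \<le> g2" "h1 \<le> g0"
    unfolding h1_def h2_def g0_def g1_def g2_def using growth[of "d + 1"] Kd d by (auto simp: eval_nat_numeral intro!: h_mono)
  have s: "h0 \<le> sz (m + 3) S" "sz (m + 3) S \<le> real m * t * h2 - h1 - (real m - 1) * g2"
    using junction_ge[OF k j] tri_span_height[OF _ _ S, of "d + 2"] k d unfolding h0_def h1_def h2_def g2_def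
    by (auto simp: eval_nat_numeral)
  have gB: "g1 + g0 \<le> (1 + \<mu>) * g2" unfolding g0_def g1_def g2_def by (rule junction_growth[OF Kd j2])
  have "real m < 3" by (rule chained_bound[OF hh s gg(1-3) gB])
  then have m2': "m = 2" using m by simp
  obtain c where c: "d + 3 \<le> c" "\<forall>i. Suc d \<le> i \<and> i \<le> c \<longrightarrow> in_span3 (Suc d) i"
    "sz (m + 3) S2 \<le> \<mu> * h (c + 1) \<or> \<not> annih n (m + 3) (y (c + 1)) S2"
    using junction_cases[OF Kd j2] by blast
  have S2: "tri (Suc d) S2" using j2 by (simp add: junction_def)
  have s2: "g0 \<le> sz (m + 3) S2" using junction_ge[OF Kd j2] by (simp add: g0_def)
  have "sz (m + 3) S2 \<le> real m * t * h (Suc d + 2) - h (Suc d + 1) - (real m - 1) * h (c + 1)"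
    by (rule tri_span_height[OF _ _ S2]) (use Kd c in auto)
  then have s2': "sz (m + 3) S2 \<le> 2 * t * g2 - g1 - h (c + 1)" using m2' by (simp add: g1_def g2_def eval_nat_numeral)
  have alt: "sz (m + 3) S2 \<le> \<mu> * h (c + 1) \<or> g2 + g1 \<le> (1 + \<mu>) * h (c + 1)"
    using c(3)
  proof
    assume nk2: "\<not> annih n (m + 3) (y (c + 1)) S2"
    \<comment> \<open>Losing \<open>S2\<close> just after \<open>c = e + 2\<close> means a third
      change, at \<open>e\<close>, whose growth condition bounds \<open>h (c + 1)\<close> from
      below.\<close>
    obtain e where e: "c = e + 2" "Suc d \<le> e" using c(1) that[of "c - 2"] by auto
    obtain S3 where "junction e S2 S3" using next_junction[OF Kd S2 e(2)] c(2) nk2 e(1) by (auto simp: eval_nat_numeral)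
    then have "h (e + 2) + h (e + 1) \<le> (1 + \<mu>) * h (e + 3)" by (intro junction_growth) (use Kd e in auto)
    moreover have "g2 \<le> h (e + 2)" "g1 \<le> h (e + 1)" unfolding g1_def g2_def using e by (auto intro!: h_mono)
    ultimately show ?thesis using e by (simp add: eval_nat_numeral)
  qed simp
  show False
    by (rule chained_contradiction[OF _ hh _ _ gg(4,1) s2 s2' alt, of "sz (m + 3) S"]) (use s m2' in auto)
qed

text \<open>Let \<open>S0\<close> be lost first at \<open>y (a + 3)\<close>. If \<open>S0\<close>
  also kills \<open>y (a - 1)\<close>, its height is bounded through the earlier triple, and the
  change at \<open>a\<close> is refuted by \<open>separated_contradiction\<close> or through a later
  change chained to it. Otherwise there is already a change at \<open>a - 1\<close>, and the two are
  chained. Starting at \<open>Suc K\<close> leaves room for the index \<open>a - 1\<close>.\<close>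

lemma no_tail: False
proof -
  define a0 where "a0 = Suc K"
  obtain S0 where S0: "tri a0 S0" using tri_ex[of a0] by (auto simp: a0_def)
  have ex: "\<exists>i. a0 \<le> i \<and> \<not> annih n (m + 3) (y i) S0" using tri_kills_finitely[OF S0] by blast
  define i0 where "i0 = (LEAST i. a0 \<le> i \<and> \<not> annih n (m + 3) (y i) S0)"
  have i0: "a0 \<le> i0" "\<not> annih n (m + 3) (y i0) S0" using LeastI_ex[OF ex] by (auto simp: i0_def)
  have min: "annih n (m + 3) (y i) S0" if "a0 \<le> i" "i < i0" for i
    using not_less_Least[of i "\<lambda>i. a0 \<le> i \<and> \<not> annih n (m + 3) (y i) S0"] that by (auto simp: i0_def)
  have "i0 \<notin> {a0, Suc a0, Suc (Suc a0)}" using i0(2) triD(4)[OF S0] by blast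
  then have "a0 + 3 \<le> i0" using i0(1) by auto
  then obtain a where a: "i0 = a + 3" "a0 \<le> a" using that[of "i0 - 3"] by auto
  have tS0: "tri a S0" using min[of a] min[of "Suc a"] min[of "Suc (Suc a)"] triD(1,2)[OF S0] a by (simp add: tri_def)
  obtain S where S: "tri (Suc a) S" using tri_ex[of "Suc a"] a by (auto simp: a0_def)
  have j: "junction a S0 S" using tS0 S i0(2) a by (simp add: junction_def)
  obtain a1 where a1: "a = Suc a1" "K \<le> a1" using a(2) by (cases a) (auto simp: a0_def)
  have Ka: "K \<le> a" using a1 by simp
  show False
  proof (cases "annih n (m + 3) (y a1) S0")
    case True
    then have t1: "tri a1 S0" using tS0 a1 by (simp add: tri_def)
    obtain c where c: "a + 3 \<le> c" "\<forall>i. Suc a \<le> i \<and> i \<le> c \<longrightarrow> in_span3 (Suc a) i"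
      "sz (m + 3) S \<le> \<mu> * h (c + 1) \<or> \<not> annih n (m + 3) (y (c + 1)) S"
      using junction_cases[OF Ka j] by blast
    from c(3) show False
    proof
      assume i: "sz (m + 3) S \<le> \<mu> * h (c + 1)"
      have w: "sz (m + 3) S \<le> real m * t * h (Suc a + 2) - h (Suc a + 1) - (real m - 1) * h (c + 1)"
        by (rule tri_span_height[OF _ _ S]) (use Ka c in auto)
      have u: "sz (m + 3) S0 \<le> real m * t * h (a1 + 2) - (real m - 1) * h (a1 + 3) - h (a1 + 1)" by (rule tri_height[OF a1(2) t1])
      show False
      proof (rule separated_contradiction)
        show "0 < h (a + 1)" by (rule h_pos)
        show "h (a + 1) \<le> t * h a" "h (a + 2) \<le> t * h (a + 1)" "h (a + 3) \<le> t * h (a + 2)"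
          using growth[of a] growth[of "a + 1"] growth[of "a + 2"] a1 by (auto simp: eval_nat_numeral)
        show "h (a + 1) \<le> h (a + 2)" by (rule h_mono) simp
        show "h (a + 1) \<le> sz (m + 3) S" using junction_ge[OF Ka j] by simp
        show "sz (m + 3) S \<le> real m * t * h (a + 3) - h (a + 2) - (real m - 1) * h (c + 1)" using w by (simp add: eval_nat_numeral)
        show "sz (m + 3) S \<le> \<mu> * h (c + 1)" by (rule i)
        show "h (a + 3) \<le> sz (m + 3) S + sz (m + 3) S0" by (rule junction_pair[OF Ka j])
        show "sz (m + 3) S0 \<le> real m * t * h (a + 1) - (real m - 1) * h (a + 2) - h a" using u a1 by (simp add: eval_nat_numeral)
      qed
    next
      assume nk: "\<not> annih n (m + 3) (y (c + 1)) S"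
      obtain d where d: "c = d + 2" "Suc a \<le> d" using c(1) that[of "c - 2"] by auto
      show False by (rule no_chained_junctions[OF Ka j d(2)]) (use c(2) nk d(1) in \<open>auto simp: eval_nat_numeral\<close>)
    qed
  next
    case False
    obtain S1 where S1: "tri a1 S1" using tri_ex[OF a1(2)] by blast
    have nk: "\<not> annih n (m + 3) (y (a1 + 3)) S1"
    proof
      assume "annih n (m + 3) (y (a1 + 3)) S1"
      then have "tri a S1" using S1 a1 by (simp add: tri_def eval_nat_numeral)
      from tri_transfer[OF Ka this tS0] have "annih n (m + 3) (y a1) S0" using S1 by (simp add: tri_def)
      then show False using False by blast
    qed
    have j1: "junction a1 S1 S0" using S1 tS0 a1 nk by (simp add: junction_def)
    show False
    proof (rule no_chained_junctions[OF a1(2) j1, of a])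
      show "\<forall>i. Suc a1 \<le> i \<and> i \<le> a + 2 \<longrightarrow> in_span3 (Suc a1) i"
      proof (intro allI impI)
        fix i assume "Suc a1 \<le> i \<and> i \<le> a + 2"
        then have "i \<in> {Suc a1, Suc (Suc a1), Suc (Suc (Suc a1))}" using a1 by auto
        then show "in_span3 (Suc a1) i" by (rule in_span3_refl)
      qed
    qed (use a1 i0(2) a in auto)
  qed
qed

end

lemma (in exponent_sequence) impossible: False
proof -
  obtain K0 where K0: "\<forall>k\<ge>K0. \<forall>P. primitive P \<longrightarrow> supp_below (m + 2) P \<longrightarrow> annih n (m + 2) (y (Suc k)) P \<longrightarrow> \<not> annih n (m + 2) (y k) P"
    using eventually_not_annih by (elim exE)
  obtain K1 where K1: "\<forall>k\<ge>K1. \<forall>p. annih n (m + 2) (y (Suc k)) p \<longrightarrow> \<not> annih n (m + 2) (y k) p \<longrightarrow> h (Suc (Suc k)) \<le> t * h (Suc k)"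
    using eventually_growth by (elim exE)
  obtain K2 where K2: "\<forall>k\<ge>K2. \<forall>N p. 1 \<le> N \<longrightarrow> N \<le> n + 1 \<longrightarrow> annih n N (y (Suc k)) p \<longrightarrow> \<not> annih n N (y k) p \<longrightarrow> h (Suc k) \<le> sz N p"
    using eventually_value by (elim exE)
  obtain K3 where K3: "\<forall>k\<ge>K3. (\<nexists>p. nonzero_below (m + 3) p \<and> annih n (m + 3) (y k) p \<and> annih n (m + 3) (y (Suc k)) p \<and> annih n (m + 3) (y (Suc (Suc k))) p) \<longrightarrow>
     2 * h (Suc k) \<le> (1 + \<mu>) * h (Suc (Suc k))"
    using eventually_common by (elim exE)
  obtain K4 where K4: "\<forall>k I i0 S. K4 \<le> i0 \<longrightarrow> i0 \<le> k \<longrightarrow> primitive S \<longrightarrow> supp_below (m + 3) S \<longrightarrow> annih n (m + 3) (y (Suc k)) S \<longrightarrow> annih n (m + 3) (y k) S \<longrightarrow>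
     (\<forall>i\<in>I. i0 \<le> i \<and> i \<le> k \<and> annih n (m + 3) (y i) S) \<longrightarrow>
     (\<forall>p. annih n (m + 3) (y (Suc k)) p \<longrightarrow> (\<forall>i\<in>I. annih n (m + 3) (y i) p) \<longrightarrow> (\<exists>a b. a \<noteq> 0 \<and> (\<forall>j<m + 3. a * p j = b * S j))) \<longrightarrow>
     sz (m + 3) S \<le> real m * t * h (Suc k) - (real m - 1) * h (Suc (Suc k)) - h (Suc i0)"
    using eventually_unique by (elim exE)
  obtain K5 where K5: "\<forall>k\<ge>K5. \<forall>S1 S2 P. primitive S1 \<longrightarrow> primitive S2 \<longrightarrow> supp_below (m + 3) S1 \<longrightarrow> supp_below (m + 3) S2 \<longrightarrow> lin_indep (m + 3) [S1, S2] \<longrightarrow>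
     (\<forall>S\<in>{S1, S2}. annih n (m + 3) (y k) S \<and> annih n (m + 3) (y (Suc k)) S) \<longrightarrow>
     primitive P \<longrightarrow> supp_below (m + 2) P \<longrightarrow> annih n (m + 2) (y (Suc k)) P \<longrightarrow> \<not> annih n (m + 2) (y k) P \<longrightarrow>
     h (Suc (Suc k)) \<le> sz (m + 3) S1 + sz (m + 3) S2"
    using eventually_pair by (elim exE)
  obtain K6 where K6: "\<forall>a c S. K6 \<le> a \<longrightarrow> K6 \<le> c \<longrightarrow> in_span3 a c \<longrightarrow> primitive S \<longrightarrow> supp_below (m + 3) S \<longrightarrow>
     (\<forall>i\<in>{a, Suc a, Suc (Suc a), c}. annih n (m + 3) (y i) S) \<longrightarrow>
     (\<forall>p. (\<forall>i\<in>{a, Suc a, Suc (Suc a)}. annih n (m + 3) (y i) p) \<longrightarrow> (\<exists>e b. e \<noteq> 0 \<and> (\<forall>j<m + 3. e * p j = b * S j))) \<longrightarrow>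
     sz (m + 3) S \<le> real m * t * h (Suc (Suc a)) - h (Suc a) - (real m - 1) * h (Suc c)"
    using eventually_span by (elim exE)
  obtain K7 where K7: "\<forall>a c S G P. K7 \<le> a \<longrightarrow> Suc (Suc a) \<le> c \<longrightarrow> in_span3 a c \<longrightarrow> \<not> in_span3 a (Suc c) \<longrightarrow>
     primitive S \<longrightarrow> supp_below (m + 3) S \<longrightarrow> (\<forall>i\<in>{a, Suc a, Suc (Suc a), c, Suc c}. annih n (m + 3) (y i) S) \<longrightarrow>
     supp_below (m + 3) G \<longrightarrow> annih n (m + 3) (y c) G \<longrightarrow> annih n (m + 3) (y (Suc c)) G \<longrightarrow> lin_indep (m + 3) [S, G] \<longrightarrow>
     supp_below (m + 2) P \<longrightarrow> annih n (m + 2) (y (Suc c)) P \<longrightarrow> \<not> annih n (m + 2) (y c) P \<longrightarrow>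
     2 * sz (m + 3) S \<le> (2 + \<mu>) * h (Suc c) - h (Suc (Suc a)) - h (Suc a)"
    using eventually_spread by (elim exE)
  define K where "K = K0 + K1 + K2 + K3 + K4 + K5 + K6 + K7"
  have KK: "K0 \<le> k" "K1 \<le> k" "K2 \<le> k" "K3 \<le> k" "K4 \<le> k" "K5 \<le> k" "K6 \<le> k" "K7 \<le> k" if "K \<le> k" for k using that by (simp_all add: K_def)
  have P: "\<exists>P. primitive P \<and> supp_below (m + 2) P \<and> annih n (m + 2) (y (Suc k)) P \<and> \<not> annih n (m + 2) (y k) P" if "K \<le> k" for k
  proof -
    obtain P where P: "primitive P" "supp_below (m + 2) P" "annih n (m + 2) (y (Suc k)) P" using P_ex by blast
    then show ?thesis using K0[rule_format, OF KK(1)[OF that] P] by blast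
  qed
  have G: "h (Suc (Suc k)) \<le> t * h (Suc k)" if k: "K \<le> k" for k
  proof -
    obtain P where "annih n (m + 2) (y (Suc k)) P" "\<not> annih n (m + 2) (y k) P" using P[OF k] by blast
    then show ?thesis by (rule K1[rule_format, OF KK(2)[OF k]])
  qed
  have N: "1 \<le> m + 3" "m + 3 \<le> n + 1" using n m by auto
  have "tail_sequence n m \<xi> y yp H M t \<mu> lam K"
  proof (unfold_locales, goal_cases)
    case (1 k P) then show ?case using K0[rule_format, OF KK(1)] by blast
  next
    case (2 k) then show ?case by (rule G)
  next
    case (3 k p) then show ?case using K2[rule_format, OF KK(3) N] by blast
  next
    case (4 k)
    show ?case
    proof (rule ccontr)
      assume "\<not> ?case"
      \<comment> \<open>This inequality and growth by at most \<open>t\<close> again contradict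
        \<open>(1 + \<mu>) * t < 2\<close>.\<close>
      then have 1: "2 * h (Suc k) \<le> (1 + \<mu>) * h (Suc (Suc k))" using K3[rule_format, OF KK(4)[OF 4]] by blast
      have "(1 + \<mu>) * h (Suc (Suc k)) \<le> (1 + \<mu>) * (t * h (Suc k))" using G[OF 4] mu_pos by (intro mult_left_mono) auto
      also have "\<dots> = ((1 + \<mu>) * t) * h (Suc k)" by simp
      also have "\<dots> < 2 * h (Suc k)" using mut h_pos by (intro mult_strict_right_mono) auto
      finally show False using 1 by linarith
    qed
  next
    case (5 k I i0 S)
    show ?case by (rule K4[THEN spec, THEN spec, THEN spec, THEN spec, THEN mp, THEN mp, THEN mp, THEN mp, THEN mp, THEN mp, THEN mp, THEN mp, OF KK(5)[OF 5(1)] 5(2-8)])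
  next
    case (6 k S1 S2)
    obtain P where "primitive P" "supp_below (m + 2) P" "annih n (m + 2) (y (Suc k)) P" "\<not> annih n (m + 2) (y k) P" using P[OF 6(1)] by blast
    then show ?case by (rule K5[THEN spec, THEN mp, THEN spec, THEN spec, THEN spec, THEN mp, THEN mp, THEN mp, THEN mp, THEN mp, THEN mp, THEN mp, THEN mp, THEN mp, THEN mp, OF KK(6)[OF 6(1)] 6(2-7)])
  next
    case (7 a c S)
    show ?case by (rule K6[THEN spec, THEN spec, THEN spec, THEN mp, THEN mp, THEN mp, THEN mp, THEN mp, THEN mp, THEN mp, OF KK(7)[OF 7(1)] KK(7)[OF 7(2)] 7(3-7)])
  next
    case (8 a c S G)
    have "K \<le> c" using 8 by simp
    then obtain P where "supp_below (m + 2) P" "annih n (m + 2) (y (Suc c)) P" "\<not> annih n (m + 2) (y c) P" using P[of c] by blast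
    then show ?case by (rule K7[THEN spec, THEN spec, THEN spec, THEN spec, THEN spec, THEN mp, THEN mp, THEN mp, THEN mp, THEN mp, THEN mp, THEN mp, THEN mp, THEN mp, THEN mp, THEN mp, THEN mp, THEN mp, THEN mp, OF KK(8)[OF 8(1)] 8(2-11)])
  qed
  then show False by (rule tail_sequence.no_tail)
qed

section \<open>Best approximations\<close>

lemma greatest_nonzero:
  fixes p :: "nat \<Rightarrow> int"
  assumes "supp_below N p" "nonzero_below N p"
  shows "\<exists>e<N. p e \<noteq> 0 \<and> (\<forall>j>e. p j = 0)"
proof -
  define Z where "Z = {j. p j \<noteq> 0}"
  have sub: "Z \<subseteq> {..<N}" using assms(1) by (auto simp: Z_def supp_below_def not_le[symmetric])
  then have fin: "finite Z" using finite_subset by blast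
  have ne: "Z \<noteq> {}" using assms(2) by (auto simp: Z_def nonzero_below_def)
  define e where "e = Max Z"
  have eZ: "e \<in> Z" unfolding e_def by (rule Max_in[OF fin ne])
  have "p j = 0" if "j > e" for j
  proof (rule ccontr)
    assume "p j \<noteq> 0"
    then have "j \<le> e" unfolding e_def by (intro Max_ge[OF fin]) (simp add: Z_def)
    then show False using that by simp
  qed
  moreover have "e < N" "p e \<noteq> 0" using eZ sub by (auto simp: Z_def)
  ultimately show ?thesis by blast
qed

text \<open>For minimal \<open>d\<close> the kernel of the \<open>d\<close> blocks of length
  \<open>n + 2 - d\<close> is spanned by the multiples of \<open>g\<close>. Another annihilator
  \<open>g'\<close> is such a combination, and if its degree does not exceed that of
  \<open>g\<close>, reading coefficients from the top removes all multiples but \<open>g\<close>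
  itself. Since either polynomial may have the larger degree, \<open>core\<close> is applied in both
  orders.\<close>

lemma low_degree_annih_unique:
  assumes d: "1 \<le> d" "2 * d \<le> n + 1" and min: "\<And>q. annih n d x q \<Longrightarrow> (\<forall>j<d. q j = 0)"
    and p: "supp_below (Suc d) p" "nonzero_below (Suc d) p" "annih n (Suc d) x p"
    and p': "supp_below (Suc d) p'" "nonzero_below (Suc d) p'" "annih n (Suc d) x p'"
  shows "\<exists>a b. a \<noteq> 0 \<and> b \<noteq> 0 \<and> (\<forall>j. a * p' j = b * p j)"
proof -
  define q where "q = n + 2 - 2 * d"
  define N where "N = d + q"
  have N: "1 \<le> N" "N \<le> n + 1" "n + 2 - N = d" "1 \<le> q" using d by (auto simp: N_def q_def)
  have ind: "lin_indep N (shift_rows n N x)" by (rule shift_rows_indep[OF N(1,2)]) (use min N in auto)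
  have kill: "killed N (set (shift_rows n N x)) (tmult i g)" if g: "supp_below (Suc d) g" "annih n (Suc d) x g" and i: "i < q" for i g
    unfolding killed_shift_rows[OF N(2)] annih_def
  proof (intro allI impI)
    fix k assume k: "k + N \<le> n + 1"
    have "dotp N (shift k x) (tmult i g) = dotp (Suc d) (shift (k + i) x) g"
      by (rule dotp_tmult_le[OF g(1)]) (use i N_def in simp)
    also have "\<dots> = 0" using g(2) k i by (simp add: annih_def N_def)
    finally show "dotp N (shift k x) (tmult i g) = 0" .
  qed
  have core: "\<exists>a b. a \<noteq> 0 \<and> b \<noteq> 0 \<and> (\<forall>j. a * g' j = b * g j)"
    if g: "supp_below (Suc d) g" "nonzero_below (Suc d) g" "annih n (Suc d) x g"
      and g': "supp_below (Suc d) g'" "nonzero_below (Suc d) g'" "annih n (Suc d) x g'"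
      and e: "e < Suc d" "g e \<noteq> 0" "\<forall>j>e. g j = 0" "\<forall>j>e. g' j = 0" for g g' e
  proof -
    define T where "T = map (\<lambda>i. tmult i g) [0..<q]"
    have kg: "killed N (set (shift_rows n N x)) g'" using kill[OF g'(1,3), of 0] N by simp
    have "\<exists>a c. a \<noteq> 0 \<and> (\<forall>j<N. a * g' j = (\<Sum>i<length T. c i * (T ! i) j))"
    proof (rule killed_in_span[OF ind _ _ _ kg])
      show "lin_indep N T" unfolding T_def N_def by (rule lin_indep_tmults[OF g(1,2)])
      show "killed N (set (shift_rows n N x)) f" if "f \<in> set T" for f using that kill[OF g(1,3)] by (auto simp: T_def)
      show "N \<le> length (shift_rows n N x) + length T" using N by (simp add: T_def N_def)
    qed
    then obtain a c where a: "a \<noteq> 0" and c: "\<forall>j<N. a * g' j = (\<Sum>i<length T. c i * (T ! i) j)" by (elim exE conjE)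
    have c': "a * g' j = (\<Sum>i<q. c i * tmult i g j)" if "j < N" for j
    proof -
      have "(\<Sum>i<length T. c i * (T ! i) j) = (\<Sum>i<q. c i * tmult i g j)" by (intro sum.cong) (auto simp: T_def)
      then show ?thesis using c that by simp
    qed
    have c0: "c i = 0" if "1 \<le> i" "i < q" for i
      using that
    proof (induction "q - i" arbitrary: i rule: less_induct)
      case less
      have "c i' * tmult i' g (e + i) = 0" if "i' < q" "i' \<noteq> i" for i'
      proof (cases "i' < i")
        case True
        then show ?thesis using e(3) by (simp add: tmult_def)
      next
        case False
        then have "c i' = 0" using that less by (intro less.hyps) auto
        then show ?thesis by simp
      qed
      then have "(\<Sum>i'<q. c i' * tmult i' g (e + i)) = (\<Sum>i'\<in>{i}. c i' * tmult i' g (e + i))"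
        using less.prems by (intro sum.mono_neutral_right) auto
      also have "\<dots> = c i * g e" by (simp add: tmult_def)
      finally have "c i * g e = a * g' (e + i)" using c'[of "e + i"] e(1) less.prems by (simp add: N_def)
      also have "\<dots> = 0" using e(4) less.prems by simp
      finally show ?case using e(2) by simp
    qed
    have eq: "a * g' j = c 0 * g j" for j
    proof (cases "j < N")
      case True
      have "(\<Sum>i<q. c i * tmult i g j) = (\<Sum>i\<in>{0}. c i * tmult i g j)"
        using N(4) c0 by (intro sum.mono_neutral_right) (auto simp: not_less_eq_eq)
      then show ?thesis using c'[OF True] by simp
    next
      case False
      then have "Suc d \<le> j" using N by (auto simp: N_def)
      then show ?thesis using g(1) g'(1) by (simp add: supp_below_def)
    qed
    have "c 0 \<noteq> 0" using g'(2) a eq by (auto simp: nonzero_below_def)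
    then show ?thesis using a eq by blast
  qed
  obtain e where e: "e < Suc d" "p e \<noteq> 0" "\<forall>j>e. p j = 0" using greatest_nonzero[OF p(1,2)] by blast
  obtain e' where e': "e' < Suc d" "p' e' \<noteq> 0" "\<forall>j>e'. p' j = 0" using greatest_nonzero[OF p'(1,2)] by blast
  show ?thesis
  proof (cases "e' \<le> e")
    case True
    then show ?thesis using core[OF p p' e] e'(3) by auto
  next
    case False
    then obtain a b where "a \<noteq> 0" "b \<noteq> 0" "\<forall>j. a * p j = b * p' j" using core[OF p' p e'] e(3) by auto
    then show ?thesis by (intro exI[of _ b] exI[of _ a]) auto
  qed
qed

text \<open>Coordinatewise rounding gives the smallest error among integer points with first
  coordinate \<open>r\<close>. The value 0 beyond \<open>n\<close> fits
  \<open>supp_below\<close>.\<close>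

definition pt :: "nat \<Rightarrow> real \<Rightarrow> nat \<Rightarrow> nat \<Rightarrow> int" where
  "pt n \<xi> r = (\<lambda>j. if j \<le> n then round (real r * \<xi> ^ j) else 0)"

definition err :: "nat \<Rightarrow> real \<Rightarrow> nat \<Rightarrow> real" where
  "err n \<xi> r = (MAX k\<in>{1..n}. \<bar>real r * \<xi> ^ k - real_of_int (round (real r * \<xi> ^ k))\<bar>)"

lemma pt_0 [simp]: "pt n \<xi> r 0 = int r"
  by (simp add: pt_def)

lemma supp_pt: "supp_below (n + 1) (pt n \<xi> r)"
  by (simp add: pt_def supp_below_def)

lemma err_ge: "k \<in> {1..n} \<Longrightarrow> \<bar>real r * \<xi> ^ k - real_of_int (round (real r * \<xi> ^ k))\<bar> \<le> err n \<xi> r"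
  unfolding err_def by (rule Max_ge) auto

lemma err_attained: "1 \<le> n \<Longrightarrow> \<exists>k\<in>{1..n}. err n \<xi> r = \<bar>real r * \<xi> ^ k - real_of_int (round (real r * \<xi> ^ k))\<bar>"
proof -
  let ?A = "(\<lambda>k. \<bar>real r * \<xi> ^ k - real_of_int (round (real r * \<xi> ^ k))\<bar>) ` {1..n}"
  assume "1 \<le> n"
  then have "?A \<noteq> {}" by simp
  then have "Max ?A \<in> ?A" by (intro Max_in) auto
  then show ?thesis unfolding err_def by (simp only: image_iff)
qed

lemma err_le:
  assumes "1 \<le> n" "\<And>k. k \<in> {1..n} \<Longrightarrow> \<bar>real r * \<xi> ^ k - real_of_int (z k)\<bar> \<le> B"
  shows "err n \<xi> r \<le> B"
proof -
  obtain k where k: "k \<in> {1..n}" "err n \<xi> r = \<bar>real r * \<xi> ^ k - real_of_int (round (real r * \<xi> ^ k))\<bar>" using err_attained[OF assms(1)] by blast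
  then show ?thesis using assms(2)[OF k(1)] round_diff_minimal[of "real r * \<xi> ^ k" "z k"] by linarith
qed

lemma err_le_half: "1 \<le> n \<Longrightarrow> err n \<xi> r \<le> 1 / 2"
  by (rule err_le[where z = "\<lambda>k. round (real r * \<xi> ^ k)"], assumption) (subst abs_minus_commute, rule of_int_round_abs_le)

lemma err_nonneg: "1 \<le> n \<Longrightarrow> 0 \<le> err n \<xi> r"
  using err_attained[of n \<xi> r] by auto

lemma near_pt:
  assumes "1 \<le> n"
  shows "near_curve n \<xi> (pt n \<xi> r) (err n \<xi> r)"
  unfolding near_curve_def
proof (intro allI impI)
  fix i assume i: "i \<le> n"
  show "\<bar>real_of_int (pt n \<xi> r i) - real_of_int (pt n \<xi> r 0) * \<xi> ^ i\<bar> \<le> err n \<xi> r"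
  proof (cases "i = 0")
    case True
    then show ?thesis using err_nonneg[OF assms] by simp
  next
    case False
    then show ?thesis using err_ge[of i n r \<xi>] i by (simp add: pt_def abs_minus_commute)
  qed
qed

text \<open>The coordinate belonging to \<xi> itself decides: zero error there would make \<xi> a
  root of a linear integer polynomial.\<close>

lemma err_pos:
  assumes n: "1 \<le> n" and no_root: "\<And>p. nonzero_below (n + 1) p \<Longrightarrow> (\<Sum>j<n + 1. real_of_int (p j) * \<xi> ^ j) \<noteq> 0" and r: "1 \<le> r"
  shows "0 < err n \<xi> r"
proof (rule ccontr)
  assume "\<not> 0 < err n \<xi> r"
  then have "\<bar>real r * \<xi> ^ 1 - real_of_int (round (real r * \<xi> ^ 1))\<bar> \<le> 0" using err_ge[of 1 n r \<xi>] n by simp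
  then have z: "real r * \<xi> - real_of_int (round (real r * \<xi>)) = 0" by simp
  define p where "p = (\<lambda>j::nat. if j = 0 then - round (real r * \<xi>) else if j = 1 then int r else 0)"
  have "nonzero_below (n + 1) p" unfolding nonzero_below_def using n r by (intro exI[of _ 1]) (auto simp: p_def)
  moreover have "(\<Sum>j<n + 1. real_of_int (p j) * \<xi> ^ j) = (\<Sum>j\<in>{0, 1}. real_of_int (p j) * \<xi> ^ j)"
    using n by (intro sum.mono_neutral_right) (auto simp: p_def)
  then have "(\<Sum>j<n + 1. real_of_int (p j) * \<xi> ^ j) = 0" using z by (simp add: p_def)
  ultimately show False using no_root by blast
qed

text \<open>\<open>q\<close> lists the heights of the best approximations. The uniform exponent
  enters only through \<open>err_bound\<close>, where the error at \<open>q i\<close> is measured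
  against the next height.\<close>

locale best_points = exponent_numbers "real m" t \<mu>
  for m :: nat and t \<mu> :: real +
  fixes n :: nat and \<xi> lam l C :: real and q :: "nat \<Rightarrow> nat"
  assumes n: "n = 2 * m + 1" and m: "2 \<le> m"
    and no_root: "\<And>p. nonzero_below (n + 1) p \<Longrightarrow> (\<Sum>j<n + 1. real_of_int (p j) * \<xi> ^ j) \<noteq> 0"
    and lam: "0 < lam" "lam * (real m + 1 + \<mu>) = 1" "lam < l"
    and q0: "q 0 = 1" and q_less: "\<And>i. q i < q (Suc i)"
    and err_less: "\<And>i. err n \<xi> (q (Suc i)) < err n \<xi> (q i)"
    and best: "\<And>i r. 1 \<le> r \<Longrightarrow> r < q (Suc i) \<Longrightarrow> err n \<xi> (q i) \<le> err n \<xi> r"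
    and C: "1 \<le> C" and err_bound: "\<And>i. err n \<xi> (q i) \<le> C * real (q (Suc i)) powr (- l)"
begin

abbreviation x :: "nat \<Rightarrow> nat \<Rightarrow> int" where "x i \<equiv> pt n \<xi> (q i)"
abbreviation \<delta> :: "nat \<Rightarrow> real" where "\<delta> i \<equiv> err n \<xi> (q i)"

lemma n1: "1 \<le> n" using n m by simp

lemma q_mono: "i < j \<Longrightarrow> q i < q j"
  using lift_Suc_mono_less[of q, OF q_less] by blast

lemma q_mono_le: "i \<le> j \<Longrightarrow> q i \<le> q j"
  using q_mono[of i j] by (cases "i = j") auto

lemma q_ge: "i < q i"
  by (induction i) (use q0 q_less in \<open>auto intro: Suc_lessI le_less_trans Suc_leI\<close>)

lemma q_pos: "1 \<le> q i"
  using q_ge[of i] by simp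

lemma err_mono: "i < j \<Longrightarrow> \<delta> j < \<delta> i"
  using lift_Suc_mono_less[of "\<lambda>i. - \<delta> i" i j] err_less by simp

lemma err_gt_0: "0 < \<delta> i"
  by (rule err_pos[OF n1 no_root q_pos])

lemma q_tendsto: "filterlim (\<lambda>i. real (q i)) at_top sequentially"
proof (rule filterlim_at_top_mono[OF filterlim_real_sequentially])
  show "\<forall>\<^sub>F i in sequentially. real i \<le> real (q i)" using q_ge by (intro always_eventually) (auto intro: less_imp_le)
qed

lemma q_Suc_tendsto: "filterlim (\<lambda>i. real (q (Suc i))) at_top sequentially"
  using filterlim_compose[OF q_tendsto filterlim_Suc] by simp

lemma err_tendsto: "\<delta> \<longlonglongrightarrow> 0"
proof (rule tendsto_sandwich[of "\<lambda>_. 0" _ _ "\<lambda>i. C * real (q (Suc i)) powr (- l)"])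
  have "(\<lambda>i. real (q (Suc i)) powr (- l)) \<longlonglongrightarrow> 0" by (rule tendsto_neg_powr[OF _ q_Suc_tendsto]) (use lam in auto)
  from tendsto_mult[OF tendsto_const[of C] this] show "(\<lambda>i. C * real (q (Suc i)) powr (- l)) \<longlonglongrightarrow> 0" by simp
qed (use err_gt_0 err_bound in \<open>auto intro!: always_eventually less_imp_le\<close>)

text \<open>A common prime factor could be divided out, giving a smaller height with an error that
  is not larger, against minimality.\<close>

lemma x_primitive: "primitive (x i)"
  unfolding primitive_def
proof (intro allI impI, rule ccontr)
  fix \<pi> :: int assume \<pi>: "Factorial_Ring.prime \<pi>" and "\<not> (\<exists>j. \<not> \<pi> dvd x i j)"
  then have dv: "\<pi> dvd x i j" for j by blast
  have \<pi>2: "2 \<le> \<pi>" using \<pi> by (rule prime_ge_2_int)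
  have "\<pi> dvd int (q i)" using dv[of 0] by simp
  then obtain r' where r': "int (q i) = \<pi> * r'" by (elim dvdE)
  have "0 < \<pi> * r'" using q_pos[of i] r' by linarith
  then have r0: "0 < r'" using \<pi>2 by (simp add: zero_less_mult_iff)
  define r where "r = nat r'"
  have rr: "int (q i) = \<pi> * int r" "1 \<le> r" using r' r0 by (auto simp: r_def)
  have "2 * int r \<le> \<pi> * int r" using \<pi>2 by (intro mult_right_mono) auto
  then have lt: "r < q i" using rr by linarith
  have "err n \<xi> r \<le> \<delta> i"
  proof (rule err_le[OF n1, where z = "\<lambda>k. x i k div \<pi>"])
    fix k assume k: "k \<in> {1..n}"
    have e: "real_of_int (x i k) = real_of_int \<pi> * real_of_int (x i k div \<pi>)" using dv[of k] by (metis dvd_mult_div_cancel of_int_mult)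
    have "real (q i) = real_of_int \<pi> * real r" using rr(1) by (metis of_int_mult of_int_of_nat_eq)
    then have "real (q i) * \<xi> ^ k - real_of_int (x i k) = real_of_int \<pi> * (real r * \<xi> ^ k - real_of_int (x i k div \<pi>))"
      unfolding e by (simp add: algebra_simps)
    then have "\<bar>real_of_int \<pi>\<bar> * \<bar>real r * \<xi> ^ k - real_of_int (x i k div \<pi>)\<bar> = \<bar>real (q i) * \<xi> ^ k - real_of_int (x i k)\<bar>"
      by (simp add: abs_mult)
    also have "\<dots> \<le> \<delta> i" using err_ge[OF k, of "q i" \<xi>] k by (simp add: pt_def)
    finally have "\<bar>real_of_int \<pi>\<bar> * \<bar>real r * \<xi> ^ k - real_of_int (x i k div \<pi>)\<bar> \<le> \<delta> i" .
    moreover have "1 * \<bar>real r * \<xi> ^ k - real_of_int (x i k div \<pi>)\<bar> \<le> \<bar>real_of_int \<pi>\<bar> * \<bar>real r * \<xi> ^ k - real_of_int (x i k div \<pi>)\<bar>"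
      using \<pi>2 by (intro mult_right_mono) auto
    ultimately show "\<bar>real r * \<xi> ^ k - real_of_int (x i k div \<pi>)\<bar> \<le> \<delta> i" unfolding mult_1 by (rule order.trans[rotated])
  qed
  moreover obtain j where "i = Suc j" using lt rr(2) q0 by (cases i) auto
  ultimately show False using best[OF rr(2), of j] lt err_less[of j] by simp
qed

text \<open>In a relation with \<open>b\<close> nonzero the larger height \<open>q j\<close> forces
  |b| \<le> |a|. Then the error at \<open>i\<close> is at most that at \<open>j\<close>, although
  errors decrease strictly.\<close>

lemma x_independent:
  assumes "i < j" and e: "\<And>k. a * x i k + b * x j k = 0"
  shows "a = 0 \<and> b = 0"
proof -
  have qq: "real (q i) < real (q j)" "0 < real (q i)" using q_mono[OF assms(1)] q_pos[of i] by auto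
  have r: "real_of_int a * real_of_int (x i k) + real_of_int b * real_of_int (x j k) = 0" for k
    using e[of k] by (metis of_int_0 of_int_add of_int_mult)
  have r0: "real_of_int a * real (q i) + real_of_int b * real (q j) = 0" using r[of 0] by simp
  have "b = 0"
  proof (rule ccontr)
    assume b: "b \<noteq> 0"
    have ab: "\<bar>real_of_int b\<bar> \<le> \<bar>real_of_int a\<bar>"
    proof (rule ccontr)
      assume "\<not> ?thesis"
      then have "\<bar>real_of_int a\<bar> * real (q i) \<le> \<bar>real_of_int b\<bar> * real (q i)" using qq by (intro mult_right_mono) auto
      also have "\<dots> < \<bar>real_of_int b\<bar> * real (q j)" using qq b by (intro mult_strict_left_mono) auto
      also have "\<bar>real_of_int b\<bar> * real (q j) = \<bar>real_of_int a\<bar> * real (q i)"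
      proof -
        have "real_of_int b * real (q j) = - (real_of_int a * real (q i))" using r0 by linarith
        then have "\<bar>real_of_int b * real (q j)\<bar> = \<bar>real_of_int a * real (q i)\<bar>" by simp
        then show ?thesis by (simp add: abs_mult)
      qed
      finally show False by simp
    qed
    have "\<delta> i \<le> \<delta> j"
    proof (rule err_le[OF n1, where z = "\<lambda>k. x i k"])
      fix k assume k: "k \<in> {1..n}"
      have "real_of_int b * (real (q j) * \<xi> ^ k - real_of_int (x j k)) = - (real_of_int a * (real (q i) * \<xi> ^ k - real_of_int (x i k)))"
      proof -
        have "(real_of_int a * real (q i) + real_of_int b * real (q j)) * \<xi> ^ k - (real_of_int a * real_of_int (x i k) + real_of_int b * real_of_int (x j k)) = 0"
          unfolding r r0 by simp
        then show ?thesis by (simp add: algebra_simps)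
      qed
      then have "\<bar>real_of_int a\<bar> * \<bar>real (q i) * \<xi> ^ k - real_of_int (x i k)\<bar> = \<bar>real_of_int b\<bar> * \<bar>real (q j) * \<xi> ^ k - real_of_int (x j k)\<bar>"
        by (metis abs_minus_cancel abs_mult)
      also have "\<dots> \<le> \<bar>real_of_int b\<bar> * \<delta> j" using err_ge[OF k, of "q j" \<xi>] k by (intro mult_left_mono) (auto simp: pt_def)
      finally have "\<bar>real_of_int a\<bar> * \<bar>real (q i) * \<xi> ^ k - real_of_int (x i k)\<bar> \<le> \<bar>real_of_int b\<bar> * \<delta> j" .
      moreover have "\<bar>real_of_int b\<bar> * \<bar>real (q i) * \<xi> ^ k - real_of_int (x i k)\<bar> \<le> \<bar>real_of_int a\<bar> * \<bar>real (q i) * \<xi> ^ k - real_of_int (x i k)\<bar>"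
        using ab by (intro mult_right_mono) auto
      ultimately have "\<bar>real_of_int b\<bar> * \<bar>real (q i) * \<xi> ^ k - real_of_int (x i k)\<bar> \<le> \<bar>real_of_int b\<bar> * \<delta> j" by linarith
      then show "\<bar>real (q i) * \<xi> ^ k - real_of_int (x i k)\<bar> \<le> \<delta> j" using b by (simp add: mult_le_cancel_left_pos)
    qed
    then show False using err_mono[OF assms(1)] by simp
  qed
  then show ?thesis using r0 qq by auto
qed

lemma eventually_x_nonzero:
  assumes p: "nonzero_below N p" "N \<le> n + 1"
  shows "\<exists>I. \<forall>i\<ge>I. dotp N (x i) p \<noteq> 0"
proof -
  have "1 \<le> x i 0" for i using q_pos[of i] by simp
  from eventually_dotp_nonzero[OF no_root p near_pt[OF n1] this err_tendsto] show ?thesis by blast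
qed

section \<open>Excluding annihilators of degree at most m\<close>

definition low :: "nat \<Rightarrow> nat \<Rightarrow> (nat \<Rightarrow> int) \<Rightarrow> bool" where
  "low i d p \<longleftrightarrow> 1 \<le> d \<and> d \<le> m \<and> primitive p \<and> supp_below (Suc d) p \<and> annih n (Suc d) (x i) p \<and>
     (\<forall>g. annih n d (x i) g \<longrightarrow> (\<forall>j<d. g j = 0))"

lemma low_exists:
  assumes p: "nonzero_below N p" "annih n N (x i) p" "N \<le> m + 1"
  shows "\<exists>d p. Suc d \<le> N \<and> low i d p"
proof -
  define N0 where "N0 = (LEAST N. \<exists>p. nonzero_below N p \<and> annih n N (x i) p)"
  have ex: "\<exists>N. \<exists>p. nonzero_below N p \<and> annih n N (x i) p" using p by blast
  obtain g where g: "nonzero_below N0 g" "annih n N0 (x i) g" using LeastI_ex[OF ex] unfolding N0_def by blast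
  have le: "N0 \<le> N" unfolding N0_def by (rule Least_le) (use p in blast)
  have "N0 \<noteq> 0" using g(1) by (auto simp: nonzero_below_def)
  moreover have "N0 \<noteq> 1"
  proof
    assume "N0 = 1"
    then have "dotp 1 (shift 0 (x i)) g = 0" "g 0 \<noteq> 0" using g n by (auto simp: annih_def nonzero_below_def)
    then show False using q_pos[of i] by (simp add: dotp_def shift_def)
  qed
  ultimately obtain d where d: "N0 = Suc d" "1 \<le> d" by (cases N0) auto
  obtain c p' where p': "c \<noteq> 0" "primitive p'" "supp_below N0 p'" "\<forall>j<N0. g j = c * p' j" using primitive_part[OF g(1)] by blast
  have "annih n N0 (x i) p'" by (rule annih_proportional[OF p'(1) _ g(2), where b = 1]) (use p'(4) in simp)
  moreover have "\<forall>j<d. f j = 0" if "annih n d (x i) f" for f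
  proof (rule ccontr)
    assume "\<not> (\<forall>j<d. f j = 0)"
    then have "nonzero_below d f" by (auto simp: nonzero_below_def)
    then have "N0 \<le> d" unfolding N0_def by (intro Least_le) (use that in blast)
    then show False using d by simp
  qed
  ultimately have "low i d p'" using p' d le assms(3) by (auto simp: low_def)
  then show ?thesis using d le by auto
qed

text \<open>Otherwise \<open>annih_value_bound\<close> bounds the height of \<open>p\<close> from
  below and \<open>single_point_height\<close> from above. Together they contain at least
  \<open>m + 2\<close> factors of error size, and \<open>l * (m + 2) > 1\<close> because
  \<open>\<mu> < 1\<close>, so a negative power of \<open>q (Suc i)\<close> would stay above a
  positive constant.\<close>

lemma low_inherited_aux:
  assumes d: "1 \<le> d" "d \<le> m"
  shows "\<forall>\<^sub>F i in sequentially. \<forall>p. low (Suc i) d p \<longrightarrow> annih n (Suc d) (x i) p"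
proof -
  have d2: "2 * d \<le> n + 1" using d n by simp
  define Q where "Q = n + 2 - 2 * d"
  obtain C1 where C1: "1 \<le> C1" and SP: "single_height_bound n \<xi> d C1" using single_point_height[OF d(1) d2] by blast
  obtain C2 where C2: "1 \<le> C2" and VB: "value_bound n \<xi> C2" using annih_value_bound by blast
  define B where "B = C2 ^ Q * C1 * C ^ (m + 2)"
  define s where "s = 1 - l * (real m + 2)"
  have s: "s < 0"
  proof -
    have "1 = lam * (real m + 1 + \<mu>)" using lam by simp
    also have "\<dots> < lam * (real m + 2)" using lam(1) mu_lt_1 by (intro mult_strict_left_mono) auto
    also have "\<dots> \<le> l * (real m + 2)" using lam by (intro mult_right_mono) auto
    finally show ?thesis by (simp add: s_def)
  qed
  have "(\<lambda>i. B * real (q (Suc i)) powr s) \<longlonglongrightarrow> B * 0"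
    by (intro tendsto_mult tendsto_const tendsto_neg_powr[OF s q_Suc_tendsto])
  then have ev1: "\<forall>\<^sub>F i in sequentially. B * real (q (Suc i)) powr s < 1" using order_tendstoD(2)[of _ "B * 0" _ 1] by simp
  have "(\<lambda>i. C * real (q (Suc i)) powr (- l)) \<longlonglongrightarrow> C * 0"
    by (intro tendsto_mult tendsto_const tendsto_neg_powr[OF _ q_Suc_tendsto]) (use lam in auto)
  then have ev2: "\<forall>\<^sub>F i in sequentially. C * real (q (Suc i)) powr (- l) < 1" using order_tendstoD(2)[of _ "C * 0" _ 1] by simp
  from ev1 ev2 show ?thesis
  proof eventually_elim
    case (elim i)
    show ?case
    proof (intro allI impI, rule ccontr)
      fix p assume lo: "low (Suc i) d p" and no: "\<not> annih n (Suc d) (x i) p"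
      define W where "W = real (q (Suc i))"
      define z where "z = C * W powr (- l)"
      have p: "primitive p" "supp_below (Suc d) p" "annih n (Suc d) (x (Suc i)) p" "\<forall>g. annih n d (x (Suc i)) g \<longrightarrow> (\<forall>j<d. g j = 0)"
        using lo by (auto simp: low_def)
      have X1: "1 \<le> W" using q_pos[of "Suc i"] by (simp add: W_def)
      have z: "0 \<le> z" "z \<le> 1" "\<delta> i \<le> z" "\<delta> (Suc i) \<le> z"
        using elim(2) err_bound[of i] err_less[of i] C by (auto simp: z_def W_def)
      have N: "Suc d \<le> n + 1" "1 \<le> Suc d" using d n by auto
      have X2: "0 < \<bar>real_of_int (x (Suc i) 0)\<bar>" "\<bar>real_of_int (x i 0)\<bar> \<le> \<bar>real_of_int (x (Suc i) 0)\<bar>"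
        using q_pos[of "Suc i"] q_less[of i] by auto
      have v: "1 \<le> C2 * (hgt (Suc d) p * \<delta> i)"
        using VB[unfolded value_bound_def, rule_format, OF N p(3) no near_pt[OF n1] near_pt[OF n1] less_imp_le[OF err_less] X2] .
      have "hgt (Suc d) p ^ (n + 2 - 2 * d) \<le> C1 * \<bar>real_of_int (x (Suc i) 0)\<bar> * \<delta> (Suc i) ^ (d - 1)"
      proof (rule SP[unfolded single_height_bound_def, rule_format, OF p(1-3)])
        show "g j = 0" if "annih n d (x (Suc i)) g" "j < d" for g j using p(4) that by blast
        show "0 < \<delta> (Suc i)" by (rule err_gt_0)
        show "\<delta> (Suc i) \<le> \<bar>real_of_int (x (Suc i) 0)\<bar>" using err_le_half[OF n1, of \<xi> "q (Suc i)"] q_pos[of "Suc i"] by auto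
        show "near_curve n \<xi> (x (Suc i)) (\<delta> (Suc i))" by (rule near_pt[OF n1])
      qed
      then have hq: "hgt (Suc d) p ^ Q \<le> C1 * W * \<delta> (Suc i) ^ (d - 1)" by (simp add: Q_def W_def)
      have "1 \<le> (C2 * (hgt (Suc d) p * \<delta> i)) ^ Q" using v by (rule one_le_power)
      also have "\<dots> = C2 ^ Q * (hgt (Suc d) p ^ Q * \<delta> i ^ Q)" by (simp add: power_mult_distrib)
      also have "\<dots> \<le> C2 ^ Q * ((C1 * W * \<delta> (Suc i) ^ (d - 1)) * \<delta> i ^ Q)"
        using hq C2 err_gt_0[of i] by (intro mult_left_mono mult_right_mono) auto
      also have "\<dots> \<le> C2 ^ Q * ((C1 * W * z ^ (d - 1)) * z ^ Q)"
        using C2 C1 X1 z err_gt_0[of i] err_gt_0[of "Suc i"]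
        by (intro mult_left_mono mult_mono power_mono mult_nonneg_nonneg zero_le_power) auto
      also have "\<dots> = C2 ^ Q * C1 * W * z ^ (d - 1 + Q)" by (simp add: power_add)
      also have "\<dots> \<le> C2 ^ Q * C1 * W * z ^ (m + 2)"
      proof -
        \<comment> \<open>The exponent equals \<open>n + 1 - d\<close>, and
          \<open>d \<le> m\<close>.\<close>
        have "m + 2 \<le> d - 1 + Q" using d n by (simp add: Q_def)
        then have "z ^ (d - 1 + Q) \<le> z ^ (m + 2)" using z by (intro power_decreasing) auto
        then show ?thesis using C2 C1 X1 by (intro mult_left_mono) auto
      qed
      also have "\<dots> = B * (W * (W powr (- l)) ^ (m + 2))" by (simp add: B_def z_def power_mult_distrib)
      also have "(W powr (- l)) ^ (m + 2) = W powr (real (m + 2) * - l)" by (rule powr_power) (use X1 in simp)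
      also have "real (m + 2) * - l = - l * (real m + 2)" by (simp add: algebra_simps)
      also have "W * W powr (- l * (real m + 2)) = W powr s" using X1 by (simp add: s_def powr_mult_base)
      finally show False using elim(1) by (simp add: W_def)
    qed
  qed
qed

lemma low_inherited: "\<exists>I. \<forall>i\<ge>I. \<forall>d p. low (Suc i) d p \<longrightarrow> annih n (Suc d) (x i) p"
proof -
  have "\<forall>\<^sub>F i in sequentially. \<forall>d\<in>{1..m}. \<forall>p. low (Suc i) d p \<longrightarrow> annih n (Suc d) (x i) p"
    by (rule eventually_ball_finite) (use low_inherited_aux in auto)
  then obtain I where I: "\<forall>i\<ge>I. \<forall>d\<in>{1..m}. \<forall>p. low (Suc i) d p \<longrightarrow> annih n (Suc d) (x i) p" unfolding eventually_sequentially by blast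
  have "annih n (Suc d) (x i) p" if "I \<le> i" "low (Suc i) d p" for i d p
  proof -
    have "d \<in> {1..m}" using that(2) by (simp add: low_def)
    then show ?thesis using I that by blast
  qed
  then show ?thesis by blast
qed

text \<open>Low annihilators pass down to smaller indices, so if infinitely many points had one, all
  points beyond \<open>I\<close> would. Their minimal degree is nondecreasing and at most
  \<open>m\<close>, hence eventually constant. By uniqueness one polynomial then annihilates all
  later points, contrary to \<open>eventually_x_nonzero\<close>.\<close>

lemma eventually_full_rank: "\<exists>I. \<forall>i\<ge>I. full_rank n m (x i)"
proof (rule ccontr)
  assume no: "\<not> ?thesis"
  obtain I where I: "\<forall>i\<ge>I. \<forall>d p. low (Suc i) d p \<longrightarrow> annih n (Suc d) (x i) p" using low_inherited by (elim exE)
  have step: "\<exists>d' p'. d' \<le> d \<and> low i d' p'" if i: "I \<le> i" and lo: "low (Suc i) d p" for i d p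
  proof -
    have "annih n (Suc d) (x i) p" using I[rule_format, OF i lo] .
    moreover have "nonzero_below (Suc d) p" using lo primitive_nonzero by (auto simp: low_def)
    moreover have "Suc d \<le> m + 1" using lo by (simp add: low_def)
    ultimately obtain d' p' where "Suc d' \<le> Suc d" "low i d' p'" using low_exists by blast
    then show ?thesis by auto
  qed
  have down: "\<exists>d p. low i d p" if "low (i + k) d p" "I \<le> i" for i k d p
    using that
  proof (induction k arbitrary: d p)
    case (Suc k)
    obtain d' p' where "low (i + k) d' p'" using step[of "i + k" d p] Suc.prems by auto
    then show ?case using Suc.IH Suc.prems(2) by blast
  qed auto
  have all: "\<exists>d p. low i d p" if i: "I \<le> i" for i
  proof -
    obtain j where j: "i \<le> j" "\<not> full_rank n m (x j)" using no by blast
    then obtain f where f: "annih n (m + 1) (x j) f" "\<not> (\<forall>j<m + 1. f j = 0)" using supp_pt unfolding full_rank_def by blast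
    then have "nonzero_below (m + 1) f" by (auto simp: nonzero_below_def)
    then obtain d p where "low j d p" using low_exists[OF _ f(1)] by blast
    then show ?thesis using down[of i "j - i" d p] i j by simp
  qed
  define D where "D i = (LEAST d. \<exists>p. low i d p)" for i
  have DI: "\<exists>p. low i (D i) p" if "I \<le> i" for i unfolding D_def by (rule LeastI_ex[OF all[OF that]])
  have Dle: "D i \<le> d" if "low i d p" for i d p unfolding D_def by (rule Least_le) (use that in blast)
  have Dm: "D i \<le> m" if "I \<le> i" for i using DI[OF that] by (auto simp: low_def)
  have Dmono: "D i \<le> D (Suc i)" if i: "I \<le> i" for i
  proof -
    obtain p where "low (Suc i) (D (Suc i)) p" using DI[of "Suc i"] i by auto
    then obtain d' p' where "d' \<le> D (Suc i)" "low i d' p'" using step[OF i] by blast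
    then show ?thesis using Dle by (meson order_trans)
  qed
  define S where "S = D ` {I..}"
  have fin: "finite S" using Dm by (intro finite_subset[of S "{..m}"]) (auto simp: S_def)
  have "Max S \<in> S" by (rule Max_in[OF fin]) (auto simp: S_def)
  then obtain i1 where i1: "I \<le> i1" "D i1 = Max S" by (auto simp: S_def)
  have Dc: "D (i1 + k) = D i1" for k
  proof (induction k)
    case (Suc k)
    have "D (i1 + k) \<le> D (i1 + Suc k)" using Dmono[of "i1 + k"] i1 by simp
    moreover have "D (i1 + Suc k) \<le> Max S" using i1 by (intro Max_ge[OF fin]) (auto simp: S_def)
    ultimately show ?case using Suc i1 by simp
  qed simp
  define d where "d = D i1"
  obtain p where p: "low i1 d p" using DI[OF i1(1)] by (auto simp: d_def)
  have lp: "low (i1 + k) d p" for k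
  proof (induction k)
    case (Suc k)
    obtain p'' where p'': "low (Suc (i1 + k)) d p''" using DI[of "i1 + Suc k"] Dc[of "Suc k"] i1 by (auto simp: d_def)
    have ki: "annih n (Suc d) (x (i1 + k)) p''" using I p'' i1 by simp
    have dm: "1 \<le> d" "d \<le> m" using p by (auto simp: low_def)
    have d: "1 \<le> d" "2 * d \<le> n + 1" using dm n by auto
    have "\<exists>a b. a \<noteq> 0 \<and> b \<noteq> 0 \<and> (\<forall>j. a * p'' j = b * p j)"
    proof (rule low_degree_annih_unique[OF d, of "x (i1 + k)"])
      show "\<forall>j<d. g j = 0" if "annih n d (x (i1 + k)) g" for g using Suc that by (simp add: low_def)
      show "supp_below (Suc d) p" "annih n (Suc d) (x (i1 + k)) p" using Suc by (simp_all add: low_def)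
      show "supp_below (Suc d) p''" using p'' by (simp add: low_def)
      show "nonzero_below (Suc d) p" "nonzero_below (Suc d) p''" using p p'' primitive_nonzero by (auto simp: low_def)
    qed (rule ki)
    then obtain a b where ab: "a \<noteq> 0" "b \<noteq> 0" "\<forall>j. a * p'' j = b * p j" by (elim exE conjE)
    have "annih n (Suc d) (x (Suc (i1 + k))) p"
      by (rule annih_proportional[OF ab(2), where b = a and S = p'']) (use ab(3) p'' in \<open>auto simp: low_def\<close>)
    then show ?case using p p'' by (simp add: low_def)
  qed (use p in simp)
  have dm: "d \<le> m" using p by (simp add: low_def)
  have "nonzero_below (Suc d) p" using p primitive_nonzero by (auto simp: low_def)
  moreover have dn: "Suc d \<le> n + 1" using dm n by simp
  ultimately obtain J where J: "\<forall>i\<ge>J. dotp (Suc d) (x i) p \<noteq> 0" using eventually_x_nonzero by blast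
  have "annih n (Suc d) (x (i1 + J)) p" using lp[of J] by (simp add: low_def)
  then have "dotp (Suc d) (shift 0 (x (i1 + J))) p = 0" using dn unfolding annih_def by simp
  then show False using J by (simp add: shift_def)
qed

section \<open>Changes of the plane of consecutive best approximations\<close>

definition in_plane :: "nat \<Rightarrow> nat \<Rightarrow> bool" where
  "in_plane i j \<longleftrightarrow> (\<exists>a b c. a \<noteq> 0 \<and> (\<forall>k. a * x j k = b * x i k + c * x (Suc i) k))"

lemma in_plane_self: "in_plane i i" "in_plane i (Suc i)"
proof -
  show "in_plane i i" unfolding in_plane_def by (rule exI[of _ 1], rule exI[of _ 1], rule exI[of _ 0]) simp
  show "in_plane i (Suc i)" unfolding in_plane_def by (rule exI[of _ 1], rule exI[of _ 0], rule exI[of _ 1]) simp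
qed

lemma in_plane_forward:
  assumes "in_plane i j" "in_plane i (Suc j)" "in_plane j (Suc (Suc j))"
  shows "in_plane i (Suc (Suc j))"
proof -
  obtain a b c where 1: "a \<noteq> 0" "\<forall>k. a * x j k = b * x i k + c * x (Suc i) k" using assms(1) unfolding in_plane_def by (elim exE conjE)
  obtain a' b' c' where 2: "a' \<noteq> 0" "\<forall>k. a' * x (Suc j) k = b' * x i k + c' * x (Suc i) k" using assms(2) unfolding in_plane_def by (elim exE conjE)
  obtain e f g where 3: "e \<noteq> 0" "\<forall>k. e * x (Suc (Suc j)) k = f * x j k + g * x (Suc j) k" using assms(3) unfolding in_plane_def by (elim exE conjE)
  have "(e * a * a') * x (Suc (Suc j)) k = (f * a' * b + g * a * b') * x i k + (f * a' * c + g * a * c') * x (Suc i) k" for k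
  proof -
    have "(e * a * a') * x (Suc (Suc j)) k = a * a' * (e * x (Suc (Suc j)) k)" by simp
    also have "\<dots> = a * a' * (f * x j k + g * x (Suc j) k)" using 3(2) by simp
    also have "\<dots> = f * a' * (a * x j k) + g * a * (a' * x (Suc j) k)" by (simp add: algebra_simps)
    also have "\<dots> = f * a' * (b * x i k + c * x (Suc i) k) + g * a * (b' * x i k + c' * x (Suc i) k)" using 1(2) 2(2) by simp
    finally show ?thesis by (simp add: algebra_simps)
  qed
  then have eq: "\<forall>k. (e * a * a') * x (Suc (Suc j)) k = (f * a' * b + g * a * b') * x i k + (f * a' * c + g * a * c') * x (Suc i) k" by blast
  have nz: "e * a * a' \<noteq> 0" using 1(1) 2(1) 3(1) by simp
  show ?thesis unfolding in_plane_def
    by (rule exI[of _ "e * a * a'"], rule exI[of _ "f * a' * b + g * a * b'"], rule exI[of _ "f * a' * c + g * a * c'"], rule conjI[OF nz eq])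
qed

text \<open>The coefficient \<open>f\<close> of \<open>x j\<close> is nonzero because
  \<open>x (Suc j)\<close> and \<open>x (Suc (Suc j))\<close> are independent, so \<open>x j\<close>
  can be exchanged for \<open>x (Suc (Suc j))\<close>.\<close>

lemma in_plane_shift:
  assumes "in_plane j i" "in_plane j (Suc (Suc j))"
  shows "in_plane (Suc j) i"
proof -
  obtain a b c where 1: "a \<noteq> 0" "\<forall>k. a * x i k = b * x j k + c * x (Suc j) k" using assms(1) unfolding in_plane_def by (elim exE conjE)
  obtain e f g where 3: "e \<noteq> 0" "\<forall>k. e * x (Suc (Suc j)) k = f * x j k + g * x (Suc j) k" using assms(2) unfolding in_plane_def by (elim exE conjE)
  have f: "f \<noteq> 0"
  proof
    assume "f = 0"
    then have "g * x (Suc j) k + (- e) * x (Suc (Suc j)) k = 0" for k using 3(2) by simp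
    then show False using x_independent[of "Suc j" "Suc (Suc j)" g "- e"] 3(1) by simp
  qed
  have "(f * a) * x i k = (f * c - b * g) * x (Suc j) k + (b * e) * x (Suc (Suc j)) k" for k
  proof -
    have "(f * a) * x i k = f * (b * x j k + c * x (Suc j) k)" using 1(2) by simp
    also have "\<dots> = b * (f * x j k) + f * c * x (Suc j) k" by (simp add: algebra_simps)
    also have "f * x j k = e * x (Suc (Suc j)) k - g * x (Suc j) k" using 3(2) by simp
    finally show ?thesis by (simp add: algebra_simps)
  qed
  then have eq: "\<forall>k. (f * a) * x i k = (f * c - b * g) * x (Suc j) k + (b * e) * x (Suc (Suc j)) k" by blast
  have nz: "f * a \<noteq> 0" using f 1(1) by simp
  show ?thesis unfolding in_plane_def
    by (rule exI[of _ "f * a"], rule exI[of _ "f * c - b * g"], rule exI[of _ "b * e"], rule conjI[OF nz eq])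
qed

lemma in_plane_range:
  assumes "\<And>j. i \<le> j \<Longrightarrow> j < i' \<Longrightarrow> in_plane j (Suc (Suc j))" "i \<le> i'"
  shows "in_plane i i' \<and> in_plane i (Suc i') \<and> in_plane i' i"
  using assms(2,1)
proof (induction i' rule: dec_induct)
  case (step j)
  then have h: "in_plane i j" "in_plane i (Suc j)" "in_plane j i" "in_plane j (Suc (Suc j))" by auto
  show ?case using in_plane_forward[OF h(1,2,4)] h(2) in_plane_shift[OF h(3,4)] by blast
qed (simp add: in_plane_self)

text \<open>The rank condition is built in so that the finitely many initial indices without it are
  discarded at once.\<close>

definition turning :: "nat set" where
  "turning = {i. \<not> in_plane i (Suc (Suc i)) \<and> (\<forall>j\<ge>i. full_rank n m (x j))}"

text \<open>Without further changes the tail would lie in one plane. Since \<open>n + 1 > 2\<close>,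
  some nonzero linear form vanishes on this plane, and \<open>eventually_x_nonzero\<close> forbids
  that.\<close>

lemma infinite_turning: "infinite turning"
proof
  assume fin: "finite turning"
  obtain I0 where I0: "\<forall>i\<ge>I0. full_rank n m (x i)" using eventually_full_rank by blast
  define I where "I = I0 + Suc (Max (insert 0 turning))"
  have pl: "in_plane j (Suc (Suc j))" if "I \<le> j" for j
  proof (rule ccontr)
    assume "\<not> ?thesis"
    then have "j \<in> turning" using that I0 by (simp add: turning_def I_def)
    then have "j \<le> Max (insert 0 turning)" using fin by (intro Max_ge) auto
    then show False using that by (simp add: I_def)
  qed
  obtain p where p: "nonzero_below (n + 1) p" "killed (n + 1) (set [x I, x (Suc I)]) p"
    using exists_killed[of "[x I, x (Suc I)]" "n + 1"] n m by auto
  have k2: "dotp (n + 1) (x I) p = 0" "dotp (n + 1) (x (Suc I)) p = 0" using p(2) by (simp_all add: killed_def)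
  have "dotp (n + 1) (x i) p = 0" if i: "I \<le> i" for i
  proof -
    have "in_plane I i" using in_plane_range[OF _ i] pl by blast
    then obtain a b c where abc: "a \<noteq> 0" "\<forall>k. a * x i k = b * x I k + c * x (Suc I) k" unfolding in_plane_def by (elim exE conjE)
    have "a * dotp (n + 1) (x i) p = dotp (n + 1) (\<lambda>k. a * x i k) p" by (simp add: dotp_scale_left)
    also have "\<dots> = dotp (n + 1) (\<lambda>k. b * x I k + c * x (Suc I) k) p" by (rule dotp_cong) (use abc(2) in auto)
    also have "\<dots> = 0" using k2 by (simp add: dotp_lincomb_left)
    finally show ?thesis using abc(1) by simp
  qed
  moreover obtain J where "\<forall>i\<ge>J. dotp (n + 1) (x i) p \<noteq> 0" using eventually_x_nonzero[OF p(1) order_refl] by blast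
  ultimately show False by (metis le_add1 le_add2)
qed

definition tn :: "nat \<Rightarrow> nat" where "tn = enumerate turning"

lemma tn_less: "tn k < tn (Suc k)"
  unfolding tn_def by (rule enumerate_step[OF infinite_turning])

lemma tn_in: "tn k \<in> turning"
  unfolding tn_def by (rule enumerate_in_set[OF infinite_turning])

lemma tn_ge: "k \<le> tn k"
proof (induction k)
  case (Suc k)
  then show ?case using tn_less[of k] by linarith
qed simp

lemma tn_gap:
  assumes "tn k < j" "j < tn (Suc k)"
  shows "in_plane j (Suc (Suc j))"
proof (rule ccontr)
  assume no: "\<not> ?thesis"
  have "\<forall>i\<ge>j. full_rank n m (x i)" using tn_in[of k] assms(1) by (auto simp: turning_def)
  then have "j \<in> turning" using no by (simp add: turning_def)
  then have "enumerate turning (Suc k) \<le> j"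
    unfolding enumerate_Suc''[OF infinite_turning] using assms(1) by (intro Least_le) (simp add: tn_def)
  then show False using assms(2) by (simp add: tn_def)
qed

lemma tn_plane: "in_plane (Suc (tn k)) (Suc (tn (Suc k)))" "in_plane (tn (Suc k)) (Suc (tn k))"
proof -
  have "in_plane (Suc (tn k)) (tn (Suc k)) \<and> in_plane (Suc (tn k)) (Suc (tn (Suc k))) \<and> in_plane (tn (Suc k)) (Suc (tn k))"
    by (rule in_plane_range) (use tn_gap[of k] tn_less[of k] in auto)
  then show "in_plane (Suc (tn k)) (Suc (tn (Suc k)))" "in_plane (tn (Suc k)) (Suc (tn k))" by auto
qed

text \<open>With \<open>f = tn (Suc k)\<close>, the first point lies in the plane of
  \<open>x f\<close> and \<open>x (f + 1)\<close>, the second is \<open>x (f + 1)\<close>, and the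
  third lies in the plane of \<open>x (f + 1)\<close> and \<open>x (f + 2)\<close>. A relation
  involving the third would bring \<open>x (f + 2)\<close> into the first plane, although the plane
  changes at \<open>f\<close>.\<close>

lemma turning_independent:
  assumes e: "\<And>j. a * x (Suc (tn k)) j + b * x (Suc (tn (Suc k))) j + c * x (Suc (tn (Suc (Suc k)))) j = 0"
  shows "a = 0 \<and> b = 0 \<and> c = 0"
proof -
  define f where "f = tn (Suc k)"
  have "c = 0"
  proof (rule ccontr)
    assume c: "c \<noteq> 0"
    obtain a2 b2 c2 where 2: "a2 \<noteq> 0" "\<forall>j. a2 * x (Suc (tn (Suc (Suc k)))) j = b2 * x (Suc f) j + c2 * x (Suc (Suc f)) j"
      using tn_plane(1)[of "Suc k"] unfolding in_plane_def f_def by (elim exE conjE)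
    obtain a1 b1 c1 where 1: "a1 \<noteq> 0" "\<forall>j. a1 * x (Suc (tn k)) j = b1 * x f j + c1 * x (Suc f) j"
      using tn_plane(2)[of k] unfolding in_plane_def f_def by (elim exE conjE)
    have c2: "c2 \<noteq> 0"
    proof
      assume "c2 = 0"
      then have "(- b2) * x (Suc f) j + a2 * x (Suc (tn (Suc (Suc k)))) j = 0" for j using 2(2) by simp
      moreover have "Suc f < Suc (tn (Suc (Suc k)))" using tn_less[of "Suc k"] by (simp add: f_def)
      ultimately show False using x_independent[of "Suc f" "Suc (tn (Suc (Suc k)))" "- b2" a2] 2(1) by simp
    qed
    have "(a1 * c * c2) * x (Suc (Suc f)) j = (- (a * a2 * b1)) * x f j + (- (a * a2 * c1) - a1 * a2 * b - a1 * c * b2) * x (Suc f) j" for j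
    proof -
      have "0 = a1 * a2 * (a * x (Suc (tn k)) j + b * x (Suc f) j + c * x (Suc (tn (Suc (Suc k)))) j)" using e[of j] by (simp add: f_def)
      also have "\<dots> = a * a2 * (a1 * x (Suc (tn k)) j) + a1 * a2 * b * x (Suc f) j + a1 * c * (a2 * x (Suc (tn (Suc (Suc k)))) j)"
        by (simp add: algebra_simps)
      also have "\<dots> = a * a2 * (b1 * x f j + c1 * x (Suc f) j) + a1 * a2 * b * x (Suc f) j + a1 * c * (b2 * x (Suc f) j + c2 * x (Suc (Suc f)) j)"
        using 1(2) 2(2) by simp
      finally show ?thesis by (simp add: algebra_simps)
    qed
    then have eq: "\<forall>j. (a1 * c * c2) * x (Suc (Suc f)) j = (- (a * a2 * b1)) * x f j + (- (a * a2 * c1) - a1 * a2 * b - a1 * c * b2) * x (Suc f) j" by blast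
    have nz: "a1 * c * c2 \<noteq> 0" using 1(1) c c2 by simp
    have "in_plane f (Suc (Suc f))" unfolding in_plane_def
      by (rule exI[of _ "a1 * c * c2"], rule exI[of _ "- (a * a2 * b1)"], rule exI[of _ "- (a * a2 * c1) - a1 * a2 * b - a1 * c * b2"], rule conjI[OF nz eq])
    then show False using tn_in[of "Suc k"] by (simp add: turning_def f_def)
  qed
  moreover from this have "a = 0 \<and> b = 0" using e tn_less[of k] by (intro x_independent[of "Suc (tn k)" "Suc (tn (Suc k))"]) auto
  ultimately show ?thesis by blast
qed

lemma impossible: False
proof -
  \<comment> \<open>The sequence will be \<open>x (Suc (tn k))\<close>, with the next best
    approximation as \<open>yp k\<close>. By truncated subtraction \<open>H 0\<close> equals
    \<open>H 1\<close>.\<close>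
  define H where "H k = real (q (Suc (Suc (tn (k - 1)))))" for k
  define M where "M k = \<delta> (Suc (tn k))" for k
  have tn_mono: "tn (k - 1) \<le> tn k" for k using tn_less[of "k - 1"] by (cases k) auto
  have lim: "filterlim (\<lambda>k. Suc (Suc (tn k))) at_top sequentially"
    by (rule filterlim_at_top_mono[OF filterlim_ident]) (use tn_ge in \<open>auto intro!: always_eventually le_SucI\<close>)
  have limH: "filterlim (\<lambda>k. H (Suc k)) at_top sequentially"
    using filterlim_compose[OF q_tendsto lim] by (simp add: H_def)
  have "exponent_sequence n m \<xi> (\<lambda>k. x (Suc (tn k))) (\<lambda>k. x (Suc (Suc (tn k)))) H M t \<mu> lam"
  proof (unfold_locales, goal_cases)
    case 1 show ?case by (rule n)
  next
    case 2 show ?case by (rule m)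
  next
    case (3 p) then show ?case by (rule no_root)
  next
    case (4 k) show ?case using tn_in[of k] by (simp add: turning_def)
  next
    case (5 k) show ?case by (rule x_primitive)
  next
    case (6 k) show ?case using q_pos[of "Suc (tn k)"] by simp
  next
    case (7 k) show ?case using q_mono[of "Suc (tn k)" "Suc (tn (Suc k))"] tn_less[of k] by simp
  next
    case (8 k) show ?case using q_less[of "Suc (tn k)"] by (simp add: H_def)
  next
    case (9 k) show ?case by (simp add: H_def)
  next
    case (10 k) show ?case by (rule supp_pt)
  next
    case (11 k) show ?case unfolding M_def by (rule near_pt[OF n1])
  next
    case (12 k) show ?case unfolding M_def by (rule near_curve_mono[OF near_pt[OF n1] less_imp_le[OF err_less]])
  next
    case (13 k) show ?case using tn_plane(1)[of k] unfolding in_plane_def .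
  next
    case (14 k a b c) then show ?case by (rule turning_independent)
  next
    case (15 k) show ?case using q_pos by (simp add: H_def)
  next
    case (16 k) show ?case using q_mono_le[of "Suc (Suc (tn (k - 1)))" "Suc (Suc (tn k))"] tn_mono[of k] by (simp add: H_def)
  next
    case (17 k) show ?case unfolding M_def by (rule err_gt_0)
  next
    case (18 k) show ?case unfolding M_def using err_le_half[OF n1, of \<xi> "q (Suc (tn k))"] by linarith
  next
    case (19 k) show ?case unfolding M_def using err_mono[of "Suc (tn k)" "Suc (tn (Suc k))"] tn_less[of k] by simp
  next
    case 20 show ?case by (rule lam(1))
  next
    case 21 show ?case by (rule lam(2))
  next
    \<comment> \<open>The excess exponent \<open>lam - l\<close> is negative and outweighs every
      constant \<open>B\<close>.\<close>
    case (22 B)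
    have "(\<lambda>k. (\<bar>B\<bar> * C) * H (Suc k) powr (lam - l)) \<longlonglongrightarrow> (\<bar>B\<bar> * C) * 0"
      by (intro tendsto_mult tendsto_const tendsto_neg_powr[OF _ limH]) (use lam in simp)
    then have "\<forall>\<^sub>F k in sequentially. (\<bar>B\<bar> * C) * H (Suc k) powr (lam - l) < 1" using order_tendstoD(2)[of _ "(\<bar>B\<bar> * C) * 0" _ 1] by simp
    then obtain K where K: "\<forall>k\<ge>K. (\<bar>B\<bar> * C) * H (Suc k) powr (lam - l) < 1" unfolding eventually_sequentially by blast
    have "B * M k \<le> H (Suc k) powr (- lam)" if "K \<le> k" for k
    proof -
      have "B * M k \<le> \<bar>B\<bar> * M k" using err_gt_0[of "Suc (tn k)"] by (intro mult_right_mono) (auto simp: M_def)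
      also have "\<dots> \<le> \<bar>B\<bar> * (C * H (Suc k) powr (- l))" using err_bound[of "Suc (tn k)"] by (intro mult_left_mono) (auto simp: M_def H_def)
      also have "H (Suc k) powr (- l) = H (Suc k) powr (lam - l) * H (Suc k) powr (- lam)"
        by (simp add: powr_add[symmetric])
      also have "\<bar>B\<bar> * (C * (H (Suc k) powr (lam - l) * H (Suc k) powr (- lam))) = ((\<bar>B\<bar> * C) * H (Suc k) powr (lam - l)) * H (Suc k) powr (- lam)" by simp
      also have "\<dots> \<le> 1 * H (Suc k) powr (- lam)" using K that by (intro mult_right_mono) (auto intro: less_imp_le)
      finally show ?thesis by simp
    qed
    then show ?case by blast
  next
    case 23
    have "filterlim (\<lambda>k. Suc (tn k)) at_top sequentially"
      by (rule filterlim_at_top_mono[OF filterlim_ident]) (use tn_ge in \<open>auto intro!: always_eventually le_SucI\<close>)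
    from filterlim_compose[OF err_tendsto this] show ?case unfolding M_def by simp
  next
    case (24 k) show ?case using q_ge[of "Suc (Suc (tn (k - 1)))"] by (simp add: H_def)
  qed
  then show False by (rule exponent_sequence.impossible)
qed

end

section \<open>The degree hypothesis\<close>

lemma real_ring_simps:
  "carrier real_ring = UNIV" "x \<otimes>\<^bsub>real_ring\<^esub> y = x * y" "x \<oplus>\<^bsub>real_ring\<^esub> y = x + y" "\<one>\<^bsub>real_ring\<^esub> = 1" "\<zero>\<^bsub>real_ring\<^esub> = 0"
  by (simp_all add: ring_of_type_algebra_def)

lemma real_ring_pow: "x [^]\<^bsub>real_ring\<^esub> (k::nat) = x ^ k"
proof -
  interpret field real_ring by (rule field_from_type_algebra)
  show ?thesis by (induction k) (simp_all add: real_ring_simps)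
qed

lemma subfield_Rats: "subfield \<rat> real_ring"
proof -
  interpret field real_ring by (rule field_from_type_algebra)
  show ?thesis
  proof (rule subfieldI')
    show "subring \<rat> real_ring"
    proof (rule subringI)
      fix h :: real assume h: "h \<in> \<rat>"
      have "\<ominus>\<^bsub>real_ring\<^esub> h = - h" by (rule minus_equality) (simp_all add: real_ring_simps)
      then show "\<ominus>\<^bsub>real_ring\<^esub> h \<in> \<rat>" using h by simp
    qed (simp_all add: real_ring_simps)
    fix k :: real assume k: "k \<in> \<rat> - {\<zero>\<^bsub>real_ring\<^esub>}"
    then have "inv\<^bsub>real_ring\<^esub> k = inverse k" by (intro inv_char) (simp_all add: real_ring_simps)
    then show "inv\<^bsub>real_ring\<^esub> k \<in> \<rat>" using k by simp
  qed
qed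

text \<open>Polynomials are lists here with the leading coefficient first, hence the
  reversal.\<close>

lemma eval_rev_list:
  "ring.eval real_ring (map f (rev [0..<k])) x = (\<Sum>j<k. f j * x ^ j)"
proof -
  interpret field real_ring by (rule field_from_type_algebra)
  show ?thesis
  proof (induction k)
    case (Suc k)
    have "map f (rev [0..<Suc k]) = f k # map f (rev [0..<k])" by simp
    then show ?case using Suc by (simp add: real_ring_simps real_ring_pow)
  qed (simp add: real_ring_simps)
qed

text \<open>If an integer polynomial of degree at most \<open>n\<close> had the root \<xi>, the
  field generated by \<xi> would be a simple extension whose dimension is the degree of the minimal
  polynomial, and this divides the given one.\<close>

lemma no_root_of_degree:
  assumes deg: "enat n < rat_adjoin_degree \<xi>" and p: "nonzero_below (n + 1) p"
  shows "(\<Sum>j<n + 1. real_of_int (p j) * \<xi> ^ j) \<noteq> 0"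
proof
  assume root: "(\<Sum>j<n + 1. real_of_int (p j) * \<xi> ^ j) = 0"
  interpret field real_ring by (rule field_from_type_algebra)
  define p' where "p' = (\<lambda>j. if j < n + 1 then p j else 0)"
  have p'1: "supp_below (n + 1) p'" by (simp add: supp_below_def p'_def)
  have p'2: "nonzero_below (n + 1) p'" using p by (auto simp: nonzero_below_def p'_def)
  \<comment> \<open>A polynomial list must begin with a nonzero coefficient, so the coefficients are
    cut off at the true degree \<open>e\<close>.\<close>
  obtain e where e: "e < n + 1" "p' e \<noteq> 0" "\<forall>j>e. p' j = 0"
    using greatest_nonzero[OF p'1 p'2] by blast
  define cs where "cs = map (\<lambda>j. real_of_int (p' j)) (rev [0..<Suc e])"
  have ev: "eval cs \<xi> = \<zero>\<^bsub>real_ring\<^esub>"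
  proof -
    have "eval cs \<xi> = (\<Sum>j<Suc e. real_of_int (p' j) * \<xi> ^ j)" unfolding cs_def by (rule eval_rev_list)
    also have "\<dots> = (\<Sum>j<n + 1. real_of_int (p' j) * \<xi> ^ j)" using e by (intro sum.mono_neutral_left) auto
    also have "\<dots> = (\<Sum>j<n + 1. real_of_int (p j) * \<xi> ^ j)" by (intro sum.cong) (auto simp: p'_def)
    finally show ?thesis using root by (simp add: real_ring_simps)
  qed
  have csne: "cs \<noteq> []" by (simp add: cs_def)
  have "polynomial\<^bsub>real_ring\<^esub> \<rat> cs" unfolding polynomial_def using e(2) by (auto simp: cs_def real_ring_simps)
  then have csc: "cs \<in> carrier (univ_poly real_ring \<rat>)" using univ_poly_carrier by blast
  have alg: "(algebraic over \<rat>) \<xi>" by (rule algebraicI[OF csc csne ev])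
  have xc: "\<xi> \<in> carrier real_ring" by (simp add: real_ring_simps)
  have Q: "\<rat> \<subseteq> carrier real_ring" "insert \<xi> \<rat> \<subseteq> carrier real_ring" by (auto simp: real_ring_simps)
  have sf: "subfield (simple_extension \<rat> \<xi>) real_ring"
    using simple_extension_is_subfield[OF subfield_Rats xc] alg by blast
  have eq: "rat_adjoin \<xi> = simple_extension \<rat> \<xi>"
  proof
    have "\<xi> \<in> simple_extension \<rat> \<xi>" by (rule simple_extension_mem[OF subfieldE(1)[OF subfield_Rats] xc])
    moreover have "\<rat> \<subseteq> simple_extension \<rat> \<xi>" by (rule simple_extension_incl[OF Q(1) xc])
    ultimately show "rat_adjoin \<xi> \<subseteq> simple_extension \<rat> \<xi>"
      unfolding rat_adjoin_def by (intro generate_field_min_subfield1[OF Q(2) sf]) auto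
    have "insert \<xi> \<rat> \<subseteq> generate_field real_ring (insert \<xi> \<rat>)" by (auto intro: generate_field.incl)
    then show "simple_extension \<rat> \<xi> \<subseteq> rat_adjoin \<xi>"
      unfolding rat_adjoin_def
      by (intro simple_extension_subring_incl[OF subfieldE(1)[OF generate_field_is_subfield[OF Q(2)]]]) auto
  qed
  have dm: "dimension (length (Irr \<rat> \<xi>) - 1) \<rat> (rat_adjoin \<xi>)"
    unfolding eq by (rule dimension_simple_extension[OF subfield_Rats xc alg])
  have fd: "finite_dimension \<rat> (rat_adjoin \<xi>)" by (rule finite_dimensionI[OF dm])
  have "dim \<rat> (rat_adjoin \<xi>) = length (Irr \<rat> \<xi>) - 1" using dimI[OF subfield_Rats dm] by (simp add: over_def)
  then have d: "rat_adjoin_degree \<xi> = enat (length (Irr \<rat> \<xi>) - 1)" using fd by (simp add: rat_adjoin_degree_def)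
  have "length (Irr \<rat> \<xi>) - 1 \<le> length cs - 1"
    by (rule pdivides_imp_degree_le[OF subfieldE(1)[OF subfield_Rats] IrrE(1)[OF subfield_Rats xc alg] csc csne])
      (rule Irr_minimal[OF subfield_Rats xc alg csc ev])
  also have "\<dots> \<le> n" using e(1) by (simp add: cs_def)
  finally show False using deg d by simp
qed

section \<open>The theorem\<close>

text \<open>For \<open>B \<ge> 2\<close> the permitted error is below 1, so \<open>x 0 = 0\<close>
  would make the whole point vanish. A change of sign then makes the first coordinate
  positive.\<close>

lemma uniform_best:
  assumes l: "0 < l" and n: "1 \<le> n" and ok: "uniform_exponent_ok n \<xi> l"
  shows "\<exists>B1\<ge>1. \<forall>B\<ge>B1. \<exists>r\<ge>1. real r \<le> B \<and> err n \<xi> r \<le> B powr (- l)"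
proof -
  obtain N where N: "\<forall>B\<ge>N. \<exists>x :: nat \<Rightarrow> int. (\<exists>k\<le>n. x k \<noteq> 0) \<and> \<bar>real_of_int (x 0)\<bar> \<le> B \<and>
        (MAX k\<in>{1..n}. \<bar>real_of_int (x 0) * \<xi> ^ k - real_of_int (x k)\<bar>) \<le> B powr (- l)"
    using ok unfolding uniform_exponent_ok_def eventually_at_top_linorder by (elim exE)
  have "\<exists>r\<ge>1. real r \<le> B \<and> err n \<xi> r \<le> B powr (- l)" if B: "max N 2 \<le> B" for B
  proof -
    have "N \<le> B" using B by simp
    then obtain x :: "nat \<Rightarrow> int" where x: "\<exists>k\<le>n. x k \<noteq> 0" "\<bar>real_of_int (x 0)\<bar> \<le> B"
        "(MAX k\<in>{1..n}. \<bar>real_of_int (x 0) * \<xi> ^ k - real_of_int (x k)\<bar>) \<le> B powr (- l)" using N by blast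
    have le: "\<bar>real_of_int (x 0) * \<xi> ^ k - real_of_int (x k)\<bar> \<le> B powr (- l)" if k: "k \<in> {1..n}" for k
    proof -
      have "\<bar>real_of_int (x 0) * \<xi> ^ k - real_of_int (x k)\<bar> \<le> (MAX k\<in>{1..n}. \<bar>real_of_int (x 0) * \<xi> ^ k - real_of_int (x k)\<bar>)"
        by (rule Max_ge) (use k in auto)
      then show ?thesis using x(3) by linarith
    qed
    have B1: "B powr (- l) < 1" using B l by (simp add: powr_less_one)
    have x0: "x 0 \<noteq> 0"
    proof
      assume z: "x 0 = 0"
      obtain k where k: "k \<le> n" "x k \<noteq> 0" using x(1) by blast
      then have "k \<in> {1..n}" using z by (cases k) auto
      from le[OF this] have "\<bar>real_of_int (x k)\<bar> < 1" using z B1 by simp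
      then show False using k(2) by linarith
    qed
    define r where "r = nat \<bar>x 0\<bar>"
    have r: "real r = \<bar>real_of_int (x 0)\<bar>" by (simp add: r_def)
    have "err n \<xi> r \<le> B powr (- l)"
    proof (rule err_le[OF n, where z = "\<lambda>k. sgn (x 0) * x k"])
      fix k assume k: "k \<in> {1..n}"
      have "\<bar>real r * \<xi> ^ k - real_of_int (sgn (x 0) * x k)\<bar> = \<bar>real_of_int (x 0) * \<xi> ^ k - real_of_int (x k)\<bar>"
      proof (cases "0 < x 0")
        case True
        then show ?thesis unfolding r by simp
      next
        case False
        then have "x 0 < 0" using x0 by simp
        then have "real r * \<xi> ^ k - real_of_int (sgn (x 0) * x k) = - (real_of_int (x 0) * \<xi> ^ k - real_of_int (x k))" unfolding r by simp
        then show ?thesis by (simp only: abs_minus_cancel)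
      qed
      then show "\<bar>real r * \<xi> ^ k - real_of_int (sgn (x 0) * x k)\<bar> \<le> B powr (- l)" using le[OF k] by simp
    qed
    moreover have "1 \<le> r" using x0 by (simp add: r_def)
    moreover have "real r \<le> B" using x(2) r by simp
    ultimately show ?thesis by blast
  qed
  then show ?thesis by (intro exI[of _ "max N 2"]) auto
qed

text \<open>\<open>nx r\<close> is the first positive integer with a strictly smaller error than
  \<open>r\<close>. It always exists because errors are positive but have infimum zero.\<close>

lemma best_sequence:
  assumes n: "1 \<le> n" and no_root: "\<And>p. nonzero_below (n + 1) p \<Longrightarrow> (\<Sum>j<n + 1. real_of_int (p j) * \<xi> ^ j) \<noteq> 0"
    and small: "\<And>e. 0 < e \<Longrightarrow> \<exists>r\<ge>1. err n \<xi> r < e"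
  shows "\<exists>q. q 0 = (1::nat) \<and> (\<forall>i. q i < q (Suc i)) \<and> (\<forall>i. err n \<xi> (q (Suc i)) < err n \<xi> (q i)) \<and>
    (\<forall>i r. 1 \<le> r \<longrightarrow> r < q (Suc i) \<longrightarrow> err n \<xi> (q i) \<le> err n \<xi> r)"
proof -
  define nx where "nx r = (LEAST r'. 1 \<le> r' \<and> err n \<xi> r' < err n \<xi> r)" for r
  define q where "q = rec_nat 1 (\<lambda>_. nx)"
  have q0: "q 0 = 1" and qS: "q (Suc i) = nx (q i)" for i by (simp_all add: q_def)
  have nx: "1 \<le> nx r \<and> err n \<xi> (nx r) < err n \<xi> r" if "1 \<le> r" for r
    unfolding nx_def by (rule LeastI_ex) (use small[OF err_pos[OF n no_root that]] in blast)
  have nx_min: "err n \<xi> r \<le> err n \<xi> r'" if "1 \<le> r'" "r' < nx r" for r r'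
    using not_less_Least[of r' "\<lambda>r'. 1 \<le> r' \<and> err n \<xi> r' < err n \<xi> r"] that unfolding nx_def by auto
  have q1: "1 \<le> q i" for i by (induction i) (use nx in \<open>auto simp: q0 qS\<close>)
  have inv: "err n \<xi> (q i) \<le> err n \<xi> r" if "1 \<le> r" "r \<le> q i" for i r
    using that
  proof (induction i)
    case 0
    then have "r = 1" by (simp add: q0)
    then show ?case by (simp add: q0)
  next
    case (Suc i)
    show ?case
    proof (cases "r = q (Suc i)")
      case False
      then have "err n \<xi> (q i) \<le> err n \<xi> r" using Suc.prems nx_min[of r "q i"] by (simp add: qS)
      then show ?thesis using nx[OF q1[of i]] by (simp add: qS)
    qed simp
  qed
  have less: "q i < q (Suc i)" for i
  proof (rule ccontr)
    assume "\<not> ?thesis"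
    then have "err n \<xi> (q i) \<le> err n \<xi> (q (Suc i))" by (intro inv q1) simp
    then show False using nx[OF q1[of i]] by (simp add: qS)
  qed
  show ?thesis
  proof (intro exI[of _ q] conjI allI impI)
    show "err n \<xi> (q (Suc i)) < err n \<xi> (q i)" for i using nx[OF q1[of i]] by (simp add: qS)
    show "err n \<xi> (q i) \<le> err n \<xi> r" if "1 \<le> r" "r < q (Suc i)" for i r using nx_min that by (simp add: qS)
  qed (use q0 less in auto)
qed

theorem theorem1p2:
  fixes m n :: nat and \<xi> :: real
  assumes "n = 2 * m + 1" and "n \<ge> 5"
    and "rat_adjoin_degree \<xi> > enat n"
  shows "lambda_hat n \<xi> \<le> ereal (alpha m)"
proof (rule ccontr)
  assume "\<not> ?thesis"
  then have "ereal (alpha m) < Sup {ereal l | l. 0 \<le> l \<and> uniform_exponent_ok n \<xi> l}" by (simp add: lambda_hat_def)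
  then obtain l where l: "alpha m < l" and ok: "uniform_exponent_ok n \<xi> l" unfolding less_Sup_iff by auto
  have m: "2 \<le> m" and n1: "1 \<le> n" using assms by auto
  have no_root: "(\<Sum>j<n + 1. real_of_int (p j) * \<xi> ^ j) \<noteq> 0" if "nonzero_below (n + 1) p" for p
    by (rule no_root_of_degree[OF assms(3) that])
  define \<alpha> where "\<alpha> = alpha m"
  have "\<alpha> > 0 \<and> poly (P_poly m) \<alpha> = 0" unfolding \<alpha>_def alpha_def by (rule theI'[OF P_poly_ex1_positive_root])
  then have \<alpha>: "0 < \<alpha>" "1 - (real m + 1) * \<alpha> - real m * \<alpha>\<^sup>2 = 0" by (auto simp: P_poly_def power2_eq_square algebra_simps)
  have m0: "0 < real m" using m by simp
  have am: "(real m + 1) * \<alpha> < 1"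
  proof -
    have "0 < real m * \<alpha>\<^sup>2" using \<alpha>(1) m0 by simp
    then show ?thesis using \<alpha>(2) by linarith
  qed
  then have "\<alpha> < 1 / (real m + 1)" by (simp add: field_simps)
  then have "\<alpha> < min l (1 / (real m + 1))" using l by (simp add: \<alpha>_def)
  \<comment> \<open>Staying below \<open>1 / (real m + 1)\<close> makes \<mu> positive; this bound
    lies above \<alpha> by the equation for \<alpha>.\<close>
  then obtain lam where lam: "\<alpha> < lam" "lam < min l (1 / (real m + 1))" using dense by blast
  then have lam0: "0 < lam" and laml: "lam < l" and lm: "(real m + 1) * lam < 1" using \<alpha>(1) by (auto simp: field_simps)
  define \<mu> where "\<mu> = 1 / lam - (real m + 1)"
  define t where "t = 1 + \<mu> / real m"
  have lmu: "lam * (real m + 1 + \<mu>) = 1" using lam0 by (simp add: \<mu>_def field_simps)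
  have mu0: "0 < \<mu>" using lm lam0 by (simp add: \<mu>_def field_simps)
  have en: "exponent_numbers (real m) t \<mu>"
  proof
    show "2 \<le> real m" using m by simp
    show "1 < t" using mu0 m0 by (simp add: t_def)
    show "\<mu> = real m * (t - 1)" using m0 by (simp add: t_def)
    have neg: "1 - (real m + 1) * lam - real m * lam\<^sup>2 < 0"
    proof -
      have "(real m + 1) * \<alpha> < (real m + 1) * lam" using lam m0 by (intro mult_strict_left_mono) auto
      moreover have "real m * \<alpha>\<^sup>2 < real m * lam\<^sup>2" using lam \<alpha> m0 by (intro mult_strict_left_mono power_strict_mono) auto
      ultimately show ?thesis using \<alpha>(2) by linarith
    qed
    \<comment> \<open>Multiplication by \<open>m * lam^2\<close> turns
      \<open>(1 + \<mu>) * t < 2\<close> into the negativity of \<open>P_poly m\<close> at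
      \<open>lam\<close>.\<close>
    have "real m * lam\<^sup>2 * ((1 + \<mu>) * t) = (lam * (1 + \<mu>)) * (lam * (real m + \<mu>))"
      using m0 by (simp add: t_def power2_eq_square field_simps)
    also have "lam * (1 + \<mu>) = 1 - real m * lam" using lmu by (simp add: algebra_simps)
    also have "lam * (real m + \<mu>) = 1 - lam" using lmu by (simp add: algebra_simps)
    also have "(1 - real m * lam) * (1 - lam) < real m * lam\<^sup>2 * 2" using neg by (simp add: power2_eq_square algebra_simps)
    finally show "(1 + \<mu>) * t < 2" using m0 lam0 by simp
  qed
  have l0: "0 < l" using laml lam0 by simp
  obtain B1 where B1: "1 \<le> B1" "\<forall>B\<ge>B1. \<exists>r\<ge>1. real r \<le> B \<and> err n \<xi> r \<le> B powr (- l)"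
    using uniform_best[OF l0 n1 ok] by (elim exE conjE)
  have small: "\<exists>r\<ge>1. err n \<xi> r < e" if e: "0 < e" for e
  proof -
    have "((\<lambda>B. B powr (- l)) \<longlongrightarrow> (0::real)) at_top" by (rule tendsto_neg_powr[OF _ filterlim_ident]) (use l0 in simp)
    then have "\<forall>\<^sub>F B in at_top. B powr (- l) < e" using order_tendstoD(2) e by blast
    then obtain N where N: "\<forall>B\<ge>N. B powr (- l) < e" unfolding eventually_at_top_linorder by blast
    obtain r where "1 \<le> r" "err n \<xi> r \<le> max N B1 powr (- l)" using B1(2) by (metis max.cobounded2)
    moreover have "max N B1 powr (- l) < e" using N by simp
    ultimately show ?thesis by (meson le_less_trans)
  qed
  have "\<exists>q. q 0 = (1::nat) \<and> (\<forall>i. q i < q (Suc i)) \<and> (\<forall>i. err n \<xi> (q (Suc i)) < err n \<xi> (q i)) \<and>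
    (\<forall>i r. 1 \<le> r \<longrightarrow> r < q (Suc i) \<longrightarrow> err n \<xi> (q i) \<le> err n \<xi> r)"
    by (rule best_sequence[OF n1 no_root small])
  then obtain q where q: "q 0 = (1::nat)" "\<forall>i. q i < q (Suc i)" "\<forall>i. err n \<xi> (q (Suc i)) < err n \<xi> (q i)"
    "\<forall>i r. 1 \<le> r \<longrightarrow> r < q (Suc i) \<longrightarrow> err n \<xi> (q i) \<le> err n \<xi> r"
    by (elim exE conjE)
  \<comment> \<open>The uniform condition is used at half of the next height \<open>W\<close>: its
    solution lies strictly below \<open>W\<close> and so has no smaller error than
    \<open>q i\<close>. The factor 2 compensates for the halving, and \<open>B1\<close> for those
    \<open>W\<close> below \<open>2 * B1\<close>, where the error bound 1/2 is enough.\<close>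
  define C where "C = (2 * B1) powr l"
  have C1: "1 \<le> C" unfolding C_def using B1(1) l0 by (intro ge_one_powr_ge_zero) auto
  have bound: "err n \<xi> (q i) \<le> C * real (q (Suc i)) powr (- l)" for i
  proof -
    define W where "W = real (q (Suc i))"
    have W0: "0 < W" using q(2)[rule_format, of i] by (simp add: W_def)
    show ?thesis
    proof (cases "B1 \<le> W / 2")
      case True
      then obtain r where r: "1 \<le> r" "real r \<le> W / 2" "err n \<xi> r \<le> (W / 2) powr (- l)" using B1(2) by blast
      have "real r < W" using r(2) W0 by linarith
      then have "r < q (Suc i)" by (simp add: W_def)
      then have "err n \<xi> (q i) \<le> err n \<xi> r" using q(4) r(1) by blast
      also note r(3)
      also have "(W / 2) powr (- l) = 2 powr l * W powr (- l)" using W0 by (simp add: powr_divide powr_minus field_simps)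
      also have "\<dots> \<le> C * W powr (- l)" unfolding C_def using B1(1) l0 by (intro mult_right_mono powr_mono2) auto
      finally show ?thesis by (simp add: W_def)
    next
      case False
      have "1 = W powr l * W powr (- l)" using W0 by (simp add: powr_add[symmetric])
      also have "\<dots> \<le> C * W powr (- l)" unfolding C_def using False W0 l0 by (intro mult_right_mono powr_mono2) auto
      finally show ?thesis using err_le_half[OF n1, of \<xi> "q i"] by (simp add: W_def)
    qed
  qed
  have "best_points m t \<mu> n \<xi> lam l C q"
    by (intro best_points.intro en best_points_axioms.intro assms(1) m no_root lam0 lmu laml q(1) C1 bound)
      (use q in auto)
  then show False by (rule best_points.impossible)
qed

end
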